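(* Let $M$ be a matroid with foundation $F_M$ and lattice of flats $\Lambda$. Then $$F_M\ \cong\ \mathbb F_1^\pm\Big(\begin{bmatrix}H_1&H_2\\H_3&H_4\end{bmatrix}\ \Big|\ (H_1,H_2,H_3,H_4)\in\Theta_M\Big)/\!\!/\langle R_M\rangle,$$ where each generator corresponds to the universal cross-ratio with the same name, and where $R_M$ consists of the multiplicative relations (R$-$) $\;-1=1$, if the Fano matroid $F_7$ or its dual $F_7^\ast$ is a minor of $M$; (R$\sigma$) $\begin{bmatrix}H_1&H_2\\H_3&H_4\end{bmatrix}=\begin{bmatrix}H_2&H_1\\H_4&H_3\end{bmatrix}=\begin{bmatrix}H_3&H_4\\H_1&H_2\end{bmatrix}=\begin{bmatrix}H_4&H_3\\H_2&H_1\end{bmatrix}$ for all $(H_1,H_2,H_3,H_4)\in\Theta_M^\diamondsuit$; (R0) $\begin{bmatrix}H_1&H_2\\H_3&H_4\end{bmatrix}=1$ for all degenerate $(H_1,H_2,H_3,H_4)\in\Theta_M$; (R1) $\begin{bmatrix}H_1&H_2\\H_4&H_3\end{bmatrix}=\begin{bmatrix}H_1&H_2\\H_3&H_4\end{bmatrix}^{-1}$ for all $(H_1,H_2,H_3,H_4)\in\Theta_M^\diamondsuit$; (R2) $\begin{bmatrix}H_1&H_2\\H_3&H_4\end{bmatrix}\cdot\begin{bmatrix}H_1&H_3\\H_4&H_2\end{bmatrix}\cdot\begin{bmatrix}H_1&H_4\\H_2&H_3\end{bmatrix}=-1$ for all $(H_1,H_2,H_3,H_4)\in\Theta_M^\diamondsuit$;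 (R3) $\begin{bmatrix}H_1&H_2\\H_3&H_4\end{bmatrix}\cdot\begin{bmatrix}H_1&H_2\\H_4&H_5\end{bmatrix}\cdot\begin{bmatrix}H_1&H_2\\H_5&H_3\end{bmatrix}=1$ for all $(H_1,H_2,H_3,H_4),(H_1,H_2,H_4,H_5),(H_1,H_2,H_5,H_3)\in\Theta_M^\diamondsuit$; (R4) $\begin{bmatrix}H_{13}&H_{23}\\H_{34}&H_{35}\end{bmatrix}\cdot\begin{bmatrix}H_{14}&H_{24}\\H_{45}&H_{34}\end{bmatrix}\cdot\begin{bmatrix}H_{15}&H_{25}\\H_{35}&H_{45}\end{bmatrix}=1$ for all $(H_{13},H_{23},H_{34},H_{35}),(H_{14},H_{24},H_{45},H_{34}),(H_{15},H_{25},H_{35},H_{45})\in\Theta_M$ such that the common intersection of all involved hyperplanes is a corank $3$ flat $L$ and such that $H_{ij}=\langle Lij\rangle$ for all involved pairs of indices $ij$, where $1,2,3,4,5$ are suitable atoms of $\Lambda$; as well as the additive Plücker relations (R$+$) $\begin{bmatrix}H_1&H_2\\H_3&H_4\end{bmatrix}+\begin{bmatrix}H_1&H_3\\H_2&H_4\end{bmatrix}=1$ for all $(H_1,H_2,H_3,H_4)\in\Theta_M^\diamondsuit$.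
   Context: **Pastures.** A pointed group is a multiplicatively written commutative monoid $P$ with neutral element $1$ and absorbing element $0\ne1$ in which every nonzero element is invertible; $P^\times=P\setminus\{0\}$. In $\mathrm{Sym}^3(P)=P^3/S_3$ write $a+b+c$ for the class of $(a,b,c)$, $a+b$ for $a+b+0$ and $a$ for $a+0+0$. A pasture is a pointed group $P$ with a subset $N_P\subseteq\mathrm{Sym}^3(P)$ (the null set) that is invariant under multiplication by elements of $P$ and such that for every $a\in P$ there is a unique $b\in P$, denoted $-a$, with $a+b\in N_P$. A pasture morphism $g:P\to Q$ is a multiplicative map preserving $0$ and $1$ with $g(a)+g(b)+g(c)\in N_Q$ whenever $a+b+c\in N_P$. The free algebra $\mathbb F_1^\pm(x_1,\dots,x_n)=\{0\}\cup\{\pm x_1^{e_1}\cdots x_n^{e_n}\mid e_i\in\mathbb Z\}$ has null set $\{a-a\}$ for $a$ in it. For a set $R\subseteq\mathrm{Sym}^3$ of it containing no $a+0+0$ with $a\ne0$, the quotient $\mathbb F_1^\pm(x_1,\dots,x_n)/\!\!/\langle R\rangle$ is the pasture characterized by: morphisms to a pasture $Q$ correspond functorially to maps $\{x_1,\dots,x_n\}\to Q^\times$ whose multiplicative extension (with $-1\mapsto-1$) sends every $a+b+c\in R$ into $N_Q$. A multiplicative relation $a=b$ stands for the element $a-b$, and a relation $a+b=1$ for the element $a+b-1$. **Representations and foundation.** Let $M$ be a matroid on a finite set $E$ with set of hyperplanes $\mathcal H$. A $P$-representation of $M$ is a family $\varphi=(\varphi_H:E\to P)_{H\in\mathcal H}$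 with $\varphi_H(e)=0$ iff $e\in H$, such that for all distinct hyperplanes $H_1,H_2,H_3$ whose intersection is a corank $2$ flat there is $(a,b,c)\in P^3\setminus\{(0,0,0)\}$ with $a\varphi_{H_1}(e)+b\varphi_{H_2}(e)+c\varphi_{H_3}(e)\in N_P$ for all $e\in E$. Two representations $\varphi,\varphi'$ are rescaling equivalent if $\varphi'_H(e)=a_Ht_e\varphi_H(e)$ for some $(a_H)\in(P^\times)^{\mathcal H}$, $(t_e)\in(P^\times)^E$. $\mathrm R_M(P)$ is the set of rescaling classes of $P$-representations of $M$. The foundation $F_M$ is the pasture representing this functor: $\mathrm R_M(P)=\mathrm{Hom}(F_M,P)$ functorially in $P$. A universal representation $\varphi_{\mathrm{univ}}$ is an $F_M$-representation whose rescaling class corresponds to $\mathrm{id}_{F_M}$. **Cross-ratios.** $\langle\cdot\rangle$ denotes closure; $\langle Lij\rangle$ is the smallest flat containing $L$, $i$ and $j$. $\Theta_M$ is the set of $4$-tuples of hyperplanes $(H_1,H_2,H_3,H_4)$ such that $L=H_1\cap H_2\cap H_3\cap H_4$ is a corank $2$ flat and $L=H_i\cap H_j$ for all $i\in\{1,2\}$, $j\in\{3,4\}$. $\Theta_M^\diamondsuit\subseteq\Theta_M$ is the subset of non-degenerate tuples, for which also $L=H_1\cap H_2=H_3\cap H_4$; the other tuples in $\Theta_M$ are degenerate. For $(H_1,H_2,H_3,H_4)\in\Theta_M$, $a\in H_3-L$ and $b\in H_4-L$, the universal cross-ratio is $\begin{bmatrix}H_1&H_2\\H_3&H_4\end{bmatrix}=\frac{\varphi_{\mathrm{univ},H_1}(a)\varphi_{\mathrm{univ},H_2}(b)}{\varphi_{\mathrm{univ},H_1}(b)\varphi_{\mathrm{univ},H_2}(a)}\in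 F_M^\times$, independent of all choices. *)

theory Defs
  imports
    "HOL-Library.Multiset"
    "HOL-Library.Infinite_Typeclass"
    "HOL-Algebra.Free_Abelian_Groups"
    "HOL-Algebra.Sym_Groups"
begin

section \<open>Matroids\<close>

record 'a matroid =
  ground :: "'a set"
  indep :: "'a set set"

locale matroid =
  fixes M :: "'a matroid"
  assumes finite_ground: "finite (ground M)"
    and indep_subset: "I \<in> indep M \<Longrightarrow> I \<subseteq> ground M"
    and empty_indep: "{} \<in> indep M"
    and indep_mono: "I \<in> indep M \<Longrightarrow> J \<subseteq> I \<Longrightarrow> J \<in> indep M"
    and augment: "I \<in> indep M \<Longrightarrow> J \<in> indep M \<Longrightarrow> card I < card J \<Longrightarrow>
                    \<exists>e\<in>J - I. insert e I \<in> indep M"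

definition rank_of :: "'a matroid \<Rightarrow> 'a set \<Rightarrow> nat" where
  "rank_of M X = Max (card ` {I \<in> indep M. I \<subseteq> X})"

definition closure_of_set :: "'a matroid \<Rightarrow> 'a set \<Rightarrow> 'a set" where
  "closure_of_set M X = {e \<in> ground M. rank_of M (insert e X) = rank_of M X}"

definition flat :: "'a matroid \<Rightarrow> 'a set \<Rightarrow> bool" where
  "flat M X \<longleftrightarrow> X \<subseteq> ground M \<and> closure_of_set M X = X"

definition corank_flat :: "'a matroid \<Rightarrow> nat \<Rightarrow> 'a set \<Rightarrow> bool" where
  "corank_flat M k X \<longleftrightarrow> flat M X \<and> rank_of M X + k = rank_of M (ground M)"

definition hyperplanes :: "'a matroid \<Rightarrow> 'a set set" where
  "hyperplanes M = {H. corank_flat M 1 H}"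

text \<open>Atoms of the lattice of flats, whose bottom element is the closure of the empty set.\<close>

definition atom_flat :: "'a matroid \<Rightarrow> 'a set \<Rightarrow> bool" where
  "atom_flat M A \<longleftrightarrow> flat M A \<and> A \<noteq> closure_of_set M {} \<and>
     (\<forall>B. flat M B \<and> B \<subseteq> A \<longrightarrow> B = closure_of_set M {} \<or> B = A)"

definition dual_matroid :: "'a matroid \<Rightarrow> 'a matroid" where
  "dual_matroid M = \<lparr> ground = ground M,
     indep = {I. I \<subseteq> ground M \<and> rank_of M (ground M - I) = rank_of M (ground M)} \<rparr>"

definition delete_set :: "'a matroid \<Rightarrow> 'a set \<Rightarrow> 'a matroid" where
  "delete_set M D = \<lparr> ground = ground M - D, indep = {I \<in> indep M. I \<inter> D = {}} \<rparr>"

definition contract_set :: "'a matroid \<Rightarrow> 'a set \<Rightarrow> 'a matroid" where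
  "contract_set M C = dual_matroid (delete_set (dual_matroid M) C)"

definition matroid_isomorphic :: "'a matroid \<Rightarrow> 'b matroid \<Rightarrow> bool" where
  "matroid_isomorphic M N \<longleftrightarrow> (\<exists>f. bij_betw f (ground M) (ground N) \<and>
     (\<forall>X. X \<subseteq> ground M \<longrightarrow> (X \<in> indep M \<longleftrightarrow> f ` X \<in> indep N)))"

definition has_minor :: "'a matroid \<Rightarrow> 'b matroid \<Rightarrow> bool" where
  "has_minor M N \<longleftrightarrow> (\<exists>C D. C \<subseteq> ground M \<and> D \<subseteq> ground M \<and> C \<inter> D = {} \<and>
     matroid_isomorphic (delete_set (contract_set M C) D) N)"

text \<open>The lines of the Fano plane are the translates of the difference set $\{0,1,3\}$ modulo $7$.\<close>

definition fano_lines :: "nat set set" where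
  "fano_lines = {{i, (i + 1) mod 7, (i + 3) mod 7} | i. i < 7}"

definition fano :: "nat matroid" where
  "fano = \<lparr> ground = {0..<7}, indep = {I. I \<subseteq> {0..<7} \<and> card I \<le> 3 \<and> I \<notin> fano_lines} \<rparr>"


section \<open>Pastures\<close>

text \<open>The element $a+b+c$ of $\mathrm{Sym}^3(P)$ is the multiset \<open>{#a, b, c#}\<close>; in particular
  zero summands are counted, so $a+b$ is \<open>{#a, b, pzero P#}\<close>.\<close>

record 'a pasture = "'a monoid" +
  pzero :: 'a
  nullset :: "'a multiset set"

definition sym3 :: "('a, 'b) pasture_scheme \<Rightarrow> 'a multiset set" where
  "sym3 P = {{#a, b, c#} | a b c. a \<in> carrier P \<and> b \<in> carrier P \<and> c \<in> carrier P}"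

abbreviation nonzeros :: "('a, 'b) pasture_scheme \<Rightarrow> 'a set" where
  "nonzeros P \<equiv> carrier P - {pzero P}"

locale pasture = comm_monoid P for P :: "'a pasture" (structure) +
  assumes zero_closed: "pzero P \<in> carrier P"
    and zero_absorb: "a \<in> carrier P \<Longrightarrow> pzero P \<otimes> a = pzero P"
    and zero_neq_one: "pzero P \<noteq> \<one>"
    and nonzero_Units: "a \<in> carrier P \<Longrightarrow> a \<noteq> pzero P \<Longrightarrow> a \<in> Units P"
    and nullset_sym3: "nullset P \<subseteq> sym3 P"
    and nullset_mult: "a \<in> carrier P \<Longrightarrow> A \<in> nullset P \<Longrightarrow> image_mset ((\<otimes>) a) A \<in> nullset P"
    and ex1_neg: "a \<in> carrier P \<Longrightarrow> \<exists>!b. b \<in> carrier P \<and> {#a, b, pzero P#} \<in> nullset P"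

definition pneg :: "('a, 'b) pasture_scheme \<Rightarrow> 'a \<Rightarrow> 'a" where
  "pneg P a = (THE b. b \<in> carrier P \<and> {#a, b, pzero P#} \<in> nullset P)"

text \<open>Morphisms are extensional, so that a morphism is determined by its values on the carrier.\<close>

definition pasture_hom :: "'a pasture \<Rightarrow> 'b pasture \<Rightarrow> ('a \<Rightarrow> 'b) set" where
  "pasture_hom P Q = {g \<in> carrier P \<rightarrow>\<^sub>E carrier Q.
     g (pzero P) = pzero Q \<and> g \<one>\<^bsub>P\<^esub> = \<one>\<^bsub>Q\<^esub> \<and>
     (\<forall>a\<in>carrier P. \<forall>b\<in>carrier P. g (a \<otimes>\<^bsub>P\<^esub> b) = g a \<otimes>\<^bsub>Q\<^esub> g b) \<and>
     (\<forall>A\<in>nullset P. image_mset g A \<in> nullset Q)}"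

definition pasture_iso :: "'a pasture \<Rightarrow> 'b pasture \<Rightarrow> ('a \<Rightarrow> 'b) set" where
  "pasture_iso P Q = {f \<in> pasture_hom P Q. \<exists>g \<in> pasture_hom Q P.
     (\<forall>x\<in>carrier P. g (f x) = x) \<and> (\<forall>y\<in>carrier Q. f (g y) = y)}"


section \<open>Free algebras over $\mathbb F_1^\pm$ and their quotients\<close>

text \<open>\<open>None\<close> is the zero element.\<close>

definition adjoin_zero :: "'a monoid \<Rightarrow> 'a option multiset set \<Rightarrow> 'a option pasture" where
  "adjoin_zero G N = \<lparr> carrier = insert None (Some ` carrier G),
     monoid.mult = (\<lambda>x y. case x of None \<Rightarrow> None | Some a \<Rightarrow> map_option ((\<otimes>\<^bsub>G\<^esub>) a) y),
     one = Some \<one>\<^bsub>G\<^esub>, pzero = None, nullset = N \<rparr>"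

text \<open>The pair \<open>(s, m)\<close> stands for the signed monomial $s\prod_x x^{m(x)}$ with $s=\pm1$.\<close>

definition signed_monomials :: "'x set \<Rightarrow> (int \<times> ('x \<Rightarrow>\<^sub>0 int)) monoid" where
  "signed_monomials X = sign_img \<times>\<times> free_Abelian_group X"

definition free_algebra :: "'x set \<Rightarrow> (int \<times> ('x \<Rightarrow>\<^sub>0 int)) option pasture" where
  "free_algebra X = adjoin_zero (signed_monomials X)
     (insert {#None, None, None#}
       {{#Some (s, m), Some (- s, m), None#} | s m. (s, m) \<in> carrier (signed_monomials X)})"

definition free_gen :: "'x \<Rightarrow> (int \<times> ('x \<Rightarrow>\<^sub>0 int)) option" where
  "free_gen x = Some (1, frag_of x)"

text \<open>For nonzero $a$ and $b$, an element $a+b+0$ of \<open>R\<close> forces $-a^{-1}b=1$ in the quotient.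
  The unit group of the quotient is the group of signed monomials modulo the subgroup
  generated by these elements, and the null set is generated by the images of the null set of
  the free algebra and of \<open>R\<close>.\<close>

definition relation_subgroup ::
    "'x set \<Rightarrow> (int \<times> ('x \<Rightarrow>\<^sub>0 int)) option multiset set \<Rightarrow> (int \<times> ('x \<Rightarrow>\<^sub>0 int)) set" where
  "relation_subgroup X R = generate (signed_monomials X)
     {(- 1, 0) \<otimes>\<^bsub>signed_monomials X\<^esub> (inv\<^bsub>signed_monomials X\<^esub> a \<otimes>\<^bsub>signed_monomials X\<^esub> b) | a b.
        {#Some a, Some b, None#} \<in> R}"

definition quotient_map ::
    "'x set \<Rightarrow> (int \<times> ('x \<Rightarrow>\<^sub>0 int)) option multiset set \<Rightarrow>
       (int \<times> ('x \<Rightarrow>\<^sub>0 int)) option \<Rightarrow> (int \<times> ('x \<Rightarrow>\<^sub>0 int)) set option" where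
  "quotient_map X R = map_option (\<lambda>a. relation_subgroup X R #>\<^bsub>signed_monomials X\<^esub> a)"

definition free_quotient ::
    "'x set \<Rightarrow> (int \<times> ('x \<Rightarrow>\<^sub>0 int)) option multiset set \<Rightarrow>
       (int \<times> ('x \<Rightarrow>\<^sub>0 int)) set option pasture" where
  "free_quotient X R = adjoin_zero (signed_monomials X Mod relation_subgroup X R)
     (image_mset (quotient_map X R) `
       (nullset (free_algebra X) \<union>
        {image_mset ((\<otimes>\<^bsub>free_algebra X\<^esub>) c) A | c A. c \<in> carrier (free_algebra X) \<and> A \<in> R}))"


subsection \<open>Universal properties\<close>

text \<open>Morphisms from the free algebra to \<open>Q\<close> correspond to families of units of \<open>Q\<close>, and morphisms
  from the quotient correspond to those morphisms from the free algebra that send \<open>R\<close> to the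
  null set, see \<open>free_algebra_universal\<close> and \<open>free_quotient_universal\<close>.\<close>

context pasture
begin

lemma neg_ex: "a \<in> carrier P \<Longrightarrow> pneg P a \<in> carrier P \<and> {#a, pneg P a, pzero P#} \<in> nullset P"
  unfolding pneg_def by (rule theI') (rule ex1_neg)

lemma neg_unique:
  "a \<in> carrier P \<Longrightarrow> b \<in> carrier P \<Longrightarrow> {#a, b, pzero P#} \<in> nullset P \<Longrightarrow> pneg P a = b"
  using neg_ex ex1_neg by blast

lemma zero_absorb_right: "a \<in> carrier P \<Longrightarrow> a \<otimes> pzero P = pzero P"
  using zero_absorb zero_closed m_comm by metis

lemma zero_nullset: "{#pzero P, pzero P, pzero P#} \<in> nullset P"
  using nullset_mult[OF zero_closed, of "{#\<one>, pneg P \<one>, pzero P#}"] neg_ex[OF one_closed]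
  by (simp add: zero_absorb zero_closed)

lemma neg_mult: assumes "a \<in> carrier P" shows "pneg P a = a \<otimes> pneg P \<one>"
proof (rule neg_unique)
  show "{#a, a \<otimes> pneg P \<one>, pzero P#} \<in> nullset P"
    using nullset_mult[OF assms, of "{#\<one>, pneg P \<one>, pzero P#}"] neg_ex[OF one_closed] assms
    by (simp add: zero_absorb_right)
qed (use assms neg_ex[OF one_closed] in auto)

lemma neg_one_square: "pneg P \<one> \<otimes> pneg P \<one> = \<one>"
proof -
  have "{#pneg P \<one>, \<one>, pzero P#} \<in> nullset P"
    using neg_ex[OF one_closed] by (simp add: add_mset_commute)
  then have "pneg P (pneg P \<one>) = \<one>"
    using neg_ex[OF one_closed] neg_unique by blast
  then show ?thesis using neg_mult neg_ex[OF one_closed] by metis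
qed

lemma Units_nonzeros: "Units P = nonzeros P"
proof -
  have "pzero P \<notin> Units P"
    using zero_neq_one zero_absorb by (auto simp: Units_def)
  then show ?thesis using nonzero_Units Units_closed by auto
qed

end

lemma adjoin_zero_simps:
  "carrier (adjoin_zero G N) = insert None (Some ` carrier G)"
  "pzero (adjoin_zero G N) = None"
  "nullset (adjoin_zero G N) = N"
  "\<one>\<^bsub>adjoin_zero G N\<^esub> = Some \<one>\<^bsub>G\<^esub>"
  "None \<otimes>\<^bsub>adjoin_zero G N\<^esub> y = None"
  "x \<otimes>\<^bsub>adjoin_zero G N\<^esub> None = None"
  "Some a \<otimes>\<^bsub>adjoin_zero G N\<^esub> Some b = Some (a \<otimes>\<^bsub>G\<^esub> b)"
  by (auto simp: adjoin_zero_def split: option.splits)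

lemma pasture_adjoin_zero:
  fixes G :: "'g monoid"
  assumes G: "comm_group G"
    and sym3: "N \<subseteq> sym3 (adjoin_zero G N)"
    and mult: "\<And>a A. a \<in> carrier (adjoin_zero G N) \<Longrightarrow> A \<in> N \<Longrightarrow>
                 image_mset ((\<otimes>\<^bsub>adjoin_zero G N\<^esub>) a) A \<in> N"
    and neg: "\<And>a. a \<in> carrier (adjoin_zero G N) \<Longrightarrow>
                 \<exists>!b. b \<in> carrier (adjoin_zero G N) \<and> {#a, b, None#} \<in> N"
  shows "pasture (adjoin_zero G N)"
proof -
  interpret comm_group G by fact
  let ?A = "adjoin_zero G N"
  have cm: "comm_monoid ?A"
    by (rule comm_monoidI) (auto simp: adjoin_zero_simps m_ac)
  have units: "a \<in> Units ?A" if a: "a \<in> carrier ?A" "a \<noteq> pzero ?A" for a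
  proof -
    obtain g where g: "a = Some g" "g \<in> carrier G"
      using a unfolding adjoin_zero_simps by blast
    show ?thesis
      unfolding Units_def using g
      by (auto simp: adjoin_zero_simps intro!: bexI[of _ "inv\<^bsub>G\<^esub> g"])
  qed
  show ?thesis
    by (intro pasture.intro pasture_axioms.intro cm units mult neg)
      (use sym3 mult neg in \<open>auto simp: adjoin_zero_simps\<close>)
qed

lemma comm_group_signed_monomials: "comm_group (signed_monomials X)"
proof -
  have "group (signed_monomials X)"
    unfolding signed_monomials_def
    by (rule DirProd_group[OF sign_img_is_group group_free_Abelian_group])
  then show ?thesis
    by (rule group.group_comm_groupI)
      (auto simp: signed_monomials_def sign_img_def add.commute mult.commute)
qed

lemma signed_monomials_simps:
  "(s, m) \<in> carrier (signed_monomials X) \<longleftrightarrow> (s = 1 \<or> s = - 1) \<and> Poly_Mapping.keys m \<subseteq> X"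
  "(s, m) \<otimes>\<^bsub>signed_monomials X\<^esub> (s', m') = (s * s', m + m')"
  "\<one>\<^bsub>signed_monomials X\<^esub> = (1, 0)"
  by (auto simp: signed_monomials_def sign_img_def)

lemma free_algebra_simps:
  "carrier (free_algebra X) = insert None (Some ` carrier (signed_monomials X))"
  "pzero (free_algebra X) = None"
  "\<one>\<^bsub>free_algebra X\<^esub> = Some (1, 0)"
  "None \<otimes>\<^bsub>free_algebra X\<^esub> y = None"
  "x \<otimes>\<^bsub>free_algebra X\<^esub> None = None"
  "Some a \<otimes>\<^bsub>free_algebra X\<^esub> Some b = Some (a \<otimes>\<^bsub>signed_monomials X\<^esub> b)"
  "nullset (free_algebra X) = insert {#None, None, None#}
       {{#Some (s, m), Some (- s, m), None#} | s m. (s, m) \<in> carrier (signed_monomials X)}"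
  by (simp_all add: free_algebra_def adjoin_zero_simps signed_monomials_simps)

lemma pasture_free_algebra: "pasture (free_algebra X)"
  unfolding free_algebra_def
proof (rule pasture_adjoin_zero[OF comm_group_signed_monomials], unfold free_algebra_def[symmetric])
  let ?N = "insert {#None, None, None#}
    {{#Some (s, m), Some (- s, m), None#} | s m. (s, m) \<in> carrier (signed_monomials X)}"
  show "?N \<subseteq> sym3 (free_algebra X)"
  proof
    fix A assume "A \<in> ?N"
    then consider "A = {#None, None, None#}"
      | s m where "A = {#Some (s, m), Some (- s, m), None#}" "(s, m) \<in> carrier (signed_monomials X)"
      by auto
    then show "A \<in> sym3 (free_algebra X)"
    proof cases
      case 1
      then show ?thesis unfolding sym3_def free_algebra_simps by blast
    next
      case 2
      moreover have "(- s, m) \<in> carrier (signed_monomials X)"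
        using 2 by (auto simp: signed_monomials_simps)
      ultimately show ?thesis unfolding sym3_def free_algebra_simps by blast
    qed
  qed
  show "image_mset ((\<otimes>\<^bsub>free_algebra X\<^esub>) a) A \<in> ?N"
    if a: "a \<in> carrier (free_algebra X)" and A: "A \<in> ?N" for a A
  proof -
    consider "A = {#None, None, None#}" | "a = None" "\<exists>b c d. A = {#b, c, d#}"
      | s m t n where "A = {#Some (s, m), Some (- s, m), None#}" "(s, m) \<in> carrier (signed_monomials X)"
        "a = Some (t, n)" "(t, n) \<in> carrier (signed_monomials X)"
    proof (cases a)
      case None
      then show thesis using A that(2) by blast
    next
      case (Some g)
      then show thesis
        using a A that(1) that(3)[of _ _ "fst g" "snd g"] by (auto simp: free_algebra_simps)
    qed
    then show ?thesis
    proof cases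
      case 3
      then have "(t * s, n + m) \<in> carrier (signed_monomials X)"
        by (auto simp: signed_monomials_simps dest: subsetD[OF keys_add])
      then show ?thesis
        using 3 by (auto simp: free_algebra_simps signed_monomials_simps(2))
    qed (auto simp: free_algebra_simps)
  qed
  show "\<exists>!b. b \<in> carrier (free_algebra X) \<and> {#a, b, None#} \<in> ?N"
    if a: "a \<in> carrier (free_algebra X)" for a
  proof (cases a)
    case None
    then show ?thesis
      by (intro ex1I[of _ None]) (auto simp: free_algebra_simps add_eq_conv_ex)
  next
    case (Some g)
    then obtain s m where "a = Some (s, m)" "(s, m) \<in> carrier (signed_monomials X)"
      using a by (cases g) (auto simp: free_algebra_simps(1))
    then show ?thesis
      by (intro ex1I[of _ "Some (- s, m)"])
        (auto simp: free_algebra_simps signed_monomials_simps add_eq_conv_ex)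
  qed
qed

lemma pneg_free_algebra:
  assumes "(s, m) \<in> carrier (signed_monomials X)"
  shows "pneg (free_algebra X) (Some (s, m)) = Some (- s, m)"
  by (rule pasture.neg_unique[OF pasture_free_algebra])
    (use assms in \<open>auto simp: free_algebra_simps signed_monomials_simps\<close>)

lemma pasture_hom_neg_one:
  assumes "pasture P" "pasture Q" "f \<in> pasture_hom P Q"
  shows "f (pneg P \<one>\<^bsub>P\<^esub>) = pneg Q \<one>\<^bsub>Q\<^esub>"
proof -
  interpret P: pasture P by fact
  interpret Q: pasture Q by fact
  have "image_mset f {#\<one>\<^bsub>P\<^esub>, pneg P \<one>\<^bsub>P\<^esub>, pzero P#} \<in> nullset Q"
    using assms(3) P.neg_ex[OF P.one_closed] unfolding pasture_hom_def by blast
  then have "{#\<one>\<^bsub>Q\<^esub>, f (pneg P \<one>\<^bsub>P\<^esub>), pzero Q#} \<in> nullset Q"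
    using assms(3) by (simp add: pasture_hom_def)
  moreover have "f (pneg P \<one>\<^bsub>P\<^esub>) \<in> carrier Q"
    using assms(3) P.neg_ex[OF P.one_closed] unfolding pasture_hom_def by blast
  ultimately show ?thesis
    by (metis Q.neg_unique Q.one_closed)
qed

lemma pasture_hom_Units:
  assumes "pasture P" "pasture Q" "f \<in> pasture_hom P Q" "a \<in> nonzeros P"
  shows "f a \<in> nonzeros Q"
proof -
  interpret P: pasture P by fact
  interpret Q: pasture Q by fact
  have "a \<in> Units P" using assms(4) P.Units_nonzeros by blast
  then obtain b where b: "b \<in> carrier P" "a \<otimes>\<^bsub>P\<^esub> b = \<one>\<^bsub>P\<^esub>"
    using P.Units_r_inv_ex by blast
  have a: "a \<in> carrier P" using assms(4) by blast
  have "f a \<in> carrier Q" "f b \<in> carrier Q"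
    using assms(3) a b(1) unfolding pasture_hom_def by blast+
  moreover have "f (a \<otimes>\<^bsub>P\<^esub> b) = f a \<otimes>\<^bsub>Q\<^esub> f b" "f \<one>\<^bsub>P\<^esub> = \<one>\<^bsub>Q\<^esub>"
    using assms(3) a b(1) unfolding pasture_hom_def by blast+
  ultimately have "f a \<noteq> pzero Q"
    using b(2) Q.zero_absorb[of "f b"] Q.zero_neq_one by metis
  then show ?thesis
    using \<open>f a \<in> carrier Q\<close> by blast
qed

lemma free_algebra_universal:
  assumes "pasture Q"
  shows "bij_betw (\<lambda>f. \<lambda>x\<in>X. f (free_gen x))
           (pasture_hom (free_algebra X) Q) (X \<rightarrow>\<^sub>E nonzeros Q)"
proof -
  interpret Q: pasture Q by fact
  interpret A: pasture "free_algebra X" by (rule pasture_free_algebra)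
  interpret S: comm_group "signed_monomials X" by (rule comm_group_signed_monomials)
  have gen: "free_gen x \<in> nonzeros (free_algebra X)" if "x \<in> X" for x
    using that by (auto simp: free_gen_def free_algebra_simps signed_monomials_simps)
  have prod: "f (Some (s * s', m + m')) = f (Some (s, m)) \<otimes>\<^bsub>Q\<^esub> f (Some (s', m'))"
    if "f \<in> pasture_hom (free_algebra X) Q" "(s, m) \<in> carrier (signed_monomials X)"
      "(s', m') \<in> carrier (signed_monomials X)" for f s m s' m'
  proof -
    have "f (Some (s, m) \<otimes>\<^bsub>free_algebra X\<^esub> Some (s', m')) = f (Some (s, m)) \<otimes>\<^bsub>Q\<^esub> f (Some (s', m'))"
    proof -
      have "\<forall>a\<in>carrier (free_algebra X). \<forall>b\<in>carrier (free_algebra X).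
          f (a \<otimes>\<^bsub>free_algebra X\<^esub> b) = f a \<otimes>\<^bsub>Q\<^esub> f b"
        using that(1) unfolding pasture_hom_def by blast
      then show ?thesis using that(2,3) by (simp add: free_algebra_simps(1))
    qed
    then show ?thesis by (simp add: free_algebra_simps signed_monomials_simps)
  qed
  have inj: "f = g" if f: "f \<in> pasture_hom (free_algebra X) Q" and g: "g \<in> pasture_hom (free_algebra X) Q"
    and eq: "\<And>x. x \<in> X \<Longrightarrow> f (free_gen x) = g (free_gen x)" for f g
  proof -
    have one: "f (Some (1, m)) = g (Some (1, m))" if "Poly_Mapping.keys m \<subseteq> X" for m
      using that
    proof (induction rule: free_Abelian_group_induct[consumes 1])
      case 1
      have "h (Some (1, 0)) = \<one>\<^bsub>Q\<^esub>" if "h \<in> pasture_hom (free_algebra X) Q" for h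
      proof -
        have "h \<one>\<^bsub>free_algebra X\<^esub> = \<one>\<^bsub>Q\<^esub>"
          using that unfolding pasture_hom_def by blast
        then show ?thesis by (simp only: free_algebra_simps(3))
      qed
      from this[OF f] this[OF g] show ?case by simp
    next
      case (2 x y)
      have xy: "Poly_Mapping.keys (x - y) \<subseteq> X"
        using 2(1,2) keys_diff[of x y] by blast
      have "f (Some (1, x - y)) \<otimes>\<^bsub>Q\<^esub> f (Some (1, y)) = g (Some (1, x - y)) \<otimes>\<^bsub>Q\<^esub> f (Some (1, y))"
        using prod[OF f, of 1 "x - y" 1 y] prod[OF g, of 1 "x - y" 1 y] 2 xy
        by (simp add: signed_monomials_simps)
      moreover have "f (Some (1, y)) \<in> Units Q" "f (Some (1, x - y)) \<in> carrier Q"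
        "g (Some (1, x - y)) \<in> carrier Q"
        using pasture_hom_Units[OF A.pasture_axioms Q.pasture_axioms f, of "Some (1, y)"]
          pasture_hom_Units[OF A.pasture_axioms Q.pasture_axioms f, of "Some (1, x - y)"]
          pasture_hom_Units[OF A.pasture_axioms Q.pasture_axioms g, of "Some (1, x - y)"] 2 xy
        by (auto simp: Q.Units_nonzeros free_algebra_simps signed_monomials_simps)
      ultimately show ?case
        by (metis Q.Units_closed Q.Units_l_cancel Q.m_comm)
    next
      case (3 x)
      then show ?case using eq by (simp add: free_gen_def)
    qed
    have minus: "h (Some (- 1, m)) = pneg Q \<one>\<^bsub>Q\<^esub> \<otimes>\<^bsub>Q\<^esub> h (Some (1, m))"
      if "Poly_Mapping.keys m \<subseteq> X" "h \<in> pasture_hom (free_algebra X) Q" for h m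
      using prod[OF that(2), of "- 1" 0 1 m] that pneg_free_algebra[of 1 0 X]
        pasture_hom_neg_one[OF A.pasture_axioms Q.pasture_axioms that(2)]
      by (simp add: signed_monomials_simps free_algebra_simps)
    have "f a = g a" if "a \<in> carrier (free_algebra X)" for a
    proof (cases a)
      case None
      have "f (pzero (free_algebra X)) = pzero Q" "g (pzero (free_algebra X)) = pzero Q"
        using f g unfolding pasture_hom_def by blast+
      then show ?thesis by (simp add: None free_algebra_simps(2))
    next
      case (Some z)
      then obtain s m where "a = Some (s, m)" "s = 1 \<or> s = - 1" "Poly_Mapping.keys m \<subseteq> X"
        using \<open>a \<in> carrier (free_algebra X)\<close>
        by (cases z) (auto simp: free_algebra_simps(1) signed_monomials_simps(1))
      then show ?thesis using one minus[OF _ f] minus[OF _ g] by auto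
    qed
    moreover have "f a = g a" if "a \<notin> carrier (free_algebra X)" for a
      using that f g unfolding pasture_hom_def by (simp add: PiE_def extensional_def)
    ultimately show ?thesis by blast
  qed
  have surj: "\<exists>f \<in> pasture_hom (free_algebra X) Q. \<forall>x\<in>X. f (free_gen x) = u x"
    if u: "u \<in> X \<rightarrow>\<^sub>E nonzeros Q" for u
  proof -
    interpret U: comm_group "units_of Q" by (rule Q.units_comm_group)
    have "u ` X \<subseteq> carrier (units_of Q)"
      using u by (auto simp: units_of_carrier Q.Units_nonzeros)
    then obtain h where h: "h \<in> hom (free_Abelian_group X) (units_of Q)"
      and hu: "\<And>x. x \<in> X \<Longrightarrow> h (frag_of x) = u x"
      using U.free_Abelian_group_universal by metis
    have hU: "h m \<in> Units Q" if "Poly_Mapping.keys m \<subseteq> X" for m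
      using hom_in_carrier[OF h, of m] that by (simp add: units_of_carrier)
    have hC: "h m \<in> carrier Q" if "Poly_Mapping.keys m \<subseteq> X" for m
      using hU[OF that] by (rule Q.Units_closed)
    have hadd: "h (m + m') = h m \<otimes>\<^bsub>Q\<^esub> h m'"
      if "Poly_Mapping.keys m \<subseteq> X" "Poly_Mapping.keys m' \<subseteq> X" for m m'
      using hom_mult[OF h, of m m'] that by (simp add: units_of_mult)
    have h0: "h 0 = \<one>\<^bsub>Q\<^esub>"
      using hom_one[OF h group_free_Abelian_group U.group_axioms] by (simp add: units_of_one)
    define \<epsilon> where "\<epsilon> = pneg Q \<one>\<^bsub>Q\<^esub>"
    have \<epsilon>: "\<epsilon> \<in> carrier Q" "\<epsilon> \<otimes>\<^bsub>Q\<^esub> \<epsilon> = \<one>\<^bsub>Q\<^esub>"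
      using Q.neg_ex[OF Q.one_closed] Q.neg_one_square by (auto simp: \<epsilon>_def)
    define sg where "sg = (\<lambda>s::int. if s = 1 then \<one>\<^bsub>Q\<^esub> else \<epsilon>)"
    have sg: "sg s \<in> carrier Q" for s using \<epsilon> by (simp add: sg_def)
    have sgm: "sg (s * s') = sg s \<otimes>\<^bsub>Q\<^esub> sg s'" if "s = 1 \<or> s = - 1" "s' = 1 \<or> s' = - 1" for s s'
      using that \<epsilon> by (auto simp: sg_def)
    define f where "f = (\<lambda>z\<in>carrier (free_algebra X).
      case z of None \<Rightarrow> pzero Q | Some (s, m) \<Rightarrow> sg s \<otimes>\<^bsub>Q\<^esub> h m)"
    have fN: "f None = pzero Q" by (simp add: f_def free_algebra_simps)
    have fS: "f (Some (s, m)) = sg s \<otimes>\<^bsub>Q\<^esub> h m" if "(s, m) \<in> carrier (signed_monomials X)" for s m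
      using that by (simp add: f_def free_algebra_simps)
    have fC: "f a \<in> carrier Q" if "a \<in> carrier (free_algebra X)" for a
    proof (cases a)
      case None
      then show ?thesis by (simp add: fN Q.zero_closed)
    next
      case (Some g)
      then show ?thesis
        using that sg hC fS by (cases g) (auto simp: free_algebra_simps(1) signed_monomials_simps(1))
    qed
    have fM: "f (a \<otimes>\<^bsub>free_algebra X\<^esub> b) = f a \<otimes>\<^bsub>Q\<^esub> f b"
      if carr: "a \<in> carrier (free_algebra X)" "b \<in> carrier (free_algebra X)" for a b
    proof (cases "a = None \<or> b = None")
      case True
      then show ?thesis
        using fC that by (auto simp: free_algebra_simps(4,5) fN Q.zero_absorb Q.zero_absorb_right)
    next
      case False
      then obtain s m s' m' where ab: "a = Some (s, m)" "b = Some (s', m')"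
        "(s, m) \<in> carrier (signed_monomials X)" "(s', m') \<in> carrier (signed_monomials X)"
        using carr by (cases a; cases b) (auto simp: free_algebra_simps(1))
      have "f (a \<otimes>\<^bsub>free_algebra X\<^esub> b) = sg (s * s') \<otimes>\<^bsub>Q\<^esub> h (m + m')"
        using fS[of "s * s'" "m + m'"] S.m_closed[OF ab(3,4)]
        by (simp add: ab(1,2) free_algebra_simps signed_monomials_simps(2))
      also have "\<dots> = (sg s \<otimes>\<^bsub>Q\<^esub> sg s') \<otimes>\<^bsub>Q\<^esub> (h m \<otimes>\<^bsub>Q\<^esub> h m')"
        using ab(3,4) sgm hadd by (simp add: signed_monomials_simps)
      also have "\<dots> = (sg s \<otimes>\<^bsub>Q\<^esub> h m) \<otimes>\<^bsub>Q\<^esub> (sg s' \<otimes>\<^bsub>Q\<^esub> h m')"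
        using ab(3,4) sg hC by (simp add: signed_monomials_simps Q.m_ac)
      finally show ?thesis using ab fS by simp
    qed
    have fnull: "image_mset f A \<in> nullset Q" if A: "A \<in> nullset (free_algebra X)" for A
    proof -
      consider "A = {#None, None, None#}"
        | s m where "A = {#Some (s, m), Some (- s, m), None#}" "(s, m) \<in> carrier (signed_monomials X)"
        using A unfolding free_algebra_simps by blast
      then show ?thesis
      proof cases
        case 1
        then show ?thesis using Q.zero_nullset by (simp add: fN)
      next
        case 2
        have m: "Poly_Mapping.keys m \<subseteq> X" and s: "s = 1 \<or> s = - 1"
          and sm: "(- s, m) \<in> carrier (signed_monomials X)"
          using 2(2) by (auto simp: signed_monomials_simps)
        have "{#h m, h m \<otimes>\<^bsub>Q\<^esub> \<epsilon>, pzero Q#} \<in> nullset Q"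
          using Q.neg_ex[OF hC[OF m]] Q.neg_mult[OF hC[OF m]] by (simp add: \<epsilon>_def)
        then have "{#h m, \<epsilon> \<otimes>\<^bsub>Q\<^esub> h m, pzero Q#} \<in> nullset Q"
          using Q.m_comm hC[OF m] \<epsilon> by simp
        then have "{#sg s \<otimes>\<^bsub>Q\<^esub> h m, sg (- s) \<otimes>\<^bsub>Q\<^esub> h m, pzero Q#} \<in> nullset Q"
          using s hC[OF m] by (auto simp: sg_def add_mset_commute)
        then show ?thesis using 2 fS[OF 2(2)] fS[OF sm] by (simp add: fN)
      qed
    qed
    have "f \<in> pasture_hom (free_algebra X) Q"
      unfolding pasture_hom_def
    proof (intro CollectI conjI ballI)
      show "f \<in> carrier (free_algebra X) \<rightarrow>\<^sub>E carrier Q"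
        using fC by (auto simp: f_def)
      show "f (pzero (free_algebra X)) = pzero Q" by (simp add: free_algebra_simps fN)
      show "f \<one>\<^bsub>free_algebra X\<^esub> = \<one>\<^bsub>Q\<^esub>"
        using fS[of 1 0] h0 by (simp add: free_algebra_simps signed_monomials_simps sg_def)
    qed (use fM fnull in auto)
    moreover have "f (free_gen x) = u x" if "x \<in> X" for x
      using that fS[of 1 "frag_of x"] hu[OF that] hC[of "frag_of x"]
      by (simp add: free_gen_def signed_monomials_simps sg_def)
    ultimately show ?thesis by blast
  qed
  show ?thesis
    unfolding bij_betw_def
  proof (intro conjI inj_onI equalityI subsetI)
    fix f g assume fg: "f \<in> pasture_hom (free_algebra X) Q" "g \<in> pasture_hom (free_algebra X) Q"
      "(\<lambda>x\<in>X. f (free_gen x)) = (\<lambda>x\<in>X. g (free_gen x))"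
    show "f = g" by (rule inj[OF fg(1,2)]) (use fg(3) in \<open>metis restrict_apply'\<close>)
  next
    fix u assume "u \<in> (\<lambda>f. \<lambda>x\<in>X. f (free_gen x)) ` pasture_hom (free_algebra X) Q"
    then obtain f where f: "f \<in> pasture_hom (free_algebra X) Q" "u = (\<lambda>x\<in>X. f (free_gen x))"
      by blast
    show "u \<in> X \<rightarrow>\<^sub>E nonzeros Q"
      unfolding f(2)
      using pasture_hom_Units[OF A.pasture_axioms Q.pasture_axioms f(1) gen] by auto
  next
    fix u assume u: "u \<in> X \<rightarrow>\<^sub>E nonzeros Q"
    then obtain f where f: "f \<in> pasture_hom (free_algebra X) Q" "\<forall>x\<in>X. f (free_gen x) = u x"
      using surj by blast
    then have "u = (\<lambda>x\<in>X. f (free_gen x))"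
    proof (intro ext)
      fix x
      show "u x = (\<lambda>x\<in>X. f (free_gen x)) x"
        using f(2) PiE_arb[OF u] by simp
    qed
    then show "u \<in> (\<lambda>f. \<lambda>x\<in>X. f (free_gen x)) ` pasture_hom (free_algebra X) Q"
      by (rule image_eqI[where x = f, OF _ f(1)])
  qed
qed

lemma image_mset_cong_sym3:
  assumes "A \<in> sym3 P" "\<And>x. x \<in> carrier P \<Longrightarrow> f x = g x"
  shows "image_mset f A = image_mset g A"
  using assms by (intro image_mset_cong) (auto simp: sym3_def)

context
  fixes X :: "'x set" and R :: "(int \<times> ('x \<Rightarrow>\<^sub>0 int)) option multiset set"
  assumes R_sym3: "R \<subseteq> sym3 (free_algebra X)"
    and R_proper: "\<And>a. {#a, None, None#} \<in> R \<Longrightarrow> a = None"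
begin

private abbreviation (input) "G \<equiv> signed_monomials X"
private abbreviation (input) "A \<equiv> free_algebra X"
private abbreviation (input) "H \<equiv> relation_subgroup X R"
private abbreviation (input) "\<pi> \<equiv> quotient_map X R"
private abbreviation (input) "N \<equiv> nullset A \<union> {image_mset ((\<otimes>\<^bsub>A\<^esub>) c) B | c B. c \<in> carrier A \<and> B \<in> R}"

interpretation A: pasture A by (rule pasture_free_algebra)
interpretation G: comm_group G by (rule comm_group_signed_monomials)

private lemma Some_carrier: "Some a \<in> carrier A \<longleftrightarrow> a \<in> carrier G"
  by (auto simp: free_algebra_simps(1))

private lemma R_pair:
  assumes "{#Some a, Some b, None#} \<in> R"
  shows "a \<in> carrier G" "b \<in> carrier G"
proof -
  have "{#Some a, Some b, None#} \<in> sym3 A" using assms R_sym3 by blast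
  then have "\<forall>x \<in># {#Some a, Some b, None#}. x \<in> carrier A"
    unfolding sym3_def by force
  then show "a \<in> carrier G" "b \<in> carrier G" by (auto simp: Some_carrier)
qed

private lemma minus_one: "(- 1, 0) \<in> carrier G"
  by (simp add: signed_monomials_simps)

private lemma H_subgroup: "subgroup H G"
  unfolding relation_subgroup_def
  using R_pair minus_one by (intro G.generate_is_subgroup) (auto intro!: G.m_closed)

interpretation H: subgroup H G by (rule H_subgroup)
interpretation H: normal H G using H_subgroup by (simp add: G.normal_iff_subgroup)

private lemma coset_eq: 
  assumes "a \<in> carrier G" "b \<in> carrier G"
  shows "H #>\<^bsub>G\<^esub> a = H #>\<^bsub>G\<^esub> b \<longleftrightarrow> a \<otimes>\<^bsub>G\<^esub> inv\<^bsub>G\<^esub> b \<in> H"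
proof
  assume "H #>\<^bsub>G\<^esub> a = H #>\<^bsub>G\<^esub> b"
  then obtain h where "h \<in> H" "a = h \<otimes>\<^bsub>G\<^esub> b"
    using G.rcos_self[OF assms(1) H_subgroup] by (auto simp: r_coset_def)
  then show "a \<otimes>\<^bsub>G\<^esub> inv\<^bsub>G\<^esub> b \<in> H"
    using assms by (simp add: G.m_assoc)
next
  assume "a \<otimes>\<^bsub>G\<^esub> inv\<^bsub>G\<^esub> b \<in> H"
  then have "(a \<otimes>\<^bsub>G\<^esub> inv\<^bsub>G\<^esub> b) \<otimes>\<^bsub>G\<^esub> b \<in> H #>\<^bsub>G\<^esub> b"
    unfolding r_coset_def by blast
  then have "a \<in> H #>\<^bsub>G\<^esub> b"
    using assms by (simp add: G.m_assoc)
  then show "H #>\<^bsub>G\<^esub> a = H #>\<^bsub>G\<^esub> b"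
    using G.repr_independence[OF _ assms(2) H_subgroup] by simp
qed

private lemma quotient_simps:
  "carrier (free_quotient X R) = \<pi> ` carrier A"
  "pzero (free_quotient X R) = None"
  "\<one>\<^bsub>free_quotient X R\<^esub> = \<pi> \<one>\<^bsub>A\<^esub>"
  "nullset (free_quotient X R) = image_mset \<pi> ` N"
proof -
  have "carrier (free_quotient X R) = insert None (Some ` (\<lambda>a. H #>\<^bsub>G\<^esub> a) ` carrier G)"
    by (simp add: free_quotient_def adjoin_zero_simps carrier_FactGroup)
  then show "carrier (free_quotient X R) = \<pi> ` carrier A"
    by (simp add: free_algebra_simps(1) quotient_map_def image_image)
  show "pzero (free_quotient X R) = None"
    by (simp add: free_quotient_def adjoin_zero_simps)
  have "H #>\<^bsub>G\<^esub> \<one>\<^bsub>G\<^esub> = H"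
    by (rule G.coset_mult_one[OF H.subset])
  then show "\<one>\<^bsub>free_quotient X R\<^esub> = \<pi> \<one>\<^bsub>A\<^esub>"
    by (simp add: free_quotient_def adjoin_zero_simps free_algebra_simps quotient_map_def
        signed_monomials_simps)
  show "nullset (free_quotient X R) = image_mset \<pi> ` N"
    by (simp add: free_quotient_def adjoin_zero_simps)
qed

private lemma \<pi>_None: "\<pi> a = None \<longleftrightarrow> a = None" "\<pi> None = None"
  by (simp_all add: quotient_map_def)

private lemma \<pi>_mult:
  assumes "a \<in> carrier A" "b \<in> carrier A"
  shows "\<pi> (a \<otimes>\<^bsub>A\<^esub> b) = \<pi> a \<otimes>\<^bsub>free_quotient X R\<^esub> \<pi> b"
proof (cases "a = None \<or> b = None")
  case True
  then show ?thesis
    by (auto simp: free_algebra_simps(4,5) free_quotient_def adjoin_zero_simps \<pi>_None)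
next
  case False
  then obtain g k where gk: "a = Some g" "b = Some k" by (cases a; cases b) auto
  then have "g \<in> carrier G" "k \<in> carrier G" using assms by (auto simp: Some_carrier)
  then show ?thesis
    by (simp add: gk free_algebra_simps(6) free_quotient_def adjoin_zero_simps quotient_map_def
        H.rcos_sum)
qed

private lemma N_sym3: "N \<subseteq> sym3 A"
proof -
  have "image_mset ((\<otimes>\<^bsub>A\<^esub>) c) B \<in> sym3 A" if c: "c \<in> carrier A" and "B \<in> R" for c B
  proof -
    obtain x y z where "B = {#x, y, z#}" "x \<in> carrier A" "y \<in> carrier A" "z \<in> carrier A"
      using \<open>B \<in> R\<close> R_sym3 unfolding sym3_def by blast
    then have "image_mset ((\<otimes>\<^bsub>A\<^esub>) c) B = {#c \<otimes>\<^bsub>A\<^esub> x, c \<otimes>\<^bsub>A\<^esub> y, c \<otimes>\<^bsub>A\<^esub> z#}"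
      "c \<otimes>\<^bsub>A\<^esub> x \<in> carrier A" "c \<otimes>\<^bsub>A\<^esub> y \<in> carrier A" "c \<otimes>\<^bsub>A\<^esub> z \<in> carrier A"
      using c by auto
    then show ?thesis unfolding sym3_def by blast
  qed
  then show ?thesis using A.nullset_sym3 by blast
qed

private lemma N_mult:
  assumes a: "a \<in> carrier A" and B: "B \<in> N"
  shows "image_mset ((\<otimes>\<^bsub>A\<^esub>) a) B \<in> N"
proof (cases "B \<in> nullset A")
  case True
  then show ?thesis using A.nullset_mult[OF a] by blast
next
  case False
  then obtain c C where c: "B = image_mset ((\<otimes>\<^bsub>A\<^esub>) c) C" "c \<in> carrier A" "C \<in> R"
    using B by blast
  have "image_mset ((\<otimes>\<^bsub>A\<^esub>) a) B = image_mset (\<lambda>x. a \<otimes>\<^bsub>A\<^esub> (c \<otimes>\<^bsub>A\<^esub> x)) C"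
    by (simp add: c(1) multiset.map_comp comp_def)
  also have "\<dots> = image_mset ((\<otimes>\<^bsub>A\<^esub>) (a \<otimes>\<^bsub>A\<^esub> c)) C"
    by (rule image_mset_cong_sym3[of _ A]) (use c a R_sym3 A.m_assoc in auto)
  finally show ?thesis using a c A.m_closed by blast
qed

private lemma N_pair:
  assumes N: "{#x, y, None#} \<in> N"
  shows "\<pi> y = \<pi> (pneg A x)"
proof -
  have "{#x, y, None#} \<in> sym3 A" using N N_sym3 by blast
  then have "\<forall>z \<in># {#x, y, None#}. z \<in> carrier A"
    unfolding sym3_def by force
  then have xy: "x \<in> carrier A" "y \<in> carrier A" by auto
  show ?thesis
  proof (cases "{#x, y, None#} \<in> nullset A")
    case True
    then show ?thesis using A.neg_unique xy by (simp add: free_algebra_simps(2))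
  next
    case False
    then obtain c C where c: "{#x, y, None#} = image_mset ((\<otimes>\<^bsub>A\<^esub>) c) C" "c \<in> carrier A" "C \<in> R"
      using N by blast
    have neg_None: "pneg A None = None"
      using A.neg_mult[OF A.zero_closed] by (simp add: free_algebra_simps(2,4))
    show ?thesis
    proof (cases c)
      case None
      have "set_mset {#x, y, None#} = (\<otimes>\<^bsub>A\<^esub>) c ` set_mset C"
        unfolding c(1) by simp
      then have "x = None" "y = None"
        using None by (auto simp: free_algebra_simps(4))
      then show ?thesis by (simp add: neg_None)
    next
      case (Some k)
      then have k: "k \<in> carrier G" using c(2) by (simp add: Some_carrier)
      have "\<exists>x' y'. C = {#x', y', None#} \<and> x = c \<otimes>\<^bsub>A\<^esub> x' \<and> y = c \<otimes>\<^bsub>A\<^esub> y'"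
      proof -
        have "image_mset ((\<otimes>\<^bsub>A\<^esub>) c) C = add_mset x (add_mset y {#None#})"
          by (rule c(1)[symmetric])
        then obtain x' C' where 1: "C = add_mset x' C'" "x = c \<otimes>\<^bsub>A\<^esub> x'"
          "image_mset ((\<otimes>\<^bsub>A\<^esub>) c) C' = add_mset y {#None#}"
          using msed_map_invR[of _ C x "add_mset y {#None#}"] by blast
        then obtain y' C'' where 2: "C' = add_mset y' C''" "y = c \<otimes>\<^bsub>A\<^esub> y'"
          "image_mset ((\<otimes>\<^bsub>A\<^esub>) c) C'' = {#None#}"
          using msed_map_invR[of _ C' y "{#None#}"] by blast
        then obtain z' where 3: "C'' = {#z'#}" "None = c \<otimes>\<^bsub>A\<^esub> z'"
          using msed_map_invR[of "(\<otimes>\<^bsub>A\<^esub>) c" C'' None "{#}"]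
          unfolding image_mset_is_empty_iff by metis
        have "z' = None"
          using 3(2) Some by (cases z') (auto simp: free_algebra_simps(6))
        then show ?thesis using 1 2 3 by blast
      qed
      then obtain x' y' where C: "C = {#x', y', None#}" "x = c \<otimes>\<^bsub>A\<^esub> x'" "y = c \<otimes>\<^bsub>A\<^esub> y'"
        by blast
      show ?thesis
      proof (cases "x' = None \<or> y' = None")
        case True
        have CR: "{#x', y', None#} \<in> R" "{#y', x', None#} \<in> R"
          using c(3) unfolding C(1) by (simp_all add: add_mset_commute[of y' x'])
        have "x' = None \<and> y' = None"
          using True R_proper[of x'] R_proper[of y'] CR by blast
        then show ?thesis using C by (simp add: free_algebra_simps(5) neg_None)
      next
        case False
        then obtain a b where ab: "x' = Some a" "y' = Some b" by (cases x'; cases y') auto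
        have abR: "{#Some a, Some b, None#} \<in> R" using ab C c by simp
        have abG: "a \<in> carrier G" "b \<in> carrier G" using R_pair[OF abR] by auto
        have mem: "(- 1, 0) \<otimes>\<^bsub>G\<^esub> (inv\<^bsub>G\<^esub> a \<otimes>\<^bsub>G\<^esub> b) \<in> H"
          unfolding relation_subgroup_def by (rule generate.incl) (use abR in blast)
        have sq: "(- 1, 0) \<otimes>\<^bsub>G\<^esub> (- 1, 0) = \<one>\<^bsub>G\<^esub>"
          by (simp add: signed_monomials_simps)
        then have inv_minus: "inv\<^bsub>G\<^esub> (- 1, 0) = (- 1, 0)"
          using minus_one by (rule G.inv_equality) (rule minus_one)
        have neg: "pneg A x = Some ((k \<otimes>\<^bsub>G\<^esub> a) \<otimes>\<^bsub>G\<^esub> (- 1, 0))"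
        proof -
          have "pneg A x = x \<otimes>\<^bsub>A\<^esub> pneg A \<one>\<^bsub>A\<^esub>"
            by (rule A.neg_mult[OF xy(1)])
          moreover have "pneg A \<one>\<^bsub>A\<^esub> = Some (- 1, 0)"
            unfolding free_algebra_simps(3)
            by (rule pneg_free_algebra) (simp add: signed_monomials_simps)
          ultimately show ?thesis
            by (simp add: C(2) ab Some free_algebra_simps(6))
        qed
        have "(k \<otimes>\<^bsub>G\<^esub> b) \<otimes>\<^bsub>G\<^esub> inv\<^bsub>G\<^esub> ((k \<otimes>\<^bsub>G\<^esub> a) \<otimes>\<^bsub>G\<^esub> (- 1, 0))
            = (k \<otimes>\<^bsub>G\<^esub> inv\<^bsub>G\<^esub> k) \<otimes>\<^bsub>G\<^esub> ((- 1, 0) \<otimes>\<^bsub>G\<^esub> (inv\<^bsub>G\<^esub> a \<otimes>\<^bsub>G\<^esub> b))"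
          using k abG minus_one by (simp only: G.inv_mult inv_minus G.m_closed G.inv_closed G.m_ac)
        also have "\<dots> = (- 1, 0) \<otimes>\<^bsub>G\<^esub> (inv\<^bsub>G\<^esub> a \<otimes>\<^bsub>G\<^esub> b)"
          using k abG minus_one by (simp only: G.r_inv G.l_one G.m_closed G.inv_closed)
        finally have "H #>\<^bsub>G\<^esub> (k \<otimes>\<^bsub>G\<^esub> b) = H #>\<^bsub>G\<^esub> ((k \<otimes>\<^bsub>G\<^esub> a) \<otimes>\<^bsub>G\<^esub> (- 1, 0))"
          using coset_eq mem k abG minus_one by simp
        then show ?thesis
          unfolding neg by (simp add: C(3) ab Some free_algebra_simps(6) quotient_map_def)
      qed
    qed
  qed
qed

lemma pasture_free_quotient: "pasture (free_quotient X R)"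
proof -
  let ?Q = "free_quotient X R"
  have Q: "?Q = adjoin_zero (G Mod H) (image_mset \<pi> ` N)"
    by (simp add: free_quotient_def)
  show ?thesis
    unfolding Q
  proof (rule pasture_adjoin_zero, unfold Q[symmetric])
    show "comm_group (G Mod H)" by (rule G.abelian_FactGroup[OF H_subgroup])
    show "image_mset \<pi> ` N \<subseteq> sym3 ?Q"
    proof
      fix B assume "B \<in> image_mset \<pi> ` N"
      then obtain C where C: "B = image_mset \<pi> C" "C \<in> sym3 A" using N_sym3 by blast
      then obtain x y z where "C = {#x, y, z#}" "x \<in> carrier A" "y \<in> carrier A" "z \<in> carrier A"
        unfolding sym3_def by blast
      then have "B = {#\<pi> x, \<pi> y, \<pi> z#}" "\<pi> x \<in> carrier ?Q" "\<pi> y \<in> carrier ?Q" "\<pi> z \<in> carrier ?Q"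
        using C by (auto simp: quotient_simps(1))
      then show "B \<in> sym3 ?Q" unfolding sym3_def by blast
    qed
    show "image_mset ((\<otimes>\<^bsub>?Q\<^esub>) q) B \<in> image_mset \<pi> ` N"
      if q: "q \<in> carrier ?Q" and B: "B \<in> image_mset \<pi> ` N" for q B
    proof -
      obtain a where a: "q = \<pi> a" "a \<in> carrier A" using q by (auto simp: quotient_simps(1))
      obtain C where C: "B = image_mset \<pi> C" "C \<in> N" using B by blast
      have "image_mset ((\<otimes>\<^bsub>?Q\<^esub>) q) B = image_mset (\<lambda>x. \<pi> a \<otimes>\<^bsub>?Q\<^esub> \<pi> x) C"
        by (simp add: C(1) a(1) multiset.map_comp comp_def)
      also have "\<dots> = image_mset (\<lambda>x. \<pi> (a \<otimes>\<^bsub>A\<^esub> x)) C"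
        by (rule image_mset_cong_sym3[OF subsetD[OF N_sym3 C(2)]]) (simp add: \<pi>_mult[OF a(2)])
      also have "\<dots> = image_mset \<pi> (image_mset ((\<otimes>\<^bsub>A\<^esub>) a) C)"
        by (simp add: multiset.map_comp comp_def)
      finally show ?thesis using N_mult[OF a(2) C(2)] by blast
    qed
    show "\<exists>!b. b \<in> carrier ?Q \<and> {#q, b, None#} \<in> image_mset \<pi> ` N" if q: "q \<in> carrier ?Q" for q
    proof -
      obtain a where a: "q = \<pi> a" "a \<in> carrier A" using q by (auto simp: quotient_simps(1))
      have neg: "pneg A a \<in> carrier A" "{#a, pneg A a, None#} \<in> nullset A"
        using A.neg_ex[OF a(2)] by (auto simp: free_algebra_simps(2))
      show ?thesis
      proof (rule ex1I[of _ "\<pi> (pneg A a)"])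
        have "image_mset \<pi> {#a, pneg A a, None#} \<in> image_mset \<pi> ` N"
          using neg(2) by blast
        then show "\<pi> (pneg A a) \<in> carrier ?Q \<and> {#q, \<pi> (pneg A a), None#} \<in> image_mset \<pi> ` N"
          using neg(1) by (simp add: a(1) quotient_simps(1) \<pi>_None(2))
      next
        fix b assume b: "b \<in> carrier ?Q \<and> {#q, b, None#} \<in> image_mset \<pi> ` N"
        obtain C where C: "C \<in> N" "image_mset \<pi> C = add_mset q (add_mset b {#None#})"
          by (rule imageE[OF conjunct2[OF b]]) (erule that, erule sym)
        then obtain x C' where 1: "C = add_mset x C'" "q = \<pi> x"
          "image_mset \<pi> C' = add_mset b {#None#}"
          using msed_map_invR[of \<pi> C q "add_mset b {#None#}"] by blast
        then obtain y C'' where 2: "C' = add_mset y C''" "b = \<pi> y" "image_mset \<pi> C'' = {#None#}"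
          using msed_map_invR[of \<pi> C' b "{#None#}"] by blast
        obtain z where "C'' = {#z#}" "\<pi> z = None"
          using msed_map_invR[OF 2(3)] unfolding image_mset_is_empty_iff by metis
        then have "C'' = {#None#}" by (simp add: \<pi>_None(1))
        then have xy: "{#x, y, None#} \<in> N" using 1 2 C(1) by simp
        then have "{#x, y, None#} \<in> sym3 A" using N_sym3 by blast
        then have "\<forall>z \<in># {#x, y, None#}. z \<in> carrier A"
          unfolding sym3_def by force
        then have x: "x \<in> carrier A" by simp
        have neg1: "pneg A \<one>\<^bsub>A\<^esub> \<in> carrier A" using A.neg_ex[OF A.one_closed] by blast
        have "\<pi> y = \<pi> (pneg A x)" by (rule N_pair[OF xy])
        also have "\<dots> = \<pi> (x \<otimes>\<^bsub>A\<^esub> pneg A \<one>\<^bsub>A\<^esub>)" by (simp only: A.neg_mult[OF x])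
        also have "\<dots> = \<pi> x \<otimes>\<^bsub>?Q\<^esub> \<pi> (pneg A \<one>\<^bsub>A\<^esub>)" by (rule \<pi>_mult[OF x neg1])
        also have "\<dots> = \<pi> a \<otimes>\<^bsub>?Q\<^esub> \<pi> (pneg A \<one>\<^bsub>A\<^esub>)" using 1(2) a(1) by simp
        also have "\<dots> = \<pi> (a \<otimes>\<^bsub>A\<^esub> pneg A \<one>\<^bsub>A\<^esub>)" by (rule \<pi>_mult[OF a(2) neg1, symmetric])
        also have "\<dots> = \<pi> (pneg A a)" by (simp only: A.neg_mult[OF a(2)])
        finally show "b = \<pi> (pneg A a)" using 2(2) by simp
      qed
    qed
  qed
qed

lemma free_quotient_universal:
  assumes Q: "pasture Q"
  shows "bij_betw (\<lambda>f. \<lambda>a\<in>carrier (free_algebra X). f (quotient_map X R a))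
           (pasture_hom (free_quotient X R) Q)
           {h \<in> pasture_hom (free_algebra X) Q. \<forall>B\<in>R. image_mset h B \<in> nullset Q}"
proof -
  interpret Q: pasture Q by fact
  let ?P = "free_quotient X R"
  have restr: "image_mset (\<lambda>a\<in>carrier A. f (\<pi> a)) B = image_mset f (image_mset \<pi> B)"
    if "B \<in> sym3 A" for f :: "_ \<Rightarrow> 'b" and B
  proof -
    have "image_mset (\<lambda>a\<in>carrier A. f (\<pi> a)) B = image_mset (\<lambda>a. f (\<pi> a)) B"
      by (rule image_mset_cong_sym3[OF that]) simp
    then show ?thesis by (simp add: multiset.map_comp comp_def)
  qed
  have wd: "(\<lambda>a\<in>carrier A. f (\<pi> a)) \<in> {h \<in> pasture_hom A Q. \<forall>B\<in>R. image_mset h B \<in> nullset Q}"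
    if f: "f \<in> pasture_hom ?P Q" for f
  proof -
    have fC: "f q \<in> carrier Q" if "q \<in> carrier ?P" for q
      using f that unfolding pasture_hom_def by blast
    have f0: "f (pzero ?P) = pzero Q" and f1: "f \<one>\<^bsub>?P\<^esub> = \<one>\<^bsub>Q\<^esub>"
      using f unfolding pasture_hom_def by blast+
    have fM: "f (p \<otimes>\<^bsub>?P\<^esub> q) = f p \<otimes>\<^bsub>Q\<^esub> f q" if "p \<in> carrier ?P" "q \<in> carrier ?P" for p q
      using f that unfolding pasture_hom_def by blast
    have fN: "image_mset f B \<in> nullset Q" if "B \<in> nullset ?P" for B
      using f that unfolding pasture_hom_def by blast
    have N: "image_mset (\<lambda>a\<in>carrier A. f (\<pi> a)) B \<in> nullset Q" if "B \<in> N" for B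
    proof -
      have "B \<in> sym3 A" using that N_sym3 by blast
      then show ?thesis using fN that by (simp only: restr quotient_simps(4)) blast
    qed
    have RN: "B \<in> N" if "B \<in> R" for B
    proof -
      have "image_mset ((\<otimes>\<^bsub>A\<^esub>) \<one>\<^bsub>A\<^esub>) B = image_mset (\<lambda>x. x) B"
        by (rule image_mset_cong_sym3[of _ A]) (use that R_sym3 in auto)
      then show ?thesis using that A.one_closed by force
    qed
    show ?thesis
      unfolding pasture_hom_def
    proof (intro CollectI conjI ballI)
      show "(\<lambda>a\<in>carrier A. f (\<pi> a)) \<in> carrier A \<rightarrow>\<^sub>E carrier Q"
        using fC by (auto simp: quotient_simps(1))
      show "(\<lambda>a\<in>carrier A. f (\<pi> a)) (pzero A) = pzero Q"
        using f0 A.zero_closed by (simp add: quotient_simps(2) free_algebra_simps(2) \<pi>_None(2))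
      show "(\<lambda>a\<in>carrier A. f (\<pi> a)) \<one>\<^bsub>A\<^esub> = \<one>\<^bsub>Q\<^esub>"
        using f1 by (simp add: quotient_simps(3))
      show "(\<lambda>a\<in>carrier A. f (\<pi> a)) (a \<otimes>\<^bsub>A\<^esub> b)
          = (\<lambda>a\<in>carrier A. f (\<pi> a)) a \<otimes>\<^bsub>Q\<^esub> (\<lambda>a\<in>carrier A. f (\<pi> a)) b"
        if "a \<in> carrier A" "b \<in> carrier A" for a b
        using that fM by (simp add: \<pi>_mult quotient_simps(1))
    qed (use N RN in blast)+
  qed
  have inj: "f = g" if f: "f \<in> pasture_hom ?P Q" and g: "g \<in> pasture_hom ?P Q"
    and eq: "(\<lambda>a\<in>carrier A. f (\<pi> a)) = (\<lambda>a\<in>carrier A. g (\<pi> a))" for f g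
  proof (rule extensionalityI)
    show "f \<in> extensional (carrier ?P)" "g \<in> extensional (carrier ?P)"
      using f g unfolding pasture_hom_def by (auto simp: PiE_def)
    fix q assume "q \<in> carrier ?P"
    then obtain a where "q = \<pi> a" "a \<in> carrier A" by (auto simp: quotient_simps(1))
    then show "f q = g q" using fun_cong[OF eq, of a] by simp
  qed
  have surj: "\<exists>f \<in> pasture_hom ?P Q. h = (\<lambda>a\<in>carrier A. f (\<pi> a))"
    if h: "h \<in> pasture_hom A Q" and hR: "\<forall>B\<in>R. image_mset h B \<in> nullset Q" for h
  proof -
    have hC: "h a \<in> carrier Q" if "a \<in> carrier A" for a
      using h that unfolding pasture_hom_def by blast
    have h0: "h None = pzero Q" and h1: "h (Some \<one>\<^bsub>G\<^esub>) = \<one>\<^bsub>Q\<^esub>"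
      using h unfolding pasture_hom_def
      by (auto simp: free_algebra_simps(2,3) signed_monomials_simps(3))
    have hM: "h (a \<otimes>\<^bsub>A\<^esub> b) = h a \<otimes>\<^bsub>Q\<^esub> h b" if "a \<in> carrier A" "b \<in> carrier A" for a b
      using h that unfolding pasture_hom_def by blast
    have hMS: "h (Some (a \<otimes>\<^bsub>G\<^esub> b)) = h (Some a) \<otimes>\<^bsub>Q\<^esub> h (Some b)"
      if "a \<in> carrier G" "b \<in> carrier G" for a b
      using hM[of "Some a" "Some b"] that by (simp add: Some_carrier free_algebra_simps(6))
    have hSC: "h (Some a) \<in> carrier Q" if "a \<in> carrier G" for a
      using hC[of "Some a"] that by (simp add: Some_carrier)
    have hN: "image_mset h B \<in> nullset Q" if BN: "B \<in> N" for B
    proof (cases "B \<in> nullset A")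
      case True
      then show ?thesis using h unfolding pasture_hom_def by blast
    next
      case False
      then obtain c C where c: "B = image_mset ((\<otimes>\<^bsub>A\<^esub>) c) C" "c \<in> carrier A" "C \<in> R"
        using BN by blast
      have "image_mset h B = image_mset (\<lambda>x. h (c \<otimes>\<^bsub>A\<^esub> x)) C"
        by (simp add: c(1) multiset.map_comp comp_def)
      also have "\<dots> = image_mset (\<lambda>x. h c \<otimes>\<^bsub>Q\<^esub> h x) C"
        by (rule image_mset_cong_sym3[of _ A]) (use c R_sym3 hM in auto)
      also have "\<dots> = image_mset ((\<otimes>\<^bsub>Q\<^esub>) (h c)) (image_mset h C)"
        by (simp add: multiset.map_comp comp_def)
      finally show ?thesis using Q.nullset_mult hC c hR by simp
    qed
    define K where "K = {a \<in> carrier G. h (Some a) = \<one>\<^bsub>Q\<^esub>}"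
    have K: "subgroup K G"
    proof (rule G.subgroupI)
      show "K \<subseteq> carrier G" by (auto simp: K_def)
      have "\<one>\<^bsub>G\<^esub> \<in> K" using h1 by (simp add: K_def)
      then show "K \<noteq> {}" by blast
      show "inv\<^bsub>G\<^esub> a \<in> K" if "a \<in> K" for a
      proof -
        have a: "a \<in> carrier G" "h (Some a) = \<one>\<^bsub>Q\<^esub>" using that by (auto simp: K_def)
        have "h (Some (inv\<^bsub>G\<^esub> a)) \<otimes>\<^bsub>Q\<^esub> h (Some a) = \<one>\<^bsub>Q\<^esub>"
          using hMS[of "inv\<^bsub>G\<^esub> a" a] a h1 by simp
        then show ?thesis using a hSC[of "inv\<^bsub>G\<^esub> a"] by (simp add: K_def)
      qed
      show "a \<otimes>\<^bsub>G\<^esub> b \<in> K" if "a \<in> K" "b \<in> K" for a b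
        using that hMS by (auto simp: K_def)
    qed
    have neg1: "pneg Q \<one>\<^bsub>Q\<^esub> \<in> carrier Q" using Q.neg_ex[OF Q.one_closed] by blast
    have hneg: "h (Some (- 1, 0)) = pneg Q \<one>\<^bsub>Q\<^esub>"
      using pasture_hom_neg_one[OF A.pasture_axioms Q h] pneg_free_algebra[of 1 0 X]
      by (simp add: free_algebra_simps(3) signed_monomials_simps)
    have "H \<subseteq> K"
      unfolding relation_subgroup_def
    proof (rule G.generate_subgroup_incl[OF _ K], rule subsetI, elim CollectE exE conjE)
      fix x a b
      assume x: "x = (- 1, 0) \<otimes>\<^bsub>G\<^esub> (inv\<^bsub>G\<^esub> a \<otimes>\<^bsub>G\<^esub> b)" and ab: "{#Some a, Some b, None#} \<in> R"
      have abG: "a \<in> carrier G" "b \<in> carrier G" using R_pair[OF ab] by auto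
      have "image_mset h {#Some a, Some b, None#} \<in> nullset Q" using hR ab by blast
      then have "pneg Q (h (Some a)) = h (Some b)"
        using Q.neg_unique hSC abG by (simp add: h0)
      then have hb: "h (Some b) = h (Some a) \<otimes>\<^bsub>Q\<^esub> pneg Q \<one>\<^bsub>Q\<^esub>"
        by (simp only: Q.neg_mult[OF hSC[OF abG(1)]])
      have inv: "h (Some (inv\<^bsub>G\<^esub> a)) \<otimes>\<^bsub>Q\<^esub> h (Some a) = \<one>\<^bsub>Q\<^esub>"
        using hMS[of "inv\<^bsub>G\<^esub> a" a] abG h1 by simp
      have "h (Some ((- 1, 0) \<otimes>\<^bsub>G\<^esub> (inv\<^bsub>G\<^esub> a \<otimes>\<^bsub>G\<^esub> b)))
          = pneg Q \<one>\<^bsub>Q\<^esub> \<otimes>\<^bsub>Q\<^esub> (h (Some (inv\<^bsub>G\<^esub> a)) \<otimes>\<^bsub>Q\<^esub> (h (Some a) \<otimes>\<^bsub>Q\<^esub> pneg Q \<one>\<^bsub>Q\<^esub>))"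
        using abG minus_one by (simp add: hMS hneg hb)
      also have "\<dots> = pneg Q \<one>\<^bsub>Q\<^esub> \<otimes>\<^bsub>Q\<^esub> ((h (Some (inv\<^bsub>G\<^esub> a)) \<otimes>\<^bsub>Q\<^esub> h (Some a)) \<otimes>\<^bsub>Q\<^esub> pneg Q \<one>\<^bsub>Q\<^esub>)"
        using abG neg1 hSC Q.m_assoc by simp
      also have "\<dots> = \<one>\<^bsub>Q\<^esub>"
        using neg1 Q.neg_one_square by (simp add: inv)
      finally show "x \<in> K"
        using abG minus_one by (simp add: K_def x)
    qed
    have factor: "h a = h b" if "a \<in> carrier A" "b \<in> carrier A" "\<pi> a = \<pi> b" for a b
    proof (cases "a = None \<or> b = None")
      case True
      then show ?thesis using \<pi>_None that(3) by metis
    next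
      case False
      then obtain g k where gk: "a = Some g" "b = Some k" by (cases a; cases b) auto
      then have G: "g \<in> carrier G" "k \<in> carrier G" using that by (auto simp: Some_carrier)
      have "H #>\<^bsub>G\<^esub> g = H #>\<^bsub>G\<^esub> k" using that(3) gk by (simp add: quotient_map_def)
      then have "g \<otimes>\<^bsub>G\<^esub> inv\<^bsub>G\<^esub> k \<in> K" using coset_eq[OF G] \<open>H \<subseteq> K\<close> by blast
      then have "h (Some (g \<otimes>\<^bsub>G\<^esub> inv\<^bsub>G\<^esub> k)) = \<one>\<^bsub>Q\<^esub>" by (simp add: K_def)
      then have "h (Some ((g \<otimes>\<^bsub>G\<^esub> inv\<^bsub>G\<^esub> k) \<otimes>\<^bsub>G\<^esub> k)) = h (Some k)"
        using G hMS[of "g \<otimes>\<^bsub>G\<^esub> inv\<^bsub>G\<^esub> k" k] hSC by simp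
      then show ?thesis using G gk by (simp add: G.m_assoc)
    qed
    define f where "f = (\<lambda>q\<in>carrier ?P. h (SOME a. a \<in> carrier A \<and> \<pi> a = q))"
    have f\<pi>: "f (\<pi> a) = h a" if "a \<in> carrier A" for a
    proof -
      have "(SOME b. b \<in> carrier A \<and> \<pi> b = \<pi> a) \<in> carrier A \<and> \<pi> (SOME b. b \<in> carrier A \<and> \<pi> b = \<pi> a) = \<pi> a"
        by (rule someI[of "\<lambda>b. b \<in> carrier A \<and> \<pi> b = \<pi> a" a]) (use that in simp)
      then have "h (SOME b. b \<in> carrier A \<and> \<pi> b = \<pi> a) = h a"
        using factor that by blast
      then show ?thesis using that by (simp add: f_def quotient_simps(1))
    qed
    have "f \<in> pasture_hom ?P Q"
      unfolding pasture_hom_def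
    proof (intro CollectI conjI ballI)
      show "f \<in> carrier ?P \<rightarrow>\<^sub>E carrier Q"
      proof (rule PiE_I)
        show "f q \<in> carrier Q" if "q \<in> carrier ?P" for q
          using that f\<pi> hC by (auto simp: quotient_simps(1))
      qed (simp add: f_def)
      show "f (pzero ?P) = pzero Q"
        using f\<pi>[OF A.zero_closed] by (simp add: quotient_simps(2) free_algebra_simps(2) \<pi>_None(2) h0)
      show "f \<one>\<^bsub>?P\<^esub> = \<one>\<^bsub>Q\<^esub>"
        using f\<pi>[OF A.one_closed] h1
        by (simp add: quotient_simps(3) free_algebra_simps(3) signed_monomials_simps(3))
      show "f (p \<otimes>\<^bsub>?P\<^esub> q) = f p \<otimes>\<^bsub>Q\<^esub> f q" if pq: "p \<in> carrier ?P" "q \<in> carrier ?P" for p q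
      proof -
        obtain a b where "p = \<pi> a" "q = \<pi> b" "a \<in> carrier A" "b \<in> carrier A"
          using pq by (auto simp: quotient_simps(1))
        then show ?thesis using hM f\<pi> by (simp flip: \<pi>_mult)
      qed
      show "image_mset f B \<in> nullset Q" if "B \<in> nullset ?P" for B
      proof -
        obtain C where C: "B = image_mset \<pi> C" "C \<in> N" using \<open>B \<in> nullset ?P\<close> quotient_simps(4) by blast
        have "image_mset f B = image_mset (\<lambda>a. f (\<pi> a)) C"
          by (simp add: C(1) multiset.map_comp comp_def)
        also have "\<dots> = image_mset h C"
          by (rule image_mset_cong_sym3[OF subsetD[OF N_sym3 C(2)]]) (rule f\<pi>)
        finally show ?thesis using hN C(2) by simp
      qed
    qed
    moreover have "h = (\<lambda>a\<in>carrier A. f (\<pi> a))"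
    proof (rule extensionalityI[of _ "carrier A"])
      show "h \<in> extensional (carrier A)"
        using h unfolding pasture_hom_def by (auto simp: PiE_def)
    qed (use f\<pi> in auto)
    ultimately show ?thesis by blast
  qed
  show ?thesis
    unfolding bij_betw_def
  proof (intro conjI inj_onI equalityI subsetI)
    fix h assume "h \<in> {h \<in> pasture_hom A Q. \<forall>B\<in>R. image_mset h B \<in> nullset Q}"
    then obtain f where f: "f \<in> pasture_hom ?P Q" "h = (\<lambda>a\<in>carrier A. f (\<pi> a))"
      using surj by blast
    show "h \<in> (\<lambda>f. \<lambda>a\<in>carrier A. f (\<pi> a)) ` pasture_hom ?P Q"
      by (rule image_eqI[where x = f, OF _ f(1)]) (rule f(2))
  next
    fix h assume "h \<in> (\<lambda>f. \<lambda>a\<in>carrier A. f (\<pi> a)) ` pasture_hom ?P Q"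
    then obtain f where f: "f \<in> pasture_hom ?P Q" "h = (\<lambda>a\<in>carrier A. f (\<pi> a))" by blast
    show "h \<in> {h \<in> pasture_hom A Q. \<forall>B\<in>R. image_mset h B \<in> nullset Q}"
      unfolding f(2) by (rule wd[OF f(1)])
  qed (use inj in blast)
qed

end


section \<open>Representations and the foundation\<close>

definition representations :: "'a matroid \<Rightarrow> 'p pasture \<Rightarrow> ('a set \<Rightarrow> 'a \<Rightarrow> 'p) set" where
  "representations M P = {\<phi>.
     (\<forall>H\<in>hyperplanes M. \<forall>e\<in>ground M. \<phi> H e \<in> carrier P \<and> (\<phi> H e = pzero P \<longleftrightarrow> e \<in> H)) \<and>
     (\<forall>H1\<in>hyperplanes M. \<forall>H2\<in>hyperplanes M. \<forall>H3\<in>hyperplanes M.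
        H1 \<noteq> H2 \<and> H1 \<noteq> H3 \<and> H2 \<noteq> H3 \<and> corank_flat M 2 (H1 \<inter> H2 \<inter> H3) \<longrightarrow>
        (\<exists>a\<in>carrier P. \<exists>b\<in>carrier P. \<exists>c\<in>carrier P.
           (a, b, c) \<noteq> (pzero P, pzero P, pzero P) \<and>
           (\<forall>e\<in>ground M.
              {#a \<otimes>\<^bsub>P\<^esub> \<phi> H1 e, b \<otimes>\<^bsub>P\<^esub> \<phi> H2 e, c \<otimes>\<^bsub>P\<^esub> \<phi> H3 e#} \<in> nullset P)))}"

text \<open>Representations are not required to be extensional: functions that agree on hyperplanes
  and elements of the ground set are rescaling equivalent.\<close>

definition rescaling :: "'a matroid \<Rightarrow> 'p pasture \<Rightarrow> ('a set \<Rightarrow> 'a \<Rightarrow> 'p) rel" where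
  "rescaling M P = {(\<phi>, \<phi>'). \<phi> \<in> representations M P \<and> \<phi>' \<in> representations M P \<and>
     (\<exists>a t. (\<forall>H\<in>hyperplanes M. a H \<in> nonzeros P) \<and> (\<forall>e\<in>ground M. t e \<in> nonzeros P) \<and>
        (\<forall>H\<in>hyperplanes M. \<forall>e\<in>ground M. \<phi>' H e = a H \<otimes>\<^bsub>P\<^esub> t e \<otimes>\<^bsub>P\<^esub> \<phi> H e))}"

definition rescaling_classes :: "'a matroid \<Rightarrow> 'p pasture \<Rightarrow> ('a set \<Rightarrow> 'a \<Rightarrow> 'p) set set" where
  "rescaling_classes M P = representations M P // rescaling M P"

text \<open>The map of rescaling classes induced by a morphism \<open>g\<close> with codomain \<open>Q\<close>.\<close>

definition push_class ::
    "'a matroid \<Rightarrow> 'q pasture \<Rightarrow> ('p \<Rightarrow> 'q) \<Rightarrow> ('a set \<Rightarrow> 'a \<Rightarrow> 'p) set \<Rightarrow> ('a set \<Rightarrow> 'a \<Rightarrow> 'q) set" where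
  "push_class M Q g C = rescaling M Q `` {\<lambda>H e. g (\<phi> H e) | \<phi>. \<phi> \<in> C}"

text \<open>\<open>F\<close> represents the functor of rescaling classes, by means of the natural bijections \<open>\<eta>\<close>.
  The pastures range over those carried by subsets of the type \<open>'u\<close>, which plays the role of the
  universe. As \<open>'u\<close> is infinite, this includes, up to isomorphism, all countable pastures, such
  as the foundation of a matroid on a finite ground set.\<close>

definition is_foundation ::
    "'a matroid \<Rightarrow> 'u::infinite pasture \<Rightarrow>
       ('u pasture \<Rightarrow> ('u \<Rightarrow> 'u) \<Rightarrow> ('a set \<Rightarrow> 'a \<Rightarrow> 'u) set) \<Rightarrow> bool" where
  "is_foundation M F \<eta> \<longleftrightarrow> pasture F \<and>
     (\<forall>P. pasture P \<longrightarrow> bij_betw (\<eta> P) (pasture_hom F P) (rescaling_classes M P)) \<and>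
     (\<forall>P Q f g. pasture P \<and> pasture Q \<and> f \<in> pasture_hom F P \<and> g \<in> pasture_hom P Q \<longrightarrow>
        \<eta> Q (compose (carrier F) g f) = push_class M Q g (\<eta> P f))"

definition universal_representations ::
    "'u pasture \<Rightarrow> ('u pasture \<Rightarrow> ('u \<Rightarrow> 'u) \<Rightarrow> ('a set \<Rightarrow> 'a \<Rightarrow> 'u) set) \<Rightarrow>
       ('a set \<Rightarrow> 'a \<Rightarrow> 'u) set" where
  "universal_representations F \<eta> = \<eta> F (\<lambda>x\<in>carrier F. x)"


section \<open>Cross-ratios and their relations\<close>

definition theta :: "'a matroid \<Rightarrow> ('a set \<times> 'a set \<times> 'a set \<times> 'a set) set" where
  "theta M = {(H1, H2, H3, H4).
     {H1, H2, H3, H4} \<subseteq> hyperplanes M \<and> corank_flat M 2 (H1 \<inter> H2 \<inter> H3 \<inter> H4) \<and>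
     (\<forall>H\<in>{H1, H2}. \<forall>H'\<in>{H3, H4}. H1 \<inter> H2 \<inter> H3 \<inter> H4 = H \<inter> H')}"

definition theta_nondeg :: "'a matroid \<Rightarrow> ('a set \<times> 'a set \<times> 'a set \<times> 'a set) set" where
  "theta_nondeg M = {(H1, H2, H3, H4) \<in> theta M.
     H1 \<inter> H2 \<inter> H3 \<inter> H4 = H1 \<inter> H2 \<and> H1 \<inter> H2 \<inter> H3 \<inter> H4 = H3 \<inter> H4}"

definition cross_ratio ::
    "'p pasture \<Rightarrow> ('a set \<Rightarrow> 'a \<Rightarrow> 'p) \<Rightarrow> 'a set \<Rightarrow> 'a set \<Rightarrow> 'a \<Rightarrow> 'a \<Rightarrow> 'p" where
  "cross_ratio P \<phi> H1 H2 a b =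
     (\<phi> H1 a \<otimes>\<^bsub>P\<^esub> \<phi> H2 b) \<otimes>\<^bsub>P\<^esub> inv\<^bsub>P\<^esub> (\<phi> H1 b \<otimes>\<^bsub>P\<^esub> \<phi> H2 a)"

type_synonym 'a cross_term = "(int \<times> (('a set \<times> 'a set \<times> 'a set \<times> 'a set) \<Rightarrow>\<^sub>0 int)) option"

abbreviation cross_algebra :: "'a matroid \<Rightarrow> 'a cross_term pasture" where
  "cross_algebra M \<equiv> free_algebra (theta M)"

abbreviation cr :: "'a set \<Rightarrow> 'a set \<Rightarrow> 'a set \<Rightarrow> 'a set \<Rightarrow> 'a cross_term" where
  "cr H1 H2 H3 H4 \<equiv> free_gen (H1, H2, H3, H4)"

text \<open>The multiplicative relation $a=b$ and the additive relation $a+b=1$.\<close>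

definition rel_eq :: "'p pasture \<Rightarrow> 'p \<Rightarrow> 'p \<Rightarrow> 'p multiset" where
  "rel_eq P a b = {#a, pneg P b, pzero P#}"

definition rel_sum_one :: "'p pasture \<Rightarrow> 'p \<Rightarrow> 'p \<Rightarrow> 'p multiset" where
  "rel_sum_one P a b = {#a, b, pneg P \<one>\<^bsub>P\<^esub>#}"

definition R_minus :: "'a matroid \<Rightarrow> 'a cross_term multiset set" where
  "R_minus M = (let A = cross_algebra M in
     if has_minor M fano \<or> has_minor M (dual_matroid fano)
     then {rel_eq A (pneg A \<one>\<^bsub>A\<^esub>) \<one>\<^bsub>A\<^esub>} else {})"

definition R_sigma :: "'a matroid \<Rightarrow> 'a cross_term multiset set" where
  "R_sigma M = (let A = cross_algebra M in
     \<Union>(H1, H2, H3, H4)\<in>theta_nondeg M.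
       {rel_eq A (cr H1 H2 H3 H4) (cr H2 H1 H4 H3),
        rel_eq A (cr H1 H2 H3 H4) (cr H3 H4 H1 H2),
        rel_eq A (cr H1 H2 H3 H4) (cr H4 H3 H2 H1)})"

definition R_zero :: "'a matroid \<Rightarrow> 'a cross_term multiset set" where
  "R_zero M = (let A = cross_algebra M in
     {rel_eq A (cr H1 H2 H3 H4) \<one>\<^bsub>A\<^esub> | H1 H2 H3 H4.
        (H1, H2, H3, H4) \<in> theta M - theta_nondeg M})"

definition R_one :: "'a matroid \<Rightarrow> 'a cross_term multiset set" where
  "R_one M = (let A = cross_algebra M in
     {rel_eq A (cr H1 H2 H4 H3) (inv\<^bsub>A\<^esub> (cr H1 H2 H3 H4)) | H1 H2 H3 H4.
        (H1, H2, H3, H4) \<in> theta_nondeg M})"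

definition R_two :: "'a matroid \<Rightarrow> 'a cross_term multiset set" where
  "R_two M = (let A = cross_algebra M in
     {rel_eq A (cr H1 H2 H3 H4 \<otimes>\<^bsub>A\<^esub> cr H1 H3 H4 H2 \<otimes>\<^bsub>A\<^esub> cr H1 H4 H2 H3) (pneg A \<one>\<^bsub>A\<^esub>)
        | H1 H2 H3 H4. (H1, H2, H3, H4) \<in> theta_nondeg M})"

definition R_three :: "'a matroid \<Rightarrow> 'a cross_term multiset set" where
  "R_three M = (let A = cross_algebra M in
     {rel_eq A (cr H1 H2 H3 H4 \<otimes>\<^bsub>A\<^esub> cr H1 H2 H4 H5 \<otimes>\<^bsub>A\<^esub> cr H1 H2 H5 H3) \<one>\<^bsub>A\<^esub>
        | H1 H2 H3 H4 H5. (H1, H2, H3, H4) \<in> theta_nondeg M \<and>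
            (H1, H2, H4, H5) \<in> theta_nondeg M \<and> (H1, H2, H5, H3) \<in> theta_nondeg M})"

definition R_four :: "'a matroid \<Rightarrow> 'a cross_term multiset set" where
  "R_four M = (let A = cross_algebra M in
     {rel_eq A (cr H13 H23 H34 H35 \<otimes>\<^bsub>A\<^esub> cr H14 H24 H45 H34 \<otimes>\<^bsub>A\<^esub> cr H15 H25 H35 H45) \<one>\<^bsub>A\<^esub>
        | H13 H23 H34 H35 H14 H24 H45 H15 H25.
            (H13, H23, H34, H35) \<in> theta M \<and> (H14, H24, H45, H34) \<in> theta M \<and>
            (H15, H25, H35, H45) \<in> theta M \<and>
            (\<exists>L A1 A2 A3 A4 A5. L = \<Inter>{H13, H23, H34, H35, H14, H24, H45, H15, H25} \<and>
               corank_flat M 3 L \<and> (\<forall>i\<in>{A1, A2, A3, A4, A5}. atom_flat M i) \<and>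
               H13 = closure_of_set M (L \<union> A1 \<union> A3) \<and> H23 = closure_of_set M (L \<union> A2 \<union> A3) \<and>
               H34 = closure_of_set M (L \<union> A3 \<union> A4) \<and> H35 = closure_of_set M (L \<union> A3 \<union> A5) \<and>
               H14 = closure_of_set M (L \<union> A1 \<union> A4) \<and> H24 = closure_of_set M (L \<union> A2 \<union> A4) \<and>
               H45 = closure_of_set M (L \<union> A4 \<union> A5) \<and> H15 = closure_of_set M (L \<union> A1 \<union> A5) \<and>
               H25 = closure_of_set M (L \<union> A2 \<union> A5))})"

definition R_plus :: "'a matroid \<Rightarrow> 'a cross_term multiset set" where
  "R_plus M = (let A = cross_algebra M in
     {rel_sum_one A (cr H1 H2 H3 H4) (cr H1 H3 H2 H4) | H1 H2 H3 H4.
        (H1, H2, H3, H4) \<in> theta_nondeg M})"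

definition cross_relations :: "'a matroid \<Rightarrow> 'a cross_term multiset set" where
  "cross_relations M = R_minus M \<union> R_sigma M \<union> R_zero M \<union> R_one M \<union> R_two M \<union> R_three M \<union>
     R_four M \<union> R_plus M"

lemma (in pasture) nonzeros_closed:
  "a \<in> nonzeros P \<Longrightarrow> b \<in> nonzeros P \<Longrightarrow> a \<otimes> b \<in> nonzeros P"
  "a \<in> nonzeros P \<Longrightarrow> inv a \<in> nonzeros P"
  "\<one> \<in> nonzeros P"
  "a \<in> nonzeros P \<Longrightarrow> pneg P a \<in> nonzeros P"
proof -
  have "pneg P \<one> \<in> Units P"
    using neg_ex[OF one_closed] neg_one_square by (auto simp: Units_def)
  then show "a \<in> nonzeros P \<Longrightarrow> pneg P a \<in> nonzeros P"
    using neg_mult[of a] Units_m_closed by (simp flip: Units_nonzeros add: Units_closed)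
qed (simp_all flip: Units_nonzeros)

lemma mem_theta:
  "(H1, H2, H3, H4) \<in> theta M \<longleftrightarrow>
     {H1, H2, H3, H4} \<subseteq> hyperplanes M \<and> corank_flat M 2 (H1 \<inter> H2 \<inter> H3 \<inter> H4) \<and>
     H1 \<inter> H2 \<inter> H3 \<inter> H4 = H1 \<inter> H3 \<and> H1 \<inter> H2 \<inter> H3 \<inter> H4 = H1 \<inter> H4 \<and>
     H1 \<inter> H2 \<inter> H3 \<inter> H4 = H2 \<inter> H3 \<and> H1 \<inter> H2 \<inter> H3 \<inter> H4 = H2 \<inter> H4"
  by (simp add: theta_def)

lemma mem_theta_nondeg:
  "(H1, H2, H3, H4) \<in> theta_nondeg M \<longleftrightarrow> (H1, H2, H3, H4) \<in> theta M \<and>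
     H1 \<inter> H2 \<inter> H3 \<inter> H4 = H1 \<inter> H2 \<and> H1 \<inter> H2 \<inter> H3 \<inter> H4 = H3 \<inter> H4"
  by (simp add: theta_nondeg_def)

lemma cross_relations_proper:
  "cross_relations M \<subseteq>
     {{#a, b, c#} | a b c. a \<in> nonzeros (cross_algebra M) \<and> b \<in> nonzeros (cross_algebra M) \<and>
        c \<in> carrier (cross_algebra M)}"
proof -
  let ?A = "cross_algebra M"
  define S where "S = {{#a, b, c#} | a b c. a \<in> nonzeros ?A \<and> b \<in> nonzeros ?A \<and> c \<in> carrier ?A}"
  interpret A: pasture ?A by (rule pasture_free_algebra)
  have eq: "rel_eq ?A a b \<in> S" if "a \<in> nonzeros ?A" "b \<in> nonzeros ?A" for a b
    using that A.nonzeros_closed(4) A.zero_closed unfolding rel_eq_def S_def by blast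
  have sum: "rel_sum_one ?A a b \<in> S" if "a \<in> nonzeros ?A" "b \<in> nonzeros ?A" for a b
    using that A.nonzeros_closed(3,4) unfolding rel_sum_one_def S_def by blast
  have gen: "free_gen x \<in> nonzeros ?A" if "x \<in> theta M" for x
    using that by (auto simp: free_gen_def free_algebra_simps signed_monomials_simps)
  have sub: "theta_nondeg M \<subseteq> theta M"
    by (auto simp: theta_nondeg_def)
  have perm1: "(H2, H1, H4, H3) \<in> theta M" "(H3, H4, H1, H2) \<in> theta M" "(H4, H3, H2, H1) \<in> theta M"
      "(H1, H2, H4, H3) \<in> theta M"
    if "(H1, H2, H3, H4) \<in> theta M" for H1 H2 H3 H4
  proof -
    define L where "L = H1 \<inter> H2 \<inter> H3 \<inter> H4"
    have "H2 \<inter> H1 \<inter> H4 \<inter> H3 = L" "H3 \<inter> H4 \<inter> H1 \<inter> H2 = L" "H4 \<inter> H3 \<inter> H2 \<inter> H1 = L"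
      "H1 \<inter> H2 \<inter> H4 \<inter> H3 = L"
      unfolding L_def by blast+
    moreover have L: "H1 \<inter> H3 = L" "H1 \<inter> H4 = L" "H2 \<inter> H3 = L" "H2 \<inter> H4 = L"
      "{H1, H2, H3, H4} \<subseteq> hyperplanes M" "corank_flat M 2 L"
      using that unfolding mem_theta_nondeg mem_theta L_def[symmetric] by metis+
    moreover have "H3 \<inter> H1 = L" "H4 \<inter> H1 = L" "H3 \<inter> H2 = L" "H4 \<inter> H2 = L"
      using L by (simp_all only: Int_commute)
    ultimately show "(H2, H1, H4, H3) \<in> theta M" "(H3, H4, H1, H2) \<in> theta M"
      "(H4, H3, H2, H1) \<in> theta M" "(H1, H2, H4, H3) \<in> theta M"
      by (simp_all add: mem_theta)
  qed
  have perm2: "(H1, H3, H2, H4) \<in> theta M" "(H1, H3, H4, H2) \<in> theta M" "(H1, H4, H2, H3) \<in> theta M"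
    if "(H1, H2, H3, H4) \<in> theta_nondeg M" for H1 H2 H3 H4
  proof -
    define L where "L = H1 \<inter> H2 \<inter> H3 \<inter> H4"
    have "H1 \<inter> H3 \<inter> H2 \<inter> H4 = L" "H1 \<inter> H3 \<inter> H4 \<inter> H2 = L" "H1 \<inter> H4 \<inter> H2 \<inter> H3 = L"
      unfolding L_def by blast+
    moreover have L: "H1 \<inter> H2 = L" "H3 \<inter> H4 = L" "H1 \<inter> H3 = L" "H1 \<inter> H4 = L" "H2 \<inter> H3 = L" "H2 \<inter> H4 = L"
      "{H1, H2, H3, H4} \<subseteq> hyperplanes M" "corank_flat M 2 L"
      using that unfolding mem_theta_nondeg mem_theta L_def[symmetric] by metis+
    moreover have "H2 \<inter> H1 = L" "H4 \<inter> H3 = L" "H3 \<inter> H1 = L" "H4 \<inter> H1 = L" "H3 \<inter> H2 = L" "H4 \<inter> H2 = L"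
      using L by (simp_all only: Int_commute)
    ultimately show "(H1, H3, H2, H4) \<in> theta M" "(H1, H3, H4, H2) \<in> theta M"
      "(H1, H4, H2, H3) \<in> theta M"
      by (simp_all add: mem_theta)
  qed
  note closed = A.nonzeros_closed gen
  have "R_minus M \<subseteq> S"
    using eq[OF closed(4)[OF closed(3)] closed(3)]
    by (simp add: R_minus_def Let_def del: Diff_iff)
  moreover have "R_sigma M \<subseteq> S"
    unfolding R_sigma_def Let_def
    by (intro UN_least) (clarify, elim insertE emptyE; hypsubst; intro eq gen;
      use sub perm1 in blast)
  moreover have "R_zero M \<subseteq> S"
    unfolding R_zero_def Let_def by (clarify, intro eq closed; blast)
  moreover have "R_one M \<subseteq> S"
    unfolding R_one_def Let_def by (clarify, intro eq closed; use sub perm1 in blast)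
  moreover have "R_two M \<subseteq> S"
    unfolding R_two_def Let_def by (clarify, intro eq closed; use sub perm2 in blast)
  moreover have "R_three M \<subseteq> S"
    unfolding R_three_def Let_def by (clarify, intro eq closed; use sub in blast)
  moreover have "R_four M \<subseteq> S"
    unfolding R_four_def Let_def by (clarify, intro eq closed; blast)
  moreover have "R_plus M \<subseteq> S"
    unfolding R_plus_def Let_def by (clarify, intro sum closed; use sub perm2 in blast)
  ultimately show ?thesis unfolding cross_relations_def S_def[symmetric] by blast
qed

lemma pasture_cross_quotient: "pasture (free_quotient (theta M) (cross_relations M))"
proof (rule pasture_free_quotient)
  show "cross_relations M \<subseteq> sym3 (cross_algebra M)"
    using cross_relations_proper[of M] unfolding sym3_def by blast
  show "a = None" if "{#a, None, None#} \<in> cross_relations M" for a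
  proof -
    obtain b c d where abc: "{#a, None, None#} = {#b, c, d#}" "b \<noteq> None" "c \<noteq> None"
      using cross_relations_proper[of M] \<open>{#a, None, None#} \<in> cross_relations M\<close>
      by (fastforce simp: free_algebra_simps(2))
    then show ?thesis by (auto simp: add_eq_conv_ex)
  qed
qed

end

theory Submission
 imports Defs "HOL-Library.Countable_Set"
begin

text \<open>It suffices to show that rescaling classes of \<open>P\<close>-representations correspond to families of
 units that satisfy the relations; the isomorphism then follows from the two universal properties.
 Writing the units of \<open>P\<close> additively, modulo the kernel of a surjection from a free abelian group, turns
 a family of cross-ratios into a function \<open>c\<close> of an independent set \<open>K\<close> of corank 2 and four elements, and
 a representation into a potential \<open>D\<close> on the bases, the logarithm of a Pluecker function, with
 \<open>D (ua) + D (vb) - D (ub) - D (va) = c\<close> over \<open>K\<close> up to sign. Potentials are constructed by induction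
 on the number of elements that are neither loops nor coloops. Separated families decompose, and up to
 duality a pivot yields a fundamental graph with a vertex of degree at least three, hence two elements
 \<open>x\<close>, \<open>y\<close> such that deleting either of them or both leaves a connected family. The potentials of the two
 deletions then agree after a shift. If the glued potential violates a relation, shortening
 exchange paths produces a violation on seven points of rank 3, where (R4) applies unless the points
 form a Fano plane; in that case (R-) makes the sign vanish. That cross-ratios determine a
 representation up to rescaling is the exactness of flat cochains on the basis graph.\<close>

section \<open>Families of bases\<close>

text \<open>Potentials live on bases, where deletion, contraction and duality act directly;
  representations are indexed by hyperplanes, which complementation does not preserve. After gluing,
  only cross-ratios that involve both \<open>x\<close> and \<open>y\<close> are open. If these two
  form one of the two pairs (u, v against x, y), no basis through both occurs, and the glued
  function has no freedom left: this is the genuine obstruction, which path shortening localizes. If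
  they belong to different pairs, exactly one basis through both occurs, and the equation defines
  the potential there. If \<open>x\<close> or \<open>y\<close> is contracted, a third element leads
  to a smaller minor, whose potential is compared with the glued one. Exactness thus enters in the
  gluing, in the comparison with minors and for rescaling classes; a variant is needed because the
  bases that miss \<open>x\<close> or \<open>y\<close> need not form a matroid. The pair comes from
  a tree with three pendant vertices: by the pigeonhole principle two of them lie on the same side
  of the basis, and duality moves them outside.\<close>

notation insert (infixr "##" 95)

text \<open>Both directions of exchange are kept because taking complements interchanges them; this
  makes duality immediate.\<close>

definition basis_family :: "'a set set => bool" where
 "basis_family F \<longleftrightarrow> finite (\<Union>F) \<and> F \<noteq> {} \<and>
   (\<forall>B\<in>F. \<forall>B'\<in>F. \<forall>i\<in>B - B'. \<exists>j\<in>B' - B. j ## (B - {i}) \<in> F) \<and>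
   (\<forall>B\<in>F. \<forall>B'\<in>F. \<forall>j\<in>B' - B. \<exists>i\<in>B - B'. j ## (B - {i}) \<in> F)"

lemma basis_family_exchange:
 assumes "basis_family F" "B \<in> F" "B' \<in> F"
 shows "i \<in> B ==> i \<notin> B' ==> \<exists>j. j \<in> B' \<and> j \<notin> B \<and> j ## (B - {i}) \<in> F"
  and "j \<in> B' ==> j \<notin> B ==> \<exists>i. i \<in> B \<and> i \<notin> B' \<and> j ## (B - {i}) \<in> F"
proof -
 have "\<forall>i\<in>B - B'. \<exists>j\<in>B' - B. j ## (B - {i}) \<in> F" "\<forall>j\<in>B' - B. \<exists>i\<in>B - B'. j ## (B - {i}) \<in> F"
  using assms unfolding basis_family_def by simp_all
 then show "i \<in> B ==> i \<notin> B' ==> \<exists>j. j \<in> B' \<and> j \<notin> B \<and> j ## (B - {i}) \<in> F"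
  and "j \<in> B' ==> j \<notin> B ==> \<exists>i. i \<in> B \<and> i \<notin> B' \<and> j ## (B - {i}) \<in> F"
  by blast+
qed

lemma basis_family_finite: "basis_family F ==> B \<in> F ==> finite B"
 unfolding basis_family_def by (meson Union_upper finite_subset)

text \<open>Each exchange towards \<open>T\<close> shrinks \<open>B - T\<close>. This is the
  connectedness of the basis graph in the form of an induction rule.\<close>

lemma basis_family_induct [consumes 3, case_names base step]:
 assumes F: "basis_family F" "B \<in> F" "T \<in> F"
  and base: "P B"
  and step: "\<And>B i j. B \<in> F ==> P B ==> i \<in> B ==> j \<notin> B ==> j ## (B - {i}) \<in> F ==>
   P (j ## (B - {i}))"
 shows "P T"
 using F(2) base
proof (induction "card (B - T)" arbitrary: B rule: less_induct)
 case less
 show ?case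
 proof (cases "B \<subseteq> T")
  case True
  have "B = T"
  proof (rule ccontr)
   assume "B \<noteq> T"
   then obtain j where "j \<in> T" "j \<notin> B" using True by blast
   then show False using basis_family_exchange(2)[OF F(1) less(2) F(3)] True by blast
  qed
  then show ?thesis using less by simp
 next
  case False
  then obtain i where i: "i \<in> B" "i \<notin> T" by blast
  then obtain j where j: "j \<in> T" "j \<notin> B" "j ## (B - {i}) \<in> F"
   using basis_family_exchange(1)[OF F(1) less(2) F(3)] by blast
  have "card (j ## (B - {i}) - T) < card (B - T)"
   by (rule psubset_card_mono) (use i j basis_family_finite[OF F(1) less(2)] in auto)
  then show ?thesis using less(1) j step[OF less(2,3) i(1) j(2,3)] by blast
 qed
qed

lemma basis_family_card:
 assumes "basis_family F" "B \<in> F" "T \<in> F"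
 shows "card T = card B"
 using assms
proof (induction rule: basis_family_induct)
 case (step B i j)
 then show ?case
  using basis_family_finite[OF assms(1) step(1)] card_Suc_Diff1[of B i] by simp
qed simp

text \<open>An exchange between \<open>B\<close> and \<open>B'\<close> never leaves the interval
  from the intersection to the union of the two sets. Deletions and contractions are convex in this
  sense.\<close>

lemma basis_family_subfamily:
 assumes "basis_family F" "G \<subseteq> F" "G \<noteq> {}"
  and convex: "\<And>B B' C. B \<in> G ==> B' \<in> G ==> C \<in> F ==> B \<inter> B' \<subseteq> C ==> C \<subseteq> B \<union> B' ==> C \<in> G"
 shows "basis_family G"
proof -
 have "finite (\<Union>G)" using assms(1,2) unfolding basis_family_def by (meson Union_mono finite_subset)
 moreover have "\<exists>j\<in>B' - B. j ## (B - {i}) \<in> G" if B: "B \<in> G" "B' \<in> G" "i \<in> B - B'" for B B' i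
 proof -
  obtain j where "j \<in> B'" "j \<notin> B" "j ## (B - {i}) \<in> F"
   using basis_family_exchange(1)[OF assms(1) subsetD[OF assms(2) B(1)] subsetD[OF assms(2) B(2)], of i]
    B(3) by auto
  then show ?thesis using convex[OF B(1,2), of "j ## (B - {i})"] B(3) by blast
 qed
 moreover have "\<exists>i\<in>B - B'. j ## (B - {i}) \<in> G" if B: "B \<in> G" "B' \<in> G" "j \<in> B' - B" for B B' j
 proof -
  obtain i where "i \<in> B" "i \<notin> B'" "j ## (B - {i}) \<in> F"
   using basis_family_exchange(2)[OF assms(1) subsetD[OF assms(2) B(1)] subsetD[OF assms(2) B(2)], of j]
    B(3) by auto
  then show ?thesis using convex[OF B(1,2), of "j ## (B - {i})"] B(3) by blast
 qed
 ultimately show ?thesis using assms(3) unfolding basis_family_def by simp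
qed

lemma basis_family_avoid:
 "basis_family F ==> B \<in> F ==> B \<inter> Y = {} ==> basis_family {B \<in> F. B \<inter> Y = {}}"
 by (rule basis_family_subfamily[of F]) auto

lemma basis_family_delete:
 "basis_family F ==> B \<in> F ==> z \<notin> B ==> basis_family {B \<in> F. z \<notin> B}"
 using basis_family_avoid[of F B "{z}"] by simp

lemma basis_family_contract:
 "basis_family F ==> B \<in> F ==> z \<in> B ==> basis_family {B \<in> F. z \<in> B}"
 by (rule basis_family_subfamily[of F]) auto

text \<open>Bases are sets, so \<open>u ## v ## K\<close> hides coincidences among u, v and the
  elements of \<open>K\<close>; the common cardinality of bases excludes them.\<close>

lemma basis_distinct2:
 assumes "basis_family F" "a ## b ## K \<in> F" "a \<noteq> b" "a \<notin> K" "b \<notin> K" "u ## v ## K \<in> F"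
 shows "u \<noteq> v" "u \<notin> K" "v \<notin> K"
proof -
 have "finite K" using basis_family_finite[OF assms(1,2)] by simp
 moreover have "card (u ## v ## K) = card (a ## b ## K)"
  using basis_family_card assms(1,2,6) by blast
 ultimately have "card (u ## v ## K) = Suc (Suc (card K))" using assms(3-5) by simp
 moreover have "card (u ## K) \<le> Suc (card K)" "card (v ## K) \<le> Suc (card K)"
  by (rule card_insert_le_m1; simp)+
 ultimately show "u \<noteq> v" "u \<notin> K" "v \<notin> K"
  by (metis Suc_n_not_le_n insert_absorb insert_commute insert_absorb2)+
qed

text \<open>Over \<open>K\<close> the rank is two, v is not a loop because of
  \<open>v ## z ## K\<close>, and v is parallel to u. Exchanging v into \<open>u ## w ## K\<close>
  cannot remove w, since that would leave u and v, so it removes u.\<close>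

lemma basis_parallel:
 assumes F: "basis_family F" "u ## w ## K \<in> F" "v ## z ## K \<in> F"
  and uv: "u ## v ## K \<notin> F"
  and d: "u \<noteq> w" "u \<notin> K" "w \<notin> K"
 shows "v ## w ## K \<in> F"
proof (cases "v = u")
 case True
 then show ?thesis using F by simp
next
 case False
 have v: "v \<notin> K" "v \<noteq> w"
  using basis_distinct2[OF F(1,2) d F(3)] uv F(2) by auto
 then have "v \<notin> u ## w ## K" using False by blast
 then obtain i where i: "i \<in> u ## w ## K" "i \<notin> v ## z ## K"
   "v ## (u ## w ## K - {i}) \<in> F"
  using basis_family_exchange(2)[OF F, of v] by blast
 have "i \<noteq> w"
 proof
  assume "i = w"
  then have "u ## w ## K - {i} = u ## K" using d by auto
  then show False using i(3) uv by (simp add: insert_commute)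
 qed
 then have "i = u" using i by blast
 then have "u ## w ## K - {i} = w ## K" using d by auto
 then show ?thesis using i(3) by simp
qed

section \<open>Fundamental graphs and pivots\<close>

definition adj :: "'a set set => 'a set => 'a => 'a => bool" where
 "adj F B r c \<longleftrightarrow> r \<in> B \<and> c \<notin> B \<and> c ## (B - {r}) \<in> F"

text \<open>Over a field \<open>adj\<close> is the support of the matrix that expresses the other
  elements in the basis \<open>B\<close>, and the pivot at (r, c) replaces the entry a_kl by a_kl -
  a_kc a_rl / a_rc. The entry is unchanged if a_kc or a_rl is zero, and it becomes nonzero if a_kl
  is zero and both are not. \<open>basis_parallel\<close> gives the same without a field.\<close>

lemma adj_pivot:
 assumes F: "basis_family F" "B \<in> F" "adj F B r c" and k: "k \<in> B" "k \<noteq> r" and l: "l \<notin> B" "l \<noteq> c"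
 shows "\<not> adj F B k c ==> adj F (c ## (B - {r})) k l \<longleftrightarrow> adj F B k l"
  and "\<not> adj F B r l ==> adj F (c ## (B - {r})) k l \<longleftrightarrow> adj F B k l"
  and "adj F B k c ==> adj F B r l ==> \<not> adj F B k l ==> adj F (c ## (B - {r})) k l"
proof -
 define K where "K = B - {r, k}"
 have r: "r \<in> B" "c \<notin> B" using F(3) by (auto simp: adj_def)
 have d: "r \<notin> K" "k \<notin> K" "c \<notin> K" "l \<notin> K" "r \<noteq> k" "c \<noteq> k" "r \<noteq> c" "l \<noteq> r" "l \<noteq> k" "l \<noteq> c"
  using r k l by (auto simp: K_def)
 have eq: "B = r ## k ## K" "B - {k} = r ## K" "B - {r} = k ## K"
  "c ## (B - {r}) = c ## k ## K"
  "c ## k ## K - {k} = c ## K"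
  using r k by (auto simp: K_def)
 have adjs: "adj F (c ## (B - {r})) k l \<longleftrightarrow> l ## c ## K \<in> F"
  "adj F B k l \<longleftrightarrow> l ## r ## K \<in> F"
  "adj F B k c \<longleftrightarrow> c ## r ## K \<in> F"
  "adj F B r l \<longleftrightarrow> l ## k ## K \<in> F"
  using k l r d unfolding adj_def eq(2-5) by auto
 have B: "r ## k ## K \<in> F" "c ## k ## K \<in> F"
  using F(2,3) eq(1,3) unfolding adj_def by auto
 note par = basis_parallel[OF F(1)]
 have "l ## c ## K \<in> F \<longleftrightarrow> l ## r ## K \<in> F" if "c ## r ## K \<notin> F"
  using par[of r l K c k] par[of c l K r k] B d that by (auto simp: insert_commute)
 then show "\<not> adj F B k c ==> adj F (c ## (B - {r})) k l \<longleftrightarrow> adj F B k l"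
  unfolding adjs by blast
 have "l ## c ## K \<in> F \<longleftrightarrow> l ## r ## K \<in> F" if "l ## k ## K \<notin> F"
  using par[of k c K l r] par[of k r K l c] B d that by (auto simp: insert_commute)
 then show "\<not> adj F B r l ==> adj F (c ## (B - {r})) k l \<longleftrightarrow> adj F B k l"
  unfolding adjs by blast
 show "adj F B k c ==> adj F B r l ==> \<not> adj F B k l ==> adj F (c ## (B - {r})) k l"
  unfolding adjs using par[of r c K l k] B d by (auto simp: insert_commute)
qed

text \<open>A double step in the bipartite fundamental graph, from row to row through a common
  column. Path lengths are counted in these double steps.\<close>

definition row_rel :: "'a set set => 'a set => 'a rel" where
 "row_rel F B = {(r, r'). \<exists>c. adj F B r c \<and> adj F B r' c}"

lemma row_rel_pivot:
 assumes F: "basis_family F" "B \<in> F" "adj F B r c"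
  and ij: "(i, j) \<in> row_rel F B" "i \<noteq> r" "j \<noteq> r" "\<not> adj F B i c" "\<not> adj F B j c"
 shows "(i, j) \<in> row_rel F (c ## (B - {r}))"
proof -
 obtain d where d: "adj F B i d" "adj F B j d" using ij by (auto simp: row_rel_def)
 then have "d \<noteq> c" "d \<notin> B" "i \<in> B" "j \<in> B" using ij by (auto simp: adj_def)
 then show ?thesis
  using adj_pivot(1)[OF F, of i d] adj_pivot(1)[OF F, of j d] d ij unfolding row_rel_def by auto
qed

text \<open>Pivoting on an edge at the second row of a shortest path shortens the path.\<close>

lemma shorten_path:
 assumes F: "basis_family F" "B \<in> F"
  and path: "(i, k) \<in> row_rel F B ^^ m" and m: "2 \<le> m"
  and min: "\<And>n. n < m ==> (i, k) \<notin> row_rel F B ^^ n"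
 obtains r c1 c2 where "adj F B i c1" "adj F B r c1" "adj F B r c2" "\<not> adj F B i c2"
  "\<not> adj F B k c1" "r \<noteq> i" "r \<noteq> k" "if m = 2 then adj F B k c2 else \<not> adj F B k c2"
  "(r, k) \<in> row_rel F B ^^ (m - 1)"
  "(i, k) \<in> row_rel F (c1 ## (B - {r})) ^^ (m - 1)"
  "(i, k) \<in> row_rel F (c2 ## (B - {r})) ^^ (m - 1)"
proof -
 obtain f where f: "f 0 = i" "f m = k" "\<And>s. s < m ==> (f s, f (Suc s)) \<in> row_rel F B"
  using path unfolding relpow_fun_conv by blast
 have seg: "(f s, f t) \<in> row_rel F B ^^ (t - s)" if "s \<le> t" "t \<le> m" for s t
 proof -
  obtain l where l: "t = s + l" using \<open>s \<le> t\<close> le_Suc_ex by blast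
  have "(f (s + n), f (Suc (s + n))) \<in> row_rel F B" if "n < l" for n
   by (rule f(3)) (use that \<open>t \<le> m\<close> l in simp)
  then show ?thesis
   unfolding relpow_fun_conv by (intro exI[of _ "\<lambda>n. f (s + n)"]) (simp add: l)
 qed
 have short: "(f s, f t) \<notin> row_rel F B" "f s \<noteq> f t" if "s + 2 \<le> t" "t \<le> m" for s t
 proof -
  have 1: "(i, f s) \<in> row_rel F B ^^ s" "(f t, k) \<in> row_rel F B ^^ (m - t)"
   using seg[of 0 s] seg[of t m] that f by auto
  show "(f s, f t) \<notin> row_rel F B"
  proof
   assume "(f s, f t) \<in> row_rel F B"
   then have "(f s, k) \<in> row_rel F B ^^ (Suc (m - t))"
    using 1(2) relpow_Suc_I2 by fastforce
   then have "(i, k) \<in> row_rel F B ^^ (s + Suc (m - t))"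
    unfolding relpow_add using 1(1) by (rule relcompI[rotated])
   moreover have "s + Suc (m - t) < m" using that by simp
   ultimately show False using min by blast
  qed
  show "f s \<noteq> f t"
  proof
   assume "f s = f t"
   then have "(i, k) \<in> row_rel F B ^^ (s + (m - t))"
    using 1 by (auto simp: relpow_add)
   moreover have "s + (m - t) < m" using that by simp
   ultimately show False using min by blast
  qed
 qed
 have ne: "f s \<noteq> f (Suc s)" if "s < m" for s
 proof
  assume eq: "f s = f (Suc s)"
  have "(i, k) \<in> row_rel F B ^^ (s + (m - Suc s))"
   unfolding relpow_add using seg[of 0 s] seg[of "Suc s" m] that f eq by auto
  moreover have "s + (m - Suc s) < m" using that by simp
  ultimately show False using min by blast
 qed
 define r where "r = f 1"
 define r2 where "r2 = f 2"
 obtain c1 where c1: "adj F B i c1" "adj F B r c1"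
  using f(3)[of 0] f(1) m by (auto simp: row_rel_def r_def)
 obtain c2 where c2: "adj F B r c2" "adj F B r2 c2"
  using f(3)[of 1] m by (auto simp: row_rel_def r_def r2_def numeral_2_eq_2)
 have no1: "\<not> adj F B (f s) c1" if "2 \<le> s" "s \<le> m" for s
  using short(1)[of 0 s] that c1 f(1) by (auto simp: row_rel_def)
 have no2: "\<not> adj F B (f s) c2" if "3 \<le> s" "s \<le> m" for s
  using short(1)[of 1 s] that c2 by (auto simp: row_rel_def r_def)
 have ic2: "\<not> adj F B i c2"
  using short(1)[of 0 2] c2 m f(1) by (auto simp: row_rel_def r2_def)
 have rne: "r \<noteq> f s" if sm: "s \<noteq> 1" "s \<le> m" for s
 proof -
  consider "s = 0" | "s = Suc 1" | "1 + 2 \<le> s" using sm by linarith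
  then show ?thesis
   using short(2)[of 1 s] ne[of 0] ne[of 1] sm m unfolding r_def by cases auto
 qed
 have rB: "i \<in> B" "r \<in> B" "r2 \<in> B" "c1 \<notin> B" "c2 \<notin> B" "c1 \<noteq> c2"
  using c1 c2 ic2 by (auto simp: adj_def)
 have ri: "r \<noteq> i" and r2: "r \<noteq> r2" and rk: "r \<noteq> k"
  using rne[of 0] rne[of 2] rne[of m] f m unfolding r2_def by auto
 have tail: "(r2, k) \<in> row_rel F (c ## (B - {r})) ^^ (m - 2)"
  if *: "\<And>s. 2 \<le> s ==> s < m ==> (f s, f (Suc s)) \<in> row_rel F (c ## (B - {r}))" for c
 proof -
  obtain l where l: "m = 2 + l" using m le_Suc_ex by blast
  have "(f (2 + n), f (Suc (2 + n))) \<in> row_rel F (c ## (B - {r}))" if "n < l" for n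
   by (rule *) (use that l in simp_all)
  then show ?thesis
   unfolding relpow_fun_conv f(2)[symmetric] r2_def
   by (intro exI[of _ "\<lambda>n. f (2 + n)"]) (simp add: l)
 qed
 have join: "(i, k) \<in> row_rel F C ^^ (m - 1)"
  if "(i, r2) \<in> row_rel F C" "(r2, k) \<in> row_rel F C ^^ (m - 2)" for C
 proof -
  have "m - 1 = Suc (m - 2)" using m by simp
  then show ?thesis using relpow_Suc_I2[OF that] by simp
 qed
 \<comment> \<open>Row i meets c1 but not c2, so the pivot at (r, c1) gives it the column c2. Row r2
   misses c1 and keeps c2, so i becomes related to r2; the later rows miss c1 too and the rest of
   the path survives.\<close>
 have 1: "(i, k) \<in> row_rel F (c1 ## (B - {r})) ^^ (m - 1)"
 proof (rule join)
  have "adj F (c1 ## (B - {r})) i c2"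
   using adj_pivot(3)[OF F c1(2), of i c2] rB ri c1 c2 ic2 by auto
  moreover have "adj F (c1 ## (B - {r})) r2 c2"
   using adj_pivot(1)[OF F c1(2), of r2 c2] rB r2 c2 no1[of 2] m unfolding r2_def by auto
  ultimately show "(i, r2) \<in> row_rel F (c1 ## (B - {r}))" by (auto simp: row_rel_def)
  show "(r2, k) \<in> row_rel F (c1 ## (B - {r})) ^^ (m - 2)"
  proof (rule tail)
   fix s assume s: "2 \<le> s" "s < m"
   show "(f s, f (Suc s)) \<in> row_rel F (c1 ## (B - {r}))"
    by (rule row_rel_pivot[OF F c1(2) f(3)[OF s(2)]])
     (use s no1[of s] no1[of "Suc s"] rne[of s] rne[of "Suc s"] in auto)
  qed
 qed
 have 2: "(i, k) \<in> row_rel F (c2 ## (B - {r})) ^^ (m - 1)"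
 proof (rule join)
  have a: "adj F (c2 ## (B - {r})) r2 c1"
   using adj_pivot(3)[OF F c2(1), of r2 c1] rB r2 c1 c2 no1[of 2] m unfolding r2_def by auto
  moreover have "adj F (c2 ## (B - {r})) i c1"
   using adj_pivot(1)[OF F c2(1), of i c1] rB ri c1 ic2 by auto
  ultimately show "(i, r2) \<in> row_rel F (c2 ## (B - {r}))" by (auto simp: row_rel_def)
  show "(r2, k) \<in> row_rel F (c2 ## (B - {r})) ^^ (m - 2)"
  proof (rule tail)
   fix s assume s: "2 \<le> s" "s < m"
   show "(f s, f (Suc s)) \<in> row_rel F (c2 ## (B - {r}))"
   proof (cases "s = 2")
    case False
    show ?thesis
     by (rule row_rel_pivot[OF F c2(1) f(3)[OF s(2)]])
      (use False s no2[of s] no2[of "Suc s"] rne[of s] rne[of "Suc s"] in auto)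
   next
    \<comment> \<open>Row r2 meets the pivot column c2, so \<open>row_rel_pivot\<close> does not
      cover its next step. Its next column c3 misses row r and is therefore unchanged in r2.\<close>
    case True
    obtain c3 where c3: "adj F B r2 c3" "adj F B (f 3) c3"
     using f(3)[OF s(2)] True by (auto simp: row_rel_def r2_def numeral_3_eq_3 numeral_2_eq_2)
    have "\<not> adj F B r c3"
     using short(1)[of 1 3] c3 True s by (auto simp: row_rel_def r_def)
    then have 1: "adj F (c2 ## (B - {r})) r2 c3"
     using adj_pivot(2)[OF F c2(1), of r2 c3] c3 c2 rB r2 no2[of 3] True s by (auto simp: adj_def)
    have "\<not> adj F B (f 3) c2" using no2[of 3] True s by simp
    then have "adj F (c2 ## (B - {r})) (f 3) c3"
     using adj_pivot(1)[OF F c2(1), of "f 3" c3] c3 rne[of 3] True s by (auto simp: adj_def)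
    then show ?thesis
     using 1 True by (auto simp: row_rel_def r2_def numeral_3_eq_3 numeral_2_eq_2)
   qed
  qed
 qed
 have k2: "if m = 2 then adj F B k c2 else \<not> adj F B k c2"
  using c2(2) f(2) no2[of m] m unfolding r2_def by auto
 have 3: "(r, k) \<in> row_rel F B ^^ (m - 1)"
  using seg[of 1 m] f(2) m by (simp add: r_def)
 show thesis by (rule that[OF c1 c2(1) ic2 _ ri rk k2 3 1 2]) (use no1[of m] m f(2) in simp)
qed

section \<open>Cochains on the basis graph\<close>

text \<open>The four bases are those in a cross-ratio of a, b against c, d. Whether a, b and c, d
  also extend \<open>K\<close> to bases is left open: this separates nondegenerate from degenerate
  tuples.\<close>

definition quad :: "'a set set => 'a set => 'a => 'a => 'a => 'a => bool" where
 "quad F K a b c d \<longleftrightarrow> distinct [a, b, c, d] \<and> {a, b, c, d} \<inter> K = {} \<and>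
   a ## c ## K \<in> F \<and> a ## d ## K \<in> F \<and>
   b ## c ## K \<in> F \<and> b ## d ## K \<in> F"

text \<open>Units of a pasture form a multiplicative group on a carrier. Written as a type-class
  group modulo a subgroup \<open>R\<close>, they are handled through representatives, and identities
  reduce to \<open>algebra_simps\<close>.\<close>

locale congruence_group =
 fixes R :: "'g::ab_group_add set"
 assumes zero_mem: "0 \<in> R" and diff_mem: "x \<in> R ==> y \<in> R ==> x - y \<in> R"
begin

definition cong :: "'g => 'g => bool" (infix "\<simeq>" 50) where "x \<simeq> y \<longleftrightarrow> x - y \<in> R"

lemma cong_refl [simp]: "x \<simeq> x"
 by (simp add: cong_def zero_mem)

lemma uminus_mem: "x \<in> R ==> - x \<in> R"
 using diff_mem[OF zero_mem, of x] by simp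

lemma add_mem: "x \<in> R ==> y \<in> R ==> x + y \<in> R"
 using diff_mem[OF _ uminus_mem, of x y] by simp

lemma cong_sym: "x \<simeq> y ==> y \<simeq> x"
 using uminus_mem[of "x - y"] by (simp add: cong_def)

lemma cong_add: "x \<simeq> y ==> u \<simeq> v ==> x + u \<simeq> y + v"
 using add_mem[of "x - y" "u - v"] by (simp add: cong_def algebra_simps)

lemma cong_diff: "x \<simeq> y ==> u \<simeq> v ==> x - u \<simeq> y - v"
 using diff_mem[of "x - y" "u - v"] by (simp add: cong_def algebra_simps)

lemma cong_minus: "x \<simeq> y ==> - x \<simeq> - y"
 using cong_diff[OF cong_refl, of x y 0] by simp

lemma cong_trans [trans]: "x \<simeq> y ==> y \<simeq> z ==> x \<simeq> z"
 using add_mem[of "x - y" "y - z"] by (simp add: cong_def)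

text \<open>The standard pattern below: known congruences are combined into
  \<open>u \<simeq> v\<close>, and an identity in the ambient group remains.\<close>

lemma cong_eqI: "u \<simeq> v ==> x - y = u - v ==> x \<simeq> y"
 by (simp add: cong_def)

lemma cong_0: "x \<simeq> 0 \<longleftrightarrow> x \<in> R"
 by (simp add: cong_def)

text \<open>The edges of the basis graph are the pairs \<open>(a ## I, b ## I)\<close>; \<open>e\<close> is the prescribed
 holonomy of the triangles below a common superset and \<open>c\<close> compares parallel edges.\<close>

definition cochain :: "'a set set => 'g => ('a set => 'a => 'a => 'a => 'a => 'g) =>
  ('a set => 'a => 'a => 'g) => bool" where
 "cochain F e c X \<longleftrightarrow>
   (\<forall>I a b d. {a, b, d} \<inter> I = {} \<and> a ## I \<in> F \<and> b ## I \<in> F \<and> d ## I \<in> F -->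
    X I a b + X I b d \<simeq> X I a d) \<and>
   (\<forall>K a b d. distinct [a, b, d] \<and> {a, b, d} \<inter> K = {} \<and>
    a ## b ## K \<in> F \<and> b ## d ## K \<in> F \<and> a ## d ## K \<in> F -->
    X (b ## K) a d + X (d ## K) b a + X (a ## K) d b \<simeq> e) \<and>
   (\<forall>K a b u v. quad F K a b u v -->
    X (b ## K) u v - X (a ## K) u v \<simeq> c K a b u v)"

abbreviation flat_cochain :: "'a set set => ('a set => 'a => 'a => 'g) => bool" where
 "flat_cochain F \<equiv> cochain F 0 (\<lambda>_ _ _ _ _. 0)"

definition exact_on :: "'a set set => ('a set => 'a => 'a => 'g) => ('a => 'g) => bool" where
 "exact_on F X t \<longleftrightarrow> (\<forall>I a b. a \<notin> I \<and> b \<notin> I \<and> a ## I \<in> F \<and> b ## I \<in> F -->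
   X I a b \<simeq> t b - t a)"

lemma cochain_path:
 "cochain F e c X ==> {a, b, d} \<inter> I = {} ==> a ## I \<in> F ==> b ## I \<in> F ==> d ## I \<in> F ==>
   X I a b + X I b d \<simeq> X I a d"
 unfolding cochain_def by blast

lemma cochain_triangle:
 "cochain F e c X ==> distinct [a, b, d] ==> {a, b, d} \<inter> K = {} ==>
   a ## b ## K \<in> F ==> b ## d ## K \<in> F ==> a ## d ## K \<in> F ==>
   X (b ## K) a d + X (d ## K) b a + X (a ## K) d b \<simeq> e"
 unfolding cochain_def by blast

lemma cochain_quad:
 "cochain F e c X ==> quad F K a b u v ==> X (b ## K) u v - X (a ## K) u v \<simeq> c K a b u v"
 unfolding cochain_def by blast

lemma quad_mono: "quad F K a b u v ==> F \<subseteq> G ==> quad G K a b u v"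
 unfolding quad_def by blast

lemma cochain_mono: "cochain F e c X ==> G \<subseteq> F ==> cochain G e c X"
 unfolding cochain_def using quad_mono[of G _ _ _ _ _ F] by (meson subsetD)

lemma cochain_diff:
 assumes "cochain F e c X" "cochain F e' c' X'"
 shows "cochain F (e - e') (\<lambda>K a b u v. c K a b u v - c' K a b u v) (\<lambda>I a b. X I a b - X' I a b)"
 unfolding cochain_def
proof (intro conjI allI impI)
 fix I a b d
 assume h: "{a, b, d} \<inter> I = {} \<and> a ## I \<in> F \<and> b ## I \<in> F \<and> d ## I \<in> F"
 show "X I a b - X' I a b + (X I b d - X' I b d) \<simeq> X I a d - X' I a d"
  by (rule cong_eqI[OF cong_diff[OF cochain_path[OF assms(1), of a b d I] cochain_path[OF assms(2), of a b d I]]])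
   (use h in \<open>auto simp: algebra_simps\<close>)
next
 fix K a b d
 assume h: "distinct [a, b, d] \<and> {a, b, d} \<inter> K = {} \<and>
  a ## b ## K \<in> F \<and> b ## d ## K \<in> F \<and> a ## d ## K \<in> F"
 show "X (b ## K) a d - X' (b ## K) a d + (X (d ## K) b a - X' (d ## K) b a) +
  (X (a ## K) d b - X' (a ## K) d b) \<simeq> e - e'"
  by (rule cong_eqI[OF cong_diff[OF cochain_triangle[OF assms(1), of a b d K]
      cochain_triangle[OF assms(2), of a b d K]]])
   (use h in \<open>auto simp: algebra_simps\<close>)
next
 fix K a b u v
 assume h: "quad F K a b u v"
 show "X (b ## K) u v - X' (b ## K) u v - (X (a ## K) u v - X' (a ## K) u v)
  \<simeq> c K a b u v - c' K a b u v"
  by (rule cong_eqI[OF cong_diff[OF cochain_quad[OF assms(1) h] cochain_quad[OF assms(2) h]]])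
   (simp add: algebra_simps)
qed

section \<open>Exactness of flat cochains\<close>

lemma flat_cochain_gradient: "flat_cochain F (\<lambda>I a b. t b - t a)"
 unfolding cochain_def by (auto intro: cong_eqI[OF cong_refl[of 0]])

lemma flat_cochain_refl: "flat_cochain F Y ==> a \<notin> I ==> a ## I \<in> F ==> Y I a a \<simeq> 0"
 using cochain_path[of F 0 _ Y a a a I] by (auto simp: cong_def)

lemma flat_cochain_swap:
 assumes "flat_cochain F Y" "a \<notin> I" "b \<notin> I" "a ## I \<in> F" "b ## I \<in> F"
 shows "Y I b a \<simeq> - Y I a b"
 by (rule cong_eqI[OF cong_trans[OF cochain_path[OF assms(1), of b a b I] flat_cochain_refl[OF assms(1), of b I]]])
  (use assms in auto)

text \<open>Each edge at the pivoted basis can be deformed to edges at \<open>B\<close> through the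
  relations of a cochain: edges over a common subset, a triangle below a common superset, or a
  square. \<open>basis_parallel\<close> supplies another square when a corner of the obvious one is
  missing.\<close>

lemma trivial_pivot:
 assumes F: "basis_family F" "flat_cochain F Y" "B \<in> F"
  and triv: "\<And>i j. adj F B i j ==> Y (B - {i}) i j \<simeq> 0"
  and ij: "adj F B i j" and pq: "adj F (j ## (B - {i})) p q"
 shows "Y (j ## (B - {i}) - {p}) p q \<simeq> 0"
proof -
 have ijB: "i \<in> B" "j \<notin> B" "j ## (B - {i}) \<in> F" using ij by (auto simp: adj_def)
 have swap: "Y (B - {k}) l k \<simeq> 0" if "adj F B k l" for k l
 proof -
  have k: "k ## (B - {k}) = B" "l \<notin> B" "l ## (B - {k}) \<in> F"
   using that by (auto simp: adj_def)
  have "Y (B - {k}) l k \<simeq> - Y (B - {k}) k l"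
   by (rule flat_cochain_swap[OF F(2)]) (use k F(3) in simp_all)
  also have "\<dots> \<simeq> - 0" by (rule cong_minus[OF triv[OF that]])
  finally show ?thesis by simp
 qed
 show ?thesis
 proof (cases "p = j")
  case True
  have eq: "j ## (B - {i}) - {p} = B - {i}" using True ijB by auto
  show ?thesis
  proof (cases "q = i")
   case True
   then show ?thesis using swap[OF ij] \<open>p = j\<close> eq by simp
  next
   case False
   then have q: "adj F B i q"
    using pq ijB \<open>p = j\<close> unfolding adj_def eq by auto
   have iB: "i ## (B - {i}) = B" "q \<notin> B" "q ## (B - {i}) \<in> F"
    using ijB q by (auto simp: adj_def)
   have "Y (B - {i}) j i + Y (B - {i}) i q \<simeq> Y (B - {i}) j q"
    by (rule cochain_path[OF F(2)]) (use iB ijB F(3) in simp_all)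
   from cong_trans[OF cong_sym[OF this] cong_add[OF swap[OF ij] triv[OF q]]]
   show ?thesis unfolding eq unfolding True by simp
  qed
 next
  case False
  define K where "K = B - {i, p}"
  have p: "p \<in> B" "p \<noteq> i" "q \<notin> j ## (B - {i})" using pq False by (auto simp: adj_def)
  have B: "B = i ## p ## K" "B - {i} = p ## K" "B - {p} = i ## K"
   "j ## (B - {i}) = j ## p ## K" "j ## (B - {i}) - {p} = j ## K"
   and d: "i \<notin> K" "p \<notin> K" "j \<notin> K" "q \<notin> K" "i \<noteq> p" "i \<noteq> j" "p \<noteq> j" "q \<noteq> j" "q \<noteq> p"
   using p ijB False by (auto simp: K_def)
  have m: "i ## p ## K \<in> F" "j ## p ## K \<in> F" "q ## j ## K \<in> F"
   using F(3) ijB(3) pq B(1,4) d unfolding adj_def by (auto simp: insert_Diff_if)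
  \<comment> \<open>The triangle on i, p, j over \<open>K\<close>; two of its edges start at
    \<open>B\<close>.\<close>
  have tr: "Y (j ## K) p i \<simeq> 0" if "i ## j ## K \<in> F"
  proof -
   have adj: "adj F B p j" using that p ijB B(3) unfolding adj_def by (simp add: insert_commute)
   have "Y (j ## K) p i + Y (i ## K) j p + Y (p ## K) i j \<simeq> 0"
    by (rule cochain_triangle[OF F(2)]) (use d m that in \<open>auto simp: insert_commute\<close>)
   from cong_diff[OF this cong_add[OF swap[OF adj] triv[OF ij]]] show ?thesis
    unfolding B(2,3) by (rule cong_eqI) (simp add: algebra_simps)
  qed
  have "Y (j ## K) p q \<simeq> 0"
  proof (cases "q = i")
   case True
   then show ?thesis using tr m(3) by simp
  next
   case qi: False
   have dd: "q \<notin> B" using p qi by auto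
   show ?thesis
   proof (cases "q ## i ## K \<in> F")
    case True
    have adj: "adj F B p q" using True p dd B(3) unfolding adj_def by simp
    have "quad F K i j p q"
     using d m True qi by (auto simp: quad_def insert_commute)
    from cong_add[OF cochain_quad[OF F(2) this] triv[OF adj]] show ?thesis
     unfolding B(3) by (rule cong_eqI) simp
   next
    \<comment> \<open>Now q and i are parallel over \<open>K\<close>. The edge from p to q is split
      at i; its first half is \<open>tr\<close>, and its second half is opposite to an edge at
      \<open>B\<close> in the square on p, j and i, q.\<close>
    case False
    have ij': "i ## j ## K \<in> F"
     using basis_parallel[OF F(1), of q j K i p] m d False qi by (auto simp: insert_commute)
    have pq': "q ## p ## K \<in> F"
     using basis_parallel[OF F(1), of i p K q j] m d False qi by (auto simp: insert_commute)
    have adj: "adj F B i q" using pq' ijB dd B(2) unfolding adj_def by simp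
    have "quad F K p j i q"
     using d m ij' pq' qi by (auto simp: quad_def insert_commute)
    from cong_add[OF cochain_quad[OF F(2) this] triv[OF adj]]
    have "Y (j ## K) i q \<simeq> 0" unfolding B(2) by (rule cong_eqI) simp
    from cong_add[OF tr[OF ij'] this]
    have "Y (j ## K) p i + Y (j ## K) i q \<simeq> 0" by simp
    moreover have "Y (j ## K) p i + Y (j ## K) i q \<simeq> Y (j ## K) p q"
     by (rule cochain_path[OF F(2)]) (use d m ij' in \<open>auto simp: insert_commute\<close>)
    ultimately show ?thesis using cong_sym cong_trans by blast
   qed
  qed
  then show ?thesis unfolding B(5) .
 qed
qed

lemma trivial_everywhere:
 assumes F: "basis_family F" "flat_cochain F Y" "B \<in> F"
  and triv: "\<And>i j. adj F B i j ==> Y (B - {i}) i j \<simeq> 0"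
  and I: "a \<notin> I" "b \<notin> I" "a ## I \<in> F" "b ## I \<in> F"
 shows "Y I a b \<simeq> 0"
proof -
 have *: "\<forall>i j. adj F (a ## I) i j --> Y (a ## I - {i}) i j \<simeq> 0"
  using F(1,3) I(3)
 proof (induction rule: basis_family_induct)
  case base
  then show ?case using triv by blast
 next
  case (step C i j)
  then show ?case using trivial_pivot[OF F(1,2), of C i j] unfolding adj_def by blast
 qed
 show ?thesis
 proof (cases "a = b")
  case True
  then show ?thesis using flat_cochain_refl[OF F(2)] I by blast
 next
  case False
  have "a ## I - {a} = I" using I by auto
  then show ?thesis using *[rule_format, of a b] I False by (auto simp: adj_def)
 qed
qed

text \<open>All edges that avoid x are normalized to zero, so the edges from \<open>B\<close> into x
  carry a weight for each row; the weight is constant along paths that avoid x. The set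
  \<open>Y\<close> has at most one element (it is empty for \<open>exact\<close> and {y} for
  \<open>exact_off_pair\<close>), so one of the two columns offered by \<open>shorten_path\<close>
  avoids it.\<close>

lemma path_claim:
 assumes F: "basis_family F" and xY: "x \<notin> Y" "\<And>u v. u \<in> Y ==> v \<in> Y ==> u = v"
  and Z: "flat_cochain {B \<in> F. x \<in> B --> B \<inter> Y = {}} Z"
  and triv: "\<And>I a b. {a, b} \<inter> I = {} ==> x \<notin> a ## b ## I ==> a ## I \<in> F ==> b ## I \<in> F ==>
   Z I a b \<simeq> 0"
 shows "B \<in> F ==> x \<notin> B ==> B \<inter> Y = {} ==> adj F B i x ==> adj F B k x ==>
  (i, k) \<in> row_rel {B \<in> F. x \<notin> B} B ^^ m ==> Z (B - {i}) i x \<simeq> Z (B - {k}) k x"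
proof (induction m arbitrary: B i k rule: less_induct)
 case (less m)
 let ?G = "{B \<in> F. x \<notin> B}" and ?H = "{B \<in> F. x \<in> B --> B \<inter> Y = {}}"
 note prems = less.prems
 have G: "basis_family ?G" by (rule basis_family_delete[OF F prems(1,2)])
 have adjG: "adj ?G B r c \<longleftrightarrow> adj F B r c \<and> c \<noteq> x" for r c
  using prems(2) by (auto simp: adj_def)
 \<comment> \<open>Rows r and s share a column c, and the square on r, s and c, x compares the two
   weights.\<close>
 have one: "Z (B - {r}) r x \<simeq> Z (B - {s}) s x"
  if rs: "adj F B r x" "adj F B s x" "(r, s) \<in> row_rel ?G B" for r s
 proof (cases "r = s")
  case False
  obtain c where c: "adj F B r c" "adj F B s c" "c \<noteq> x"
   using rs(3) adjG by (auto simp: row_rel_def)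
  define K where "K = B - {r, s}"
  have B: "B = r ## s ## K" "B - {r} = s ## K" "B - {s} = r ## K"
   and d: "r \<notin> K" "s \<notin> K" "c \<notin> K" "x \<notin> K" "r \<noteq> s" "c \<noteq> r" "c \<noteq> s" "x \<noteq> r" "x \<noteq> s" "c \<noteq> x"
   using c rs False prems(2) by (auto simp: K_def adj_def)
  have m: "r ## s ## K \<in> F" "c ## s ## K \<in> F" "c ## r ## K \<in> F"
   "x ## s ## K \<in> F" "x ## r ## K \<in> F"
   using prems(1) c rs B d unfolding adj_def by auto
  have Yd: "r ## s ## K \<inter> Y = {}" using prems(3) B(1) by simp
  have H: "r ## s ## K \<in> ?H" "s ## r ## K \<in> ?H" "c ## s ## K \<in> ?H" "c ## r ## K \<in> ?H"
   "x ## s ## K \<in> ?H" "x ## r ## K \<in> ?H"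
   using m d Yd xY(1) by (auto simp: insert_commute)
  have "quad ?H K r s c x"
   using d H by (auto simp: quad_def insert_commute)
  note q = cochain_quad[OF Z this]
  have r: "Z (s ## K) r c + Z (s ## K) c x \<simeq> Z (s ## K) r x"
   by (rule cochain_path[OF Z]) (use d H in auto)
  have s: "Z (r ## K) s c + Z (r ## K) c x \<simeq> Z (r ## K) s x"
   by (rule cochain_path[OF Z]) (use d H in auto)
  have t: "Z (s ## K) r c \<simeq> 0" "Z (r ## K) s c \<simeq> 0"
   by (rule triv; use d m in \<open>auto simp: insert_commute\<close>)+
  show ?thesis unfolding B(2,3)
   by (rule cong_eqI[OF cong_add[OF cong_diff[OF s r] cong_add[OF cong_diff[OF t] q]]])
    (simp add: algebra_simps)
 qed simp
 show ?case
 proof (cases "\<exists>n<m. (i, k) \<in> row_rel ?G B ^^ n")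
  case True
  then show ?thesis using less.IH prems by blast
 next
  case min: False
  consider "m = 0" | "m = 1" | "2 \<le> m" by linarith
  then show ?thesis
  proof cases
   case 1
   then show ?thesis using prems(6) by simp
  next
   case 2
   then show ?thesis using one[OF prems(4,5)] prems(6) by simp
  next
   case 3
   have BG: "B \<in> ?G" using prems(1,2) by simp
   have min': "(i, k) \<notin> row_rel ?G B ^^ n" if "n < m" for n using min that by blast
   obtain r c1 c2 where rc: "adj ?G B i c1" "adj ?G B r c1" "adj ?G B r c2" "\<not> adj ?G B i c2"
    "\<not> adj ?G B k c1" "r \<noteq> i" "r \<noteq> k" "if m = 2 then adj ?G B k c2 else \<not> adj ?G B k c2"
    "(r, k) \<in> row_rel ?G B ^^ (m - 1)"
    "(i, k) \<in> row_rel ?G (c1 ## (B - {r})) ^^ (m - 1)"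
    "(i, k) \<in> row_rel ?G (c2 ## (B - {r})) ^^ (m - 1)"
    by (rule shorten_path[OF G BG prems(6) 3 min'])
   have "\<exists>c. adj ?G B r c \<and> c \<notin> Y \<and> (i, k) \<in> row_rel ?G (c ## (B - {r})) ^^ (m - 1)"
   proof (cases "c1 \<in> Y")
    case True
    have "c2 \<noteq> c1" using rc(1,4) by blast
    then have "c2 \<notin> Y" using True xY(2) by blast
    then show ?thesis using rc(3,11) by blast
   next
    case False
    then show ?thesis using rc(2,10) by blast
   qed
   then obtain c where c: "adj F B r c" "c \<notin> Y" "c \<noteq> x"
    "(i, k) \<in> row_rel ?G (c ## (B - {r})) ^^ (m - 1)"
    using adjG by blast
   show ?thesis
   proof (cases "adj F B r x")
    case True
    have "(i, r) \<in> row_rel ?G B" using rc by (auto simp: row_rel_def)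
    then have 1: "Z (B - {i}) i x \<simeq> Z (B - {r}) r x" using one prems True by blast
    have "Z (B - {r}) r x \<simeq> Z (B - {k}) k x"
     using less.IH[OF _ prems(1-3) True prems(5) rc(9)] 3 by simp
    then show ?thesis using 1 cong_trans by blast
   next
    \<comment> \<open>Row r misses the column x, so a pivot in row r leaves every weight into x
      unchanged while it shortens the path.\<close>
    case False
    let ?C = "c ## (B - {r})"
    have cB: "r \<in> B" "c \<notin> B" "?C \<in> F" using c(1) by (auto simp: adj_def)
    have C: "?C \<in> F" "x \<notin> ?C" "?C \<inter> Y = {}" using cB c prems by auto
    have piv: "adj F ?C j x \<and> Z (?C - {j}) j x \<simeq> Z (B - {j}) j x"
     if j: "adj F B j x" for j
    proof -
     have jB: "j \<in> B" "j \<noteq> r" "x \<notin> B" using j False by (auto simp: adj_def)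
     have adj': "adj F ?C j x"
      using adj_pivot(2)[OF F prems(1) c(1) jB(1,2,3)] c(3) False j by auto
     define K where "K = B - {r, j}"
     have B: "B = r ## j ## K" "?C = c ## j ## K" "B - {j} = r ## K"
      "?C - {j} = c ## K"
      and d: "r \<notin> K" "j \<notin> K" "c \<notin> K" "x \<notin> K" "r \<noteq> j" "c \<noteq> r" "c \<noteq> j" "x \<noteq> r" "x \<noteq> j" "c \<noteq> x"
      using cB jB c(3) by (auto simp: K_def)
     have "r ## j ## K \<in> F" "c ## j ## K \<in> F"
      "x ## r ## K \<in> F" "x ## c ## K \<in> F"
      using prems(1) C(1) adj' j B unfolding adj_def by auto
     then have "quad ?H K c r j x"
      using d prems(3) B(1) C(3) B(2) xY(1) by (auto simp: quad_def insert_commute)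
     from cochain_quad[OF Z this] show ?thesis
      using adj' unfolding B(3,4) by (auto intro: cong_sym cong_eqI)
    qed
    have "m - 1 < m" using 3 by simp
    then have "Z (?C - {i}) i x \<simeq> Z (?C - {k}) k x"
     using less.IH C piv prems(4,5) c(4) by blast
    then show ?thesis
     using piv[OF prems(4)] piv[OF prems(5)] cong_trans cong_sym by blast
   qed
  qed
 qed
qed

text \<open>The correction has to vanish along edges that avoid x, hence to be constant on
  components of the fundamental graph without x, and it has to cancel the edges into x.
  \<open>path_claim\<close> makes these demands compatible.\<close>

lemma exact_step:
 assumes F: "basis_family F" "B \<in> F" "x \<notin> B" "B \<inter> Y = {}"
  and xY: "x \<notin> Y" "\<And>u v. u \<in> Y ==> v \<in> Y ==> u = v"
  and Z: "flat_cochain {B \<in> F. x \<in> B --> B \<inter> Y = {}} Z"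
  and triv: "\<And>I a b. {a, b} \<inter> I = {} ==> x \<notin> a ## b ## I ==> a ## I \<in> F ==> b ## I \<in> F ==>
   Z I a b \<simeq> 0"
 shows "\<exists>t. exact_on {B \<in> F. x \<in> B --> B \<inter> Y = {}} Z t"
proof -
 let ?H = "{B \<in> F. x \<in> B --> B \<inter> Y = {}}" and ?G = "{B \<in> F. x \<notin> B}"
 define rel where "rel = (row_rel ?G B)\<^sup>*"
 have relpow: "\<exists>m. (i, k) \<in> row_rel ?G B ^^ m" if "(i, k) \<in> rel" for i k
  using that rtrancl_imp_relpow unfolding rel_def by blast
 have "sym (row_rel ?G B)" by (auto simp: sym_def row_rel_def)
 then have sym: "(k, i) \<in> rel" if "(i, k) \<in> rel" for i k
  using that sym_rtrancl[of "row_rel ?G B"] unfolding rel_def by (meson symD)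
 have claim: "Z (B - {i}) i x \<simeq> Z (B - {k}) k x" if "adj F B i x" "adj F B k x" "(i, k) \<in> rel" for i k
  using path_claim[OF F(1) xY Z triv F(2-4) that(1,2)] relpow[OF that(3)] by blast
 \<comment> \<open>\<open>touch v i\<close> says that row i meets the column x and lies in the
   component of v. Components that do not reach x receive the value 0 in \<open>t\<close>, and so
   does x.\<close>
 define touch where "touch v i \<longleftrightarrow> adj F B i x \<and> (i = v \<or> (\<exists>j. (i, j) \<in> rel \<and> (j = v \<or> adj ?G B j v)))" for v i
 define t where "t v = (if v \<noteq> x \<and> (\<exists>i. touch v i) then - Z (B - {SOME i. touch v i}) (SOME i. touch v i) x else 0)" for v
 have touch_ex: "\<exists>j. (l, j) \<in> rel \<and> (j = v \<or> adj ?G B j v)" if "touch v l" for v l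
  using that unfolding touch_def rel_def by blast
 have touch_rel: "(i, k) \<in> rel" if tv: "touch v i" "touch v k" for v i k
 proof -
  obtain i' where i': "(i, i') \<in> rel" "i' = v \<or> adj ?G B i' v" using touch_ex[OF tv(1)] by blast
  obtain k' where k': "(k, k') \<in> rel" "k' = v \<or> adj ?G B k' v" using touch_ex[OF tv(2)] by blast
  have inB: "j \<in> B" if "(l, j) \<in> rel" "l \<in> B" for l j
   using that unfolding rel_def by (induction rule: rtrancl_induct) (auto simp: row_rel_def adj_def)
  have "i' \<in> B" "k' \<in> B" using inB i'(1) k'(1) tv by (auto simp: touch_def adj_def)
  have "(i', k') \<in> rel"
  proof (cases "i' = k'")
   case False
   then have "adj ?G B i' v \<and> adj ?G B k' v"
    using i' k' \<open>i' \<in> B\<close> \<open>k' \<in> B\<close> by (auto simp: adj_def)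
   then show ?thesis unfolding rel_def row_rel_def by blast
  qed (simp add: rel_def)
  then show ?thesis using i'(1) k'(1) sym unfolding rel_def by (meson rtrancl_trans)
 qed
 have t_val: "t v \<simeq> - Z (B - {i}) i x" if "touch v i" "v \<noteq> x" for v i
 proof -
  have s: "touch v (SOME i. touch v i)" using that(1) by (rule someI)
  have "Z (B - {SOME i. touch v i}) (SOME i. touch v i) x \<simeq> Z (B - {i}) i x"
   by (rule claim) (use s that touch_rel touch_def in blast)+
  then show ?thesis using that by (auto simp: t_def intro: cong_minus)
 qed
 define Z' where "Z' = (\<lambda>I a b. Z I a b - (t b - t a))"
 have Z': "flat_cochain ?H Z'"
  using cochain_diff[OF Z flat_cochain_gradient[of ?H t]] by (simp add: Z'_def)
 have near: "Z' (B - {i}) i j \<simeq> 0" if ij: "adj F B i j" for i j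
 proof (cases "j = x")
  case True
  have "i \<noteq> x" using ij F(3) by (auto simp: adj_def)
  moreover have "touch i i" using ij True by (simp add: touch_def)
  moreover have "t x = 0" by (simp add: t_def)
  ultimately show ?thesis
   unfolding Z'_def True by (intro cong_eqI[OF t_val[of i i]]) simp_all
 next
  case False
  have ne: "i \<noteq> x" using ij F(3) by (auto simp: adj_def)
  have adjG: "adj ?G B i j" using ij False F(3) by (auto simp: adj_def)
  have "touch i k \<longleftrightarrow> touch j k" for k
  proof
   assume k: "touch i k"
   then obtain l where l: "(k, l) \<in> rel" "l = i \<or> adj ?G B l i" unfolding touch_def rel_def by blast
   then have "l = i" using ij by (auto simp: adj_def)
   then show "touch j k" using l k adjG unfolding touch_def by blast
  next
   assume k: "touch j k"
   then have "k \<noteq> j" using ij by (auto simp: touch_def adj_def)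
   then obtain l where l: "(k, l) \<in> rel" "l = j \<or> adj ?G B l j" using k unfolding touch_def by blast
   have "(k, i) \<in> rel"
   proof (cases "adj ?G B l j")
    case True
    then have "(l, i) \<in> rel" using adjG unfolding rel_def row_rel_def by blast
    then show ?thesis using l unfolding rel_def by (meson rtrancl_trans)
   next
    case F: False
    then have "l = j" using l by blast
    then show ?thesis using l(1) \<open>k \<noteq> j\<close> ij unfolding rel_def
     by (auto elim!: rtranclE simp: row_rel_def adj_def)
   qed
   then show "touch i k" using k unfolding touch_def by blast
  qed
  then have "touch i = touch j" by blast
  then have "t i = t j" using ne False by (auto simp: t_def)
  moreover have "Z (B - {i}) i j \<simeq> 0"
  proof (rule triv)
   have "i ## (B - {i}) = B" using ij by (auto simp: adj_def)
   then show "i ## (B - {i}) \<in> F" using F by simp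
  qed (use ij F(3) False in \<open>auto simp: adj_def\<close>)
  ultimately show ?thesis by (simp add: Z'_def)
 qed
 \<comment> \<open>Triviality at the edges of \<open>B\<close> spreads over every basis family
   through \<open>B\<close> inside \<open>?H\<close>; \<open>?H\<close> itself is no basis family in
   general.\<close>
 have sub: "Z' I a b \<simeq> 0" if I: "a \<notin> I" "b \<notin> I" "a ## I \<in> C" "b ## I \<in> C" and C: "basis_family C" "C \<subseteq> ?H" "B \<in> C" for C I a b
  using trivial_everywhere[OF C(1) cochain_mono[OF Z' C(2)] C(3) _ I] near C(2)
  unfolding adj_def by blast
 let ?A = "{B \<in> F. B \<inter> Y = {}}"
 have A: "basis_family ?A" "basis_family ?G"
  using basis_family_avoid[OF F(1,2,4)] basis_family_delete[OF F(1-3)] by auto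
 have main: "Z' I a b \<simeq> 0" if I: "a \<notin> I" "b \<notin> I" "a ## I \<in> ?H" "b ## I \<in> ?H" for I a b
 proof -
  consider "x \<notin> a ## I" "x \<notin> b ## I" | "a ## I \<inter> Y = {}" "b ## I \<inter> Y = {}"
   | "x \<notin> I" "x \<in> a ## b ## I" "I \<inter> Y = {}"
   using I(3,4) by blast
  then show ?thesis
  proof cases
   case 1
   then show ?thesis using sub[OF I(1,2), of ?G] I A F by auto
  next
   case 2
   then show ?thesis using sub[OF I(1,2), of ?A] I A F by auto
  next
   \<comment> \<open>One end contains x and the other may meet \<open>Y\<close>. Both are joined to
     \<open>c ## I\<close> with c taken from \<open>B\<close>, which avoids x and \<open>Y\<close>;
     each of the two edges then lies in one of the families covered by \<open>sub\<close>.\<close>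
   case 3
   obtain u where u: "u \<in> a ## b ## I" "u = x" "x ## I \<in> F" using 3 I by auto
   obtain c where c: "c \<in> B" "c \<notin> x ## I" "c ## (x ## I - {x}) \<in> F"
    using basis_family_exchange(1)[OF F(1) u(3) F(2), of x] F(3) by blast
   have "x ## I - {x} = I" using 3 by auto
   then have cF: "c ## I \<in> F" "c \<notin> I" "c \<noteq> x" "c \<notin> Y" using c F(4) by auto
   have "Z' I p c \<simeq> 0" if "p \<notin> I" "p ## I \<in> ?H" for p
    using sub[of p I c ?G] sub[of p I c ?A] that cF 3 A F by (cases "p = x") auto
   note ac = this[OF I(1,3)] and bc = this[OF I(2,4)]
   have "Z' I a b + Z' I b c \<simeq> Z' I a c"
    by (rule cochain_path[OF Z']) (use I cF 3 in auto)
   from cong_diff[OF cong_add[OF this ac] bc] show ?thesis by (rule cong_eqI) simp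
  qed
 qed
 have "exact_on ?H Z t"
  unfolding exact_on_def using main by (auto simp: Z'_def cong_def)
 then show ?thesis by blast
qed

text \<open>A function that fits the deletion of x is corrected by \<open>exact_step\<close> with
  empty \<open>Y\<close>. If no element can be deleted, all edges are loops.\<close>

theorem exact:
 "basis_family F ==> flat_cochain F Z ==> \<exists>t. exact_on F Z t"
proof (induction "card (\<Union>F)" arbitrary: F Z rule: less_induct)
 case less
 show ?case
 proof (cases "\<exists>x B. x \<in> \<Union>F \<and> B \<in> F \<and> x \<notin> B")
  case False
  then have "a = b" if "a \<notin> I" "b \<notin> I" "a ## I \<in> F" "b ## I \<in> F" for I a b
   using that by blast
  then have "exact_on F Z (\<lambda>_. 0)"
   unfolding exact_on_def using flat_cochain_refl[OF less.prems(2)] by force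
  then show ?thesis by blast
 next
  case True
  then obtain x B where x: "x \<in> \<Union>F" "B \<in> F" "x \<notin> B" by blast
  let ?G = "{B \<in> F. x \<notin> B}"
  have G: "basis_family ?G" by (rule basis_family_delete[OF less.prems(1) x(2,3)])
  have "card (\<Union>?G) < card (\<Union>F)"
  proof (rule psubset_card_mono)
   show "finite (\<Union>F)" using less.prems(1) by (simp add: basis_family_def)
   show "\<Union>?G \<subset> \<Union>F" using x(1) by blast
  qed
  then obtain t where t: "exact_on ?G Z t"
   using less.hyps[OF _ G cochain_mono[OF less.prems(2)]] by blast
  define Z' where "Z' = (\<lambda>I a b. Z I a b - (t b - t a))"
  have "flat_cochain F Z'"
   using cochain_diff[OF less.prems(2) flat_cochain_gradient[of F t]] by (simp add: Z'_def)
  then have "\<exists>t'. exact_on {B \<in> F. x \<in> B --> B \<inter> {} = {}} Z' t'"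
   using t by (intro exact_step[OF less.prems(1) x(2,3)])
    (auto simp: exact_on_def Z'_def cong_def)
  then obtain t' where "exact_on F Z' t'" by auto
  then have "exact_on F Z (\<lambda>v. t v + t' v)"
   unfolding exact_on_def Z'_def by (fastforce simp: cong_def algebra_simps)
  then show ?thesis by blast
 qed
qed

text \<open>The bases that do not contain both x and y need not satisfy the exchange axioms, so
  \<open>exact\<close> does not apply to them; \<open>exact_step\<close> with \<open>Y\<close> = {y}
  does.\<close>

corollary exact_off_pair:
 assumes F: "basis_family F" "B \<in> F" "x \<notin> B" "y \<notin> B" "x \<noteq> y"
  and Z: "flat_cochain {B \<in> F. \<not> (x \<in> B \<and> y \<in> B)} Z"
 shows "\<exists>t. exact_on {B \<in> F. \<not> (x \<in> B \<and> y \<in> B)} Z t"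
proof -
 let ?H = "{B \<in> F. \<not> (x \<in> B \<and> y \<in> B)}" and ?G = "{B \<in> F. x \<notin> B}"
 obtain t where t: "exact_on ?G Z t"
  using exact[OF basis_family_delete[OF F(1-3)] cochain_mono[OF Z]] by blast
 define Z' where "Z' = (\<lambda>I a b. Z I a b - (t b - t a))"
 have H: "?H = {B \<in> F. x \<in> B --> B \<inter> {y} = {}}" by auto
 have "flat_cochain ?H Z'"
  using cochain_diff[OF Z flat_cochain_gradient[of ?H t]] by (simp add: Z'_def)
 then have "\<exists>t'. exact_on ?H Z' t'"
  unfolding H using t F by (intro exact_step[OF F(1-3)])
   (auto simp: exact_on_def Z'_def cong_def)
 then obtain t' where "exact_on ?H Z' t'" by auto
 then have "exact_on ?H Z (\<lambda>v. t v + t' v)"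
  unfolding exact_on_def Z'_def by (fastforce simp: cong_def algebra_simps)
 then show ?thesis by blast
qed

end

section \<open>Cross systems and potentials\<close>

text \<open>A Fano minor in terms of bases: \<open>K\<close> is contracted and the seven points
  \<open>p\<close> are kept.\<close>

definition fano_pattern :: "'a set set => 'a set => (nat => 'a) => bool" where
 "fano_pattern F K p \<longleftrightarrow> inj_on p {0..<7} \<and> p ` {0..<7} \<inter> K = {} \<and>
   (\<forall>S\<subseteq>{0..<7}. card S = 3 --> (K \<union> p ` S \<in> F \<longleftrightarrow> S \<notin> fano_lines))"

definition dual_family :: "'a set => 'a set set => 'a set set" where
 "dual_family E F = (\<lambda>B. E - B) ` F"

text \<open>\<open>eps\<close> is the logarithm of -1, and \<open>w\<close> is the sign of an
  inversion with respect to a fixed order of the elements, see \<open>order_sign\<close>.\<close>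

locale signed_group = congruence_group R for R :: "'g::ab_group_add set" +
 fixes eps :: 'g and w :: "'a => 'a => 'g" and E :: "'a set"
 assumes finite_E: "finite E" and eps_double: "eps + eps \<in> R"
  and w_swap: "a \<noteq> b ==> w a b + w b a \<simeq> eps" and w_double: "w a b + w a b \<in> R"
begin

text \<open>The additive form of the relations between cross-ratios, indexed by an independent set \<open>K\<close> of
 corank 2 and four elements that span the hyperplanes over \<open>K\<close>. The list of axioms is self-dual
 under \<open>K \<mapsto> E - K - {a, b, u, v}\<close>.\<close>

definition cross_system :: "'a set set => ('a set => 'a => 'a => 'a => 'a => 'g) => bool" where
 "cross_system F c \<longleftrightarrow>
  (\<forall>K a b u v. quad F K a b u v --> c K a b v u \<simeq> - c K a b u v \<and> c K b a v u \<simeq> c K a b u v \<and>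
    c K u v a b \<simeq> c K a b u v) \<and>
  (\<forall>K a b u v. quad F K a b u v \<and> (a ## b ## K \<notin> F \<or> u ## v ## K \<notin> F) -->
    c K a b u v \<simeq> 0) \<and>
  (\<forall>K a b u v. quad F K a b u v \<and> a ## b ## K \<in> F \<and> u ## v ## K \<in> F -->
    c K a b u v + c K a u v b + c K a v b u \<simeq> eps) \<and>
  (\<forall>K a b u v z. quad F K a b u v \<and> quad F K a b v z \<and> quad F K a b z u -->
    c K a b u v + c K a b v z + c K a b z u \<simeq> 0) \<and>
  (\<forall>K a b u v z. quad F (z ## K) a b u v \<and> quad F (u ## K) a b v z \<and>
    quad F (v ## K) a b z u -->
    c (z ## K) a b u v + c (u ## K) a b v z + c (v ## K) a b z u \<simeq> 0) \<and>
  (\<forall>K s t a b u v. s \<noteq> t \<and> s \<notin> K \<and> t \<notin> K \<and> quad F (s ## K) a b u v \<and> quad F (t ## K) a b u v \<and>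
    (\<forall>z\<in>{a, b, u, v}. z ## s ## t ## K \<notin> F \<and> {a, b, u, v} - {z} \<union> K \<notin> F) -->
    c (s ## K) a b u v \<simeq> c (t ## K) a b u v) \<and>
  ((\<exists>K p. fano_pattern F K p \<or> fano_pattern (dual_family E F) K p) --> eps \<in> R)"

lemma cross_system_perm:
 assumes "cross_system F c" "quad F K a b u v"
 shows "c K a b v u \<simeq> - c K a b u v" "c K b a v u \<simeq> c K a b u v" "c K u v a b \<simeq> c K a b u v"
proof -
 have "\<forall>K a b u v. quad F K a b u v --> c K a b v u \<simeq> - c K a b u v \<and> c K b a v u \<simeq> c K a b u v \<and>
   c K u v a b \<simeq> c K a b u v"
  using assms(1) unfolding cross_system_def by (elim conjE)
 then show "c K a b v u \<simeq> - c K a b u v" "c K b a v u \<simeq> c K a b u v" "c K u v a b \<simeq> c K a b u v"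
  using assms(2) by simp_all
qed

lemma cross_system_degenerate:
 assumes "cross_system F c" "quad F K a b u v" "a ## b ## K \<notin> F \<or> u ## v ## K \<notin> F"
 shows "c K a b u v \<simeq> 0"
proof -
 have "\<forall>K a b u v. quad F K a b u v \<and> (a ## b ## K \<notin> F \<or> u ## v ## K \<notin> F) -->
   c K a b u v \<simeq> 0"
  using assms(1) unfolding cross_system_def by (elim conjE)
 then show ?thesis using assms(2,3) by simp
qed

lemma cross_system_cyclic:
 assumes "cross_system F c" "quad F K a b u v" "a ## b ## K \<in> F" "u ## v ## K \<in> F"
 shows "c K a b u v + c K a u v b + c K a v b u \<simeq> eps"
proof -
 have "\<forall>K a b u v. quad F K a b u v \<and> a ## b ## K \<in> F \<and> u ## v ## K \<in> F -->
   c K a b u v + c K a u v b + c K a v b u \<simeq> eps"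
  using assms(1) unfolding cross_system_def by (elim conjE)
 then show ?thesis using assms(2-4) by simp
qed

lemma cross_system_rank2:
 assumes "cross_system F c" "quad F K a b u v" "quad F K a b v z" "quad F K a b z u"
 shows "c K a b u v + c K a b v z + c K a b z u \<simeq> 0"
proof -
 have "\<forall>K a b u v z. quad F K a b u v \<and> quad F K a b v z \<and> quad F K a b z u -->
   c K a b u v + c K a b v z + c K a b z u \<simeq> 0"
  using assms(1) unfolding cross_system_def by (elim conjE)
 then show ?thesis using assms(2-4) by simp
qed

lemma cross_system_rank3:
 assumes "cross_system F c" "quad F (z ## K) a b u v" "quad F (u ## K) a b v z"
  "quad F (v ## K) a b z u"
 shows "c (z ## K) a b u v + c (u ## K) a b v z + c (v ## K) a b z u \<simeq> 0"
proof -
 have "\<forall>K a b u v z. quad F (z ## K) a b u v \<and> quad F (u ## K) a b v z \<and>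
   quad F (v ## K) a b z u -->
   c (z ## K) a b u v + c (u ## K) a b v z + c (v ## K) a b z u \<simeq> 0"
  using assms(1) unfolding cross_system_def by (elim conjE)
 then show ?thesis using assms(2-4) by simp
qed

lemma quad_perm:
 "quad F K a b v u \<longleftrightarrow> quad F K a b u v" "quad F K b a u v \<longleftrightarrow> quad F K a b u v"
 "quad F K u v a b \<longleftrightarrow> quad F K a b u v"
 unfolding quad_def by (auto simp: insert_commute)

section \<open>Signs and the cross-ratios of a potential\<close>

definition W :: "'a => 'a => 'a => 'a => 'g" where
 "W a b u v = w a u + w b v + w a v + w b u"

text \<open>The logarithm of a quotient of Pluecker coordinates. The signs for moving a, b, u, v
  past \<open>K\<close> occur twice and cancel, so only the signs \<open>W\<close> of the four pairs
  remain.\<close>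

definition delta :: "('a set => 'g) => 'a set => 'a => 'a => 'a => 'a => 'g" where
 "delta D K a b u v = D (a ## u ## K) + D (b ## v ## K)
   - D (a ## v ## K) - D (b ## u ## K) + W a b u v"

text \<open>\<open>D\<close> is the logarithm of a Pluecker function; since \<open>w\<close> records the signs of transpositions,
 \<open>D\<close> can be defined on sets instead of tuples.\<close>

definition potential :: "'a set set => ('a set => 'a => 'a => 'a => 'a => 'g) => ('a set => 'g) => bool" where
 "potential F c D \<longleftrightarrow> (\<forall>K a b u v. quad F K a b u v --> delta D K a b u v \<simeq> c K a b u v)"

lemma w_flip: "a \<noteq> b ==> w a b - w b a \<simeq> eps"
 by (rule cong_eqI[OF cong_diff[OF w_swap[of a b] w_double[of b a, folded cong_0]]])
  (auto simp: algebra_simps)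

lemma delta_swap: "delta D K a b v u \<simeq> - delta D K a b u v"
proof -
 have "W a b u v + W a b u v = (w a u + w a u) + (w b v + w b v) + (w a v + w a v) + (w b u + w b u)"
  by (simp add: W_def algebra_simps)
 also have "\<dots> \<in> R" by (intro add_mem w_double)
 finally have "W a b u v + W a b u v \<in> R" .
 moreover have "W a b v u = W a b u v" by (simp add: W_def algebra_simps)
 ultimately show ?thesis by (simp add: delta_def cong_def algebra_simps)
qed

lemma delta_swap2: "delta D K b a v u = delta D K a b u v"
 by (simp add: delta_def W_def algebra_simps)

lemma delta_transpose:
 assumes "distinct [a, b, u, v]"
 shows "delta D K u v a b \<simeq> delta D K a b u v"
proof -
 have "delta D K u v a b - delta D K a b u v = (w u a - w a u) + (w v b - w b v) + ((w u b - w b u) + (w v a - w a v))"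
  by (simp add: delta_def W_def insert_commute algebra_simps)
 moreover have "(w u a - w a u) + (w v b - w b v) + ((w u b - w b u) + (w v a - w a v)) \<simeq> eps + eps + (eps + eps)"
  by (intro cong_add w_flip) (use assms in auto)
 moreover have "eps + eps + (eps + eps) \<simeq> 0"
  unfolding cong_0 by (rule add_mem[OF eps_double eps_double])
 ultimately show ?thesis using cong_trans cong_0 cong_def by metis
qed

lemma delta_cyclic:
 assumes "distinct [a, b, u, v]"
 shows "delta D K a b u v + delta D K a u v b + delta D K a v b u \<simeq> eps"
proof -
 have "(w b v + w v b) + (w b u + w u b) + (w u v + w v u) \<simeq> eps + eps + eps"
  by (intro cong_add w_swap) (use assms in auto)
 from cong_add[OF cong_add[OF this add_mem[OF add_mem[OF w_double[of a u] w_double[of a v]] w_double[of a b], folded cong_0]]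
   eps_double[folded cong_0]]
 show ?thesis
  by (rule cong_eqI) (simp add: delta_def W_def insert_commute algebra_simps)
qed

lemma W_cyclic: "W a b u v + W a b v z + W a b z u \<simeq> 0"
 using add_mem[OF add_mem[OF add_mem[OF w_double[of a u] w_double[of a v]] add_mem[OF w_double[of a z] w_double[of b u]]]
   add_mem[OF w_double[of b v] w_double[of b z]]]
 by (simp add: W_def cong_def algebra_simps)

lemma delta_rank2: "delta D K a b u v + delta D K a b v z + delta D K a b z u \<simeq> 0"
 by (rule cong_eqI[OF W_cyclic[of a b u v z]]) (simp add: delta_def algebra_simps)

lemma delta_rank3:
 "delta D (z ## K) a b u v + delta D (u ## K) a b v z + delta D (v ## K) a b z u \<simeq> 0"
 by (rule cong_eqI[OF W_cyclic[of a b u v z]]) (simp add: delta_def insert_commute algebra_simps)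

abbreviation good :: "('a set => 'a => 'a => 'a => 'a => 'g) => ('a set => 'g) =>
  'a set => 'a => 'a => 'a => 'a => bool" where
 "good c D K a b u v \<equiv> delta D K a b u v \<simeq> c K a b u v"

lemma good_perm:
 assumes c: "cross_system F c" "quad F K a b u v"
 shows "good c D K a b v u \<longleftrightarrow> good c D K a b u v" "good c D K b a v u \<longleftrightarrow> good c D K a b u v"
  "good c D K u v a b \<longleftrightarrow> good c D K a b u v"
proof -
 have "(delta D K a b v u - c K a b v u) + (delta D K a b u v - c K a b u v) \<in> R"
  using cong_diff[OF delta_swap[of D K a b v u] cross_system_perm(1)[OF c]]
  by (simp add: cong_def algebra_simps)
 from diff_mem[OF this] show "good c D K a b v u \<longleftrightarrow> good c D K a b u v"
  unfolding cong_def by (metis add_diff_cancel_left' add_diff_cancel_right')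
 show "good c D K b a v u \<longleftrightarrow> good c D K a b u v"
  unfolding delta_swap2[of D K b a v u] using cong_trans cong_sym cross_system_perm(2)[OF c] by blast
 have "distinct [a, b, u, v]" using c(2) by (simp add: quad_def)
 then show "good c D K u v a b \<longleftrightarrow> good c D K a b u v"
  using cong_trans cong_sym cross_system_perm(3)[OF c] delta_transpose[of a b u v D K] by blast
qed

lemma cong_cancel3:
 assumes "x + y + z \<simeq> t" "x' + y' + z' \<simeq> t" "y \<simeq> y'" "z \<simeq> z'"
 shows "x \<simeq> x'"
 by (rule cong_eqI[OF cong_diff[OF cong_diff[OF assms(1,2)] cong_add[OF assms(3,4)]]]) (simp add: algebra_simps)

lemma good_chain:
 assumes c: "cross_system F c" "quad F K a b u z" "quad F K a b z v" "u \<noteq> v"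
  and g: "good c D K a b u z" "good c D K a b z v"
 shows "good c D K a b u v"
proof -
 have q: "quad F K a b v u" "quad F K a b u v" using c by (auto simp: quad_def)
 have "good c D K a b v u"
  by (rule cong_eqI[OF cong_diff[OF cong_diff[OF delta_rank2[of D K a b u z v] cross_system_rank2[OF c(1-3) q(1)]]
      cong_add[OF g]]]) (simp add: algebra_simps)
 then show ?thesis using good_perm(1)[OF c(1) q(1)] by blast
qed

lemma good_rank3:
 assumes c: "cross_system F c" "quad F (z ## K) a b u v" "quad F (u ## K) a b v z"
   "quad F (v ## K) a b z u"
  and g: "good c D (u ## K) a b v z" "good c D (v ## K) a b z u"
 shows "good c D (z ## K) a b u v"
 by (rule cong_eqI[OF cong_diff[OF cong_diff[OF delta_rank3[of D z K a b u v] cross_system_rank3[OF c]]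
     cong_add[OF g]]]) (simp add: algebra_simps)

text \<open>In the chain relation through u, v, z the term between z and u is degenerate.\<close>

lemma cross_system_parallel:
 assumes c: "cross_system F c" "quad F K a b u v" "quad F K a b z v" "u \<noteq> z" "u ## z ## K \<notin> F"
 shows "c K a b u v \<simeq> c K a b z v"
proof -
 have q: "quad F K a b v z" "quad F K a b z u" using c by (auto simp: quad_def)
 have "c K a b z u \<simeq> 0"
  by (rule cross_system_degenerate[OF c(1) q(2)]) (use c(5) in \<open>simp add: insert_commute\<close>)
 from cong_diff[OF cross_system_rank2[OF c(1,2) q] cong_add[OF this cross_system_perm(1)[OF c(1,3)]]]
 show ?thesis by (rule cong_eqI) (simp add: algebra_simps)
qed

lemma cross_system_parallel':
 assumes c: "cross_system F c" "quad F K u v a b" "quad F K z v a b" "u \<noteq> z" "u ## z ## K \<notin> F"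
 shows "c K u v a b \<simeq> c K z v a b"
proof -
 note q = iffD1[OF quad_perm(3) c(2)] iffD1[OF quad_perm(3) c(3)]
 show ?thesis
  using cross_system_parallel[OF c(1) q c(4,5)] cross_system_perm(3)[OF c(1) q(1)]
   cross_system_perm(3)[OF c(1) q(2)] cong_trans cong_sym by blast
qed

end

lemma basis_parallel3:
 assumes "basis_family F" "a ## b ## z ## K \<in> F" "a ## b ## u ## K \<notin> F"
  "a ## u ## v ## K \<in> F" "distinct [a, u, v]" "{a, u, v} \<inter> K = {}"
 shows "a ## b ## v ## K \<in> F"
 using basis_parallel[OF assms(1), of u v "a ## K" b z] assms(2-) by (auto simp: insert_commute)

context signed_group
begin

text \<open>The axiom for replacing s by t asks in addition that no three of a, b, u, v extend
  \<open>K\<close> to a basis, which makes it self-dual. That condition is removed here: if a, b or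
  u, v are dependent over s, both values vanish; if two suitable triples are bases, the rank 3
  relation transfers the comparison to terms in which s and t are parallel points.\<close>

lemma cross_system_closure:
 assumes F: "basis_family F" "cross_system F c"
  and st: "s \<noteq> t" "s \<notin> K" "t \<notin> K" and q: "quad F (s ## K) a b u v" "quad F (t ## K) a b u v"
  and par: "\<And>z. z \<in> {a, b, u, v} ==> z ## s ## t ## K \<notin> F"
 shows "c (s ## K) a b u v \<simeq> c (t ## K) a b u v"
proof -
 define T where "T x y z \<longleftrightarrow> x ## y ## z ## K \<in> F" for x y z
 have comm: "T x y z \<longleftrightarrow> T y x z" "T x y z \<longleftrightarrow> T x z y" for x y z
  by (simp_all add: T_def insert_commute)
 define P where "P = {a, b, u, v, s, t}"
 have rule: "T x y z ==> \<not> T x y p ==> T x p r ==> distinct [x, p, r] ==> x \<in> P ==> p \<in> P ==> r \<in> P ==> T x y r"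
  for x y z p r
  using basis_parallel3[OF F(1), of x y z K p r] q st unfolding T_def P_def quad_def by auto
 have d: "distinct [a, b, u, v, s, t]" using q st by (auto simp: quad_def)
 have Ts: "T s a u" "T s a v" "T s b u" "T s b v" "T t a u" "T t a v" "T t b u" "T t b v"
  using q unfolding quad_def T_def by (simp_all add: insert_commute)
 have par': "\<not> T s t a" "\<not> T s t b" "\<not> T s t u" "\<not> T s t v"
  unfolding T_def using par[of a] par[of b] par[of u] par[of v] by (simp_all add: insert_commute)
 have Q: "quad F (x ## K) p r y z"
  if "T x p y" "T x p z" "T x r y" "T x r z" "distinct [x, p, r, y, z]" "{x, p, r, y, z} \<subseteq> P" for x p r y z
  using that q st unfolding quad_def T_def P_def by (auto simp: insert_commute)
 have main: "c (s ## K) p r x y \<simeq> c (t ## K) p r x y"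
  if h: "T p x y" "T r x y" "T s p x" "T s p y" "T s r x" "T s r y" "T t p x" "T t p y" "T t r x" "T t r y"
   "\<not> T s t x" "\<not> T s t y" "distinct [p, r, x, y, s, t]" "{p, r, x, y} \<subseteq> P" for p r x y
 proof -
  have P: "s \<in> P" "t \<in> P" by (auto simp: P_def)
  have q3: "quad F (l ## K) p r x y" "quad F (x ## K) p r y l" "quad F (y ## K) p r l x"
   if "l = s \<or> l = t" for l
   by (rule Q; use that h P in \<open>auto simp: comm\<close>)+
  have "c (x ## K) p r s y \<simeq> c (x ## K) p r t y"
   by (rule cross_system_parallel[OF F(2)])
    (use q3(2)[of s] q3(2)[of t] st(1) h(11) quad_perm(1)[of F "x ## K" p r] in
     \<open>auto simp: T_def insert_commute\<close>)
  then have 1: "c (x ## K) p r y s \<simeq> c (x ## K) p r y t"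
   using cross_system_perm(1)[OF F(2), of "x ## K" p r] q3(2)[of s] q3(2)[of t]
    quad_perm(1)[of F "x ## K" p r] cong_minus cong_trans cong_sym by meson
  have 2: "c (y ## K) p r s x \<simeq> c (y ## K) p r t x"
   by (rule cross_system_parallel[OF F(2)])
    (use q3(3)[of s] q3(3)[of t] st(1) h(12) in \<open>auto simp: T_def insert_commute\<close>)
  show ?thesis
   by (rule cong_cancel3[OF cross_system_rank3[OF F(2) q3(1-3)[of s]] cross_system_rank3[OF F(2) q3(1-3)[of t]] 1 2])
    auto
 qed
 consider "\<not> T s a b" | "\<not> T s u v" | "T a u v" "T b u v" | "T u a b" "T v a b"
  | "T s a b" "T s u v" "\<not> T a u v \<or> \<not> T b u v" "\<not> T u a b \<or> \<not> T v a b" by blast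
 then show ?thesis
 proof cases
  case 1
  then have "\<not> T t a b" using rule[of a s u t b] Ts par' d comm unfolding P_def by auto
  then have "c (s ## K) a b u v \<simeq> 0" "c (t ## K) a b u v \<simeq> 0"
   using cross_system_degenerate[OF F(2) q(1)] cross_system_degenerate[OF F(2) q(2)] 1
   unfolding T_def by (simp_all add: insert_commute)
  then show ?thesis using cong_trans cong_sym by blast
 next
  case 2
  then have "\<not> T t u v" using rule[of u s a t v] Ts par' d comm unfolding P_def by auto
  then have "c (s ## K) a b u v \<simeq> 0" "c (t ## K) a b u v \<simeq> 0"
   using cross_system_degenerate[OF F(2) q(1)] cross_system_degenerate[OF F(2) q(2)] 2
   unfolding T_def by (simp_all add: insert_commute)
  then show ?thesis using cong_trans cong_sym by blast
 next
  case 3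
  then show ?thesis using main[of a u v b] Ts par' d by (auto simp: P_def)
 next
  case 4
  then have "c (s ## K) u v a b \<simeq> c (t ## K) u v a b"
   using main[of u a b v] Ts par' d comm by (auto simp: P_def)
  then show ?thesis
   using cross_system_perm(3)[OF F(2) q(1)] cross_system_perm(3)[OF F(2) q(2)] cong_trans cong_sym by blast
 next
  \<comment> \<open>By \<open>col\<close>, if p and r lie on the line x y, then x, p, r are
    collinear. The two assumed collinearities thus make all four triples dependent, and the axiom
    applies.\<close>
  case 5
  have col: "\<not> T x p r" if "T x y s" "\<not> T x y p" "\<not> T x y r" "distinct [x, y, p, r]" "{x, y, p, r} \<subseteq> P" for x y p r
   using rule[of x y s p r] that by auto
  have "\<not> T a b u \<and> \<not> T a b v \<and> \<not> T a u v \<and> \<not> T b u v"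
   using 5(3,4) col[of a u v b] col[of u a v b] col[of a v u b] col[of v a u b] col[of b u v a] col[of u b v a]
    col[of b v u a] col[of v b u a] Ts 5(1,2) d comm unfolding P_def by (smt (verit) distinct_length_2_or_more insert_subset insertI1 insertI2 empty_subsetI distinct_singleton)
  moreover have "{a, b, u, v} - {a} = {b, u, v}" "{a, b, u, v} - {b} = {a, u, v}"
   "{a, b, u, v} - {u} = {a, b, v}" "{a, b, u, v} - {v} = {a, b, u}"
   using d by auto
  ultimately have "\<forall>z\<in>{a, b, u, v}. z ## s ## t ## K \<notin> F \<and> {a, b, u, v} - {z} \<union> K \<notin> F"
   using par unfolding T_def by auto
  moreover have "\<forall>K s t a b u v. s \<noteq> t \<and> s \<notin> K \<and> t \<notin> K \<and>
    quad F (s ## K) a b u v \<and> quad F (t ## K) a b u v \<and>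
    (\<forall>z\<in>{a, b, u, v}. z ## s ## t ## K \<notin> F \<and> {a, b, u, v} - {z} \<union> K \<notin> F) -->
    c (s ## K) a b u v \<simeq> c (t ## K) a b u v"
   using F(2) unfolding cross_system_def by (elim conjE)
  ultimately show ?thesis using st q by blast
 qed
qed

text \<open>The logarithm of the quotient of the Pluecker coordinates of \<open>b ## I\<close> and
  \<open>a ## I\<close>; the sums over \<open>I\<close> are the signs for writing b and a in front
  of \<open>I\<close>.\<close>

definition gradient :: "('a set => 'g) => 'a set => 'a => 'a => 'g" where
 "gradient D I a b = D (b ## I) + sum (w b) I - (D (a ## I) + sum (w a) I)"

lemma gradient_quad:
 assumes "finite K" "distinct [a, b, u, v]" "{a, b, u, v} \<inter> K = {}"
 shows "gradient D (b ## K) u v - gradient D (a ## K) u v \<simeq> delta D K a b u v"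
proof -
 have 1: "(w v b - w b v) + (w u a - w a u) - ((w u b + w b u) + (w v a + w a v)) \<simeq> (eps + eps) - (eps + eps)"
  by (intro cong_add cong_diff w_flip w_swap) (use assms in auto)
 show ?thesis
  by (rule cong_eqI[OF 1]) (use assms in \<open>simp add: gradient_def delta_def W_def insert_commute algebra_simps\<close>)
qed

text \<open>Around a triangle the values of \<open>D\<close> cancel and three sign flips remain,
  which explains the holonomy \<open>eps\<close>.\<close>

lemma potential_cochain:
 assumes F: "\<And>B. B \<in> F ==> finite B" "potential F c D"
 shows "cochain F eps c (gradient D)"
 unfolding cochain_def
proof (intro conjI allI impI)
 fix I a b d
 show "gradient D I a b + gradient D I b d \<simeq> gradient D I a d"
  by (simp add: gradient_def algebra_simps)
next
 fix K a b d
 assume h: "distinct [a, b, d] \<and> {a, b, d} \<inter> K = {} \<and>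
  a ## b ## K \<in> F \<and> b ## d ## K \<in> F \<and> a ## d ## K \<in> F"
 then have K: "finite K" using F(1)[of "a ## b ## K"] by simp
 have 1: "(w d b - w b d) + (w a d - w d a) + (w b a - w a b) \<simeq> eps + eps + eps"
  by (intro cong_add w_flip) (use h in auto)
 show "gradient D (b ## K) a d + gradient D (d ## K) b a + gradient D (a ## K) d b \<simeq> eps"
  by (rule cong_eqI[OF cong_add[OF 1 eps_double[folded cong_0]]])
   (use h K in \<open>simp add: gradient_def insert_commute algebra_simps\<close>)
next
 fix K a b u v
 assume h: "quad F K a b u v"
 then have "finite K" using F(1)[of "a ## u ## K"] by (simp add: quad_def)
 then have "gradient D (b ## K) u v - gradient D (a ## K) u v \<simeq> delta D K a b u v"
  by (rule gradient_quad) (use h in \<open>auto simp: quad_def\<close>)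
 also have "\<dots> \<simeq> c K a b u v" using F(2) h by (simp add: potential_def)
 finally show "gradient D (b ## K) u v - gradient D (a ## K) u v \<simeq> c K a b u v" .
qed

lemma cochain_parallel:
 assumes "cochain H e c X" "quad H K a b u v" "c K a b u v \<simeq> 0"
 shows "X (b ## K) u v \<simeq> X (a ## K) u v"
 using cong_trans[OF cochain_quad[OF assms(1,2)] assms(3)] by (simp add: cong_def)

end

lemma quad_insertI:
 assumes "x ## p ## y ## K \<in> F" "x ## p ## z ## K \<in> F"
  "x ## r ## y ## K \<in> F" "x ## r ## z ## K \<in> F"
  "distinct [x, p, r, y, z]" "{x, p, r, y, z} \<inter> K = {}"
 shows "quad F (x ## K) p r y z"
 using assms unfolding quad_def by (auto simp: insert_commute)

context signed_group
begin

text \<open>In the coordinates given by the basis \<open>{e1, e2, e3}\<close> over \<open>K\<close>, the points are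
 \<open>f = e1 + e2\<close>, \<open>g = e2 + e3\<close>, \<open>x = e1 - e3\<close> and \<open>y = e1 + e2 + e3\<close>.\<close>

lemma fano_cross_value:
 assumes X: "cochain {B \<in> F. y \<notin> B} eps c X" "cochain {B \<in> F. x \<notin> B} eps c X"
  and deg: "\<And>K a b u v. quad F K a b u v ==>
   a ## b ## K \<notin> F \<or> u ## v ## K \<notin> F ==> c K a b u v \<simeq> 0"
  and T_def: "\<And>a b d. T a b d \<longleftrightarrow> a ## b ## d ## K \<in> F"
  and d: "distinct [e1, e2, e3, f, g, x, y]" "{e1, e2, e3, f, g, x, y} \<inter> K = {}"
  and bases: "T e1 e2 x" "T e2 e3 x" "T e1 f x" "T e3 f x" "T e1 f g" "T e2 f g" "T e3 f g" "T e1 e3 f"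
   "T e2 e3 f" "T e1 e2 g" "T e1 e3 g" "T e1 e2 y" "T e2 e3 y" "T e1 e3 y"
  and lines: "\<not> T e1 e3 x" "\<not> T f g x" "\<not> T e1 e2 f" "\<not> T e2 e3 g" "\<not> T e3 f y" "\<not> T e1 g y"
 shows "X (e2 ## y ## K) e1 e3 - X (e2 ## x ## K) e1 e3 \<simeq> eps"
proof -
 let ?Hx = "{B \<in> F. y \<notin> B}" and ?Hy = "{B \<in> F. x \<notin> B}"
 have comm: "T a b d \<longleftrightarrow> T b a d" "T a b d \<longleftrightarrow> T a d b" for a b d
  by (simp_all add: T_def insert_commute)
 have par: "X (r ## p ## K) u v \<simeq> X (q ## p ## K) u v"
  if H: "H = ?Hx \<and> y \<notin> {p, q, r, u, v} \<or> H = ?Hy \<and> x \<notin> {p, q, r, u, v}"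
   and h: "T p q u" "T p q v" "T p r u" "T p r v" "\<not> T p q r \<or> \<not> T p u v" "distinct [p, q, r, u, v]"
    "{p, q, r, u, v} \<subseteq> {e1, e2, e3, f, g, x, y}" for p q r u v H
 proof -
  have pK: "{p, q, r, u, v} \<inter> K = {}" using d(2) h(7) by blast
  have F: "quad F (p ## K) q r u v"
   by (rule quad_insertI) (use h pK in \<open>auto simp: T_def[symmetric]\<close>)
  have Q: "quad H (p ## K) q r u v"
   using F H d(2) unfolding quad_def by auto
  have co: "cochain H eps c X" using H X by auto
  have "c (p ## K) q r u v \<simeq> 0"
   by (rule deg[OF F]) (use h(5) in \<open>auto simp: T_def insert_commute\<close>)
  then show ?thesis by (rule cochain_parallel[OF co Q])
 qed
 \<comment> \<open>On the bases without y: the lines e1 e3 x and f g x carry the edge from e1 to e3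
   to the line f g, where it is split at e2; the lines e1 e2 f and e2 e3 g move the two halves to e3
   f and e1 g.\<close>
 have 1: "X (e2 ## x ## K) e1 e3 \<simeq> X (f ## x ## K) e1 e3"
  by (rule par[of ?Hx]) (use d bases lines in \<open>auto simp: comm\<close>)
 have 2: "X (x ## f ## K) e1 e3 \<simeq> X (g ## f ## K) e1 e3"
  by (rule par[of ?Hx]) (use d bases lines in \<open>auto simp: comm\<close>)
 have 3: "X (g ## f ## K) e1 e2 + X (g ## f ## K) e2 e3 \<simeq> X (g ## f ## K) e1 e3"
  by (rule cochain_path[OF X(1)]) (use d bases in \<open>auto simp: T_def insert_commute\<close>)
 have 4: "X (g ## f ## K) e1 e2 \<simeq> X (e3 ## f ## K) e1 e2"
  by (rule par[of ?Hx]) (use d bases lines in \<open>auto simp: comm\<close>)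
 have 5: "X (f ## g ## K) e2 e3 \<simeq> X (e1 ## g ## K) e2 e3"
  by (rule par[of ?Hx]) (use d bases lines in \<open>auto simp: comm\<close>)
 have x: "X (e2 ## x ## K) e1 e3 \<simeq> X (e3 ## f ## K) e1 e2 + X (e1 ## g ## K) e2 e3"
  by (rule cong_eqI[OF cong_add[OF cong_add[OF 1 2] cong_add[OF cong_minus[OF 3] cong_add[OF 4 5]]]])
   (simp add: insert_commute algebra_simps)
 \<comment> \<open>On the bases without x: the triangle e1, e2, e3 over y contributes
   \<open>eps\<close>, and the lines e3 f y and e1 g y carry its other two edges to the same places
   e3 f and e1 g.\<close>
 have 6: "X (e2 ## y ## K) e1 e3 + X (e3 ## y ## K) e2 e1 + X (e1 ## y ## K) e3 e2 \<simeq> eps"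
  by (rule cochain_triangle[OF X(2)]) (use d bases in \<open>auto simp: T_def insert_commute\<close>)
 have 7: "X (y ## e3 ## K) e2 e1 \<simeq> X (f ## e3 ## K) e2 e1"
  by (rule par[of ?Hy]) (use d bases lines in \<open>auto simp: comm\<close>)
 have 8: "X (y ## e1 ## K) e3 e2 \<simeq> X (g ## e1 ## K) e3 e2"
  by (rule par[of ?Hy]) (use d bases lines in \<open>auto simp: comm\<close>)
 have swap: "X (q ## p ## K) u v + X (q ## p ## K) v u \<simeq> 0"
  if h: "T p q u" "T p q v" "distinct [p, q, u, v]" "{p, q, u, v} \<subseteq> {e1, e2, e3, f, g}" for p q u v
 proof -
  let ?I = "q ## p ## K"
  have I: "u \<notin> ?I" "v \<notin> ?I" "u ## ?I \<in> ?Hx" "v ## ?I \<in> ?Hx"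
   using h d by (auto simp: T_def insert_commute)
  have "X ?I u u + X ?I u u \<simeq> X ?I u u" "X ?I u v + X ?I v u \<simeq> X ?I u u"
   by (rule cochain_path[OF X(1)]; use I in auto)+
  from cong_add[OF this] show ?thesis by (rule cong_eqI) simp
 qed
 have 9: "X (e3 ## f ## K) e1 e2 + X (e3 ## f ## K) e2 e1 \<simeq> 0"
  by (rule swap) (use d bases in \<open>auto simp: comm\<close>)
 have 10: "X (e1 ## g ## K) e2 e3 + X (e1 ## g ## K) e3 e2 \<simeq> 0"
  by (rule swap) (use d bases in \<open>auto simp: comm\<close>)
 show ?thesis
  by (rule cong_eqI[OF cong_diff[OF cong_diff[OF cong_diff[OF 6 cong_add[OF 9 10]] cong_add[OF 7 8]] x]])
   (simp add: insert_commute algebra_simps)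
qed

end

section \<open>The Fano plane in indices\<close>

lemma fano_lines_eq:
 "fano_lines = {{0, 1, 3}, {1, 2, 4}, {2, 3, 5}, {3, 4, 6}, {0, 4, 5}, {1, 5, 6}, {0, 2, 6}}"
proof -
 have "fano_lines = (\<lambda>i. {i, (i + 1) mod 7, (i + 3) mod 7}) ` {0, 1, 2, 3, 4, 5, 6}"
 proof -
  have "{i. i < 7} = {0, 1, 2, 3, 4, 5, 6::nat}" by auto
  moreover have "fano_lines = (\<lambda>i. {i, (i + 1) mod 7, (i + 3) mod 7}) ` {i. i < 7}"
   unfolding fano_lines_def by blast
  ultimately show ?thesis by simp
 qed
 also have "\<dots> = {{0, 1, 3}, {1, 2, 4}, {2, 3, 5}, {3, 4, 6}, {4, 5, 0}, {5, 6, 1}, {6, 0, 2}}"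
  by (simp add: numeral_2_eq_2)
 finally show ?thesis by (simp add: insert_commute)
qed

lemma fano_lines_sorted:
 assumes "a < b" "b < c" "c < (7::nat)"
 shows "{a, b, c} \<in> fano_lines \<longleftrightarrow>
  (a, b, c) \<in> {(0, 1, 3), (1, 2, 4), (2, 3, 5), (3, 4, 6), (0, 4, 5), (1, 5, 6), (0, 2, 6)}"
proof -
 have sorted: "a = a' \<and> b = b' \<and> c = c'" if "{a, b, c} = {a', b', c'}" "a' < b'" "b' < c'" for a' b' c' :: nat
 proof -
  have "Min {a, b, c} = a" "Max {a, b, c} = c" "Min {a', b', c'} = a'" "Max {a', b', c'} = c'"
   using assms that(2,3) by (simp_all add: min_def max_def)
  then have ac: "a = a'" "c = c'" using that(1) by simp_all
  moreover have "b \<in> {a', b', c'}" using that(1) by blast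
  ultimately show ?thesis using assms by auto
 qed
 then have iff: "{a, b, c} = {a', b', c'} \<longleftrightarrow> a = a' \<and> b = b' \<and> c = c'" if "a' < b'" "b' < c'" for a' b' c' :: nat
  using that by blast
 show ?thesis
  unfolding fano_lines_eq by (simp add: iff)
qed

lemma card_3_sorted:
 assumes "S \<subseteq> {0..<n::nat}" "card S = 3"
 obtains a b c where "S = {a, b, c}" "a < b" "b < c" "c < n"
proof -
 obtain x y z where S: "S = {x, y, z}" "x \<noteq> y" "x \<noteq> z" "y \<noteq> z"
  using assms(2) card_3_iff by metis
 consider "x < y \<and> y < z" | "x < z \<and> z < y" | "y < x \<and> x < z" | "y < z \<and> z < x" | "z < x \<and> x < y" | "z < y \<and> y < x"
  using S by linarith
 then show thesis
  using S(1) assms(1) that by cases (auto simp: insert_commute)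
qed

lemma fano_pattern_iff:
 "fano_pattern F K p \<longleftrightarrow> inj_on p {0..<7} \<and> p ` {0..<7} \<inter> K = {} \<and>
  (\<forall>a b c. a < b \<and> b < c \<and> c < 7 --> ((p a) ## (p b) ## (p c) ## K \<in> F \<longleftrightarrow>
    (a, b, c) \<notin> {(0, 1, 3), (1, 2, 4), (2, 3, 5), (3, 4, 6), (0, 4, 5), (1, 5, 6), (0, 2, 6)}))"
 (is "_ \<longleftrightarrow> _ \<and> _ \<and> ?P")
proof -
 have eq: "K \<union> p ` {a, b, c} = (p a) ## (p b) ## (p c) ## K" for a b c by auto
 have iff: "(\<forall>S\<subseteq>{0..<7}. card S = 3 --> (K \<union> p ` S \<in> F \<longleftrightarrow> S \<notin> fano_lines)) \<longleftrightarrow> ?P"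
 proof (rule iffI; intro allI impI)
  fix a b c :: nat assume h: "\<forall>S\<subseteq>{0..<7}. card S = 3 --> (K \<union> p ` S \<in> F \<longleftrightarrow> S \<notin> fano_lines)" "a < b \<and> b < c \<and> c < 7"
  then have "{a, b, c} \<subseteq> {0..<7}" "card {a, b, c} = 3" by auto
  then have "K \<union> p ` {a, b, c} \<in> F \<longleftrightarrow> {a, b, c} \<notin> fano_lines" using h(1) by blast
  then show "(p a) ## (p b) ## (p c) ## K \<in> F \<longleftrightarrow>
    (a, b, c) \<notin> {(0, 1, 3), (1, 2, 4), (2, 3, 5), (3, 4, 6), (0, 4, 5), (1, 5, 6), (0, 2, 6)}"
   using h(2) fano_lines_sorted[of a b c] unfolding eq by simp
 next
  fix S assume h: ?P "S \<subseteq> {0..<7::nat}" "card S = 3"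
  obtain a b c where S: "S = {a, b, c}" "a < b" "b < c" "c < 7" by (rule card_3_sorted[OF h(2,3)])
  show "K \<union> p ` S \<in> F \<longleftrightarrow> S \<notin> fano_lines"
   using h(1)[rule_format, of a b c] S(2-4) unfolding S(1) eq fano_lines_sorted[OF S(2-4)] by simp
 qed
 show ?thesis unfolding fano_pattern_def iff by (rule refl)
qed

lemma sorted_triples_7:
 assumes "a < b" "b < c" "c < (7::nat)"
 shows "(a, b, c) \<in> {(0,1,2),(0,1,3),(0,1,4),(0,1,5),(0,1,6),(0,2,3),(0,2,4),(0,2,5),(0,2,6),(0,3,4),(0,3,5),
  (0,3,6),(0,4,5),(0,4,6),(0,5,6),(1,2,3),(1,2,4),(1,2,5),(1,2,6),(1,3,4),(1,3,5),(1,3,6),(1,4,5),(1,4,6),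
  (1,5,6),(2,3,4),(2,3,5),(2,3,6),(2,4,5),(2,4,6),(2,5,6),(3,4,5),(3,4,6),(3,5,6),(4,5,6)}"
proof -
 have "c = 2 \<or> c = 3 \<or> c = 4 \<or> c = 5 \<or> c = 6" using assms by linarith
 moreover have "b = 1 \<or> b = 2 \<or> b = 3 \<or> b = 4 \<or> b = 5" using assms by linarith
 moreover have "a = 0 \<or> a = 1 \<or> a = 2 \<or> a = 3 \<or> a = 4" using assms by linarith
 ultimately show ?thesis using assms by (elim disjE) simp_all
qed

text \<open>The order e1, e2, e3, f, g, y, x is chosen so that the seven lines become the translates
  of {0, 1, 3} modulo 7.\<close>

lemma fano_patternI:
 assumes T: "\<And>a b d. T a b d \<longleftrightarrow> a ## b ## d ## K \<in> F"
  and d: "distinct [e1, e2, e3, f, g, y, x]" "{e1, e2, e3, f, g, y, x} \<inter> K = {}"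
  and lines: "\<not> T e1 e2 f" "\<not> T e2 e3 g" "\<not> T e3 f y" "\<not> T f g x" "\<not> T e1 g y" "\<not> T e2 y x" "\<not> T e1 e3 x"
  and bases: "T e1 e2 e3" "T e1 e2 g" "T e1 e2 y" "T e1 e2 x" "T e1 e3 f" "T e1 e3 g" "T e1 e3 y"
   "T e1 f g" "T e1 f y" "T e1 f x" "T e1 g x" "T e1 y x" "T e2 e3 f" "T e2 e3 y" "T e2 e3 x"
   "T e2 f g" "T e2 f y" "T e2 f x" "T e2 g y" "T e2 g x" "T e3 f g" "T e3 f x" "T e3 g y" "T e3 g x"
   "T e3 y x" "T f g y" "T f y x" "T g y x"
 shows "\<exists>p. fano_pattern F K p"
proof -
 define p where "p = (\<lambda>n. [e1, e2, e3, f, g, y, x] ! n)"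
 have pv: "p 0 = e1" "p (Suc 0) = e2" "p 2 = e3" "p 3 = f" "p 4 = g" "p 5 = y" "p 6 = x" by (simp_all add: p_def)
 have inj: "inj_on p {0..<7}"
  unfolding p_def using inj_on_nth[OF d(1), of "{0..<7}"] by simp
 have im: "p ` {0..<7} = {e1, e2, e3, f, g, y, x}"
 proof -
  have "{0..<7} = {0, Suc 0, 2, 3, 4, 5, 6::nat}" by auto
  then show ?thesis by (simp add: pv)
 qed
 have mem: "(p a) ## (p b) ## (p c) ## K \<in> F \<longleftrightarrow>
    (a, b, c) \<notin> {(0, 1, 3), (1, 2, 4), (2, 3, 5), (3, 4, 6), (0, 4, 5), (1, 5, 6), (0, 2, 6)}"
  if "a < b" "b < c" "c < 7" for a b c
  unfolding T[symmetric] using sorted_triples_7[OF that]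
  by (elim insertE; (clarsimp simp: pv lines bases)?)
 show ?thesis
  unfolding fano_pattern_iff
  by (intro exI[of _ p] conjI allI impI inj mem) (simp_all only: im d(2))
qed

section \<open>Gluing potentials of two deletions\<close>

text \<open>The values of \<open>D\<close> at bases through both x and y are not constrained, and
  the cross-ratios that involve both elements are the open ones.\<close>

locale glued_pair = signed_group R eps w E
 for R :: "'g::ab_group_add set" and eps w and E :: "'a set" +
 fixes F :: "'a set set" and c :: "'a set => 'a => 'a => 'a => 'a => 'g" and D :: "'a set => 'g" and x y :: 'a
 assumes F: "basis_family F" and c: "cross_system F c" and xy: "x \<noteq> y"
  and pot_x: "potential {B \<in> F. x \<notin> B} c D" and pot_y: "potential {B \<in> F. y \<notin> B} c D"
begin

lemma good_avoid:
 "quad F K a b u v ==> x \<notin> a ## b ## u ## v ## K \<or>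
  y \<notin> a ## b ## u ## v ## K ==> good c D K a b u v"
 using pot_x pot_y unfolding potential_def quad_def by auto

text \<open>The chain x, p, y splits the cross-ratio into one that avoids y and one that avoids
  x.\<close>

lemma good_pair:
 assumes q: "quad F K i k x y" and p: "i ## p ## K \<in> F" "k ## p ## K \<in> F" "p \<noteq> x" "p \<noteq> y"
 shows "good c D K i k x y"
proof -
 have ix: "i ## x ## K \<in> F" "i \<noteq> x" "i \<notin> K" "x \<notin> K" using q by (auto simp: quad_def)
 have "i \<noteq> p \<and> k \<noteq> p \<and> p \<notin> K"
  using basis_distinct2[OF F ix p(1)] basis_distinct2[OF F ix p(2)] by blast
 then have q': "quad F K i k x p" "quad F K i k p y" using q p by (auto simp: quad_def)
 show ?thesis
  by (rule good_chain[OF c q' xy good_avoid[OF q'(1)] good_avoid[OF q'(2)]])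
   (use q' q p xy in \<open>auto simp: quad_def\<close>)
qed

lemma good_pair':
 assumes q: "quad F K x y i k" and p: "i ## p ## K \<in> F" "k ## p ## K \<in> F" "p \<noteq> x" "p \<noteq> y"
 shows "good c D K x y i k"
 by (rule iffD1[OF good_perm(3)[OF c q] good_pair[OF iffD1[OF quad_perm(3) q] p]])

text \<open>The points have the incidences of \<open>fano_cross_value\<close>, so
  \<open>delta\<close> is \<open>eps\<close>; it remains to show the same for c. With the
  coordinates given there, e2, x, y are collinear exactly in characteristic two. If they are, the
  points form a Fano plane, \<open>eps\<close> vanishes and c is degenerate. If not, two rank 3
  relations through x identify two terms of the cyclic relation up to sign, and the cyclic relation
  leaves \<open>eps\<close>.\<close>

lemma seven_points_fano:
 assumes T_def: "\<And>a b d. T a b d \<longleftrightarrow> a ## b ## d ## K \<in> F"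
  and d: "distinct [e1, e2, e3, f, g, x, y]" "{e1, e2, e3, f, g, x, y} \<inter> K = {}"
  and T: "T e1 e2 e3" "T e2 e3 f" "T e1 e3 f" "\<not> T e1 e2 f" "T e1 e3 g" "T e1 e2 g" "\<not> T e2 e3 g"
   "T e2 e3 x" "T e1 e2 x" "T e2 e3 y" "T e1 e2 y"
  and L: "\<not> T e1 e3 x" "\<not> T f g x" "\<not> T e3 f y" "\<not> T e1 g y"
  and B: "T e1 g x" "T e3 f x" "T e1 e3 y" "T f g y"
 shows "good c D (e2 ## K) e1 e3 x y"
proof -
 have comm: "T a b d \<longleftrightarrow> T b a d" "T a b d \<longleftrightarrow> T a d b" for a b d
  by (simp_all add: T_def insert_commute)
 define P where "P = {e1, e2, e3, f, g, x, y}"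
 have rule: "T p q z ==> \<not> T p q u ==> T p u r ==> distinct [p, u, r] ==> {p, u, r} \<subseteq> P ==> T p q r"
  for p q z u r
  using basis_parallel3[OF F, of p q z K u r] d(2) unfolding T_def P_def by blast
 have Q: "quad F (p ## K) q r u v"
  if "T p q u" "T p q v" "T p r u" "T p r v" "distinct [p, q, r, u, v]" "{p, q, r, u, v} \<subseteq> P" for p q r u v
  by (rule quad_insertI) (use that d(2) in \<open>auto simp: T_def P_def\<close>)
 have m1: "T e2 f g" using rule[of e2 g e1 e3 f] T d by (auto simp: comm P_def)
 have m2: "T e2 f x" using rule[of e2 f e3 e1 x] T d by (auto simp: comm P_def)
 have m3: "T e2 f y" using rule[of e2 f e3 e1 y] T d by (auto simp: comm P_def)
 have m4: "T e2 g x" using rule[of e2 g e1 e3 x] T d by (auto simp: comm P_def)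
 have m5: "T e2 g y" using rule[of e2 g e1 e3 y] T d by (auto simp: comm P_def)
 have m6: "T e3 f g" using rule[of e3 g e1 e2 f] T d by (auto simp: comm P_def)
 have m7: "T e1 f g" using rule[of e1 f e3 e2 g] T d by (auto simp: comm P_def)
 have m8: "T e1 x y" using rule[of e1 y e2 g x] T L B d by (auto simp: comm P_def)
 have m9: "T e3 x y" using rule[of e3 y e2 f x] T L B d by (auto simp: comm P_def)
 have m10: "T e1 f x" using rule[of f x e3 g e1] T L B d m7 by (auto simp: comm P_def)
 have m11: "T e1 f y" using rule[of e1 f e3 e2 y] T d by (auto simp: comm P_def)
 have m12: "T e3 g x" using rule[of e3 g e1 e2 x] T d by (auto simp: comm P_def)
 have m13: "T e3 g y" using rule[of e3 g e1 e2 y] T d by (auto simp: comm P_def)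
 have m14: "T f x y" using rule[of f y g e3 x] L B d by (auto simp: comm P_def)
 have m15: "T g x y" using rule[of g y f e1 x] L B d by (auto simp: comm P_def)
 note M = m1 m2 m3 m4 m5 m6 m7 m8 m9 m10 m11 m12 m13 m14 m15
 have q: "quad F (e2 ## K) e1 e3 x y" "quad F (e2 ## K) x y e1 e3"
  by (rule Q; use T d in \<open>auto simp: comm P_def\<close>)+
 have X: "cochain {B \<in> F. y \<notin> B} eps c (gradient D)" "cochain {B \<in> F. x \<notin> B} eps c (gradient D)"
  using potential_cochain[OF _ pot_x] potential_cochain[OF _ pot_y] basis_family_finite[OF F] by auto
 have "gradient D (e2 ## y ## K) e1 e3 - gradient D (e2 ## x ## K) e1 e3 \<simeq> eps"
  by (rule fano_cross_value[OF X cross_system_degenerate[OF c] T_def d]; use T L B M in \<open>simp add: comm\<close>)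
 moreover have "gradient D (y ## e2 ## K) e1 e3 - gradient D (x ## e2 ## K) e1 e3
   \<simeq> delta D (e2 ## K) x y e1 e3"
  by (rule gradient_quad) (use d basis_family_finite[OF F, of "e1 ## e2 ## e3 ## K"] T in \<open>auto simp: T_def\<close>)
 ultimately have "delta D (e2 ## K) x y e1 e3 \<simeq> eps"
  using cong_trans cong_sym by (metis insert_commute)
 then have delta: "delta D (e2 ## K) e1 e3 x y \<simeq> eps"
  using cong_trans[OF delta_transpose[of x y e1 e3 D "e2 ## K"]] d by auto
 have "c (e2 ## K) e1 e3 x y \<simeq> eps"
 proof (cases "T e2 x y")
  case False
  have "\<exists>p. fano_pattern F K p"
   by (rule fano_patternI[OF T_def, of e1 e2 e3 f g y x]; use T L B M False d in \<open>auto simp: comm\<close>)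
  then have "eps \<simeq> 0" using c unfolding cross_system_def cong_0 by blast
  moreover have "c (e2 ## K) e1 e3 x y \<simeq> 0"
   by (rule cross_system_degenerate[OF c q(1)]) (use False in \<open>auto simp: T_def insert_commute\<close>)
  ultimately show ?thesis using cong_trans cong_sym by blast
 next
  case True
  have deg: "c (p ## K) q r u v \<simeq> 0" if "\<not> T p q r" "quad F (p ## K) q r u v" for p q r u v
   by (rule cross_system_degenerate[OF c that(2)]) (use that(1) in \<open>auto simp: T_def insert_commute\<close>)
  have par: "c (p ## K) q r u v \<simeq> c (p ## K) q' r u v"
   if "quad F (p ## K) q r u v" "quad F (p ## K) q' r u v" "q \<noteq> q'" "\<not> T p q q'" for p q q' r u v
   by (rule cross_system_parallel'[OF c that(1-3)]) (use that(4) in \<open>auto simp: T_def insert_commute\<close>)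
  have par2: "c (p ## K) q r u v \<simeq> c (p ## K) q r u' v"
   if "quad F (p ## K) q r u v" "quad F (p ## K) q r u' v" "u \<noteq> u'" "\<not> T p u u'" for p q r u u' v
   by (rule cross_system_parallel[OF c that(1-3)]) (use that(4) in \<open>auto simp: T_def insert_commute\<close>)
  have qs: "quad F (e2 ## K) g y x e1" "quad F (x ## K) g y e1 e2" "quad F (e1 ## K) g y e2 x"
   "quad F (e2 ## K) f y x e3" "quad F (x ## K) f y e3 e2" "quad F (e3 ## K) f y e2 x"
   "quad F (x ## K) f y e1 e2" "quad F (e2 ## K) e3 y x e1" "quad F (e2 ## K) e1 y x e3"
   by (rule Q; use T L B M True d in \<open>auto simp: comm P_def\<close>)+
  have r1: "c (e2 ## K) g y x e1 + c (x ## K) g y e1 e2 + c (e1 ## K) g y e2 x \<simeq> 0"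
   by (rule cross_system_rank3[OF c qs(1-3)])
  have r2: "c (e2 ## K) f y x e3 + c (x ## K) f y e3 e2 + c (e3 ## K) f y e2 x \<simeq> 0"
   by (rule cross_system_rank3[OF c qs(4-6)])
  have d1: "c (e1 ## K) g y e2 x \<simeq> 0" "c (e3 ## K) f y e2 x \<simeq> 0"
   by (rule deg; use qs L in \<open>auto simp: comm\<close>)+
  have p1: "c (x ## K) g y e1 e2 \<simeq> c (x ## K) f y e1 e2"
   by (rule par) (use qs L d in \<open>auto simp: comm\<close>)
  have p2: "c (x ## K) f y e1 e2 \<simeq> c (x ## K) f y e3 e2"
   by (rule par2) (use qs L d in \<open>auto simp: comm\<close>)
  have p3: "c (e2 ## K) g y x e1 \<simeq> c (e2 ## K) e3 y x e1"
   by (rule par) (use qs T d in \<open>auto simp: comm\<close>)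
  have p4: "c (e2 ## K) f y x e3 \<simeq> c (e2 ## K) e1 y x e3"
   by (rule par) (use qs T d in \<open>auto simp: comm\<close>)
  have A: "c (e2 ## K) e3 y x e1 \<simeq> c (e2 ## K) e1 y x e3"
   by (rule cong_eqI[OF cong_add[OF cong_diff[OF cong_diff[OF r1 r2] cong_diff[OF d1]]
      cong_diff[OF cong_diff[OF p4 p3] cong_add[OF p1 p2]]]]) (simp add: algebra_simps)
  have cyc: "c (e2 ## K) e1 e3 x y + c (e2 ## K) e1 x y e3 + c (e2 ## K) e1 y e3 x \<simeq> eps"
   by (rule cross_system_cyclic[OF c q(1)]) (use T True in \<open>auto simp: T_def insert_commute\<close>)
  have q': "quad F (e2 ## K) y e3 e1 x" using qs(8) by (auto simp: quad_def)
  have s1: "c (e2 ## K) e1 x y e3 \<simeq> c (e2 ## K) y e3 e1 x"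
   by (rule cross_system_perm(3)[OF c q'])
  have s2: "c (e2 ## K) y e3 e1 x \<simeq> c (e2 ## K) e3 y x e1"
   by (rule cross_system_perm(2)[OF c qs(8)])
  have s3: "c (e2 ## K) e1 y e3 x \<simeq> - c (e2 ## K) e1 y x e3"
   by (rule cross_system_perm(1)[OF c qs(9)])
  show ?thesis
   by (rule cong_eqI[OF cong_diff[OF cyc cong_add[OF cong_add[OF s1 s2] cong_add[OF s3 A]]]]) (simp add: algebra_simps)
 qed
 then show ?thesis using delta cong_trans cong_sym by blast
qed

end

lemma (in signed_group) glued_pair_swap: "glued_pair R eps w E F c D x y ==> glued_pair R eps w E F c D y x"
 unfolding glued_pair_def glued_pair_axioms_def by auto

context glued_pair
begin

text \<open>The point f lies on e1 e2 and g on e2 e3. If one of the four lines from {e1, f} to {e3,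
  g} misses x and y, the rank 3 relation over that line reduces to terms settled by
  \<open>good_pair'\<close>, and chains lead back to e1 and e3. Otherwise x lies on two opposite
  lines and y on the other two, which is the configuration of \<open>seven_points_fano\<close> up to
  exchanging x and y.\<close>

lemma seven_points:
 assumes T_def: "\<And>a b d. T a b d \<longleftrightarrow> a ## b ## d ## K \<in> F"
  and d: "distinct [e1, e2, e3, f, g, x, y]" "{e1, e2, e3, f, g, x, y} \<inter> K = {}"
  and T: "T e1 e2 e3" "T e2 e3 f" "T e1 e3 f" "\<not> T e1 e2 f" "T e1 e3 g" "T e1 e2 g" "\<not> T e2 e3 g"
   "T e2 e3 x" "T e1 e2 x" "T e2 e3 y" "T e1 e2 y"
 shows "good c D (e2 ## K) e1 e3 x y"
proof -
 have comm: "T a b d \<longleftrightarrow> T b a d" "T a b d \<longleftrightarrow> T a d b" for a b d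
  by (simp_all add: T_def insert_commute)
 define P where "P = {e1, e2, e3, f, g, x, y}"
 have rule: "T p q z ==> \<not> T p q u ==> T p u r ==> distinct [p, u, r] ==> {p, u, r} \<subseteq> P ==> T p q r"
  for p q z u r
  using basis_parallel3[OF F, of p q z K u r] d(2) unfolding T_def P_def by blast
 have Q: "quad F (p ## K) q r u v"
  if "T p q u" "T p q v" "T p r u" "T p r v" "distinct [p, q, r, u, v]" "{p, q, r, u, v} \<subseteq> P" for p q r u v
  by (rule quad_insertI) (use that d(2) in \<open>auto simp: T_def P_def\<close>)
 have fx1: "T e2 f x" using rule[of e2 f e3 e1 x] T d by (auto simp: comm P_def)
 have fx2: "T e2 f y" using rule[of e2 f e3 e1 y] T d by (auto simp: comm P_def)
 have fx3: "T e2 g x" using rule[of e2 g e1 e3 x] T d by (auto simp: comm P_def)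
 have fx4: "T e2 g y" using rule[of e2 g e1 e3 y] T d by (auto simp: comm P_def)
 note fxs = fx1 fx2 fx3 fx4
 have fg: "T e3 f g" "T e1 f g" "T e2 f g"
  using rule[of e3 g e1 e2 f] rule[of e1 f e3 e2 g] rule[of e2 g e1 e3 f] T d by (auto simp: comm P_def)
 have q: "quad F (e2 ## K) e1 e3 x y" "quad F (e2 ## K) x y e1 e3"
  by (rule Q; use T d in \<open>auto simp: comm P_def\<close>)+
 have main: "good c D (e2 ## K) e1 e3 x y"
  if u: "(u, u') \<in> {(e1, f), (f, e1)}" and v: "(v, v') \<in> {(e3, g), (g, e3)}" and uv: "T u v x" "T u v y"
  for u u' v v'
 proof -
  have m: "T u v v'" "T u e2 v'" "T v e2 u'" "T v u u'" "T e2 u x" "T e2 u y" "T e2 v x" "T e2 v y" "T e2 u v"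
   "T e2 u e3" "T e2 u' e3" "T e2 e1 v" "T e2 e1 v'" "\<not> T e2 u u'" "\<not> T e2 v v'" "T e2 u' x" "T e2 u' y"
   "T e2 v' x" "T e2 v' y"
   using u v T fg fxs by (elim insertE emptyE; simp add: comm)+
  have dd: "distinct [u, u', v, v', x, y, e2]" "{u, u', v, v', x, y, e2} \<subseteq> P"
   using u v d by (auto simp: P_def)
  have qq: "quad F (e2 ## K) x y u v" "quad F (u ## K) x y v e2" "quad F (v ## K) x y e2 u"
   by (rule Q; use m uv dd in \<open>simp add: comm; blast?\<close>)+
  have "good c D (e2 ## K) x y u v"
  proof (rule good_rank3[OF c qq])
   show "good c D (u ## K) x y v e2"
    by (rule good_pair'[OF qq(2), of v']) (use m dd in \<open>auto simp: T_def insert_commute\<close>)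
   show "good c D (v ## K) x y e2 u"
    by (rule good_pair'[OF qq(3), of u']) (use m dd in \<open>auto simp: T_def insert_commute\<close>)
  qed
  note g1 = this
  have g2: "good c D (e2 ## K) x y e1 v"
  proof (cases "u = e1")
   case False
   have q2: "quad F (e2 ## K) x y e1 u"
    by (rule Q) (use m dd False u T in \<open>auto simp: comm P_def\<close>)
   have "good c D (e2 ## K) x y e1 u"
    by (rule good_pair'[OF q2, of e3]) (use m T d in \<open>auto simp: T_def insert_commute\<close>)
   then show ?thesis
    using good_chain[OF c q2 qq(1) _ _ g1] d v by auto
  qed (use g1 in simp)
  have q3: "quad F (e2 ## K) x y e1 v"
   by (rule Q) (use m dd T d v in \<open>auto simp: comm P_def\<close>)
  have "good c D (e2 ## K) x y e1 e3"
  proof (cases "v = e3")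
   case False
   have q4: "quad F (e2 ## K) x y v e3"
    by (rule Q) (use m dd False v T in \<open>auto simp: comm P_def\<close>)
   have "good c D (e2 ## K) x y v e3"
    by (rule good_pair'[OF q4, of e1]) (use m T d in \<open>auto simp: T_def insert_commute\<close>)
   then show ?thesis
    using good_chain[OF c q3 q4 _ g2] d by auto
  qed (use g2 in simp)
  then show ?thesis using iffD1[OF good_perm(3)[OF c q(1)]] by blast
 qed
 show ?thesis
 proof (rule ccontr)
  assume no: "\<not> ?thesis"
  have n: "\<not> T e1 e3 x \<or> \<not> T e1 e3 y" "\<not> T e1 g x \<or> \<not> T e1 g y" "\<not> T f e3 x \<or> \<not> T f e3 y"
   "\<not> T f g x \<or> \<not> T f g y"
   using main[of e1 f e3 g] main[of e1 f g e3] main[of f e1 e3 g] main[of f e1 g e3] no by auto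
  \<comment> \<open>A point on one of the opposite lines e1 e3 and f g lies on neither of the lines
    e1 g and e3 f, since these meet both in points different from it.\<close>
  have z: "T e1 g z \<and> T e3 f z" if h: "\<not> T e1 e3 z \<or> \<not> T f g z" "T e1 e2 z" "T e2 e3 z" "T e2 f z" "T e2 g z"
   "z = x \<or> z = y" for z
  proof -
   have dz: "distinct [e1, e2, e3, f, g, z]" "{e1, e2, e3, f, g, z} \<subseteq> P" using d h(6) by (auto simp: P_def)
   show ?thesis
   proof (cases "T e1 e3 z")
    case False
    then show ?thesis
     using h(2,3) rule[of e1 z e2 e3 g] rule[of e3 z e2 e1 f] T dz by (auto simp: comm)
   next
    case True
    then show ?thesis
     using h(1,4,5) fg rule[of f z e2 g e3] rule[of g z e2 f e1] T dz by (auto simp: comm)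
   qed
  qed
  consider "\<not> T e1 e3 x" "\<not> T f g x" "\<not> T f e3 y" "\<not> T e1 g y" "T e1 g x" "T e3 f x" "T e1 e3 y" "T f g y"
   | "\<not> T e1 e3 y" "\<not> T f g y" "\<not> T f e3 x" "\<not> T e1 g x" "T e1 g y" "T e3 f y" "T e1 e3 x" "T f g x"
   using n z[of x] z[of y] fxs T comm by blast
  then show False
  proof cases
   case 1
   show False
    using seven_points_fano[OF T_def d T] 1 no by (simp add: comm)
  next
   case 2
   have d': "distinct [e1, e2, e3, f, g, y, x]" "{e1, e2, e3, f, g, y, x} \<inter> K = {}" using d by auto
   have "good c D (e2 ## K) e1 e3 y x"
    using glued_pair.seven_points_fano[OF glued_pair_swap[OF glued_pair_axioms] T_def d' T(1-7)] T 2
    by (simp add: comm)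
   then show False using no good_perm(1)[OF c q(1)] by blast
  qed
 qed
qed

text \<open>Induction on the length of a path from i to k in the fundamental graph without x and y.
  A common column is handled by \<open>good_pair\<close>, distance two is exactly
  \<open>seven_points\<close>, and a longer path is shortened by a pivot that changes neither the
  prescribed nor the actual cross-ratio.\<close>

lemma good_violation:
 "B \<in> F ==> x \<notin> B ==> y \<notin> B ==> i \<in> B ==> k \<in> B ==> quad F (B - {i, k}) i k x y ==>
  (i, k) \<in> row_rel {B \<in> F. x \<notin> B \<and> y \<notin> B} B ^^ m ==> good c D (B - {i, k}) i k x y"
proof (induction m arbitrary: B rule: less_induct)
 case (less m)
 note prems = less.prems
 let ?G = "{B \<in> F. x \<notin> B \<and> y \<notin> B}"
 have G: "basis_family ?G"
  using basis_family_avoid[OF F prems(1), of "{x, y}"] prems(2,3) by simp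
 have adjG: "adj ?G B r p \<longleftrightarrow> adj F B r p \<and> p \<noteq> x \<and> p \<noteq> y" for r p
  using prems(2,3) by (auto simp: adj_def)
 define K where "K = B - {i, k}"
 have ik: "i \<noteq> k" "i \<notin> K" "k \<notin> K" "x \<notin> K" "y \<notin> K" "x \<noteq> i" "x \<noteq> k" "y \<noteq> i" "y \<noteq> k" using prems(6) by (auto simp: quad_def K_def)
 have B: "B = i ## k ## K" "B - {i} = k ## K" "B - {k} = i ## K"
  using prems ik by (auto simp: K_def)
 have q: "quad F K i k x y" using prems(6) by (simp add: K_def)
 show ?case
 proof (cases "\<exists>n<m. (i, k) \<in> row_rel ?G B ^^ n")
  case True
  then show ?thesis using less.IH prems by blast
 next
  case min: False
  have min': "(i, k) \<notin> row_rel ?G B ^^ n" if "n < m" for n using min that by blast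
  consider "m = 0" | "m = 1" | "2 \<le> m" by linarith
  then show ?thesis
  proof cases
   case 1
   then show ?thesis using prems(7) ik by simp
  next
   case 2
   then obtain p where p: "adj ?G B i p" "adj ?G B k p" using prems(7) by (auto simp: row_rel_def)
   then have "i ## p ## K \<in> F" "k ## p ## K \<in> F" "p \<noteq> x" "p \<noteq> y"
    using adjG B unfolding adj_def by (auto simp: insert_commute)
   then show ?thesis using good_pair[OF q] unfolding K_def by blast
  next
   case 3
   have BG: "B \<in> ?G" using prems(1-3) by simp
   obtain r c1 c2 where rc: "adj ?G B i c1" "adj ?G B r c1" "adj ?G B r c2" "\<not> adj ?G B i c2"
    "\<not> adj ?G B k c1" "r \<noteq> i" "r \<noteq> k" "if m = 2 then adj ?G B k c2 else \<not> adj ?G B k c2"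
    "(r, k) \<in> row_rel ?G B ^^ (m - 1)"
    "(i, k) \<in> row_rel ?G (c1 ## (B - {r})) ^^ (m - 1)"
    "(i, k) \<in> row_rel ?G (c2 ## (B - {r})) ^^ (m - 1)"
    by (rule shorten_path[OF G BG prems(7) 3 min'])
   define L where "L = K - {r}"
   have rB: "r \<in> K" "c1 \<notin> B" "c2 \<notin> B" "c1 \<noteq> x" "c1 \<noteq> y" "c2 \<noteq> x" "c2 \<noteq> y"
    using rc(1-3,6,7) adjG by (auto simp: adj_def K_def)
   then have K: "K = r ## L" "r \<notin> L" by (auto simp: L_def)
   have BL: "B = i ## r ## k ## L" "B - {i} = r ## k ## L"
    "B - {k} = i ## r ## L" "B - {r} = i ## k ## L"
    using B K rc(6,7) ik by auto
   have d: "distinct [i, r, k, c2, x, y]" "distinct [i, r, k, c1, x, y]" "{i, r, k, c1, c2, x, y} \<inter> L = {}"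
    using ik rB K rc(6,7) xy unfolding B(1) by auto
   have cc: "c1 \<noteq> c2" using rc by blast
   have m: "i ## r ## k ## L \<in> F" "c1 ## r ## k ## L \<in> F"
    "c1 ## i ## k ## L \<in> F" "c2 ## i ## k ## L \<in> F"
    "c2 ## r ## k ## L \<notin> F" "c1 ## i ## r ## L \<notin> F"
    using prems(1) rc(1-5) adjG rB d ik B(1) unfolding BL(2-4)[symmetric] BL(1)[symmetric] adj_def by auto
   have qL: "quad F (r ## L) i k x y" using q K(1) by simp
   then have xy4: "i ## x ## r ## L \<in> F" "k ## x ## r ## L \<in> F"
    "i ## y ## r ## L \<in> F" "k ## y ## r ## L \<in> F"
    by (auto simp: quad_def)
   show ?thesis
   proof (cases "m = 2")
    case True
    then have "adj F B k c2" using rc(8) adjG by simp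
    then have "c2 ## i ## r ## L \<in> F" unfolding adj_def BL(3) by simp
    moreover have dd: "distinct [i, r, k, c1, c2, x, y]" using d cc by auto
    ultimately have "good c D (r ## L) i k x y"
     by (intro seven_points[of "\<lambda>a b d. a ## b ## d ## L \<in> F" L i r k c1 c2, OF refl dd d(3)])
      (use m xy4 in \<open>simp_all add: insert_commute\<close>)
    then show ?thesis using K(1) K_def by simp
   next
    \<comment> \<open>Beyond distance two, r and c2 are parallel over each of i, k, x, y. Therefore
      \<open>cross_system_closure\<close> allows replacing r by c2, which is the pivot from
      \<open>B\<close> to \<open>?C\<close>.\<close>
    case False
    let ?C = "c2 ## (B - {r})"
    have kc2: "c2 ## i ## r ## L \<notin> F"
    proof -
     have "\<not> adj F B k c2" using rc(8) adjG False rB by simp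
     then show ?thesis using rB(3) prems(5) unfolding adj_def BL(3) by simp
    qed
    have C: "?C = i ## k ## c2 ## L" "?C - {i, k} = c2 ## L"
     using d unfolding BL(4) by (auto simp: insert_commute)
    have nxy: "c2 ## r ## z ## L \<notin> F" if "z = x \<or> z = y" for z
    proof
     assume a: "c2 ## r ## z ## L \<in> F"
     have a': "c2 ## z ## r ## L \<in> F" using a by (simp add: insert_commute)
     have "k ## c2 ## r ## L \<notin> F" using m(5) by (simp add: insert_commute)
     then have "c2 ## i ## r ## L \<in> F"
      using basis_parallel[OF F, of k i "r ## L" c2 z] a' m(1) d by (auto simp: insert_commute)
     then show False using kc2 by blast
    qed
    have C2z: "i ## z ## c2 ## L \<in> F" "k ## z ## c2 ## L \<in> F" if z: "z = x \<or> z = y" for z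
    proof -
     show "i ## z ## c2 ## L \<in> F"
      using basis_parallel3[OF F, of i c2 k L r z] m kc2 xy4 z d by (auto simp: insert_commute)
     show "k ## z ## c2 ## L \<in> F"
      using basis_parallel3[OF F, of k c2 i L r z] m xy4 z d by (auto simp: insert_commute)
    qed
    have C4: "i ## x ## c2 ## L \<in> F" "k ## x ## c2 ## L \<in> F"
     "i ## y ## c2 ## L \<in> F" "k ## y ## c2 ## L \<in> F"
     using C2z by blast+
    have qC: "quad F (c2 ## L) i k x y"
     using C4 d by (auto simp: quad_def)
    have gC: "good c D (c2 ## L) i k x y"
    proof -
     have "good c D (?C - {i, k}) i k x y"
      by (rule less.IH[of "m - 1"])
       (use 3 C qC rc(11) rc(3) adjG prems(2,3) in \<open>auto simp: adj_def\<close>)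
     then show ?thesis unfolding C(2) .
    qed
    have cc2: "c (r ## L) i k x y \<simeq> c (c2 ## L) i k x y"
    proof (rule cross_system_closure[OF F c _ _ _ qL qC])
     fix z assume "z \<in> {i, k, x, y}"
     then show "z ## r ## c2 ## L \<notin> F"
      using m(5) kc2 nxy[of x] nxy[of y] by (auto simp: insert_commute)
    qed (use d in auto)
    \<comment> \<open>From x to y through the remaining one of i and k: each half avoids y or x,
      hence is good, and it is degenerate because r and c2 are parallel over z.\<close>
    have par: "delta D (z ## L) r c2 x y \<simeq> 0"
     if z: "(z, o') = (i, k) \<or> (z, o') = (k, i)" for z o'
    proof -
     have q1: "quad F (z ## L) r c2 x o'" "quad F (z ## L) r c2 o' y"
      by (rule quad_insertI; use m xy4 C4 d z in \<open>auto simp: insert_commute\<close>)+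
     have "r ## c2 ## z ## L \<notin> F"
      using z m(5) kc2 by (auto simp: insert_commute)
     then have "c (z ## L) r c2 x o' \<simeq> 0" "c (z ## L) r c2 o' y \<simeq> 0"
      using cross_system_degenerate[OF c] q1 by blast+
     moreover have "good c D (z ## L) r c2 x o'" "good c D (z ## L) r c2 o' y"
      by (rule good_avoid[OF q1(1)] good_avoid[OF q1(2)]; use d z in auto)+
     ultimately have "delta D (z ## L) r c2 x o' \<simeq> 0" "delta D (z ## L) r c2 o' y \<simeq> 0"
      using cong_trans by blast+
     from cong_diff[OF delta_rank2[of D "z ## L" r c2 x o' y] cong_add[OF this]]
     have "delta D (z ## L) r c2 y x \<simeq> 0" by (rule cong_eqI) simp
     from cong_trans[OF delta_swap[of D "z ## L" r c2 x y] cong_minus[OF this]]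
     show ?thesis by simp
    qed
    have "delta D (r ## L) i k x y - delta D (c2 ## L) i k x y =
     delta D (i ## L) r c2 x y - delta D (k ## L) r c2 x y"
     by (simp add: delta_def W_def insert_commute algebra_simps)
    moreover have "\<dots> \<simeq> 0 - 0" by (rule cong_diff[OF par[of i k] par[of k i]]) simp_all
    ultimately have "delta D (r ## L) i k x y \<simeq> delta D (c2 ## L) i k x y"
     by (simp add: cong_def)
    then show ?thesis
     using gC cc2 K(1) cong_trans cong_sym unfolding K_def[symmetric] by blast
   qed
  qed
 qed
qed

end

section \<open>Uniqueness and gluing of potentials\<close>

context signed_group
begin

text \<open>The signs cancel in the difference of two potentials, so the triangle holonomy is 0
  instead of \<open>eps\<close>.\<close>

lemma flat_cochain_difference:
 assumes "\<And>K a b u v. quad H K a b u v ==> delta D K a b u v \<simeq> delta D' K a b u v"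
 shows "flat_cochain H (\<lambda>I a b. (D (b ## I) - D' (b ## I)) - (D (a ## I) - D' (a ## I)))"
 unfolding cochain_def
proof (intro conjI allI impI)
 fix K a b u v
 assume "quad H K a b u v"
 then show "D (v ## b ## K) - D' (v ## b ## K) - (D (u ## b ## K) - D' (u ## b ## K)) -
   (D (v ## a ## K) - D' (v ## a ## K) - (D (u ## a ## K) - D' (u ## a ## K))) \<simeq> 0"
  by (intro cong_eqI[OF assms]) (auto simp: delta_def insert_commute algebra_simps)
qed (simp_all add: insert_commute algebra_simps)

lemma exact_on_potential:
 assumes F: "basis_family F" "F \<subseteq> H" "C \<in> F" "B \<in> F"
  and t: "exact_on H (\<lambda>I a b. G (b ## I) - G (a ## I)) t"
 shows "G B \<simeq> (G C - sum t C) + sum t B"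
 using F(1,3,4)
proof (induction rule: basis_family_induct)
 case (step B i j)
 have iB: "i ## (B - {i}) = B" "finite B"
  using step.hyps(2) basis_family_finite[OF F(1) step.hyps(1)] by auto
 have "G (j ## (B - {i})) - G (i ## (B - {i})) \<simeq> t j - t i"
  using t[unfolded exact_on_def, rule_format, of i "B - {i}" j] step.hyps F(2) iB(1) by auto
 from cong_add[OF this[unfolded iB(1)] step.IH] show ?case
  by (rule cong_eqI) (use step.hyps(2,3) iB(2) in \<open>simp add: sum_diff1 algebra_simps\<close>)
qed simp

lemma potential_unique:
 assumes F: "basis_family F" and D: "potential F c D" "potential F c D'"
 obtains k t where "\<And>B. B \<in> F ==> D B \<simeq> D' B + k + sum t B"
proof -
 have "flat_cochain F (\<lambda>I a b. (D (b ## I) - D' (b ## I)) - (D (a ## I) - D' (a ## I)))"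
  by (rule flat_cochain_difference) (use D cong_trans cong_sym in \<open>unfold potential_def, blast\<close>)
 from exact[OF F this] obtain t
  where t: "exact_on F (\<lambda>I a b. (D (b ## I) - D' (b ## I)) - (D (a ## I) - D' (a ## I))) t" by blast
 obtain C where C: "C \<in> F" using F by (auto simp: basis_family_def)
 have "D B \<simeq> D' B + (D C - D' C - sum t C) + sum t B" if "B \<in> F" for B
  by (rule cong_eqI[OF exact_on_potential[OF F subset_refl C that, of "\<lambda>B. D B - D' B" t, OF t]]) (simp add: algebra_simps)
 then show thesis by (rule that)
qed

lemma potential_unique_off_pair:
 assumes F: "basis_family F" "C \<in> F" "x \<notin> C" "y \<notin> C" "x \<noteq> y"
  and D: "\<And>K a b u v. quad {B \<in> F. \<not> (x \<in> B \<and> y \<in> B)} K a b u v ==> delta D K a b u v \<simeq> delta D' K a b u v"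
 obtains k t where "\<And>B. B \<in> F ==> \<not> (x \<in> B \<and> y \<in> B) ==> D B \<simeq> D' B + k + sum t B"
proof -
 let ?H = "{B \<in> F. \<not> (x \<in> B \<and> y \<in> B)}"
 from exact_off_pair[OF F flat_cochain_difference[OF D]] obtain t
  where t: "exact_on ?H (\<lambda>I a b. (D (b ## I) - D' (b ## I)) - (D (a ## I) - D' (a ## I))) t" by blast
 have "D B \<simeq> D' B + (D C - D' C - sum t C) + sum t B" if B: "B \<in> F" "\<not> (x \<in> B \<and> y \<in> B)" for B
 proof -
  \<comment> \<open>The basis C avoids both elements, so B and C lie in a common deletion, where
    exchanges connect them.\<close>
  obtain z where z: "z = x \<or> z = y" "z \<notin> B" "z \<notin> C" using B F(3,4) by blast
  let ?G = "{B \<in> F. z \<notin> B}"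
  have G: "basis_family ?G" "?G \<subseteq> ?H" "C \<in> ?G" "B \<in> ?G"
   using basis_family_delete[OF F(1,2) z(3)] z F(2) B by auto
  show ?thesis
   by (rule cong_eqI[OF exact_on_potential[OF G, of "\<lambda>B. D B - D' B" t, OF t]]) (simp add: algebra_simps)
 qed
 then show thesis by (rule that)
qed

lemma potential_shift:
 assumes F: "\<And>B. B \<in> F ==> finite B" and D: "potential F c D" "\<And>B. B \<in> F ==> D' B \<simeq> D B + k + sum t B"
 shows "potential F c D'"
 unfolding potential_def
proof (intro allI impI)
 fix K a b u v assume q: "quad F K a b u v"
 then have K: "finite K" using F[of "a ## u ## K"] by (simp add: quad_def)
 have m: "a ## u ## K \<in> F" "b ## v ## K \<in> F" "a ## v ## K \<in> F" "b ## u ## K \<in> F"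
  using q by (auto simp: quad_def)
 have "delta D' K a b u v \<simeq> delta D K a b u v"
  by (rule cong_eqI[OF cong_diff[OF cong_diff[OF cong_add[OF D(2)[OF m(1)] D(2)[OF m(2)]] D(2)[OF m(3)]] D(2)[OF m(4)]]])
   (use q K in \<open>auto simp: delta_def quad_def algebra_simps\<close>)
 also have "\<dots> \<simeq> c K a b u v" using D(1) q by (simp add: potential_def)
 finally show "delta D' K a b u v \<simeq> c K a b u v" .
qed

lemma potential_mono: "potential F c D ==> G \<subseteq> F ==> potential G c D"
 using quad_mono[of G _ _ _ _ _ F] unfolding potential_def by blast

lemma glue_potentials:
 assumes F: "basis_family F" "cross_system F c" "x \<noteq> y" "C \<in> F" "x \<notin> C" "y \<notin> C"
  and D: "potential {B \<in> F. x \<notin> B} c Dx" "potential {B \<in> F. y \<notin> B} c Dy"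
 shows "\<exists>D. glued_pair R eps w E F c D x y"
proof -
 let ?G = "{B \<in> F. x \<notin> B \<and> y \<notin> B}"
 have G: "basis_family ?G" using basis_family_avoid[OF F(1,4), of "{x, y}"] F by simp
 have pot: "potential ?G c Dx" "potential ?G c Dy"
  by (rule potential_mono[OF D(1)] potential_mono[OF D(2)]; blast)+
 obtain k t where kt: "\<And>B. B \<in> ?G ==> Dx B \<simeq> Dy B + k + sum t B"
  using potential_unique[OF G pot] by blast
 \<comment> \<open>Bases through x are seen only by the deletion of y; its potential is shifted so
   as to agree with \<open>Dx\<close> on the bases that avoid both.\<close>
 define D where "D B = (if x \<in> B then Dy B + k + sum t B else Dx B)" for B
 have "potential {B \<in> F. x \<notin> B} c D"
  by (rule potential_shift[OF _ D(1), where k = 0 and t = "\<lambda>_. 0"])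
   (use basis_family_finite[OF F(1)] in \<open>auto simp: D_def\<close>)
 moreover have "potential {B \<in> F. y \<notin> B} c D"
  by (rule potential_shift[OF _ D(2), where k = k and t = t])
   (use basis_family_finite[OF F(1)] kt in \<open>auto simp: D_def\<close>)
 ultimately show ?thesis
  unfolding glued_pair_def glued_pair_axioms_def using F(1-3) signed_group_axioms
  by (intro exI[of _ D] conjI)
qed

lemma good_swap_left:
 assumes c: "cross_system F c" "quad F K a b u v"
 shows "good c D K b a u v \<longleftrightarrow> good c D K a b u v"
proof -
 have "quad F K a b v u" using c(2) by (simp add: quad_perm(1))
 then show ?thesis using good_perm(1)[OF c] good_perm(2)[OF c(1), of K a b v u] by simp
qed

lemma good_cyclic:
 assumes c: "cross_system F c" "quad F K a b u v" "a ## b ## K \<in> F" "u ## v ## K \<in> F"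
  and g: "good c D K a b u v" "good c D K a v b u"
 shows "good c D K a u v b"
proof -
 have d: "distinct [a, b, u, v]" using c(2) by (simp add: quad_def)
 show ?thesis
  by (rule cong_eqI[OF cong_diff[OF cong_diff[OF delta_cyclic[OF d, of D K] cross_system_cyclic[OF c]] cong_add[OF g]]])
   (simp add: algebra_simps)
qed

end

text \<open>Two exchanges with C replace y and x by u and v. If v and y do not extend
  \<open>K\<close> to a basis, they are parallel, and u and v may change roles.\<close>

lemma exchange_pair:
 assumes F: "basis_family F" "x ## y ## K \<in> F" "x \<noteq> y" "x \<notin> K" "y \<notin> K" "C \<in> F" "x \<notin> C" "y \<notin> C"
 obtains u v where "quad F K x v y u" "u ## v ## K \<in> F"
proof -
 obtain u where u: "u \<in> C" "u \<notin> x ## y ## K" "u ## (x ## y ## K - {y}) \<in> F"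
  using basis_family_exchange(1)[OF F(1,2,6), of y] F(8) by blast
 have "x ## y ## K - {y} = x ## K" using F by auto
 then have xu: "u ## x ## K \<in> F" using u by simp
 obtain v where v: "v \<in> C" "v \<notin> u ## x ## K" "v ## (u ## x ## K - {x}) \<in> F"
  using basis_family_exchange(1)[OF F(1) xu F(6), of x] F(7) by blast
 have "u ## x ## K - {x} = u ## K" using F u by auto
 then have uv: "v ## u ## K \<in> F" using v by simp
 have d: "distinct [x, v, y, u]" "{x, v, y, u} \<inter> K = {}" using u v F by auto
 show thesis
 proof (cases "v ## y ## K \<in> F")
  case True
  then show thesis using that[of v u] xu uv F(2) d by (simp add: quad_def insert_commute)
 next
  case False
  have "v ## x ## K \<in> F"
   using basis_parallel[OF F(1), of y x K v u] F(2) uv False d by (auto simp: insert_commute)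
  moreover have "y ## u ## K \<in> F"
   using basis_parallel[OF F(1), of v u K y x] F(2) uv False d by (auto simp: insert_commute)
  ultimately show thesis using that[of u v] uv F(2) d by (auto simp: quad_def insert_commute)
 qed
qed

section \<open>Completing a glued potential\<close>

context glued_pair
begin

text \<open>If u and v extend \<open>K\<close> to a basis, they are joined in its fundamental graph
  and \<open>good_violation\<close> applies. Otherwise they are parallel over \<open>K\<close>, and
  an element of C serves as the p of \<open>good_pair\<close>.\<close>

lemma good_off_pair:
 assumes C: "C \<in> F" "x \<notin> C" "y \<notin> C"
  and conn: "\<And>B u v. B \<in> F ==> x \<notin> B ==> y \<notin> B ==> u \<in> B - \<Inter>F ==> v \<in> B - \<Inter>F ==>
   (u, v) \<in> (row_rel {B \<in> F. x \<notin> B \<and> y \<notin> B} B)\<^sup>*"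
  and q: "quad F K u v x y"
 shows "good c D K u v x y"
proof (cases "u ## v ## K \<in> F")
 case True
 let ?B = "u ## v ## K"
 have "u ## x ## K \<in> F" "v \<notin> u ## x ## K" "v ## x ## K \<in> F" "u \<notin> v ## x ## K"
  using q by (auto simp: quad_def)
 then have "u \<notin> \<Inter>F" "v \<notin> \<Inter>F" by blast+
 then have "(u, v) \<in> (row_rel {B \<in> F. x \<notin> B \<and> y \<notin> B} ?B)\<^sup>*"
  using conn[OF True, of u v] q by (auto simp: quad_def)
 then obtain m where m: "(u, v) \<in> row_rel {B \<in> F. x \<notin> B \<and> y \<notin> B} ?B ^^ m"
  using rtrancl_imp_relpow by blast
 have eq: "?B - {u, v} = K" using q by (auto simp: quad_def)
 show ?thesis
  using good_violation[OF True, of u v m] m q unfolding eq by (auto simp: quad_def)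
next
 case False
 have ux: "u ## x ## K \<in> F" "v ## x ## K \<in> F" "u \<noteq> x" "u \<notin> K" "x \<notin> K" "v \<noteq> u" "v \<notin> K"
  using q by (auto simp: quad_def)
 obtain p where p: "p \<in> C" "p \<notin> u ## x ## K" "p ## (u ## x ## K - {x}) \<in> F"
  using basis_family_exchange(1)[OF F ux(1) C(1), of x] C(2) by blast
 have "u ## x ## K - {x} = u ## K" using ux by auto
 then have up: "u ## p ## K \<in> F" using p(3) by (simp add: insert_commute)
 have "v ## p ## K \<in> F"
  using basis_parallel[OF F up ux(2) False] p(2) ux by auto
 then show ?thesis using good_pair[OF q up] p C by auto
qed

text \<open>For each \<open>K\<close> the value at \<open>x ## y ## K\<close> is still free, and it
  occurs in the cross-ratios that have x and y in different pairs. One of these is used to fix it.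
  The others follow by replacing u or v one at a time, which changes the equation by a cross-ratio
  that avoids x or y.\<close>

lemma exists_type_zero:
 assumes C: "C \<in> F" "x \<notin> C" "y \<notin> C" and viol: "\<And>K u v. quad F K u v x y ==> good c D K u v x y"
 shows "\<exists>D'. glued_pair R eps w E F c D' x y \<and> (\<forall>K u v. quad F K u v x y --> good c D' K u v x y) \<and>
  (\<forall>K u v. quad F K x v y u --> good c D' K x v y u)"
proof -
 define P where "P K p \<longleftrightarrow> quad F K x (snd p) y (fst p) \<and> (fst p) ## (snd p) ## K \<in> F" for K p
 \<comment> \<open>The solution of \<open>delta D K x v y u = c K x v y u\<close> for the value at
   \<open>x ## y ## K\<close>.\<close>
 define val where "val K p = c K x (snd p) y (fst p) - D ((snd p) ## (fst p) ## K) +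
   D (x ## (fst p) ## K) + D ((snd p) ## y ## K) - W x (snd p) y (fst p)" for K p
 define D' where "D' B = (if x \<in> B \<and> y \<in> B then val (B - {x, y}) (SOME p. P (B - {x, y}) p) else D B)" for B
 have same: "D' B = D B" if "x \<notin> B \<or> y \<notin> B" for B using that by (auto simp: D'_def)
 have gp: "glued_pair R eps w E F c D' x y"
 proof -
  have "potential {B \<in> F. x \<notin> B} c D'"
   by (rule potential_shift[OF _ pot_x, where k = 0 and t = "\<lambda>_. 0"])
    (use basis_family_finite[OF F] in \<open>auto simp: same\<close>)
  moreover have "potential {B \<in> F. y \<notin> B} c D'"
   by (rule potential_shift[OF _ pot_y, where k = 0 and t = "\<lambda>_. 0"])
    (use basis_family_finite[OF F] in \<open>auto simp: same\<close>)
  ultimately show ?thesis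
   unfolding glued_pair_def glued_pair_axioms_def using F c xy signed_group_axioms by (intro conjI)
 qed
 interpret D': glued_pair R eps w E F c D' x y by (rule gp)
 have viol': "good c D' K u v x y" if q: "quad F K u v x y" for K u v
 proof -
  have "delta D' K u v x y = delta D K u v x y"
   using q xy by (auto simp: delta_def quad_def same)
  then show ?thesis using viol[OF q] by simp
 qed
 have step1: "good c D' K x v y u'"
  if q: "quad F K x v y u" "quad F K x v y u'" and g: "good c D' K x v y u" for K u u' v
 proof (cases "u = u'")
  case False
  have q2: "quad F K x v u u'" using q False by (auto simp: quad_def)
  have "good c D' K x v u u'" by (rule D'.good_avoid[OF q2]) (use q q2 xy in \<open>auto simp: quad_def\<close>)
  then show ?thesis using good_chain[OF c q(1) q2 _ g] q(2) by (auto simp: quad_def)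
 qed (use g in simp)
 have step2: "good c D' K x v' y u"
  if q: "quad F K x v y u" "quad F K x v' y u" and g: "good c D' K x v y u" for K u v v'
 proof (cases "v = v'")
  case False
  have q2: "quad F K y u x v" "quad F K y u v v'" "quad F K y u x v'"
   using q False by (auto simp: quad_def insert_commute)
  have g': "good c D' K y u x v" using iffD2[OF good_perm(3)[OF c q(1)] g] .
  have "good c D' K y u v v'" by (rule D'.good_avoid[OF q2(2)]) (use q q2 xy in \<open>auto simp: quad_def\<close>)
  then have "good c D' K y u x v'" using good_chain[OF c q2(1,2) _ g'] q2(3) by (auto simp: quad_def)
  then show ?thesis using good_perm(3)[OF c q2(3)] by blast
 qed (use g in simp)
 have swap: "good c D' K x u y v"
  if q: "quad F K x v y u" "quad F K x u y v" "u ## v ## K \<in> F" and g: "good c D' K x v y u" for K u v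
 proof -
  have q2: "quad F K x y u v" "quad F K u v x y" using q by (auto simp: quad_def insert_commute)
  have "good c D' K x y u v" using good_perm(3)[OF c q2(1)] viol'[OF q2(2)] by blast
  then have "good c D' K x u v y"
   using good_cyclic[OF c q2(1)] q g by (auto simp: quad_def)
  then show ?thesis using good_perm(1)[OF c q(2)] by blast
 qed
 have "good c D' K x v y u" if q: "quad F K x v y u" for K u v
 proof -
  have xyK: "x ## y ## K \<in> F" "x \<notin> K" "y \<notin> K" and d: "distinct [x, v, y, u]" "u \<notin> K" "v \<notin> K"
   using q by (auto simp: quad_def)
  have K: "x ## y ## K - {x, y} = K" using xyK by auto
  have "\<exists>p. P K p"
   using exchange_pair[OF F xyK(1) xy xyK(2,3) C] unfolding P_def by (metis fst_conv snd_conv)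
  then have "P K (SOME p. P K p)" by (rule someI_ex)
  moreover obtain u0 v0 where sp: "(SOME p. P K p) = (u0, v0)" by fastforce
  ultimately have p: "quad F K x v0 y u0" "u0 ## v0 ## K \<in> F" by (auto simp: P_def)
  have d0: "distinct [x, v0, y, u0]" "u0 \<notin> K" "v0 \<notin> K" using p(1) by (auto simp: quad_def)
  have "D' (x ## y ## K) = val K (u0, v0)"
   unfolding D'_def K sp by simp
  moreover have "D' (v0 ## u0 ## K) = D (v0 ## u0 ## K)"
   "D' (x ## u0 ## K) = D (x ## u0 ## K)"
   "D' (v0 ## y ## K) = D (v0 ## y ## K)"
   using d0 xyK by (auto intro!: same)
  ultimately have "delta D' K x v0 y u0 = c K x v0 y u0"
   by (simp add: delta_def val_def insert_commute)
  then have g0: "good c D' K x v0 y u0" by simp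
  have uvF: "u ## v ## K \<in> F" "x ## u ## K \<in> F" "v ## y ## K \<in> F"
   "x ## u0 ## K \<in> F" "v0 ## y ## K \<in> F"
   using q p by (auto simp: quad_def insert_commute)
  show ?thesis
  proof (cases "u ## v0 ## K \<in> F")
   case True
   then have "u \<noteq> v0" using basis_distinct2(1)[OF F p(2)] d0 by auto
   then have q1: "quad F K x v0 y u" using True uvF xyK d d0 by (auto simp: quad_def insert_commute)
   then show ?thesis using step2[OF q1 q step1[OF p(1) q1 g0]] by blast
  next
   case F1: False
   show ?thesis
   proof (cases "u0 ## v ## K \<in> F")
    case True
    then have "u0 \<noteq> v" using basis_distinct2(1)[OF F p(2)] d0 by auto
    then have q1: "quad F K x v y u0" using True uvF xyK d d0 by (auto simp: quad_def insert_commute)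
    then show ?thesis using step1[OF q1 q step2[OF p(1) q1 g0]] by blast
   next
    \<comment> \<open>Neither mixed pair extends \<open>K\<close> to a basis, so u is parallel to v0
      and v to u0. The cyclic relation, through \<open>swap\<close>, exchanges u0 and v0; afterwards
      u and v can be inserted one at a time.\<close>
    case F2: False
    note par = basis_parallel[OF F]
    have a: "u ## u0 ## K \<in> F"
     using par[of v0 u0 K u v] p(2) uvF F1 d0 by (auto simp: insert_commute)
    have b: "v ## v0 ## K \<in> F"
     using par[of u0 v0 K v u] p(2) uvF F2 d0 by (auto simp: insert_commute)
    have e: "x ## v0 ## K \<in> F"
     using par[of u x K v0 u0] p(2) uvF F1 d xyK by (auto simp: insert_commute)
    have f: "y ## u0 ## K \<in> F"
     using par[of v y K u0 v0] p(2) uvF F2 d xyK by (auto simp: insert_commute)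
    have ne: "u \<noteq> u0" "v \<noteq> v0"
     using a b basis_distinct2(1)[OF F p(2)] d0 by auto
    have q1: "quad F K x u0 y v0" "quad F K x u0 y u"
     using a e f uvF p xyK d d0 ne by (auto simp: quad_def insert_commute)
    have g1: "good c D' K x u0 y v0" using swap[OF p(1) q1(1) p(2) g0] .
    show ?thesis using step2[OF q1(2) q step1[OF q1 g1]] .
   qed
  qed
 qed
 then show ?thesis using gp viol' by blast
qed

text \<open>By uniqueness off the pair, \<open>D'\<close> can be shifted to agree with
  \<open>D\<close> at the bases that miss x or y. A basis through both occurs as the single such
  basis in a cross-ratio with x and y in different pairs, so \<open>zero\<close> forces agreement
  there as well.\<close>

lemma good_of_minor:
 assumes N: "basis_family N" "N \<subseteq> F" "C \<in> N" "x \<notin> C" "y \<notin> C" and D': "potential N c D'"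
  and viol: "\<And>K u v. quad F K u v x y ==> good c D K u v x y"
  and zero: "\<And>K u v. quad F K x v y u ==> good c D K x v y u"
  and q: "quad N K a b u v"
 shows "good c D K a b u v"
proof -
 let ?H = "{B \<in> N. \<not> (x \<in> B \<and> y \<in> B)}"
 have agree: "delta D' K a b u v \<simeq> delta D K a b u v" if h: "quad ?H K a b u v" for K a b u v
 proof -
  have qN: "quad N K a b u v" by (rule quad_mono[OF h]) blast
  have qF: "quad F K a b u v" by (rule quad_mono[OF qN N(2)])
  have nn: "\<not> (x \<in> a ## u ## K \<and> y \<in> a ## u ## K)"
   "\<not> (x \<in> a ## v ## K \<and> y \<in> a ## v ## K)"
   "\<not> (x \<in> b ## u ## K \<and> y \<in> b ## u ## K)"
   "\<not> (x \<in> b ## v ## K \<and> y \<in> b ## v ## K)"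
   using h unfolding quad_def by (simp_all only: mem_Collect_eq simp_thms)
  have "good c D K a b u v"
  proof (cases "x \<notin> a ## b ## u ## v ## K \<or> y \<notin> a ## b ## u ## v ## K")
   case True
   then show ?thesis using good_avoid[OF qF] by blast
  next
   case False
   then consider "x = a" "y = b" | "x = b" "y = a" | "x = u" "y = v" | "x = v" "y = u"
   proof -
    have K: "x \<notin> K" using nn False by (cases "x \<in> K") auto
    have K': "y \<notin> K" using nn False by (cases "y \<in> K") auto
    have "x \<in> {a, b, u, v}" "y \<in> {a, b, u, v}" using K K' False by simp_all
    then show thesis using nn xy that by (elim insertE emptyE; simp)
   qed
   then show ?thesis
   proof cases
    case 1
    have q2: "quad F K u v a b" using iffD1[OF quad_perm(3) qF] .
    show ?thesis using iffD2[OF good_perm(3)[OF c q2]] viol q2 1 by blast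
   next
    case 2
    have q2: "quad F K u v a b" "quad F K u v b a" using qF by (auto simp: quad_def insert_commute)
    have "good c D K u v b a" using viol[of K u v] q2(2) 2 by simp
    then have "good c D K u v a b" using iffD1[OF good_perm(1)[OF c q2(1)]] by blast
    then show ?thesis using iffD2[OF good_perm(3)[OF c q2(1)]] by blast
   next
    case 3
    then show ?thesis using viol qF by blast
   next
    case 4
    have "quad F K a b v u" using qF by (simp add: quad_perm(1))
    then have "good c D K a b v u" using viol[of K a b] 4 by simp
    then show ?thesis using iffD1[OF good_perm(1)[OF c qF]] by blast
   qed
  qed
  then show ?thesis using D' qN cong_trans cong_sym unfolding potential_def by blast
 qed
 obtain k t where kt: "\<And>B. B \<in> N ==> \<not> (x \<in> B \<and> y \<in> B) ==> D' B \<simeq> D B + k + sum t B"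
  using potential_unique_off_pair[OF N(1,3-5) xy agree] by blast
 define D2 where "D2 B = D' B + (- k) + sum (\<lambda>v. - t v) B" for B
 have pot2: "potential N c D2"
  by (rule potential_shift[OF _ D', where k = "- k" and t = "\<lambda>v. - t v"])
   (use basis_family_finite[OF N(1)] in \<open>auto simp: D2_def\<close>)
 have eq1: "D2 B \<simeq> D B" if "B \<in> N" "\<not> (x \<in> B \<and> y \<in> B)" for B
  by (rule cong_eqI[OF kt[OF that]]) (simp add: D2_def sum_negf algebra_simps)
 have eq2: "D2 B \<simeq> D B" if B: "B \<in> N" for B
 proof (cases "x \<in> B \<and> y \<in> B")
  case True
  define K where "K = B - {x, y}"
  have K: "B = x ## y ## K" "x \<notin> K" "y \<notin> K" using True by (auto simp: K_def)
  obtain u v where uv: "quad N K x v y u" "u ## v ## K \<in> N"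
   using exchange_pair[OF N(1) _ xy K(2,3) N(3-5)] B K(1) by blast
  have d: "x \<noteq> v" "x \<noteq> u" "y \<noteq> u" "y \<noteq> v" using uv(1) by (auto simp: quad_def)
  have m: "v ## u ## K \<in> N" "x ## u ## K \<in> N" "v ## y ## K \<in> N"
   using uv by (auto simp: quad_def insert_commute)
  have e: "D2 (v ## u ## K) \<simeq> D (v ## u ## K)" "D2 (x ## u ## K) \<simeq> D (x ## u ## K)"
   "D2 (v ## y ## K) \<simeq> D (v ## y ## K)"
   by (rule eq1; use m d K xy in auto)+
  have "delta D2 K x v y u \<simeq> delta D K x v y u"
   using zero[OF quad_mono[OF uv(1) N(2)]] pot2 uv(1) cong_trans cong_sym unfolding potential_def by blast
  from cong_add[OF cong_diff[OF this e(1)] cong_add[OF e(2,3)]] show ?thesis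
   unfolding K(1) by (rule cong_eqI) (simp add: delta_def algebra_simps)
 qed (use eq1 B in blast)
 have m: "a ## u ## K \<in> N" "b ## v ## K \<in> N" "a ## v ## K \<in> N" "b ## u ## K \<in> N"
  using q by (auto simp: quad_def)
 have "delta D2 K a b u v \<simeq> delta D K a b u v"
  by (rule cong_eqI[OF cong_diff[OF cong_diff[OF cong_add[OF eq2[OF m(1)] eq2[OF m(2)]] eq2[OF m(3)]] eq2[OF m(4)]]])
   (simp add: delta_def algebra_simps)
 then show ?thesis using pot2 q cong_trans cong_sym unfolding potential_def by blast
qed

end

text \<open>If x and y are among the four elements of a cross-ratio, it is covered by
  \<open>viol\<close> or \<open>zero\<close> up to symmetry. If one of them is contracted, there is
  a third element z that is also contracted or does not occur at all, and the minor at z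
  decides.\<close>

lemma (in signed_group) pair_extension:
 assumes bF: "basis_family F" "cross_system F c" and xy: "x \<noteq> y" "x \<in> \<Union>F" "y \<in> \<Union>F"
  and C: "C \<in> F" "x \<notin> C" "y \<notin> C"
  and conn: "\<And>B u v. B \<in> F ==> x \<notin> B ==> y \<notin> B ==> u \<in> B - \<Inter>F ==> v \<in> B - \<Inter>F ==>
   (u, v) \<in> (row_rel {B \<in> F. x \<notin> B \<and> y \<notin> B} B)\<^sup>*"
  and nontriv: "\<And>v. v \<in> \<Union>F - \<Inter>F - {x, y} ==>
   (\<exists>B\<in>F. x \<notin> B \<and> y \<notin> B \<and> v \<in> B) \<and> (\<exists>B\<in>F. x \<notin> B \<and> y \<notin> B \<and> v \<notin> B)"
  and IH: "\<And>z. z \<in> \<Union>F - \<Inter>F ==> (\<exists>D. potential {B \<in> F. z \<in> B} c D) \<and> (\<exists>D. potential {B \<in> F. z \<notin> B} c D)"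
 shows "\<exists>D. potential F c D"
proof -
 obtain Dx Dy where D: "potential {B \<in> F. x \<notin> B} c Dx" "potential {B \<in> F. y \<notin> B} c Dy"
  using IH[of x] IH[of y] xy C by blast
 obtain D1 where gp1: "glued_pair R eps w E F c D1 x y"
  using glue_potentials[OF bF xy(1) C D] by blast
 obtain D where gp: "glued_pair R eps w E F c D x y"
  and viol: "\<And>K u v. quad F K u v x y ==> good c D K u v x y"
  and zero: "\<And>K u v. quad F K x v y u ==> good c D K x v y u"
  using glued_pair.exists_type_zero[OF gp1 C glued_pair.good_off_pair[OF gp1 C conn]] by blast
 interpret glued_pair R eps w E F c D x y by (rule gp)
 have "good c D J a b u v" if q: "quad F J a b u v" for J a b u v
 proof -
  let ?U = "a ## b ## u ## v ## J"
  note perm = good_perm[OF bF(2)] good_swap_left[OF bF(2)]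
  have sub: "\<Inter>F \<subseteq> J" using q by (auto simp: quad_def)
  consider "x \<notin> ?U \<or> y \<notin> ?U" | "x \<in> ?U" "y \<in> ?U" "x \<notin> J" "y \<notin> J" | "x \<in> ?U" "y \<in> ?U" "x \<in> J \<or> y \<in> J"
   by blast
  then show ?thesis
  proof cases
   case 1
   then show ?thesis using good_avoid[OF q] by blast
  next
   case 2
   have qs: "quad F J a b v u" "quad F J b a u v" "quad F J b a v u" "quad F J u v a b" "quad F J v u a b"
    "quad F J u v b a" "quad F J v u b a"
    using q by (auto simp: quad_def insert_commute)
   have g1: "good c D J a b u v \<longleftrightarrow> good c D J a b v u" "good c D J a b u v \<longleftrightarrow> good c D J b a u v"
    "good c D J a b u v \<longleftrightarrow> good c D J b a v u" "good c D J a b u v \<longleftrightarrow> good c D J u v a b"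
    using perm(1,2,3,4)[OF q] by simp_all
   have g2: "good c D J a b u v \<longleftrightarrow> good c D J v u a b" "good c D J a b u v \<longleftrightarrow> good c D J u v b a"
    "good c D J a b u v \<longleftrightarrow> good c D J v u b a"
    using perm(1,2,4)[OF qs(4)] g1(4) by simp_all
   have "{x, y} \<subseteq> {a, b, u, v}" using 2 by auto
   then consider "x = a" "y = b" | "x = b" "y = a" | "x = u" "y = v" | "x = v" "y = u"
    | "x = a" "y = u" | "x = a" "y = v" | "x = b" "y = u" | "x = b" "y = v"
    | "x = u" "y = a" | "x = u" "y = b" | "x = v" "y = a" | "x = v" "y = b"
    using xy(1) by auto
   then show ?thesis
    by cases (use viol zero q qs g1 g2 in blast)+
  next
   case 3
   \<comment> \<open>Otherwise \<open>?U - {x, y}\<close> is the only basis that avoids x and y. But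
     {a, b, u, v} contains a further active element, and by \<open>nontriv\<close> some such basis
     contains it and another does not.\<close>
   have "\<exists>z \<in> \<Union>F - \<Inter>F - {x, y}. z \<in> J \<or> z \<notin> ?U"
   proof (rule ccontr)
    assume no: "\<not> ?thesis"
    have fin: "finite B" if "B \<in> F" for B using basis_family_finite[OF bF(1) that] .
    have mem: "a ## u ## J \<in> F" "b ## v ## J \<in> F" and d: "distinct [a, b, u, v]" "{a, b, u, v} \<inter> J = {}"
     using q by (auto simp: quad_def)
    have finJ: "finite J" using fin[OF mem(1)] by simp
    have BU: "B = ?U - {x, y}" if B: "B \<in> F" "x \<notin> B" "y \<notin> B" for B
    proof -
     have "B \<subseteq> ?U - {x, y}" using B no sub by blast
     moreover have "card B = card (?U - {x, y})"
     proof -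
      have "card (?U - {x, y}) = card ?U - 2"
       using 3 xy(1) finJ by (subst card_Diff_subset) auto
      also have "\<dots> = card (a ## u ## J)" using d finJ by simp
      also have "\<dots> = card B" using basis_family_card[OF bF(1) mem(1) B(1)] by simp
      finally show ?thesis by simp
     qed
     ultimately show ?thesis using finJ by (intro card_subset_eq) auto
    qed
    have "\<exists>z\<in>{a, b, u, v} - {x, y}. True" using 3 d by auto
    then obtain z where z: "z \<in> {a, b, u, v}" "z \<noteq> x" "z \<noteq> y" by blast
    then have "z \<in> \<Union>F - \<Inter>F - {x, y}"
    proof -
     have "z \<notin> J" "z \<in> a ## u ## J \<union> b ## v ## J" using z(1) d by auto
     then show ?thesis using mem sub z(2,3) by blast
    qed
    then show False using nontriv[of z] BU by blast
   qed
   then obtain z where z: "z \<in> \<Union>F - \<Inter>F" "z \<noteq> x" "z \<noteq> y" "z \<in> J \<or> z \<notin> ?U" by blast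
   obtain D' D'' where D': "potential {B \<in> F. z \<in> B} c D'" "potential {B \<in> F. z \<notin> B} c D''"
    using IH[OF z(1)] by blast
   obtain B1 B2 where B12: "B1 \<in> F" "x \<notin> B1" "y \<notin> B1" "z \<in> B1" "B2 \<in> F" "x \<notin> B2" "y \<notin> B2" "z \<notin> B2"
    using nontriv[of z] z by blast
   show ?thesis
   proof (cases "z \<in> J")
    case True
    have "quad {B \<in> F. z \<in> B} J a b u v" using q True by (auto simp: quad_def)
    then show ?thesis
     using good_of_minor[OF basis_family_contract[OF bF(1) B12(1,4)] _ _ B12(2,3) D'(1) viol zero] B12 by blast
   next
    case False
    have "quad {B \<in> F. z \<notin> B} J a b u v" using q z(4) False by (auto simp: quad_def)
    then show ?thesis
     using good_of_minor[OF basis_family_delete[OF bF(1) B12(5,8)] _ _ B12(6,7) D'(2) viol zero] B12 by blast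
   qed
  qed
 qed
 then show ?thesis unfolding potential_def by blast
qed

text \<open>Two bases on disjoint triples of points force a contracted z into \<open>K\<close>; a
  deleted z is neither in \<open>K\<close> nor among the points. So no membership changes between
  the minor and \<open>F\<close>.\<close>

lemma fano_pattern_minor:
 assumes p: "fano_pattern G K p" and G: "G = {B \<in> F. z \<in> B} \<or> G = {B \<in> F. z \<notin> B}"
 shows "fano_pattern F K p"
proof -
 have inj: "p i \<noteq> p j" if "i < 7" "j < 7" "i \<noteq> j" for i j
  using p that unfolding fano_pattern_def by (auto dest: inj_onD)
 have iff: "(p a) ## (p b) ## (p c) ## K \<in> G \<longleftrightarrow>
    (a, b, c) \<notin> {(0, 1, 3), (1, 2, 4), (2, 3, 5), (3, 4, 6), (0, 4, 5), (1, 5, 6), (0, 2, 6)}"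
  if "a < b" "b < c" "c < 7" for a b c
 proof -
  have "\<forall>a b c. a < b \<and> b < c \<and> c < 7 --> ((p a) ## (p b) ## (p c) ## K \<in> G \<longleftrightarrow>
    (a, b, c) \<notin> {(0, 1, 3), (1, 2, 4), (2, 3, 5), (3, 4, 6), (0, 4, 5), (1, 5, 6), (0, 2, 6)})"
   using p unfolding fano_pattern_iff by (elim conjE)
  from this[rule_format, of a b c] that show ?thesis by (simp only: simp_thms)
 qed
 have b1: "(p 0) ## (p 1) ## (p 2) ## K \<in> G" by (subst iff) auto
 have b2: "(p 3) ## (p 4) ## (p 5) ## K \<in> G" by (subst iff) auto
 have b3: "(p 0) ## (p 1) ## (p 6) ## K \<in> G" by (subst iff) auto
 have G_iff: "(p a) ## (p b) ## (p c) ## K \<in> G \<longleftrightarrow> (p a) ## (p b) ## (p c) ## K \<in> F"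
  if "c < 7" "b < 7" "a < 7" for a b c
  using G
 proof
  assume G: "G = {B \<in> F. z \<in> B}"
  have "z \<in> K"
  proof (rule ccontr)
   assume "z \<notin> K"
   then have "z \<in> {p 0, p 1, p 2}" "z \<in> {p 3, p 4, p 5}" using b1 b2 unfolding G by auto
   then show False
    using inj[of 0 3] inj[of 0 4] inj[of 0 5] inj[of 1 3] inj[of 1 4] inj[of 1 5] inj[of 2 3] inj[of 2 4] inj[of 2 5]
    by auto
  qed
  then show ?thesis unfolding G by blast
 next
  assume G: "G = {B \<in> F. z \<notin> B}"
  have "z \<notin> K" "z \<notin> {p 0, p 1, p 2, p 3, p 4, p 5, p 6}" using b1 b2 b3 unfolding G by auto
  moreover have "p i \<in> {p 0, p 1, p 2, p 3, p 4, p 5, p 6}" if "i < 7" for i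
  proof -
   have "i \<in> {0, 1, 2, 3, 4, 5, 6}" using that by auto
   then show ?thesis by blast
  qed
  ultimately show ?thesis unfolding G using that by (metis (no_types, lifting) insert_iff mem_Collect_eq)
 qed
 show ?thesis
  unfolding fano_pattern_iff
 proof (intro conjI allI impI)
  show "inj_on p {0..<7}" "p ` {0..<7} \<inter> K = {}" using p unfolding fano_pattern_def by blast+
  fix a b c :: nat assume "a < b \<and> b < c \<and> c < 7"
  then show "(p a) ## (p b) ## (p c) ## K \<in> F \<longleftrightarrow>
    (a, b, c) \<notin> {(0, 1, 3), (1, 2, 4), (2, 3, 5), (3, 4, 6), (0, 4, 5), (1, 5, 6), (0, 2, 6)}"
   using G_iff[of c b a] iff[of a b c] by simp
 qed
qed

section \<open>Duality\<close>

lemma dual_family_iff: "F \<subseteq> Pow E ==> B \<subseteq> E ==> B \<in> dual_family E F \<longleftrightarrow> E - B \<in> F"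
 unfolding dual_family_def using double_diff[of _ E E] by (auto intro: rev_image_eqI)

lemma dual_family_subset: "dual_family E F \<subseteq> Pow E"
 by (auto simp: dual_family_def)

lemma dual_dual_family: "F \<subseteq> Pow E ==> dual_family E (dual_family E F) = F"
 unfolding dual_family_def image_image by (force simp: double_diff)

lemma dual_family_delete:
 "F \<subseteq> Pow E ==> z \<in> E ==> dual_family E {B \<in> F. z \<in> B} = {B \<in> dual_family E F. z \<notin> B}"
 "F \<subseteq> Pow E ==> z \<in> E ==> dual_family E {B \<in> F. z \<notin> B} = {B \<in> dual_family E F. z \<in> B}"
 by (auto simp: dual_family_def)

lemma basis_family_dual:
 assumes F: "basis_family F" "F \<subseteq> Pow E" "finite E"
 shows "basis_family (dual_family E F)"
proof -
 have ex: "B \<subseteq> E \<and> E - B \<in> F" if "B \<in> dual_family E F" for B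
  using that dual_family_iff[OF F(2)] dual_family_subset[of E F] by blast
 have "finite (\<Union>(dual_family E F))"
  using dual_family_subset[of E F] F(3) by (meson Sup_le_iff PowD finite_subset subsetD)
 moreover have "dual_family E F \<noteq> {}" using F(1) by (auto simp: basis_family_def dual_family_def)
 moreover have "\<exists>j\<in>B' - B. j ## (B - {i}) \<in> dual_family E F"
  if B: "B \<in> dual_family E F" "B' \<in> dual_family E F" "i \<in> B - B'" for B B' i
 proof -
  obtain j where j: "j \<in> E - B" "j \<notin> E - B'" "i ## (E - B - {j}) \<in> F"
   using basis_family_exchange(2)[OF F(1), of "E - B" "E - B'" i] ex[OF B(1)] ex[OF B(2)] B(3) by blast
  have "E - j ## (B - {i}) = i ## (E - B - {j})" using j ex[OF B(1)] B(3) by auto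
  then have "j ## (B - {i}) \<in> dual_family E F"
   using dual_family_iff[OF F(2), of "j ## (B - {i})"] j ex[OF B(1)] by auto
  then show ?thesis using j by blast
 qed
 moreover have "\<exists>i\<in>B - B'. j ## (B - {i}) \<in> dual_family E F"
  if B: "B \<in> dual_family E F" "B' \<in> dual_family E F" "j \<in> B' - B" for B B' j
 proof -
  obtain i where i: "i \<in> E - B'" "i \<notin> E - B" "i ## (E - B - {j}) \<in> F"
   using basis_family_exchange(1)[OF F(1), of "E - B" "E - B'" j] ex[OF B(1)] ex[OF B(2)] B(3) by blast
  have "E - j ## (B - {i}) = i ## (E - B - {j})" using i ex[OF B(1)] B(3) by auto
  then have "j ## (B - {i}) \<in> dual_family E F"
   using dual_family_iff[OF F(2), of "j ## (B - {i})"] i ex[OF B(1)] ex[OF B(2)] B(3) by auto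
  then show ?thesis using i ex[OF B(1)] by blast
 qed
 ultimately show ?thesis unfolding basis_family_def by simp
qed

text \<open>The complement of a, u and \<open>K\<close> consists of b, v and the remaining elements,
  so complementation permutes the four bases and keeps the order of a, b, u, v.\<close>

lemma quad_dual:
 assumes F: "F \<subseteq> Pow E"
 shows "quad (dual_family E F) K a b u v \<longleftrightarrow> K \<subseteq> E \<and> {a, b, u, v} \<subseteq> E \<and> {a, b, u, v} \<inter> K = {} \<and>
  quad F (E - K - {a, b, u, v}) a b u v"
proof (cases "K \<subseteq> E \<and> {a, b, u, v} \<subseteq> E \<and> {a, b, u, v} \<inter> K = {} \<and> distinct [a, b, u, v]")
 case True
 define L where "L = E - K - {a, b, u, v}"
 have mem: "p ## q ## K \<in> dual_family E F \<longleftrightarrow> r ## s ## L \<in> F"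
  if "{p, q, r, s} = {a, b, u, v}" "distinct [p, q, r, s]" for p q r s
 proof -
  have "E - p ## q ## K = r ## s ## L"
   using True that(2) unfolding that(1)[symmetric] L_def by auto
  moreover have "p ## q ## K \<subseteq> E" using True that(1) by auto
  ultimately show ?thesis using dual_family_iff[OF F] by metis
 qed
 have e: "a ## u ## K \<in> dual_family E F \<longleftrightarrow> b ## v ## L \<in> F"
  "a ## v ## K \<in> dual_family E F \<longleftrightarrow> b ## u ## L \<in> F"
  "b ## u ## K \<in> dual_family E F \<longleftrightarrow> a ## v ## L \<in> F"
  "b ## v ## K \<in> dual_family E F \<longleftrightarrow> a ## u ## L \<in> F"
  by (rule mem; use True in auto)+
 have "{a, b, u, v} \<inter> L = {}" by (auto simp: L_def)
 then show ?thesis unfolding quad_def e L_def[symmetric] using True by blast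
next
 case False
 then show ?thesis using dual_family_subset[of E F] by (auto simp: quad_def)
qed

context signed_group
begin

lemma cross_system_axioms_closure:
 assumes "cross_system F c" "s \<noteq> t" "s \<notin> K" "t \<notin> K" "quad F (s ## K) a b u v" "quad F (t ## K) a b u v"
  "\<And>z. z \<in> {a, b, u, v} ==> z ## s ## t ## K \<notin> F" "\<And>z. z \<in> {a, b, u, v} ==> {a, b, u, v} - {z} \<union> K \<notin> F"
 shows "c (s ## K) a b u v \<simeq> c (t ## K) a b u v"
proof -
 have "\<forall>K s t a b u v. s \<noteq> t \<and> s \<notin> K \<and> t \<notin> K \<and> quad F (s ## K) a b u v \<and> quad F (t ## K) a b u v \<and>
    (\<forall>z\<in>{a, b, u, v}. z ## s ## t ## K \<notin> F \<and> {a, b, u, v} - {z} \<union> K \<notin> F) -->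
    c (s ## K) a b u v \<simeq> c (t ## K) a b u v"
  using assms(1) unfolding cross_system_def by (elim conjE)
 then show ?thesis using assms(2-) by blast
qed

lemma cross_systemI:
 assumes "\<And>K a b u v. quad F K a b u v ==> c K a b v u \<simeq> - c K a b u v"
  "\<And>K a b u v. quad F K a b u v ==> c K b a v u \<simeq> c K a b u v"
  "\<And>K a b u v. quad F K a b u v ==> c K u v a b \<simeq> c K a b u v"
  "\<And>K a b u v. quad F K a b u v ==> a ## b ## K \<notin> F \<or> u ## v ## K \<notin> F ==> c K a b u v \<simeq> 0"
  "\<And>K a b u v. quad F K a b u v ==> a ## b ## K \<in> F ==> u ## v ## K \<in> F ==>
   c K a b u v + c K a u v b + c K a v b u \<simeq> eps"
  "\<And>K a b u v z. quad F K a b u v ==> quad F K a b v z ==> quad F K a b z u ==>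
   c K a b u v + c K a b v z + c K a b z u \<simeq> 0"
  "\<And>K a b u v z. quad F (z ## K) a b u v ==> quad F (u ## K) a b v z ==> quad F (v ## K) a b z u ==>
   c (z ## K) a b u v + c (u ## K) a b v z + c (v ## K) a b z u \<simeq> 0"
  "\<And>K s t a b u v. s \<noteq> t ==> s \<notin> K ==> t \<notin> K ==> quad F (s ## K) a b u v ==> quad F (t ## K) a b u v ==>
   (\<And>z. z \<in> {a, b, u, v} ==> z ## s ## t ## K \<notin> F) ==>
   (\<And>z. z \<in> {a, b, u, v} ==> {a, b, u, v} - {z} \<union> K \<notin> F) ==> c (s ## K) a b u v \<simeq> c (t ## K) a b u v"
  "\<And>K p. fano_pattern F K p ==> eps \<in> R" "\<And>K p. fano_pattern (dual_family E F) K p ==> eps \<in> R"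
 shows "cross_system F c"
 unfolding cross_system_def
 by (intro conjI allI impI; (elim exE disjE conjE)?; (rule assms; (assumption | blast)))

lemma cross_system_fano:
 "cross_system F c ==> fano_pattern F K p ==> eps \<in> R"
 "cross_system F c ==> fano_pattern (dual_family E F) K p ==> eps \<in> R"
 unfolding cross_system_def by blast+

lemma cross_system_minor:
 assumes c: "cross_system F c" and F: "F \<subseteq> Pow E" "z \<in> E"
  and G: "G = {B \<in> F. z \<in> B} \<or> G = {B \<in> F. z \<notin> B}"
 shows "cross_system G c"
proof -
 have sub: "G \<subseteq> F" using G by blast
 note q = quad_mono[OF _ sub]
 have iff2: "p ## r ## K \<in> G \<longleftrightarrow> p ## r ## K \<in> F"
  if "quad G K a b u v" "{p, r} \<subseteq> {a, b, u, v}" for K a b u v p r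
  using G that unfolding quad_def by auto
 \<comment> \<open>The closure axiom has negative hypotheses, which must be lifted from the minor to
   \<open>F\<close>: a contracted z lies in \<open>K\<close>, and a deleted z lies in none of the
   sets concerned.\<close>
 have K3: "(\<forall>B. K \<subseteq> B --> (B \<in> F \<longleftrightarrow> B \<in> G)) \<or> (\<forall>B. B \<subseteq> s ## t ## K \<union> {a, b, u, v} --> (B \<in> F \<longleftrightarrow> B \<in> G))"
  if "quad G (s ## K) a b u v" "quad G (t ## K) a b u v" "s \<noteq> t" "s \<notin> K" "t \<notin> K" for s t K a b u v
  using G
 proof
  assume G: "G = {B \<in> F. z \<in> B}"
  have "z \<in> s ## K" "z \<in> t ## K" using that(1,2) unfolding G quad_def by auto
  then have "z \<in> K" using that(3-5) by auto
  then show ?thesis unfolding G by blast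
 next
  assume G: "G = {B \<in> F. z \<notin> B}"
  have "z \<notin> s ## t ## K \<union> {a, b, u, v}" using that(1,2) unfolding G quad_def by auto
  then show ?thesis unfolding G by blast
 qed
 show ?thesis
 proof (rule cross_systemI)
  fix K a b u v assume h: "quad G K a b u v"
  show "c K a b v u \<simeq> - c K a b u v" "c K b a v u \<simeq> c K a b u v" "c K u v a b \<simeq> c K a b u v"
   using cross_system_perm[OF c q[OF h]] by blast+
  show "c K a b u v \<simeq> 0" if "a ## b ## K \<notin> G \<or> u ## v ## K \<notin> G"
   using that cross_system_degenerate[OF c q[OF h]] iff2[OF h, of a b] iff2[OF h, of u v] by blast
  show "c K a b u v + c K a u v b + c K a v b u \<simeq> eps" if "a ## b ## K \<in> G" "u ## v ## K \<in> G"
   using that cross_system_cyclic[OF c q[OF h]] sub by blast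
 next
  fix K a b u v z' assume "quad G K a b u v" "quad G K a b v z'" "quad G K a b z' u"
  then show "c K a b u v + c K a b v z' + c K a b z' u \<simeq> 0" using cross_system_rank2[OF c] q by blast
 next
  fix K a b u v z' assume "quad G (z' ## K) a b u v" "quad G (u ## K) a b v z'" "quad G (v ## K) a b z' u"
  then show "c (z' ## K) a b u v + c (u ## K) a b v z' + c (v ## K) a b z' u \<simeq> 0"
   by (intro cross_system_rank3[OF c] q)
 next
  fix K s t a b u v
  assume st: "s \<noteq> t" "s \<notin> K" "t \<notin> K" and qs: "quad G (s ## K) a b u v" "quad G (t ## K) a b u v"
   and n: "\<And>z. z \<in> {a, b, u, v} ==> z ## s ## t ## K \<notin> G" "\<And>z. z \<in> {a, b, u, v} ==> {a, b, u, v} - {z} \<union> K \<notin> G"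
  have "z' ## s ## t ## K \<in> F \<longleftrightarrow> z' ## s ## t ## K \<in> G"
   "{a, b, u, v} - {z'} \<union> K \<in> F \<longleftrightarrow> {a, b, u, v} - {z'} \<union> K \<in> G" if z': "z' \<in> {a, b, u, v}" for z'
  proof -
   have s1: "K \<subseteq> z' ## s ## t ## K" "z' ## s ## t ## K \<subseteq> s ## t ## K \<union> {a, b, u, v}"
    "K \<subseteq> {a, b, u, v} - {z'} \<union> K" "{a, b, u, v} - {z'} \<union> K \<subseteq> s ## t ## K \<union> {a, b, u, v}"
    by (use z' in simp_all, blast+)
   show "z' ## s ## t ## K \<in> F \<longleftrightarrow> z' ## s ## t ## K \<in> G"
    using K3[OF qs st] s1(1,2) by metis
   show "{a, b, u, v} - {z'} \<union> K \<in> F \<longleftrightarrow> {a, b, u, v} - {z'} \<union> K \<in> G"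
    using K3[OF qs st] s1(3,4) by metis
  qed
  then show "c (s ## K) a b u v \<simeq> c (t ## K) a b u v"
   by (intro cross_system_axioms_closure[OF c st q[OF qs(1)] q[OF qs(2)]]) (use n in blast)+
 next
  fix K p assume p: "fano_pattern G K p"
  show "eps \<in> R" by (rule cross_system_fano(1)[OF c fano_pattern_minor[OF p G]])
 next
  fix K p assume p: "fano_pattern (dual_family E G) K p"
  have G': "dual_family E G = {B \<in> dual_family E F. z \<in> B} \<or> dual_family E G = {B \<in> dual_family E F. z \<notin> B}"
   using G dual_family_delete[OF F] by blast
  show "eps \<in> R" by (rule cross_system_fano(2)[OF c fano_pattern_minor[OF p G']])
 qed
qed

definition cross_dual :: "('a set => 'a => 'a => 'a => 'a => 'g) => 'a set => 'a => 'a => 'a => 'a => 'g" where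
 "cross_dual c K a b u v = c (E - K - {a, b, u, v}) a b u v"

text \<open>Complementation interchanges the chain relation in rank 2 with the rank 3 relation, the
  two families of nonbases in the closure axiom, and the two kinds of Fano patterns.\<close>

lemma cross_system_dual:
 assumes c: "cross_system F c" and F: "F \<subseteq> Pow E"
 shows "cross_system (dual_family E F) (cross_dual c)"
proof -
 note q = quad_dual[OF F]
 have mem: "p ## r ## K \<in> dual_family E F \<longleftrightarrow> x ## (y ## (E - K - {p, r, x, y})) \<in> F"
  if "distinct [p, r, x, y]" "{p, r, x, y} \<subseteq> E" "{p, r, x, y} \<inter> K = {}" "K \<subseteq> E" for p r x y K
 proof -
  have "E - p ## r ## K = x ## (y ## (E - K - {p, r, x, y}))" using that by auto
  then show ?thesis using that dual_family_iff[OF F, of "p ## r ## K"] by auto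
 qed
 show ?thesis
 proof (rule cross_systemI)
  fix K a b u v assume h: "quad (dual_family E F) K a b u v"
  let ?K = "E - K - {a, b, u, v}"
  have hq: "quad F ?K a b u v" and d: "distinct [a, b, u, v]" and K: "K \<subseteq> E" "{a, b, u, v} \<subseteq> E" "{a, b, u, v} \<inter> K = {}"
   using h unfolding q by (auto simp: quad_def)
  have eqs: "{a, b, v, u} = {a, b, u, v}" "{b, a, v, u} = {a, b, u, v}" "{u, v, a, b} = {a, b, u, v}"
   "{a, u, v, b} = {a, b, u, v}" "{a, v, b, u} = {a, b, u, v}" by auto
  show "cross_dual c K a b v u \<simeq> - cross_dual c K a b u v" "cross_dual c K b a v u \<simeq> cross_dual c K a b u v"
   "cross_dual c K u v a b \<simeq> cross_dual c K a b u v"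
   using cross_system_perm[OF c hq] unfolding cross_dual_def eqs by blast+
  have m: "a ## b ## K \<in> dual_family E F \<longleftrightarrow> u ## v ## ?K \<in> F"
   "u ## v ## K \<in> dual_family E F \<longleftrightarrow> a ## b ## ?K \<in> F"
   using mem[of a b u v K] mem[of u v a b K] d K unfolding eqs by auto
  show "cross_dual c K a b u v \<simeq> 0" if "a ## b ## K \<notin> dual_family E F \<or> u ## v ## K \<notin> dual_family E F"
   using that cross_system_degenerate[OF c hq] unfolding m cross_dual_def by blast
  show "cross_dual c K a b u v + cross_dual c K a u v b + cross_dual c K a v b u \<simeq> eps"
   if "a ## b ## K \<in> dual_family E F" "u ## v ## K \<in> dual_family E F"
   using that cross_system_cyclic[OF c hq] unfolding m cross_dual_def eqs by blast
 next
  fix K a b u v z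
  assume h: "quad (dual_family E F) K a b u v" "quad (dual_family E F) K a b v z" "quad (dual_family E F) K a b z u"
  define L where "L = E - K - {a, b, u, v, z}"
  have d: "distinct [a, b, u, v, z]" "{a, b, u, v, z} \<subseteq> E" "{a, b, u, v, z} \<inter> K = {}" using h unfolding q by (auto simp: quad_def)
  then have eqs: "E - K - {a, b, u, v} = z ## L" "E - K - {a, b, v, z} = u ## L" "E - K - {a, b, z, u} = v ## L"
   by (auto simp: L_def)
  show "cross_dual c K a b u v + cross_dual c K a b v z + cross_dual c K a b z u \<simeq> 0"
   unfolding cross_dual_def eqs
   by (rule cross_system_rank3[OF c]) (use h in \<open>simp_all only: q eqs\<close>)
 next
  fix K a b u v z
  assume h: "quad (dual_family E F) (z ## K) a b u v" "quad (dual_family E F) (u ## K) a b v z"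
   "quad (dual_family E F) (v ## K) a b z u"
  define L where "L = E - K - {a, b, u, v, z}"
  have eqs: "E - z ## K - {a, b, u, v} = L" "E - u ## K - {a, b, v, z} = L" "E - v ## K - {a, b, z, u} = L"
   by (auto simp: L_def)
  show "cross_dual c (z ## K) a b u v + cross_dual c (u ## K) a b v z + cross_dual c (v ## K) a b z u \<simeq> 0"
   unfolding cross_dual_def eqs
   by (rule cross_system_rank2[OF c]) (use h in \<open>simp_all only: q eqs\<close>)
 next
  fix K s t a b u v
  assume st: "s \<noteq> t" "s \<notin> K" "t \<notin> K" and qs: "quad (dual_family E F) (s ## K) a b u v" "quad (dual_family E F) (t ## K) a b u v"
   and n: "\<And>z. z \<in> {a, b, u, v} ==> z ## s ## t ## K \<notin> dual_family E F"
    "\<And>z. z \<in> {a, b, u, v} ==> {a, b, u, v} - {z} \<union> K \<notin> dual_family E F"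
  define L where "L = E - K - {a, b, u, v, s, t}"
  have d: "distinct [a, b, u, v, s, t]" "{a, b, u, v, s, t} \<subseteq> E" "{a, b, u, v, s, t} \<inter> K = {}" "K \<subseteq> E"
   using qs st unfolding q by (auto simp: quad_def)
  have eqs: "E - s ## K - {a, b, u, v} = t ## L" "E - t ## K - {a, b, u, v} = s ## L"
   using d by (auto simp: L_def)
  have "c (t ## L) a b u v \<simeq> c (s ## L) a b u v"
  proof (rule cross_system_axioms_closure[OF c])
   show "quad F (t ## L) a b u v" "quad F (s ## L) a b u v" using qs by (simp_all only: q eqs)
   show "z ## t ## s ## L \<notin> F" if "z \<in> {a, b, u, v}" for z
   proof -
    have "E - ({a, b, u, v} - {z} \<union> K) = z ## t ## s ## L"
     using d that by (auto simp: L_def)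
    then show ?thesis using n(2)[OF that] dual_family_iff[OF F, of "{a, b, u, v} - {z} \<union> K"] d by auto
   qed
   show "{a, b, u, v} - {z} \<union> L \<notin> F" if "z \<in> {a, b, u, v}" for z
   proof -
    have "E - z ## s ## t ## K = {a, b, u, v} - {z} \<union> L"
     using d that by (auto simp: L_def)
    moreover have "z ## s ## t ## K \<subseteq> E" using d that by auto
    ultimately show ?thesis using n(1)[OF that] dual_family_iff[OF F] by metis
   qed
  qed (use d in \<open>auto simp: L_def\<close>)
  then show "cross_dual c (s ## K) a b u v \<simeq> cross_dual c (t ## K) a b u v"
   unfolding cross_dual_def eqs .
 next
  show "eps \<in> R" if "fano_pattern (dual_family E F) K p" for K p
   using cross_system_fano(2)[OF c that] .
  show "eps \<in> R" if "fano_pattern (dual_family E (dual_family E F)) K p" for K p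
   using cross_system_fano(1)[OF c] that unfolding dual_dual_family[OF F] .
 qed
qed

lemma potential_dual:
 assumes F: "F \<subseteq> Pow E" and D: "potential (dual_family E F) (cross_dual c) D"
 shows "potential F c (\<lambda>B. D (E - B))"
 unfolding potential_def
proof (intro allI impI)
 fix K a b u v assume h: "quad F K a b u v"
 let ?K = "E - K - {a, b, u, v}"
 have K: "K \<subseteq> E" "{a, b, u, v} \<subseteq> E" "distinct [a, b, u, v]" "{a, b, u, v} \<inter> K = {}"
  using h F by (auto simp: quad_def)
 then have eq: "E - ?K - {a, b, u, v} = K" by auto
 have "quad (dual_family E F) ?K a b u v" unfolding quad_dual[OF F] eq using h K by auto
 then have "delta D ?K a b u v \<simeq> cross_dual c ?K a b u v" using D by (simp add: potential_def)
 moreover have "cross_dual c ?K a b u v = c K a b u v" unfolding cross_dual_def eq ..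
 moreover have "E - a ## u ## K = b ## v ## ?K" "E - a ## v ## K = b ## u ## ?K"
  "E - b ## u ## K = a ## v ## ?K" "E - b ## v ## K = a ## u ## ?K"
  using K by auto
 then have "delta (\<lambda>B. D (E - B)) K a b u v = delta D ?K a b u v"
  by (simp add: delta_def algebra_simps)
 ultimately show "delta (\<lambda>B. D (E - B)) K a b u v \<simeq> c K a b u v" by simp
qed

end

section \<open>Fundamental graphs and existence of potentials\<close>

abbreviation active :: "'a set set => 'a set" where
 "active F \<equiv> \<Union>F - \<Inter>F"

definition fund_edges :: "'a set set => 'a set => 'a rel" where
 "fund_edges F B = {(u, v). adj F B u v \<or> adj F B v u}"

lemma sym_fund_edges: "sym (fund_edges F B)"
 by (auto simp: sym_def fund_edges_def)

lemma adj_active: "B \<in> F ==> adj F B u v ==> u \<in> active F \<and> v \<in> active F"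
 unfolding adj_def by blast

lemma fund_edges_active: "B \<in> F ==> fund_edges F B \<subseteq> active F \<times> active F"
proof (rule subrelI)
 fix u v assume "B \<in> F" "(u, v) \<in> fund_edges F B"
 then show "(u, v) \<in> active F \<times> active F"
  using adj_active[of B F u v] adj_active[of B F v u] unfolding fund_edges_def mem_Collect_eq prod.case mem_Sigma_iff by argo
qed

lemma adj_inverse:
 assumes "adj F B r c" "B \<in> F"
 shows "adj F (c ## (B - {r})) c r" "r ## (c ## (B - {r}) - {c}) = B"
proof -
 have "r \<in> B" "c \<notin> B" using assms by (auto simp: adj_def)
 then show "r ## (c ## (B - {r}) - {c}) = B" by auto
 then show "adj F (c ## (B - {r})) c r" using \<open>r \<in> B\<close> \<open>c \<notin> B\<close> assms(2) by (auto simp: adj_def)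
qed

text \<open>An entry (k, l) created by the pivot comes with the old path k, c, r, l, so the new
  edges stay inside the old components.\<close>

lemma fund_edges_pivot_subset:
 assumes F: "basis_family F" "B \<in> F" and rc: "adj F B r c"
 shows "fund_edges F (c ## (B - {r})) \<subseteq> (fund_edges F B)\<^sup>*"
proof -
 let ?B = "c ## (B - {r})" and ?E = "fund_edges F B"
 have rcB: "r \<in> B" "c \<notin> B" using rc by (auto simp: adj_def)
 have edge: "(k, l) \<in> ?E" "(l, k) \<in> ?E" if "adj F B k l" for k l
  using that by (auto simp: fund_edges_def)
 have "(k, l) \<in> ?E\<^sup>*" if kl: "adj F ?B k l" for k l
 proof -
  have k: "k = c \<or> k \<in> B \<and> k \<noteq> r" "l \<notin> ?B" "l ## (?B - {k}) \<in> F" using kl by (auto simp: adj_def)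
  consider "k = c" "l = r" | "k = c" "l \<noteq> r" | "k \<noteq> c" "l = r" | "k \<noteq> c" "l \<noteq> r" by blast
  then show ?thesis
  proof cases
   case 1
   then show ?thesis using edge[OF rc] by blast
  next
   case 2
   then have "l ## (B - {r}) \<in> F" "l \<notin> B" using k(2,3) rcB by auto
   then have "adj F B r l" using rcB by (simp add: adj_def)
   from rtrancl_into_rtrancl[OF r_into_rtrancl[OF edge(2)[OF rc]] edge(1)[OF this]]
   show ?thesis using 2 by simp
  next
   case 3
   then have "r ## (?B - {k}) = c ## (B - {k})" "k \<in> B" using k(1) rcB by auto
   then have "adj F B k c" using k(3) 3 rcB by (simp add: adj_def)
   from rtrancl_into_rtrancl[OF r_into_rtrancl[OF edge(1)[OF this]] edge(2)[OF rc]]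
   show ?thesis using 3 by simp
  next
   case 4
   then have kl': "k \<in> B" "k \<noteq> r" "l \<notin> B" "l \<noteq> c" using k by auto
   show ?thesis
   proof (cases "adj F B k l")
    case True
    then show ?thesis using edge(1) by blast
   next
    case False
    then have "adj F B k c" "adj F B r l"
     using adj_pivot(1,2)[OF F rc kl'] kl by blast+
    from rtrancl_into_rtrancl[OF rtrancl_into_rtrancl[OF r_into_rtrancl[OF edge(1)[OF this(1)]]
       edge(2)[OF rc]] edge(1)[OF this(2)]]
    show ?thesis .
   qed
  qed
 qed
 moreover have "sym (?E\<^sup>*)" by (rule sym_rtrancl[OF sym_fund_edges])
 ultimately show ?thesis by (auto simp: fund_edges_def[of F ?B] dest: symD)
qed

lemma fund_edges_rtrancl_eq:
 assumes "basis_family F" "B \<in> F" "T \<in> F"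
 shows "(fund_edges F T)\<^sup>* = (fund_edges F B)\<^sup>*"
 using assms
proof (induction rule: basis_family_induct)
 case (step B' i j)
 have a: "adj F B' i j" using step.hyps by (simp add: adj_def)
 note inv = adj_inverse[OF a step.hyps(1)]
 have "(fund_edges F (j ## (B' - {i})))\<^sup>* \<subseteq> (fund_edges F B')\<^sup>*"
  using rtrancl_subset_rtrancl[OF fund_edges_pivot_subset[OF assms(1) step.hyps(1) a]] .
 moreover have "(fund_edges F B')\<^sup>* \<subseteq> (fund_edges F (j ## (B' - {i})))\<^sup>*"
  using rtrancl_subset_rtrancl[OF fund_edges_pivot_subset[OF assms(1) step.hyps(4) inv(1)]] inv(2) by simp
 ultimately show ?case using step.IH by simp
qed simp

lemma row_rel_of_fund_edges:
 assumes "(u, v) \<in> (fund_edges F B)\<^sup>*" "u \<in> B"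
 shows "if v \<in> B then (u, v) \<in> (row_rel F B)\<^sup>* else \<exists>r. adj F B r v \<and> (u, r) \<in> (row_rel F B)\<^sup>*"
 using assms(1)
proof (induction rule: rtrancl_induct)
 case base
 then show ?case using assms(2) by simp
next
 case (step y z)
 show ?case
 proof (cases "y \<in> B")
  case True
  then have "adj F B y z" "z \<notin> B" using step(2) by (auto simp: fund_edges_def adj_def)
  then show ?thesis using step(3) True by auto
 next
  case False
  then have z: "adj F B z y" "z \<in> B" using step(2) by (auto simp: fund_edges_def adj_def)
  obtain r where r: "adj F B r y" "(u, r) \<in> (row_rel F B)\<^sup>*" using step(3) False by auto
  then have "(r, z) \<in> row_rel F B" using z by (auto simp: row_rel_def)
  then show ?thesis using r z by (auto intro: rtrancl_into_rtrancl)
 qed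
qed

section \<open>Vertex pairs with connected complement\<close>

lemma crossing_edge:
 assumes "(u, v) \<in> E\<^sup>*" "u \<in> S" "v \<notin> S"
 shows "\<exists>p\<in>S. \<exists>q. q \<notin> S \<and> (p, q) \<in> E"
 using assms(1,3)
proof (induction rule: rtrancl_induct)
 case (step y z)
 then show ?case by (cases "y \<in> S") auto
qed (use assms(2) in simp)

text \<open>A connected inner part \<open>S\<close> with three pendant vertices \<open>U\<close>
  grows until it exhausts the graph: a new neighbour of \<open>S\<close> joins \<open>S\<close>, and
  a new neighbour of a pendant vertex takes its place while the latter moves into
  \<open>S\<close>.\<close>

lemma three_leaves:
 fixes E :: "'a rel"
 assumes V: "finite V" "E \<subseteq> V \<times> V" and conn: "\<And>u v. u \<in> V ==> v \<in> V ==> (u, v) \<in> E\<^sup>*"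
  and S: "S \<union> U \<subseteq> V" "S \<inter> U = {}" "card U = 3" "r \<in> S"
  and S_conn: "\<And>s. s \<in> S ==> (r, s) \<in> (Restr E S)\<^sup>*" and leaf: "\<And>u. u \<in> U ==> \<exists>s\<in>S. (s, u) \<in> E"
 shows "\<exists>S U. S \<union> U = V \<and> S \<inter> U = {} \<and> card U = 3 \<and> r \<in> S \<and> (\<forall>s\<in>S. (r, s) \<in> (Restr E S)\<^sup>*) \<and>
  (\<forall>u\<in>U. \<exists>s\<in>S. (s, u) \<in> E)"
 using S S_conn leaf
proof (induction "card (V - (S \<union> U))" arbitrary: S U rule: less_induct)
 case less
 show ?case
 proof (cases "S \<union> U = V")
  case True
  show ?thesis
   by (intro exI[of _ S] exI[of _ U] conjI ballI True less.prems)
 next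
  case False
  then obtain v where "v \<in> V" "v \<notin> S \<union> U" using less.prems(1) by blast
  then obtain p q where pq: "p \<in> S \<union> U" "q \<notin> S \<union> U" "(p, q) \<in> E"
   using crossing_edge[OF conn, of r v "S \<union> U"] less.prems(1,4) by blast
  have q: "q \<in> V" using pq(3) V(2) by blast
  have smaller: "card (V - (S \<union> U \<union> {q})) < card (V - (S \<union> U))"
   using q pq(2) V(1) by (intro psubset_card_mono) auto
  have grow: "(r, s) \<in> (Restr E (t ## S))\<^sup>*" if st: "s \<in> t ## S" "\<exists>s\<in>S. (s, t) \<in> E" for s t
  proof -
   have sub: "(Restr E S)\<^sup>* \<subseteq> (Restr E (t ## S))\<^sup>*" by (rule rtrancl_mono) blast
   show ?thesis
   proof (cases "s \<in> S")
    case True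
    then show ?thesis using less.prems(5) sub by blast
   next
    case False
    then have "s = t" using st(1) by blast
    obtain s' where s': "s' \<in> S" "(s', t) \<in> E" using st(2) by blast
    then have "(r, s') \<in> (Restr E (t ## S))\<^sup>*" "(s', t) \<in> Restr E (t ## S)"
     using less.prems(5) sub by blast+
    then show ?thesis using \<open>s = t\<close> by (meson rtrancl.rtrancl_into_rtrancl)
   qed
  qed
  show ?thesis
  proof (cases "p \<in> S")
   case True
   show ?thesis
   proof (rule less.hyps[of "q ## S" U])
    show "card (V - (q ## S \<union> U)) < card (V - (S \<union> U))" using smaller by (simp add: Un_commute)
    show "(r, s) \<in> (Restr E (q ## S))\<^sup>*" if "s \<in> q ## S" for s
     using grow[OF that] True pq(3) by blast
   qed (use less.prems pq q in auto)
  next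
   case False
   then have pU: "p \<in> U" using pq by blast
   have fU: "finite U" using less.prems(3) card.infinite by fastforce
   show ?thesis
   proof (rule less.hyps[of "p ## S" "q ## (U - {p})"])
    have "p ## S \<union> q ## (U - {p}) = S \<union> U \<union> {q}" using pU by auto
    then show "card (V - (p ## S \<union> q ## (U - {p}))) < card (V - (S \<union> U))" using smaller by simp
    show "(r, s) \<in> (Restr E (p ## S))\<^sup>*" if "s \<in> p ## S" for s
     using grow[OF that] less.prems(6)[OF pU] by blast
    show "card (q ## (U - {p})) = 3" using less.prems(3) pU pq(2) fU by simp
    show "\<exists>s\<in>p ## S. (s, u) \<in> E" if "u \<in> q ## (U - {p})" for u
     using that pq(3) less.prems(6) by blast
   qed (use less.prems pq q pU in auto)
  qed
 qed
qed

text \<open>Two of the three pendant vertices lie on the same side of \<open>B\<close>, and removing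
  pendant vertices keeps the inner part connected.\<close>

lemma connected_complement_pair:
 fixes E :: "'a rel"
 assumes V: "finite V" "E \<subseteq> V \<times> V" "sym E" and conn: "\<And>u v. u \<in> V ==> v \<in> V ==> (u, v) \<in> E\<^sup>*"
  and deg: "(r, n1) \<in> E" "(r, n2) \<in> E" "(r, n3) \<in> E" "distinct [r, n1, n2, n3]"
 obtains x y where "x \<in> V" "y \<in> V" "x \<noteq> y" "x \<in> B \<longleftrightarrow> y \<in> B"
  "\<And>u v. u \<in> V - {x, y} ==> v \<in> V - {x, y} ==> (u, v) \<in> (Restr E (V - {x, y}))\<^sup>*"
proof -
 have "\<exists>S U. S \<union> U = V \<and> S \<inter> U = {} \<and> card U = 3 \<and> r \<in> S \<and> (\<forall>s\<in>S. (r, s) \<in> (Restr E S)\<^sup>*) \<and>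
  (\<forall>u\<in>U. \<exists>s\<in>S. (s, u) \<in> E)"
  by (rule three_leaves[OF V(1,2) conn, of "{r}" "{n1, n2, n3}"]) (use deg V(2) in auto)
 then obtain S U where SU: "S \<union> U = V" "S \<inter> U = {}" "card U = 3" "r \<in> S"
  "\<And>s. s \<in> S ==> (r, s) \<in> (Restr E S)\<^sup>*" "\<And>u. u \<in> U ==> \<exists>s\<in>S. (s, u) \<in> E" by metis
 obtain a b d where U: "U = {a, b, d}" "a \<noteq> b" "b \<noteq> d" "a \<noteq> d"
  using SU(3) by (auto simp: card_3_iff)
 obtain x y where xy: "x \<in> U" "y \<in> U" "x \<noteq> y" "x \<in> B \<longleftrightarrow> y \<in> B"
  unfolding U(1) using U(2-4) by (metis insertCI)
 let ?W = "V - {x, y}"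
 have to: "(r, s) \<in> (Restr E ?W)\<^sup>*" if s: "s \<in> ?W" for s
 proof -
  have "S \<subseteq> ?W" using SU(1,2) xy by blast
  then have sub: "(Restr E S)\<^sup>* \<subseteq> (Restr E ?W)\<^sup>*" by (intro rtrancl_mono) blast
  show ?thesis
  proof (cases "s \<in> S")
   case True
   then show ?thesis using SU(5) sub by blast
  next
   case False
   then obtain t where t: "t \<in> S" "(t, s) \<in> E" using s SU(1,6) by blast
   then have "(r, t) \<in> (Restr E ?W)\<^sup>*" "(t, s) \<in> Restr E ?W" using SU(5) sub \<open>S \<subseteq> ?W\<close> s by blast+
   then show ?thesis by (meson rtrancl.rtrancl_into_rtrancl)
  qed
 qed
 have "sym (Restr E ?W)" using V(3) by (auto simp: sym_def)
 then have "sym ((Restr E ?W)\<^sup>*)" by (rule sym_rtrancl)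
 then have "(u, v) \<in> (Restr E ?W)\<^sup>*" if "u \<in> ?W" "v \<in> ?W" for u v
  using to[OF that(1)] to[OF that(2)] by (meson symD rtrancl_trans)
 then show ?thesis using that[of x y] xy SU(1) by blast
qed

text \<open>A path with fewer than five vertices is left by some edge. This edge extends the path at
  an end or branches off at an inner vertex.\<close>

lemma star_or_path:
 fixes E :: "'a rel"
 assumes V: "card V \<ge> 5" "E \<subseteq> V \<times> V" "sym E" "irrefl E" and conn: "\<And>u v. u \<in> V ==> v \<in> V ==> (u, v) \<in> E\<^sup>*"
 obtains r n1 n2 n3 where "(r, n1) \<in> E" "(r, n2) \<in> E" "(r, n3) \<in> E" "distinct [r, n1, n2, n3]"
 | v0 v1 v2 v3 v4 where "(v0, v1) \<in> E" "(v1, v2) \<in> E" "(v2, v3) \<in> E" "(v3, v4) \<in> E" "distinct [v0, v1, v2, v3, v4]"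
proof -
 have s: "(v, u) \<in> E" "u \<noteq> v" "u \<in> V" "v \<in> V" if "(u, v) \<in> E" for u v
  using that V by (auto dest: symD simp: irrefl_def)
 have cross: "\<exists>p q. p \<in> set S \<and> q \<notin> set S \<and> (p, q) \<in> E" if S: "set S \<subseteq> V" "S \<noteq> []" "length S < 5" for S
 proof -
  have "card (set S) < card V" using card_length[of S] S(3) V(1) by linarith
  then have "set S \<noteq> V" by auto
  then obtain v where "v \<in> V" "v \<notin> set S" using S(1) by blast
  then show ?thesis
   using crossing_edge[OF conn, of "hd S" v "set S"] hd_in_set[OF S(2)] S(1) by blast
 qed
 note star = that(1) and path = that(2)
 have "V \<noteq> {}" using V(1) by auto
 then obtain a where a: "a \<in> V" by blast
 obtain b where b: "(a, b) \<in> E" using cross[of "[a]"] a by auto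
 obtain p q where pq: "p = a \<or> p = b" "q \<noteq> a" "q \<noteq> b" "(p, q) \<in> E" using cross[of "[a, b]"] s[OF b] by auto
 have "\<exists>a b d. (a, b) \<in> E \<and> (b, d) \<in> E \<and> a \<noteq> d"
  using pq(1)
 proof
  assume "p = a" then show ?thesis using pq s[OF b] by blast
 next
  assume "p = b" then show ?thesis using pq b by blast
 qed
 then obtain a b d where P3: "(a, b) \<in> E" "(b, d) \<in> E" "a \<noteq> d" by blast
 note ab = s[OF P3(1)] and bd = s[OF P3(2)]
 obtain p q where pq: "p \<in> {a, b, d}" "q \<notin> {a, b, d}" "(p, q) \<in> E" using cross[of "[a, b, d]"] ab bd by auto
 show thesis
 proof (cases "p = b")
  case True
  then show ?thesis using star[of b a d q] pq P3 ab bd by auto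
 next
  case False
  have "\<exists>v0 v1 v2 v3. (v0, v1) \<in> E \<and> (v1, v2) \<in> E \<and> (v2, v3) \<in> E \<and> distinct [v0, v1, v2, v3]"
  proof (cases "p = a")
   case True
   then have "(q, a) \<in> E" "distinct [q, a, b, d]" using s[OF pq(3)] pq ab bd P3 by auto
   then show ?thesis using P3 by blast
  next
   case pa: False
   then have "(d, q) \<in> E" "distinct [a, b, d, q]" using False pq ab bd P3 by auto
   then show ?thesis using P3 by blast
  qed
  then obtain v0 v1 v2 v3 where P4: "(v0, v1) \<in> E" "(v1, v2) \<in> E" "(v2, v3) \<in> E" "distinct [v0, v1, v2, v3]" by blast
  obtain p q where pq: "p \<in> {v0, v1, v2, v3}" "q \<notin> {v0, v1, v2, v3}" "(p, q) \<in> E"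
   using cross[of "[v0, v1, v2, v3]"] s[OF P4(1)] s[OF P4(3)] by auto
  consider "p = v0" | "p = v1" | "p = v2" | "p = v3" using pq(1) by blast
  then show thesis
  proof cases
   case 1
   then show ?thesis using path[of q v0 v1 v2 v3] pq P4 s[OF pq(3)] by auto
  next
   case 2
   then show ?thesis using star[of v1 v0 v2 q] pq P4 s[OF P4(1)] by auto
  next
   case 3
   then show ?thesis using star[of v2 v1 v3 q] pq P4 s[OF P4(2)] by auto
  next
   case 4
   then show ?thesis using path[of v0 v1 v2 v3 q] pq P4 by auto
  qed
 qed
qed

text \<open>Pivoting on the second edge of a path with five vertices creates a vertex of degree three.\<close>

lemma exists_degree_three:
 assumes F: "basis_family F" "B0 \<in> F" "card (active F) \<ge> 5"
  and conn: "\<And>u v. u \<in> active F ==> v \<in> active F ==> (u, v) \<in> (fund_edges F B0)\<^sup>*"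
 obtains B r n1 n2 n3 where "B \<in> F" "(r, n1) \<in> fund_edges F B" "(r, n2) \<in> fund_edges F B"
  "(r, n3) \<in> fund_edges F B" "distinct [r, n1, n2, n3]"
proof -
 let ?E = "fund_edges F B0"
 have irr: "irrefl ?E" by (auto simp: irrefl_def fund_edges_def adj_def)
 show thesis
 proof (rule star_or_path[OF F(3) fund_edges_active[OF F(2)] sym_fund_edges irr conn])
  fix v0 v1 v2 v3 v4
  assume p: "(v0, v1) \<in> ?E" "(v1, v2) \<in> ?E" "(v2, v3) \<in> ?E" "(v3, v4) \<in> ?E" "distinct [v0, v1, v2, v3, v4]"
  have swap: "(u, v) \<in> ?E ==> (v, u) \<in> ?E" for u v by (auto simp: fund_edges_def)
  \<comment> \<open>An edge v0 v3 or v1 v4 gives v3 or v1 three neighbours at once. Without these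
    edges the pivot on v1 v2 creates the edge v0 v3, keeps v3 v4 and turns v2 v3 into v1 v3.\<close>
  show thesis
  proof (cases "(v0, v3) \<in> ?E \<or> (v1, v4) \<in> ?E")
   case True
   then show thesis
   proof
    assume "(v0, v3) \<in> ?E"
    then show thesis using that[OF F(2), of v3 v0 v2 v4] p swap by auto
   next
    assume "(v1, v4) \<in> ?E"
    then show thesis using that[OF F(2), of v1 v0 v2 v4] p swap by auto
   qed
  next
   case False
   show thesis
   proof (cases "v1 \<in> B0")
    case True
    have e: "adj F B0 v1 v0" "adj F B0 v1 v2" "adj F B0 v3 v2" "adj F B0 v3 v4"
     using p True by (auto simp: fund_edges_def adj_def)
    have n: "\<not> adj F B0 v3 v0" "\<not> adj F B0 v1 v4" using False by (auto simp: fund_edges_def)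
    have m: "v3 \<in> B0" "v0 \<notin> B0" "v4 \<notin> B0" "v1 \<in> B0" "v2 \<notin> B0" using e by (auto simp: adj_def)
    let ?B = "v2 ## (B0 - {v1})"
    have "?B \<in> F" using e(2) by (simp add: adj_def)
    moreover have "adj F ?B v3 v0" using adj_pivot(3)[OF F(1,2) e(2), of v3 v0] e n m p(5) by auto
    moreover have "adj F ?B v3 v4" using adj_pivot(2)[OF F(1,2) e(2), of v3 v4] e n m p(5) by auto
    moreover have "adj F ?B v3 v1"
    proof -
     have "v1 ## (?B - {v3}) = v2 ## (B0 - {v3})" using m p(5) by auto
     then show ?thesis using e(3) m p(5) by (auto simp: adj_def)
    qed
    ultimately show ?thesis using that[of ?B v3 v0 v4 v1] p(5) by (auto simp: fund_edges_def)
   next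
    case v1: False
    have e: "adj F B0 v0 v1" "adj F B0 v2 v1" "adj F B0 v2 v3" "adj F B0 v4 v3"
     using p v1 by (auto simp: fund_edges_def adj_def)
    have n: "\<not> adj F B0 v0 v3" "\<not> adj F B0 v4 v1" using False by (auto simp: fund_edges_def)
    have m: "v3 \<notin> B0" "v0 \<in> B0" "v4 \<in> B0" "v1 \<notin> B0" "v2 \<in> B0" using e by (auto simp: adj_def)
    let ?B = "v1 ## (B0 - {v2})"
    have "?B \<in> F" using e(2) by (simp add: adj_def)
    moreover have "adj F ?B v0 v3" using adj_pivot(3)[OF F(1,2) e(2), of v0 v3] e n m p(5) by auto
    moreover have "adj F ?B v4 v3" using adj_pivot(1)[OF F(1,2) e(2), of v4 v3] e n m p(5) by auto
    moreover have "adj F ?B v1 v3"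
    proof -
     have "v3 ## (?B - {v1}) = v3 ## (B0 - {v2})" using m p(5) by auto
     then show ?thesis using e(3) m p(5) by (auto simp: adj_def)
    qed
    ultimately show ?thesis using that[of ?B v3 v0 v4 v1] p(5) by (auto simp: fund_edges_def)
   qed
  qed
 qed (assumption | rule that[OF F(2)])+
qed

section \<open>Separated families and their potentials\<close>

definition separates :: "'a set set => 'a set => bool" where
 "separates F Z \<longleftrightarrow> (\<forall>B\<in>F. \<forall>r c. adj F B r c --> (r \<in> Z \<longleftrightarrow> c \<in> Z))"

lemma separatesD: "separates F Z ==> B \<in> F ==> adj F B r c ==> r \<in> Z \<longleftrightarrow> c \<in> Z"
 unfolding separates_def by blast

lemma separates_uminus: "separates F Z ==> separates F (- Z)"
 unfolding separates_def by simp

lemma separates_exchange: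
 assumes "separates F Z" "i ## I \<in> F" "j ## I \<in> F" "i \<notin> I" "j \<notin> I"
 shows "i \<in> Z \<longleftrightarrow> j \<in> Z"
proof (cases "i = j")
 case False
 then have "adj F (i ## I) i j" using assms by (simp add: adj_def)
 then show ?thesis using separatesD[OF assms(1,2)] by blast
qed simp

lemma separates_quad:
 assumes "separates F Z" "quad F K a b u v"
 shows "a \<in> Z \<longleftrightarrow> b \<in> Z" "u \<in> Z \<longleftrightarrow> v \<in> Z"
 using separates_exchange[OF assms(1), of a "u ## K" b] separates_exchange[OF assms(1), of u "a ## K" v]
  assms(2) by (auto simp: quad_def insert_commute)

text \<open>Exchanges do not cross \<open>Z\<close>, so the part of a basis inside \<open>Z\<close>
  can be moved towards \<open>T\<close> without touching the part outside.\<close>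

lemma separates_mix:
 assumes F: "basis_family F" "separates F Z" and B: "B \<in> F" "T \<in> F"
 shows "(B - Z) \<union> (T \<inter> Z) \<in> F"
 using F(1) B
proof (induction rule: basis_family_induct)
 case base
 then show ?case using B(1) by (simp add: Un_Diff_Int)
next
 case (step T i j)
 have ij: "i \<in> Z \<longleftrightarrow> j \<in> Z" using separatesD[OF F(2) step.hyps(1), of i j] step.hyps by (simp add: adj_def)
 let ?T = "j ## (T - {i})"
 show ?case
 proof (cases "i \<in> Z")
  case False
  then have "?T \<inter> Z = T \<inter> Z" using ij by auto
  then show ?thesis using step.IH by simp
 next
  case True
  let ?C = "(B - Z) \<union> (T \<inter> Z)"
  have "i \<in> ?C" "i \<notin> ?T" using True step.hyps by auto
  then obtain k where k: "k \<in> ?T" "k \<notin> ?C" "k ## (?C - {i}) \<in> F"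
   using basis_family_exchange(1)[OF F(1) step.IH step.hyps(4)] by meson
  have "i \<in> Z \<longleftrightarrow> k \<in> Z"
   using separatesD[OF F(2) step.IH, of i k] k(2,3) \<open>i \<in> ?C\<close> unfolding adj_def by blast
  then have "k = j" using k(1,2) True by blast
  moreover have "j ## (?C - {i}) = (B - Z) \<union> (?T \<inter> Z)" using True ij step.hyps by auto
  ultimately show ?thesis using k(3) by simp
 qed
qed

context signed_group
begin

text \<open>An exchange of i for j inside \<open>Z\<close> changes only the contracted set. If some
  z among the four elements together with i and j extended the rest to a basis, j could be exchanged
  with an element outside \<open>Z\<close>; hence i and j are parallel over each of the four and
  \<open>cross_system_closure\<close> applies.\<close>

lemma cross_system_separated:
 assumes F: "basis_family F" "cross_system F c" "separates F Z"
  and q: "quad F K a b u v" "a \<notin> Z" "u \<notin> Z" and T: "T \<in> F"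
 shows "quad F ((K - Z) \<union> (T \<inter> Z)) a b u v \<and> c ((K - Z) \<union> (T \<inter> Z)) a b u v \<simeq> c K a b u v"
proof -
 have out: "b \<notin> Z" "v \<notin> Z" using separates_quad[OF F(3) q(1)] q(2,3) by blast+
 have qu: "quad F ((K - Z) \<union> (T \<inter> Z)) a b u v" if "T \<in> F" for T
 proof -
  have "p ## (r ## ((K - Z) \<union> (T \<inter> Z))) \<in> F"
   if "p ## r ## K \<in> F" "p \<notin> Z" "r \<notin> Z" for p r
  proof -
   have "(p ## r ## K - Z) \<union> (T \<inter> Z) = p ## (r ## ((K - Z) \<union> (T \<inter> Z)))" using that by auto
   then show ?thesis using separates_mix[OF F(1,3) that(1) \<open>T \<in> F\<close>] by simp
  qed
  then show ?thesis using q out unfolding quad_def by auto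
 qed
 have aub: "a ## u ## K \<in> F" "a \<notin> K" "u \<notin> K" using q(1) by (auto simp: quad_def)
 have "c ((K - Z) \<union> (T \<inter> Z)) a b u v \<simeq> c K a b u v"
  using F(1) aub(1) T
 proof (induction rule: basis_family_induct)
  case base
  have "a ## u ## K \<inter> Z = K \<inter> Z" using q by auto
  then show ?case by (simp add: Un_Diff_Int)
 next
  case (step T i j)
  have ij: "i \<in> Z \<longleftrightarrow> j \<in> Z" using separatesD[OF F(3) step.hyps(1), of i j] step.hyps by (simp add: adj_def)
  let ?T = "j ## (T - {i})"
  show ?case
  proof (cases "i \<in> Z")
   case False
   then have "?T \<inter> Z = T \<inter> Z" using ij by auto
   then show ?thesis using step.IH by simp
  next
   case True
   define L where "L = (K - Z) \<union> (T \<inter> Z) - {i}"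
   have eq: "(K - Z) \<union> (T \<inter> Z) = i ## L" "(K - Z) \<union> (?T \<inter> Z) = j ## L"
    using True ij step.hyps unfolding L_def by auto
   have L: "j \<noteq> i" "j \<notin> L" "i \<notin> L" using True ij step.hyps unfolding L_def by auto
   note q1 = qu[OF step.hyps(1), unfolded eq] and q2 = qu[OF step.hyps(4), unfolded eq]
   have "z ## j ## i ## L \<notin> F" if z: "z \<in> {a, b, u, v}" for z
   proof
    assume h: "z ## j ## i ## L \<in> F"
    obtain y where y: "y ## z ## i ## L \<in> F" "y \<notin> Z" "y \<notin> z ## i ## L"
    proof (cases "z \<in> {a, b}")
     case True
     then show thesis using that[of u] q1 q(3) unfolding quad_def by (auto simp: insert_commute)
    next
     case False
     then show thesis using that[of a] z q1 q(2) unfolding quad_def by (auto simp: insert_commute)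
    qed
    have "y \<in> Z \<longleftrightarrow> j \<in> Z"
    proof (rule separates_exchange[OF F(3) y(1)])
     show "j ## z ## i ## L \<in> F" using h by (simp add: insert_commute)
     show "j \<notin> z ## i ## L" using L z q2 by (auto simp: quad_def)
    qed (use y in simp)
    then show False using y(2) True ij by blast
   qed
   then have "c (j ## L) a b u v \<simeq> c (i ## L) a b u v"
    by (intro cross_system_closure[OF F(1,2) L q2 q1])
   then show ?thesis using step.IH cong_trans unfolding eq by blast
  qed
 qed
 then show ?thesis using qu[OF T] by blast
qed

lemma delta_separated:
 assumes fin: "finite K" and q: "quad F K a b u v" "a \<notin> Z" "b \<notin> Z" "u \<notin> Z" "v \<notin> Z"
 shows "delta (\<lambda>B. D1 ((B - Z) \<union> Y) + D2 (B \<inter> Z) + (\<Sum>p\<in>B - Z. h (B \<inter> Z) p)) K a b u v =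
  delta D1 ((K - Z) \<union> Y) a b u v"
proof -
 have 1: "p ## r ## K \<inter> Z = K \<inter> Z" "p ## r ## K - Z = p ## (r ## (K - Z))"
  if "p \<notin> Z" "r \<notin> Z" for p r
  using that by auto
 have 2: "(\<Sum>p\<in>p ## (r ## (K - Z)). h (K \<inter> Z) p) = h (K \<inter> Z) p + (h (K \<inter> Z) r + (\<Sum>p\<in>K - Z. h (K \<inter> Z) p))"
  if "p \<notin> K" "r \<notin> K" "p \<noteq> r" for p r
  using fin that by simp
 have d: "a \<notin> K" "b \<notin> K" "u \<notin> K" "v \<notin> K" "a \<noteq> u" "a \<noteq> v" "b \<noteq> u" "b \<noteq> v" using q by (auto simp: quad_def)
 show ?thesis
  unfolding delta_def 1[OF q(2,4)] 1[OF q(2,5)] 1[OF q(3,4)] 1[OF q(3,5)]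
   2[OF d(1,3,5)] 2[OF d(1,4,6)] 2[OF d(2,3,7)] 2[OF d(2,4,8)]
  by (simp add: algebra_simps)
qed

text \<open>As for a direct sum, the potentials of the two sides are added. The double sum is the
  sign of writing the elements outside \<open>Z\<close> before those inside; it makes the
  cross-ratios with one pair on each side trivial, as they must be because these are
  degenerate.\<close>

lemma potential_separated:
 assumes F: "basis_family F" "cross_system F c" "separates F Z" "B0 \<in> F"
  and D: "potential {B \<in> F. B \<inter> Z = B0 \<inter> Z} c D1" "potential {B \<in> F. B - Z = B0 - Z} c D2"
 shows "\<exists>D. potential F c D"
proof -
 define D where "D B = D1 ((B - Z) \<union> (B0 \<inter> Z)) + D2 ((B0 - Z) \<union> (B \<inter> Z)) + (\<Sum>p\<in>B - Z. \<Sum>q\<in>B \<inter> Z. w p q)" for B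
 have fin: "finite K" if "quad F K a b u v" for K a b u v
  using basis_family_finite[OF F(1), of "a ## u ## K"] that by (simp add: quad_def)
 have inner: "good c D K a b u v" if q: "quad F K a b u v" "a \<notin> Z" "u \<notin> Z" for K a b u v
 proof -
  have o: "b \<notin> Z" "v \<notin> Z" using separates_quad[OF F(3) q(1)] q(2,3) by blast+
  note s = cross_system_separated[OF F(1-3) q F(4)]
  have "quad {B \<in> F. B \<inter> Z = B0 \<inter> Z} ((K - Z) \<union> (B0 \<inter> Z)) a b u v"
   using conjunct1[OF s] q(2,3) o unfolding quad_def by auto
  then have 1: "delta D1 ((K - Z) \<union> (B0 \<inter> Z)) a b u v \<simeq> c ((K - Z) \<union> (B0 \<inter> Z)) a b u v"
   using D(1) unfolding potential_def by blast
  have 2: "delta D K a b u v = delta D1 ((K - Z) \<union> (B0 \<inter> Z)) a b u v"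
   unfolding D_def by (rule delta_separated[OF fin[OF q(1)] q(1,2) o(1) q(3) o(2), of D1 _ "\<lambda>B. D2 ((B0 - Z) \<union> B)" "\<lambda>B p. sum (w p) B"])
  show ?thesis unfolding 2 by (rule cong_trans[OF 1 conjunct2[OF s]])
 qed
 have outer: "good c D K a b u v" if q: "quad F K a b u v" "a \<in> Z" "u \<in> Z" for K a b u v
 proof -
  have o: "b \<in> Z" "v \<in> Z" using separates_quad[OF F(3) q(1)] q(2,3) by blast+
  have q': "a \<notin> - Z" "b \<notin> - Z" "u \<notin> - Z" "v \<notin> - Z" using q o by auto
  have co: "X - - Z = X \<inter> Z" "X \<inter> - Z = X - Z" for X by auto
  note s = cross_system_separated[OF F(1,2) separates_uminus[OF F(3)] q(1) q'(1,3) F(4), unfolded co]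
  have "quad {B \<in> F. B - Z = B0 - Z} ((K \<inter> Z) \<union> (B0 - Z)) a b u v"
   using conjunct1[OF s] q(2,3) o unfolding quad_def by auto
  then have 1: "delta D2 ((K \<inter> Z) \<union> (B0 - Z)) a b u v \<simeq> c ((K \<inter> Z) \<union> (B0 - Z)) a b u v"
   using D(2) unfolding potential_def by blast
  \<comment> \<open>The construction is symmetric under exchanging \<open>Z\<close> with its
    complement once the order of summation is changed.\<close>
  have D': "D = (\<lambda>B. D2 ((B \<inter> Z) \<union> (B0 - Z)) + D1 ((B - Z) \<union> (B0 \<inter> Z)) + (\<Sum>q\<in>B \<inter> Z. \<Sum>p\<in>B - Z. w p q))"
   unfolding D_def by (intro ext) (simp add: Un_commute sum.swap[of _ "_ \<inter> Z"] algebra_simps)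
  have 2: "delta D K a b u v = delta D2 ((K \<inter> Z) \<union> (B0 - Z)) a b u v"
   unfolding D'
   by (rule delta_separated[OF fin[OF q(1)] q(1) q', of D2 _ "\<lambda>B. D1 (B \<union> (B0 \<inter> Z))" "\<lambda>B q. \<Sum>p\<in>B. w p q", unfolded co])
  show ?thesis unfolding 2 by (rule cong_trans[OF 1 conjunct2[OF s]])
 qed
 have mixed: "good c D K a b u v" if q: "quad F K a b u v" "a \<in> Z" "u \<notin> Z" for K a b u v
 proof -
  have o: "b \<in> Z" "v \<notin> Z" using separates_quad[OF F(3) q(1)] q(2,3) by blast+
  have d: "distinct [a, b, u, v]" "a \<notin> K" "b \<notin> K" "u \<notin> K" "v \<notin> K" using q by (auto simp: quad_def)
  have "a ## b ## K \<notin> F"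
  proof
   assume "a ## b ## K \<in> F"
   then have "b \<in> Z \<longleftrightarrow> u \<in> Z"
    using separates_exchange[OF F(3), of b "a ## K" u] q(1) by (auto simp: quad_def insert_commute)
   then show False using o q by blast
  qed
  then have c0: "c K a b u v \<simeq> 0" using cross_system_degenerate[OF F(2) q(1)] by blast
  define S where "S p r = (\<Sum>q\<in>K \<inter> Z. w r q) + (\<Sum>q\<in>K - Z. w q p)" for p r
  have eq: "D (p ## r ## K) = D1 (r ## ((K - Z) \<union> (B0 \<inter> Z))) + D2 (p ## ((B0 - Z) \<union> (K \<inter> Z)))
    + w r p + (\<Sum>q\<in>K \<inter> Z. w r q) + (\<Sum>q\<in>K - Z. w q p) + (\<Sum>p\<in>K - Z. \<Sum>q\<in>K \<inter> Z. w p q)"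
   if "p \<in> Z" "r \<notin> Z" "p \<notin> K" "r \<notin> K" for p r
  proof -
   have 1: "p ## r ## K - Z = r ## (K - Z)" "p ## r ## K \<inter> Z = p ## (K \<inter> Z)"
    using that by auto
   show ?thesis unfolding D_def 1 using fin[OF q(1)] that by (simp add: sum.distrib algebra_simps)
  qed
  have "delta D K a b u v = (w u a + w a u) + (w v b + w b v) + ((w a v - w v a) + (w b u - w u b))"
   unfolding delta_def W_def eq[OF q(2,3) d(2,4)] eq[OF q(2) o(2) d(2,5)] eq[OF o(1) q(3) d(3,4)] eq[OF o d(3,5)]
   by (simp add: algebra_simps)
  moreover have "(w u a + w a u) + (w v b + w b v) + ((w a v - w v a) + (w b u - w u b)) \<simeq> eps + eps + (eps + eps)"
   by (intro cong_add w_flip w_swap) (use d in auto)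
  moreover have "eps + eps + (eps + eps) \<simeq> 0" unfolding cong_0 by (rule add_mem[OF eps_double eps_double])
  ultimately have "delta D K a b u v \<simeq> 0" using cong_trans by metis
  then show ?thesis using c0 cong_trans cong_sym by blast
 qed
 have "good c D K a b u v" if q: "quad F K a b u v" for K a b u v
 proof (cases "a \<in> Z"; cases "u \<in> Z")
  assume au: "a \<notin> Z" "u \<in> Z"
  have "good c D K u v a b" using mixed[of K u v a b] au q by (simp add: quad_perm(3))
  then show ?thesis using good_perm(3)[OF F(2) q] by blast
 qed (use inner outer mixed q in blast)+
 then show ?thesis unfolding potential_def by blast
qed

text \<open>All cross-ratios use the same four elements over the same \<open>K\<close>. On the six
  pairs \<open>D\<close> is zero except at a, u and a, b, whose values solve the equations for two
  of the three basic cross-ratios; the cyclic relation gives the third.\<close>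

lemma potential_small:
 assumes F: "basis_family F" "cross_system F c" and small: "card (active F) \<le> 4"
 shows "\<exists>D. potential F c D"
proof (cases "\<exists>K a b u v. quad F K a b u v")
 case False
 then show ?thesis unfolding potential_def by blast
next
 case True
 then obtain K a b u v where q: "quad F K a b u v" by blast
 have fin: "finite (active F)" using F(1) by (simp add: basis_family_def)
 have act: "active F = {a, b, u, v} \<and> \<Inter>F = K" if "quad F K a b u v" for K a b u v
 proof -
  have d: "distinct [a, b, u, v]" "{a, b, u, v} \<inter> K = {}" using that by (auto simp: quad_def)
  have mem: "p \<in> active F" if "B \<in> F" "B' \<in> F" "p \<in> B" "p \<notin> B'" for p B B' using that by blast
  have Bs: "a ## u ## K \<in> F" "b ## v ## K \<in> F" using that by (auto simp: quad_def)
  have sub: "{a, b, u, v} \<subseteq> active F"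
   using mem[OF Bs, of a] mem[OF Bs, of u] mem[OF Bs(2,1), of b] mem[OF Bs(2,1), of v] d by auto
  moreover have "card {a, b, u, v} = 4" using d by simp
  ultimately have act: "active F = {a, b, u, v}" using card_seteq[OF fin sub] small by simp
  moreover have "\<Inter>F \<subseteq> K" using act d(2) that unfolding quad_def by auto
  moreover have "K \<subseteq> \<Inter>F"
  proof
   fix k assume "k \<in> K"
   then have "k \<in> \<Union>F" "k \<notin> active F" using that act d(2) unfolding quad_def by auto
   then show "k \<in> \<Inter>F" by blast
  qed
  ultimately show ?thesis by blast
 qed
 define \<alpha> where "\<alpha> = c K a b u v - W a b u v"
 define D where "D B = (if B = a ## u ## K then \<alpha> else
  if B = a ## b ## K then c K a v b u + \<alpha> - W a v b u else 0)" for B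
 have d: "distinct [a, b, u, v]" "{a, b, u, v} \<inter> K = {}" using q by (auto simp: quad_def)
 have ne: "p ## X \<noteq> Y" if "p \<notin> Y" for p :: 'a and X Y using that by auto
 have D1: "D (a ## u ## K) = \<alpha>" by (simp add: D_def)
 have D2: "D (a ## b ## K) = c K a v b u + \<alpha> - W a v b u"
  using ne[of u "a ## K" "a ## b ## K"] d by (auto simp: D_def insert_commute)
 have D0: "D (p ## r ## K) = 0" if "p \<in> {u, v, b}" "r = v" for p r
  using that d unfolding D_def by (auto simp: insert_eq_iff)
 have D3: "D (b ## u ## K) = 0" "D (a ## v ## K) = 0" "D (v ## u ## K) = 0"
  using d unfolding D_def by (auto simp: insert_eq_iff)
 have g1: "good c D K a b u v" unfolding delta_def D1 D3 D0[of b v, simplified] by (simp add: \<alpha>_def)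
 have g2: "good c D K a v b u"
  unfolding delta_def D2 D3 D1 insert_commute[of v b K] D0[of b v, simplified] by (simp add: algebra_simps)
 have g3: "good c D K a q r s" if h: "quad F K a q r s" "{q, r, s} = {b, u, v}" for q r s
 proof -
  have d': "distinct [q, r, s]" using h by (auto simp: quad_def)
  have qrs: "q \<in> {b, u, v}" "r \<in> {b, u, v}" "s \<in> {b, u, v}" using h(2) by blast+
  have g4: "good c D K a u v b" if "quad F K a u v b"
   by (rule good_cyclic[OF F(2) q _ _ g1 g2]) (use that in \<open>simp_all add: quad_def\<close>)
  have g5: "good c D K a u b v" if "quad F K a u b v"
  proof -
   have q': "quad F K a u v b" using that by (simp add: quad_perm(1))
   show ?thesis using good_perm(1)[OF F(2) q'] g4[OF q'] by blast
  qed
  have g6: "good c D K a v u b" if "quad F K a v u b"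
  proof -
   have q': "quad F K a v b u" using that by (simp add: quad_perm(1))
   show ?thesis using good_perm(1)[OF F(2) q'] g2 by blast
  qed
  have g7: "good c D K a b v u" using good_perm(1)[OF F(2) q] g1 by blast
  from qrs d' consider "q = b" "r = u" "s = v" | "q = b" "r = v" "s = u" | "q = u" "r = b" "s = v" | "q = u" "r = v" "s = b"
   | "q = v" "r = b" "s = u" | "q = v" "r = u" "s = b"
   by (elim insertE emptyE) simp_all
  then show ?thesis
   by cases (use h(1) g1 g2 g4 g5 g6 g7 in \<open>simp_all only:\<close>)
 qed
 have "good c D L p q r s" if h: "quad F L p q r s" for L p q r s
 proof -
  have L: "L = K" "{p, q, r, s} = {a, b, u, v}" using act[OF h] act[OF q] by auto
  have d': "distinct [p, q, r, s]" using h by (auto simp: quad_def)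
  have h1: "quad F K q p s r" "quad F K r s p q" "quad F K s r q p" using h unfolding L(1) quad_def by (auto simp: insert_commute)
  have three: "{y, z, t} = {b, u, v}" if "{a, y, z, t} = {a, b, u, v}" "distinct [a, y, z, t]" for y z t
   using that d(1) by auto
  have "a \<in> {p, q, r, s}" using L by auto
  then consider "p = a" | "q = a" | "r = a" | "s = a" by blast
  then show ?thesis unfolding L(1)
  proof cases
   case 1
   then show "good c D K p q r s" using g3[of q r s] three[of q r s] h d' L by simp
  next
   case 2
   then have "good c D K q p s r" using g3[of p s r] three[of p s r] h1 d' L(2) by (auto simp: insert_commute)
   then show "good c D K p q r s" using good_perm(2)[OF F(2), of K p q r s] h L by simp
  next
   case 3
   then have "good c D K r s p q" using g3[of s p q] three[of s p q] h1 d' L(2) by (auto simp: insert_commute)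
   then show "good c D K p q r s" using good_perm(3)[OF F(2), of K p q r s] h L by simp
  next
   case 4
   then have "good c D K s r q p" using g3[of r q p] three[of r q p] h1 d' L(2) by (auto simp: insert_commute)
   then have "good c D K r s p q" using good_perm(2)[OF F(2), of K r s p q] h1(2) by simp
   then show "good c D K p q r s" using good_perm(3)[OF F(2), of K p q r s] h L by simp
  qed
 qed
 then show ?thesis unfolding potential_def by blast
qed

end

lemma finite_active: "basis_family F ==> finite (active F)"
 by (simp add: basis_family_def)

lemma active_minor:
 assumes F: "basis_family F" "z \<in> active F" and G: "G = {B \<in> F. z \<in> B} \<or> G = {B \<in> F. z \<notin> B}"
 shows "basis_family G" "active G \<subseteq> active F - {z}" "card (active G) < card (active F)"
proof -
 obtain B1 B2 where B: "B1 \<in> F" "z \<in> B1" "B2 \<in> F" "z \<notin> B2" using F(2) by blast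
 show "basis_family G"
  using G basis_family_contract[OF F(1) B(1,2)] basis_family_delete[OF F(1) B(3,4)] by auto
 show sub: "active G \<subseteq> active F - {z}" using G by blast
 then have "active G \<subset> active F" using F(2) by blast
 then show "card (active G) < card (active F)" by (rule psubset_card_mono[OF finite_active[OF F(1)]])
qed

lemma adj_avoid:
 assumes "B \<in> {B \<in> F. x \<notin> B \<and> y \<notin> B}"
 shows "adj {B \<in> F. x \<notin> B \<and> y \<notin> B} B r c \<longleftrightarrow> adj F B r c \<and> c \<noteq> x \<and> c \<noteq> y"
 using assms unfolding adj_def by auto

text \<open>Over a field the dual matrix is the negative transpose, so rows and columns change roles
  and the undirected graph is the same.\<close>

lemma fund_edges_dual:
 assumes "F \<subseteq> Pow E" "B \<in> F"
 shows "fund_edges (dual_family E F) (E - B) = fund_edges F B"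
proof -
 have "adj (dual_family E F) (E - B) u v \<longleftrightarrow> adj F B v u" for u v
 proof (cases "u \<in> E - B \<and> v \<in> B")
  case True
  then have "E - v ## (E - B - {u}) = u ## (B - {v})" "v ## (E - B - {u}) \<subseteq> E" "v \<in> E"
   using assms by auto
  then show ?thesis using True dual_family_iff[OF assms(1), of "v ## (E - B - {u})"] by (simp add: adj_def)
 next
  case False
  then have "\<not> adj (dual_family E F) (E - B) u v"
   using dual_family_subset[of E F] by (auto simp: adj_def)
  moreover have "\<not> adj F B v u" using False assms by (auto simp: adj_def)
  ultimately show ?thesis by blast
 qed
 then show ?thesis unfolding fund_edges_def by blast
qed

lemma active_dual:
 assumes "F \<subseteq> Pow E" "F \<noteq> {}"
 shows "active (dual_family E F) = active F"
 using assms unfolding dual_family_def by auto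

context signed_group
begin

lemma potential_of_connected_pair:
 assumes F: "basis_family F" "cross_system F c" and B0: "B0 \<in> F" "x \<notin> B0" "y \<notin> B0"
  and xy: "x \<noteq> y" "x \<in> active F" "y \<in> active F" and big: "card (active F) \<ge> 4"
  and conn: "\<And>u v. u \<in> active F - {x, y} ==> v \<in> active F - {x, y} ==>
   (u, v) \<in> (Restr (fund_edges F B0) (active F - {x, y}))\<^sup>*"
  and IH: "\<And>z G. z \<in> active F ==> G = {B \<in> F. z \<in> B} \<or> G = {B \<in> F. z \<notin> B} ==> \<exists>D. potential G c D"
 shows "\<exists>D. potential F c D"
proof -
 let ?G = "{B \<in> F. x \<notin> B \<and> y \<notin> B}"
 have B0G: "B0 \<in> ?G" using B0 by simp
 have G: "basis_family ?G" using basis_family_avoid[OF F(1) B0(1), of "{x, y}"] B0 by simp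
 have sub: "Restr (fund_edges F B0) (active F - {x, y}) \<subseteq> fund_edges ?G B0"
  using B0 unfolding fund_edges_def adj_avoid[OF B0G] by blast
 have conn': "(u, v) \<in> (fund_edges ?G B)\<^sup>*" if uv: "u \<in> active F - {x, y}" "v \<in> active F - {x, y}" and B: "B \<in> ?G" for u v B
  using rtrancl_mono[OF sub] conn[OF uv] fund_edges_rtrancl_eq[OF G B0G B] by blast
 show ?thesis
 proof (rule pair_extension[OF F xy(1) _ _ B0])
  show "x \<in> \<Union>F" "y \<in> \<Union>F" using xy by blast+
  show "(u, v) \<in> (row_rel ?G B)\<^sup>*"
   if h: "B \<in> F" "x \<notin> B" "y \<notin> B" "u \<in> B - \<Inter>F" "v \<in> B - \<Inter>F" for B u v
  proof -
   have "B \<in> ?G" "u \<in> active F - {x, y}" "v \<in> active F - {x, y}" using h by auto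
   from row_rel_of_fund_edges[OF conn'[OF this(2,3,1)]] h show ?thesis by simp
  qed
  show "(\<exists>B\<in>F. x \<notin> B \<and> y \<notin> B \<and> v \<in> B) \<and> (\<exists>B\<in>F. x \<notin> B \<and> y \<notin> B \<and> v \<notin> B)"
   if h: "v \<in> \<Union>F - \<Inter>F - {x, y}" for v
  proof -
   \<comment> \<open>With four active elements a vertex v' besides x, y, v exists. Connectedness
     then gives v a neighbour, so v stays active after x and y are deleted.\<close>
   have "card {x, y, v} < card (active F)" using big card_insert_le_m1[of 3 "{y, v}" x] by (simp add: card_insert_if)
   then have "\<not> active F \<subseteq> {x, y, v}" using card_mono[of "{x, y, v}" "active F"] by fastforce
   then obtain v' where v': "v' \<in> active F - {x, y}" "v' \<noteq> v" by blast
   have "(v, v') \<in> (fund_edges ?G B0)\<^sup>*" using conn'[OF h v'(1) B0G] .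
   then obtain u where "(v, u) \<in> fund_edges ?G B0" using v'(2) by (auto elim: converse_rtranclE)
   then have "(v, u) \<in> active ?G \<times> active ?G" using fund_edges_active[OF B0G] by blast
   then show ?thesis by blast
  qed
  show "(\<exists>D. potential {B \<in> F. z \<in> B} c D) \<and> (\<exists>D. potential {B \<in> F. z \<notin> B} c D)"
   if "z \<in> \<Union>F - \<Inter>F" for z
   using IH[OF that] by blast
 qed
qed

theorem potential_exists:
 assumes "basis_family F" "F \<subseteq> Pow E" "cross_system F c"
 shows "\<exists>D. potential F c D"
 using assms
proof (induction "card (active F)" arbitrary: F c rule: less_induct)
 case less
 note F = less.prems
 \<comment> \<open>Stated for every family with the same active elements, so that it also serves the
   dual family.\<close>
 have minor: "\<exists>D. potential G c' D"
  if F': "basis_family F'" "F' \<subseteq> Pow E" "cross_system F' c'" "active F' = active F"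
   and z: "z \<in> active F'" "G = {B \<in> F'. z \<in> B} \<or> G = {B \<in> F'. z \<notin> B}" for F' G z c'
 proof (rule less.hyps)
  show "card (active G) < card (active F)" using active_minor(3)[OF F'(1) z] F'(4) by simp
  show "basis_family G" by (rule active_minor(1)[OF F'(1) z])
  show "G \<subseteq> Pow E" using z(2) F'(2) by blast
  have "z \<in> E" using z(1) F'(2) by blast
  then show "cross_system G c'" by (rule cross_system_minor[OF F'(3,2) _ z(2)])
 qed
 obtain B0 where B0: "B0 \<in> F" using F(1) by (auto simp: basis_family_def)
 show ?case
 proof (cases "\<forall>u\<in>active F. \<forall>v\<in>active F. (u, v) \<in> (fund_edges F B0)\<^sup>*")
  case False
  then obtain u v where uv: "u \<in> active F" "v \<in> active F" "(u, v) \<notin> (fund_edges F B0)\<^sup>*" by blast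
  \<comment> \<open>A component of the fundamental graph; components do not depend on the basis, so
    \<open>Z\<close> separates \<open>F\<close>.\<close>
  define Z where "Z = {x. (u, x) \<in> (fund_edges F B0)\<^sup>*}"
  have "separates F Z"
   unfolding separates_def
  proof (intro ballI allI impI)
   fix B r k assume h: "B \<in> F" "adj F B r k"
   then have "(r, k) \<in> (fund_edges F B0)\<^sup>*" "(k, r) \<in> (fund_edges F B0)\<^sup>*"
    using fund_edges_rtrancl_eq[OF F(1) B0 h(1)] by (auto simp: fund_edges_def)
   then show "r \<in> Z \<longleftrightarrow> k \<in> Z" unfolding Z_def by (auto intro: rtrancl_trans)
  qed
  moreover have "u \<in> Z" "v \<notin> Z" using uv by (auto simp: Z_def)
  \<comment> \<open>Bases that agree with B0 on \<open>Z\<close> agree at u, so they lie in one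
    deletion or contraction at u, which has fewer active elements.\<close>
  moreover have "\<exists>D. potential {B \<in> F. B \<inter> Z = B0 \<inter> Z} c D"
  proof -
   obtain D where "potential (if u \<in> B0 then {B \<in> F. u \<in> B} else {B \<in> F. u \<notin> B}) c D"
    using minor[OF F refl uv(1)] by presburger
   then have "potential {B \<in> F. B \<inter> Z = B0 \<inter> Z} c D"
    by (rule potential_mono) (use \<open>u \<in> Z\<close> in auto)
   then show ?thesis by (rule exI[of _ D])
  qed
  moreover have "\<exists>D. potential {B \<in> F. B - Z = B0 - Z} c D"
  proof -
   obtain D where "potential (if v \<in> B0 then {B \<in> F. v \<in> B} else {B \<in> F. v \<notin> B}) c D"
    using minor[OF F refl uv(2)] by presburger
   then have "potential {B \<in> F. B - Z = B0 - Z} c D"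
    by (rule potential_mono) (use \<open>v \<notin> Z\<close> in auto)
   then show ?thesis by (rule exI[of _ D])
  qed
  ultimately show ?thesis using potential_separated[OF F(1,3) _ B0] by blast
 next
  case True
  show ?thesis
  proof (cases "card (active F) \<le> 4")
   case True
   then show ?thesis by (rule potential_small[OF F(1,3)])
  next
   case False
   then have big: "card (active F) \<ge> 5" by simp
   obtain B r n1 n2 n3 where B: "B \<in> F" "(r, n1) \<in> fund_edges F B" "(r, n2) \<in> fund_edges F B"
    "(r, n3) \<in> fund_edges F B" "distinct [r, n1, n2, n3]"
    by (rule exists_degree_three[OF F(1) B0 big]) (use True in blast)+
   have conn: "(u, v) \<in> (fund_edges F B)\<^sup>*" if "u \<in> active F" "v \<in> active F" for u v
    using True that fund_edges_rtrancl_eq[OF F(1) B0 B(1)] by blast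
   obtain x y where xy: "x \<in> active F" "y \<in> active F" "x \<noteq> y" "x \<in> B \<longleftrightarrow> y \<in> B"
    and comp: "\<And>u v. u \<in> active F - {x, y} ==> v \<in> active F - {x, y} ==>
     (u, v) \<in> (Restr (fund_edges F B) (active F - {x, y}))\<^sup>*"
    using connected_complement_pair[OF finite_active[OF F(1)] fund_edges_active[OF B(1)] sym_fund_edges conn B(2-5), of B]
    by metis
   show ?thesis
   proof (cases "x \<in> B")
    case False
    then show ?thesis
     using potential_of_connected_pair[OF F(1,3) B(1) _ _ xy(3,1,2) _ comp minor[OF F refl]] xy(4) big by simp
   next
    \<comment> \<open>Both elements lie in B and hence outside the basis \<open>E - B\<close> of the
      dual family, whose fundamental graph is the same.\<close>
    case True
    let ?F = "dual_family E F" and ?c = "cross_dual c"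
    have ne: "F \<noteq> {}" using B0 by blast
    note act = active_dual[OF F(2) ne] and ed = fund_edges_dual[OF F(2) B(1)]
    note F' = basis_family_dual[OF F(1,2) finite_E] dual_family_subset cross_system_dual[OF F(3,2)]
    have "E - B \<in> ?F" using B(1) by (simp add: dual_family_def)
    then have "\<exists>D. potential ?F ?c D"
     using potential_of_connected_pair[OF F'(1,3), of "E - B" x y, unfolded act ed] comp True xy big
      minor[OF F' act, unfolded act] by simp
    then show ?thesis using potential_dual[OF F(2)] by blast
   qed
  qed
 qed
qed

end

section \<open>Bases, hyperplanes and minors of matroids\<close>

definition bases :: "'a matroid => 'a set set" where
 "bases M = {B \<in> indep M. card B = rank_of M (ground M)}"

abbreviation cl :: "'a matroid => 'a set => 'a set" where
 "cl \<equiv> closure_of_set"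

context matroid
begin

lemma finite_indep: "I \<in> indep M ==> finite I"
 using indep_subset finite_ground finite_subset by blast

lemma finite_indep_below: "finite {I \<in> indep M. I \<subseteq> X}"
 by (rule finite_subset[of _ "Pow (ground M)"]) (use indep_subset finite_ground in auto)

lemma card_le_rank: "I \<in> indep M ==> I \<subseteq> X ==> card I \<le> rank_of M X"
 unfolding rank_of_def using finite_indep_below by (intro Max_ge) auto

lemma rank_witness: "\<exists>I\<in>indep M. I \<subseteq> X \<and> card I = rank_of M X"
proof -
 have "{} \<in> {I \<in> indep M. I \<subseteq> X}" using empty_indep by simp
 then have "card ` {I \<in> indep M. I \<subseteq> X} \<noteq> {}" by blast
 then have "rank_of M X \<in> card ` {I \<in> indep M. I \<subseteq> X}"
  unfolding rank_of_def by (intro Max_in finite_imageI finite_indep_below)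
 then show ?thesis by (elim imageE) (auto simp only: mem_Collect_eq)
qed

lemma rank_le:
 assumes "\<And>I. I \<in> indep M ==> I \<subseteq> X ==> card I \<le> n"
 shows "rank_of M X \<le> n"
proof -
 obtain I where "I \<in> indep M" "I \<subseteq> X" "card I = rank_of M X" using rank_witness by blast
 then show ?thesis using assms[of I] by simp
qed

lemma rank_mono: "X \<subseteq> Y ==> rank_of M X \<le> rank_of M Y"
 by (rule rank_le) (auto intro: card_le_rank)

lemma rank_indep: assumes "I \<in> indep M" shows "rank_of M I = card I"
proof (rule antisym)
 show "rank_of M I \<le> card I" by (rule rank_le) (use finite_indep[OF assms] card_mono in blast)
 show "card I \<le> rank_of M I" by (rule card_le_rank[OF assms order_refl])
qed

lemma extend_indep:
 assumes "I \<in> indep M" "I \<subseteq> X"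
 shows "\<exists>J\<in>indep M. I \<subseteq> J \<and> J \<subseteq> X \<and> card J = rank_of M X"
 using assms
proof (induction "rank_of M X - card I" arbitrary: I rule: less_induct)
 case less
 show ?case
 proof (cases "card I = rank_of M X")
  case False
  then have lt: "card I < rank_of M X" using card_le_rank[OF less.prems] by simp
  obtain J where J: "J \<in> indep M" "J \<subseteq> X" "card J = rank_of M X" using rank_witness by blast
  obtain e where e: "e \<in> J - I" "e ## I \<in> indep M" using augment[OF less.prems(1) J(1)] lt J(3) by auto
  have "rank_of M X - card (e ## I) < rank_of M X - card I"
   using e(1) lt finite_indep[OF less.prems(1)] by simp
  from less.hyps[OF this e(2)] show ?thesis using e(1) J(2) less.prems(2) by blast
 qed (use less.prems in blast)
qed

lemma closure_indep_iff:
 assumes I: "I \<in> indep M" and e: "e \<in> ground M"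
 shows "e \<in> cl M I \<longleftrightarrow> e \<in> I \<or> e ## I \<notin> indep M"
proof (cases "e \<in> I")
 case True
 then show ?thesis using e by (simp add: closure_of_set_def insert_absorb)
next
 case False
 have c: "card (e ## I) = Suc (card I)" using False finite_indep[OF I] by simp
 show ?thesis
 proof (cases "e ## I \<in> indep M")
  case True
  then show ?thesis using rank_indep[OF I] rank_indep[OF True] c False by (simp add: closure_of_set_def)
 next
  case not: False
  have "rank_of M (e ## I) \<le> card I"
  proof (rule rank_le)
   fix J assume J: "J \<in> indep M" "J \<subseteq> e ## I"
   then have "J \<noteq> e ## I" using not by blast
   then have "card J < card (e ## I)"
    using J(2) finite_indep[OF I] by (intro psubset_card_mono) auto
   then show "card J \<le> card I" using c by simp
  qed
  moreover have "card I \<le> rank_of M (e ## I)" by (rule card_le_rank[OF I]) blast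
  ultimately show ?thesis using not e rank_indep[OF I] by (simp add: closure_of_set_def)
 qed
qed

lemma closure_subset_ground: "cl M X \<subseteq> ground M"
 by (auto simp: closure_of_set_def)

lemma closure_of_basis:
 assumes I: "I \<in> indep M" "I \<subseteq> X" "card I = rank_of M X"
 shows "cl M X = cl M I"
proof -
 have "rank_of M (e ## X) = rank_of M X \<longleftrightarrow> rank_of M (e ## I) = rank_of M I" for e
 proof
  assume h: "rank_of M (e ## X) = rank_of M X"
  have "rank_of M (e ## I) \<le> rank_of M (e ## X)" using I(2) by (intro rank_mono) blast
  moreover have "rank_of M I \<le> rank_of M (e ## I)" by (rule rank_mono) blast
  ultimately show "rank_of M (e ## I) = rank_of M I" using h I(3) rank_indep[OF I(1)] by simp
 next
  assume h: "rank_of M (e ## I) = rank_of M I"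
  have "rank_of M (e ## X) \<le> card I"
  proof (rule ccontr)
   assume "\<not> rank_of M (e ## X) \<le> card I"
   moreover obtain J where J: "J \<in> indep M" "J \<subseteq> e ## X" "card J = rank_of M (e ## X)"
    using rank_witness by blast
   ultimately obtain j where j: "j \<in> J - I" "j ## I \<in> indep M" using augment[OF I(1) J(1)] by auto
   have c: "card (j ## I) = Suc (card I)" using j finite_indep[OF I(1)] by simp
   show False
   proof (cases "j \<in> X")
    case True
    then show False using card_le_rank[OF j(2), of X] I c by simp
   next
    case False
    then have "j = e" using j J by blast
    then show False using h c rank_indep[OF j(2)] rank_indep[OF I(1)] by simp
   qed
  qed
  moreover have "rank_of M X \<le> rank_of M (e ## X)" by (rule rank_mono) blast
  ultimately show "rank_of M (e ## X) = rank_of M X" using I(3) by simp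
 qed
 then show ?thesis by (simp add: closure_of_set_def)
qed

lemma indep_subset_closure: "I \<in> indep M ==> I \<subseteq> cl M I"
 using closure_indep_iff indep_subset by blast

lemma rank_closure: assumes I: "I \<in> indep M" shows "rank_of M (cl M I) = card I"
proof (rule antisym)
 show "rank_of M (cl M I) \<le> card I"
 proof (rule rank_le, rule ccontr)
  fix J assume J: "J \<in> indep M" "J \<subseteq> cl M I" "\<not> card J \<le> card I"
  then obtain e where "e \<in> J - I" "e ## I \<in> indep M" using augment[OF I J(1)] by auto
  then show False using closure_indep_iff[OF I, of e] J indep_subset[OF J(1)] by blast
 qed
 show "card I \<le> rank_of M (cl M I)" by (rule card_le_rank[OF I indep_subset_closure[OF I]])
qed

lemma flat_closure: "I \<in> indep M ==> flat M (cl M I)"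
 unfolding flat_def using closure_of_basis[of I "cl M I"] rank_closure indep_subset_closure closure_subset_ground
 by simp

lemma flat_eq_closure: "flat M X ==> I \<in> indep M ==> I \<subseteq> X ==> card I = rank_of M X ==> X = cl M I"
 using closure_of_basis unfolding flat_def by metis

lemma closure_eqI:
 assumes "I \<in> indep M" "J \<in> indep M" "J \<subseteq> cl M I" "card J = card I"
 shows "cl M J = cl M I"
 using flat_eq_closure[OF flat_closure[OF assms(1)] assms(2,3)] rank_closure[OF assms(1)] assms(4) by simp

lemma closure_mono_indep:
 assumes "J \<in> indep M" "I \<subseteq> cl M J" "I \<in> indep M"
 shows "cl M I \<subseteq> cl M J"
proof
 fix e assume e: "e \<in> cl M I"
 obtain J' where J': "J' \<in> indep M" "I \<subseteq> J'" "J' \<subseteq> cl M J" "card J' = rank_of M (cl M J)"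
  using extend_indep[OF assms(3,2)] by blast
 have "cl M J' = cl M J" using closure_eqI[OF assms(1) J'(1,3)] J'(4) rank_closure[OF assms(1)] by simp
 moreover have "e \<in> ground M" using e closure_subset_ground by blast
 moreover have "e \<in> J' \<or> e ## J' \<notin> indep M"
  using e closure_indep_iff[OF assms(3) \<open>e \<in> ground M\<close>] J'(2) indep_mono[of "e ## J'" "e ## I"] by blast
 ultimately show "e \<in> cl M J" using closure_indep_iff[OF J'(1)] by blast
qed

lemma corank_flat_iff:
 "corank_flat M k X \<longleftrightarrow> (\<exists>I\<in>indep M. card I + k = rank_of M (ground M) \<and> X = cl M I)"
proof
 assume h: "corank_flat M k X"
 obtain I where I: "I \<in> indep M" "I \<subseteq> X" "card I = rank_of M X" using rank_witness by blast
 then have "card I + k = rank_of M (ground M) \<and> X = cl M I"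
  using h flat_eq_closure[of X I] unfolding corank_flat_def by simp
 then show "\<exists>I\<in>indep M. card I + k = rank_of M (ground M) \<and> X = cl M I" using I(1) by blast
next
 assume "\<exists>I\<in>indep M. card I + k = rank_of M (ground M) \<and> X = cl M I"
 then show "corank_flat M k X" unfolding corank_flat_def using flat_closure rank_closure by auto
qed

lemma corank_flat_basis:
 "corank_flat M k X ==> I \<in> indep M ==> I \<subseteq> X ==> card I + k = rank_of M (ground M) ==> X = cl M I"
 using flat_eq_closure unfolding corank_flat_def by auto

lemma bases_indep: "B \<in> bases M ==> B \<in> indep M"
 by (simp add: bases_def)

lemma bases_subset: "bases M \<subseteq> Pow (ground M)"
 using bases_indep indep_subset by blast

lemma hyperplanes_iff: "H \<in> hyperplanes M \<longleftrightarrow> (\<exists>I\<in>indep M. card I + 1 = rank_of M (ground M) \<and> H = cl M I)"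
 unfolding hyperplanes_def by (simp add: corank_flat_iff)

lemma closure_hyperplane:
 assumes "e ## I \<in> bases M" "e \<notin> I"
 shows "cl M I \<in> hyperplanes M" "I \<in> indep M" "card I + 1 = rank_of M (ground M)"
proof -
 show I: "I \<in> indep M" using indep_mono[OF bases_indep[OF assms(1)]] by blast
 show c: "card I + 1 = rank_of M (ground M)" using assms finite_indep[OF I] by (simp add: bases_def)
 show "cl M I \<in> hyperplanes M" using I c hyperplanes_iff by blast
qed

lemma notin_hyperplane_iff:
 assumes I: "I \<in> indep M" "card I + 1 = rank_of M (ground M)"
 shows "e \<in> ground M \<and> e \<notin> cl M I \<longleftrightarrow> e \<notin> I \<and> e ## I \<in> bases M"
proof -
 have "card (e ## I) = rank_of M (ground M)" if "e \<notin> I" using that I finite_indep[OF I(1)] by simp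
 then show ?thesis
  using closure_indep_iff[OF I(1), of e] indep_subset[of "e ## I"] by (auto simp: bases_def)
qed

lemma notin_closure:
 assumes "e ## I \<in> bases M" "e \<notin> I"
 shows "e \<notin> cl M I"
 using notin_hyperplane_iff[OF closure_hyperplane(2,3)[OF assms]] assms by blast

lemma closure_eq_of_dependent:
 assumes "a ## K \<in> indep M" "b ## K \<in> indep M" "a \<notin> K" "b \<notin> K" "a = b \<or> a ## b ## K \<notin> indep M"
 shows "cl M (a ## K) = cl M (b ## K)"
proof (rule closure_eqI[OF assms(2,1)])
 have "a \<in> ground M" using indep_subset[OF assms(1)] by blast
 then have "a \<in> cl M (b ## K)" using closure_indep_iff[OF assms(2), of a] assms(5) by auto
 then show "a ## K \<subseteq> cl M (b ## K)" using indep_subset_closure[OF assms(2)] by blast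
 show "card (a ## K) = card (b ## K)"
  using assms(3,4) finite_indep[OF assms(1)] by simp
qed

text \<open>If e were outside \<open>cl M K\<close>, augmentation would add a or u to
  \<open>e ## K\<close>, which contradicts that e lies in both closures.\<close>

lemma closure_Int:
 assumes "a ## u ## K \<in> indep M" "a \<noteq> u" "a \<notin> K" "u \<notin> K"
 shows "cl M (a ## K) \<inter> cl M (u ## K) = cl M K"
proof -
 have sub: "a ## K \<in> indep M" "u ## K \<in> indep M" "K \<in> indep M"
  using indep_mono[OF assms(1)] by blast+
 have "e \<in> cl M K" if e: "e \<in> cl M (a ## K)" "e \<in> cl M (u ## K)" for e
 proof (rule ccontr)
  assume n: "e \<notin> cl M K"
  have eg: "e \<in> ground M" using e closure_subset_ground by blast
  have eK: "e \<notin> K" "e ## K \<in> indep M" using n closure_indep_iff[OF sub(3) eg] by blast+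
  have "card (e ## K) < card (a ## u ## K)"
   using eK assms finite_indep[OF sub(3)] by simp
  then obtain z where z: "z \<in> a ## u ## K - e ## K" "z ## e ## K \<in> indep M"
   using augment[OF eK(2) assms(1)] by blast
  then have "z = a \<or> z = u" by blast
  then show False
  proof
   assume "z = a"
   then show False using z closure_indep_iff[OF sub(1) eg] e(1) eK(1) by (simp add: insert_commute)
  next
   assume "z = u"
   then show False using z closure_indep_iff[OF sub(2) eg] e(2) eK(1) by (simp add: insert_commute)
  qed
 qed
 moreover have "cl M K \<subseteq> cl M (a ## K)" "cl M K \<subseteq> cl M (u ## K)"
  using closure_mono_indep[OF sub(1) _ sub(3)] closure_mono_indep[OF sub(2) _ sub(3)]
   indep_subset_closure[OF sub(1)] indep_subset_closure[OF sub(2)] by blast+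
 ultimately show ?thesis by blast
qed

lemma basis_family_bases: "basis_family (bases M)"
proof -
 have "bases M \<noteq> {}" using rank_witness[of "ground M"] unfolding bases_def by blast
 moreover have "\<exists>j\<in>B' - B. j ## (B - {i}) \<in> bases M"
  if h: "B \<in> bases M" "B' \<in> bases M" "i \<in> B - B'" for B B' i
 proof -
  have f: "finite B" "i \<in> B" "B - {i} \<in> indep M"
   using h finite_indep[OF bases_indep[OF h(1)]] indep_mono[OF bases_indep[OF h(1)]] by blast+
  have "card (B - {i}) < card B'" using f h card_Suc_Diff1[OF f(1,2)] by (simp add: bases_def)
  then obtain j where j: "j \<in> B' - (B - {i})" "j ## (B - {i}) \<in> indep M"
   using augment[OF f(3) bases_indep[OF h(2)]] by blast
  then have "j \<in> B' - B" "card (j ## (B - {i})) = card B" using h f card_Suc_Diff1[OF f(1,2)] by auto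
  then show ?thesis using j h(1) by (auto simp: bases_def)
 qed
 moreover have "\<exists>i\<in>B - B'. j ## (B - {i}) \<in> bases M"
  if h: "B \<in> bases M" "B' \<in> bases M" "j \<in> B' - B" for B B' j
 proof -
  have B: "B \<in> indep M" "B' \<in> indep M" using h bases_indep by blast+
  have j: "j ## (B \<inter> B') \<in> indep M" by (rule indep_mono[OF B(2)]) (use h in blast)
  obtain J where J: "J \<in> indep M" "j ## (B \<inter> B') \<subseteq> J" "J \<subseteq> j ## B" "card J = rank_of M (j ## B)"
   using extend_indep[OF j, of "j ## B"] by blast
  have r: "rank_of M (j ## B) = card B"
  proof (rule antisym)
   have "rank_of M (j ## B) \<le> rank_of M (ground M)" using h indep_subset[OF B(1)] indep_subset[OF B(2)]
    by (intro rank_mono) blast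
   then show "rank_of M (j ## B) \<le> card B" using h by (simp add: bases_def)
   show "card B \<le> rank_of M (j ## B)" by (rule card_le_rank[OF B(1)]) blast
  qed
  have cj: "card (j ## B) = Suc (card B)" using h finite_indep[OF B(1)] by simp
  have "J \<noteq> j ## B" using cj J(4) r by auto
  then obtain i where i: "i \<in> j ## B" "i \<notin> J" using J(3) by blast
  then have iB: "i \<in> B - B'" using J(2) by blast
  have "J \<subseteq> j ## (B - {i})" using J(3) i by blast
  moreover have "card (j ## (B - {i})) = card J"
   using J(4) r h iB finite_indep[OF B(1)] card_Suc_Diff1[of B i] by simp
  ultimately have "J = j ## (B - {i})" using finite_indep[OF B(1)] by (intro card_seteq) auto
  then show ?thesis using iB J(1,4) r h(1) by (auto simp: bases_def)
 qed
 moreover have "finite (\<Union>(bases M))"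
  using bases_subset finite_ground by (meson Sup_le_iff PowD finite_subset subsetD)
 ultimately show ?thesis unfolding basis_family_def by blast
qed

section \<open>Bases and quadruples of hyperplanes\<close>

lemma quad_bases:
 assumes "quad (bases M) K a b u v"
 shows "a \<noteq> u" "a \<noteq> v" "b \<noteq> u" "b \<noteq> v" "a \<noteq> b" "u \<noteq> v" "a \<notin> K" "b \<notin> K" "u \<notin> K" "v \<notin> K"
  "a ## u ## K \<in> bases M" "a ## v ## K \<in> bases M"
  "b ## u ## K \<in> bases M" "b ## v ## K \<in> bases M"
  "{a, b, u, v} \<subseteq> ground M" "K \<in> indep M" "card K + 2 = rank_of M (ground M)"
  "a ## K \<in> indep M" "b ## K \<in> indep M" "u ## K \<in> indep M" "v ## K \<in> indep M"
proof -
 show d: "a \<noteq> u" "a \<noteq> v" "b \<noteq> u" "b \<noteq> v" "a \<noteq> b" "u \<noteq> v" "a \<notin> K" "b \<notin> K" "u \<notin> K" "v \<notin> K"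
  and B: "a ## u ## K \<in> bases M" "a ## v ## K \<in> bases M"
  "b ## u ## K \<in> bases M" "b ## v ## K \<in> bases M"
  using assms unfolding quad_def by auto
 then show "{a, b, u, v} \<subseteq> ground M" using bases_subset by blast
 show i: "a ## K \<in> indep M" "b ## K \<in> indep M" "u ## K \<in> indep M" "v ## K \<in> indep M" "K \<in> indep M"
  using indep_mono[OF bases_indep[OF B(1)]] indep_mono[OF bases_indep[OF B(4)]] by blast+
 show "card K + 2 = rank_of M (ground M)"
  using B(1) d finite_indep[OF i(5)] by (simp add: bases_def)
qed

lemma closure_Int_bases:
 assumes "a ## u ## K \<in> bases M" "a \<noteq> u" "a \<notin> K" "u \<notin> K"
 shows "cl M (a ## K) \<inter> cl M (u ## K) = cl M K"
 using closure_Int[OF bases_indep[OF assms(1)] assms(2-4)] .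

lemma closure_eq_iff_bases:
 assumes "quad (bases M) K a b u v"
 shows "cl M (a ## K) = cl M (b ## K) \<longleftrightarrow> a ## b ## K \<notin> bases M"
  and "cl M (u ## K) = cl M (v ## K) \<longleftrightarrow> u ## v ## K \<notin> bases M"
proof -
 note q = quad_bases[OF assms]
 have *: "cl M (p ## K) = cl M (r ## K) \<longleftrightarrow> p ## r ## K \<notin> bases M"
  if "p ## K \<in> indep M" "r ## K \<in> indep M" "p \<noteq> r" "p \<notin> K" "r \<notin> K" for p r
 proof
  assume h: "cl M (p ## K) = cl M (r ## K)"
  have "p \<in> cl M (p ## K)" using indep_subset_closure[OF that(1)] by blast
  then show "p ## r ## K \<notin> bases M" using notin_closure[of p "r ## K"] that h by auto
 next
  assume "p ## r ## K \<notin> bases M"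
  moreover have "card (p ## r ## K) = rank_of M (ground M)"
   using that q(17) finite_indep[OF q(16)] by simp
  ultimately have "p ## r ## K \<notin> indep M" by (simp add: bases_def)
  then show "cl M (p ## K) = cl M (r ## K)"
   using closure_eq_of_dependent[OF that(1,2,4,5)] by blast
 qed
 show "cl M (a ## K) = cl M (b ## K) \<longleftrightarrow> a ## b ## K \<notin> bases M"
  and "cl M (u ## K) = cl M (v ## K) \<longleftrightarrow> u ## v ## K \<notin> bases M"
  by (rule *[OF q(18,19,5,7,8)], rule *[OF q(20,21,6,9,10)])
qed

lemma quad_theta:
 assumes "quad (bases M) K a b u v"
 shows "(cl M (a ## K), cl M (b ## K), cl M (u ## K), cl M (v ## K)) \<in> theta M"
  and "cl M (a ## K) \<inter> cl M (b ## K) \<inter> cl M (u ## K) \<inter> cl M (v ## K) = cl M K"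
  and "a ## b ## K \<in> bases M \<and> u ## v ## K \<in> bases M \<longleftrightarrow>
   (cl M (a ## K), cl M (b ## K), cl M (u ## K), cl M (v ## K)) \<in> theta_nondeg M"
proof -
 note q = quad_bases[OF assms]
 note I = closure_Int_bases[OF q(11,1,7,9)] closure_Int_bases[OF q(12,2,7,10)]
  closure_Int_bases[OF q(13,3,8,9)] closure_Int_bases[OF q(14,4,8,10)]
 show all: "cl M (a ## K) \<inter> cl M (b ## K) \<inter> cl M (u ## K) \<inter> cl M (v ## K) = cl M K"
  using I by blast
 have hyp: "{cl M (a ## K), cl M (b ## K), cl M (u ## K), cl M (v ## K)} \<subseteq> hyperplanes M"
  using closure_hyperplane(1)[of u "a ## K"] closure_hyperplane(1)[of u "b ## K"]
   closure_hyperplane(1)[of a "u ## K"] closure_hyperplane(1)[of a "v ## K"] q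
  by (auto simp: insert_commute)
 have "corank_flat M 2 (cl M K)" using q(16,17) corank_flat_iff by blast
 then show th: "(cl M (a ## K), cl M (b ## K), cl M (u ## K), cl M (v ## K)) \<in> theta M"
  unfolding mem_theta all using hyp I by simp
 have *: "cl M (p ## K) \<inter> cl M (r ## K) = cl M K \<longleftrightarrow> p ## r ## K \<in> bases M"
  if "p \<noteq> r" "p \<notin> K" "r \<notin> K" "p ## K \<in> indep M" "r ## K \<in> indep M"
   and eq: "cl M (p ## K) = cl M (r ## K) \<longleftrightarrow> p ## r ## K \<notin> bases M" for p r
 proof
  assume h: "cl M (p ## K) \<inter> cl M (r ## K) = cl M K"
  have "p \<in> cl M (p ## K)" "p \<notin> cl M K"
   using indep_subset_closure[OF that(4)] closure_indep_iff[OF q(16), of p] that(2,4) closure_subset_ground[of "p ## K"]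
   by blast+
  then show "p ## r ## K \<in> bases M" using h eq by blast
 next
  assume "p ## r ## K \<in> bases M"
  then show "cl M (p ## K) \<inter> cl M (r ## K) = cl M K" using closure_Int_bases that by blast
 qed
 show "a ## b ## K \<in> bases M \<and> u ## v ## K \<in> bases M \<longleftrightarrow>
   (cl M (a ## K), cl M (b ## K), cl M (u ## K), cl M (v ## K)) \<in> theta_nondeg M"
  unfolding mem_theta_nondeg all
  using th *[of a b] *[of u v] closure_eq_iff_bases[OF assms] q by auto
qed

lemma rank_le_ground: "I \<in> indep M ==> card I \<le> rank_of M (ground M)"
 using card_le_rank indep_subset by blast

lemma extend_to_basis:
 assumes "I \<in> indep M" "I \<subseteq> X" "B \<in> bases M" "B \<subseteq> X"
 obtains B' where "B' \<in> bases M" "I \<subseteq> B'" "B' \<subseteq> X"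
proof -
 obtain J where J: "J \<in> indep M" "I \<subseteq> J" "J \<subseteq> X" "card J = rank_of M X"
  using extend_indep[OF assms(1,2)] by blast
 have "rank_of M (ground M) \<le> card J"
  using card_le_rank[OF bases_indep[OF assms(3)] assms(4)] J(4) assms(3) by (simp add: bases_def)
 then have "J \<in> bases M" using rank_le_ground[OF J(1)] J(1) by (simp add: bases_def)
 then show thesis using that J by blast
qed

section \<open>Dual rank, contraction and minors\<close>

lemma rank_dual_matroid:
 assumes X: "X \<subseteq> ground M"
 shows "rank_of (dual_matroid M) X + rank_of M (ground M) = card X + rank_of M (ground M - X)"
proof -
 let ?E = "ground M" and ?r = "rank_of M (ground M)"
 have finX: "finite X" using X finite_ground finite_subset by blast
 have bound: "card J + ?r \<le> card X + rank_of M (?E - X)"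
  if J: "J \<subseteq> X" "rank_of M (?E - J) = ?r" for J
 proof -
  obtain I where I: "I \<in> indep M" "I \<subseteq> ?E - X" "card I = rank_of M (?E - X)" using rank_witness by blast
  obtain B where B: "B \<in> indep M" "I \<subseteq> B" "B \<subseteq> ?E - J" "card B = rank_of M (?E - J)"
   using extend_indep[OF I(1), of "?E - J"] I(2) J(1) by blast
  have "B - X \<in> indep M" using indep_mono[OF B(1)] by blast
  then have "card (B - X) \<le> rank_of M (?E - X)" using indep_subset[OF B(1)] by (intro card_le_rank) auto
  moreover have "card B = card (B - X) + card (B \<inter> X)"
   using card_Int_Diff[OF finite_indep[OF B(1)], of X] by simp
  moreover have "card J + card (B \<inter> X) \<le> card X"
  proof -
   have "card (J \<union> (B \<inter> X)) = card J + card (B \<inter> X)"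
    using J(1) B(3) finX finite_subset by (intro card_Un_disjoint) auto
   moreover have "card (J \<union> (B \<inter> X)) \<le> card X" using J(1) finX by (intro card_mono) auto
   ultimately show ?thesis by simp
  qed
  ultimately show ?thesis using B(4) J(2) by simp
 qed
 obtain I where I: "I \<in> indep M" "I \<subseteq> ?E - X" "card I = rank_of M (?E - X)" using rank_witness by blast
 obtain B where B: "B \<in> indep M" "I \<subseteq> B" "B \<subseteq> ?E" "card B = ?r"
  using extend_indep[OF I(1), of ?E] indep_subset[OF I(1)] by blast
 let ?J = "X - B"
 have r: "rank_of M (?E - ?J) = ?r"
 proof (rule antisym)
  show "rank_of M (?E - ?J) \<le> ?r" by (rule rank_mono) blast
  show "?r \<le> rank_of M (?E - ?J)" using card_le_rank[OF B(1), of "?E - ?J"] B(3,4) by auto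
 qed
 have "card B = card (B - X) + card (B \<inter> X)"
  using card_Int_Diff[OF finite_indep[OF B(1)], of X] by simp
 moreover have "card I \<le> card (B - X)" using I(2) B(2) finite_indep[OF B(1)] by (intro card_mono) auto
 moreover have "card X = card ?J + card (B \<inter> X)" using card_Int_Diff[OF finX, of B] by (simp add: Int_commute)
 ultimately have J: "card X + rank_of M (?E - X) \<le> card ?J + ?r" using I(3) B(4) by simp
 have "finite {I \<in> indep (dual_matroid M). I \<subseteq> X}" by (rule finite_subset[of _ "Pow X"]) (use finX in auto)
 moreover have "?J \<in> {I \<in> indep (dual_matroid M). I \<subseteq> X}" using r X by (auto simp: dual_matroid_def)
 ultimately have "card ?J \<le> rank_of (dual_matroid M) X" "rank_of (dual_matroid M) X \<in> card ` {I \<in> indep (dual_matroid M). I \<subseteq> X}"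
  unfolding rank_of_def by (intro Max_ge Max_in; blast)+
 moreover have "card X + rank_of M (?E - X) \<ge> rank_of (dual_matroid M) X + ?r"
 proof -
  obtain J where "J \<in> indep (dual_matroid M)" "J \<subseteq> X" "rank_of (dual_matroid M) X = card J"
   using \<open>rank_of (dual_matroid M) X \<in> _\<close> by blast
  then show ?thesis using bound[of J] by (simp add: dual_matroid_def)
 qed
 ultimately show ?thesis using J by linarith
qed

text \<open>Contraction is deletion between two dualizations. The rank formula at the complements of
  \<open>C\<close> and of \<open>C \<union> I\<close> eliminates the dual ranks.\<close>

lemma contract_indep_iff:
 assumes C: "C \<subseteq> ground M"
 shows "I \<in> indep (contract_set M C) \<longleftrightarrow> I \<subseteq> ground M - C \<and> rank_of M (C \<union> I) = card I + rank_of M C"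
proof -
 let ?E = "ground M" and ?N = "delete_set (dual_matroid M) C"
 have rank: "rank_of ?N X = rank_of (dual_matroid M) X" if "X \<subseteq> ?E - C" for X
 proof -
  have "{I \<in> indep ?N. I \<subseteq> X} = {I \<in> indep (dual_matroid M). I \<subseteq> X}"
   using that by (auto simp: delete_set_def)
  then show ?thesis by (simp add: rank_of_def)
 qed
 have "rank_of ?N (?E - C - I) = rank_of ?N (?E - C) \<longleftrightarrow> rank_of M (C \<union> I) = card I + rank_of M C"
  if I: "I \<subseteq> ?E - C"
 proof -
  have d: "?E - (?E - C) = C" "?E - (?E - C - I) = C \<union> I" using C I by auto
  have f: "finite (?E - C)" using finite_ground by simp
  have "card (?E - C) = card (?E - C - I) + card I"
   using card_Diff_subset[of I "?E - C"] card_mono[OF f I] I f finite_subset[OF I f] by simp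
  moreover have "rank_of ?N (?E - C - I) + rank_of M ?E = card (?E - C - I) + rank_of M (C \<union> I)"
   using rank_dual_matroid[of "?E - C - I"] rank[of "?E - C - I"] d by auto
  moreover have "rank_of ?N (?E - C) + rank_of M ?E = card (?E - C) + rank_of M C"
   using rank_dual_matroid[of "?E - C"] rank[of "?E - C"] d by auto
  ultimately show ?thesis by linarith
 qed
 then show ?thesis by (auto simp: contract_set_def dual_matroid_def delete_set_def)
qed

lemma contract_indep_iff_basis:
 assumes C: "C \<subseteq> ground M" and K: "K \<in> indep M" "K \<subseteq> C" "card K = rank_of M C"
 shows "I \<in> indep (contract_set M C) \<longleftrightarrow> I \<subseteq> ground M - C \<and> K \<union> I \<in> indep M"
proof -
 have "rank_of M (C \<union> I) = card I + card K \<longleftrightarrow> K \<union> I \<in> indep M" if I: "I \<subseteq> ground M - C"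
 proof -
  have f: "finite I" using I finite_ground finite_subset by blast
  obtain J where J: "J \<in> indep M" "K \<subseteq> J" "J \<subseteq> C \<union> I" "card J = rank_of M (C \<union> I)"
   using extend_indep[OF K(1), of "C \<union> I"] K(2) by blast
  have "J \<inter> C \<in> indep M" using indep_mono[OF J(1)] by blast
  then have "card (J \<inter> C) \<le> card K" unfolding K(3) by (intro card_le_rank) auto
  moreover have "card (J - C) \<le> card I" using J(3) f by (intro card_mono) auto
  moreover have cJ: "card J = card (J \<inter> C) + card (J - C)" using card_Int_Diff[OF finite_indep[OF J(1)]] .
  ultimately have le: "rank_of M (C \<union> I) \<le> card I + card K" using J(4) by simp
  show ?thesis
  proof
   assume "rank_of M (C \<union> I) = card I + card K"
   then have "card I \<le> card (J - C)" using \<open>card (J \<inter> C) \<le> card K\<close> cJ J(4) by simp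
   moreover have "J - C \<subseteq> I" using J(3) by blast
   ultimately have "J - C = I" using f by (intro card_seteq)
   then have "K \<union> I \<subseteq> J" using J(2) by blast
   then show "K \<union> I \<in> indep M" by (rule indep_mono[OF J(1)])
  next
   assume h: "K \<union> I \<in> indep M"
   have "card (K \<union> I) = card K + card I"
    using I K(2) f finite_indep[OF K(1)] by (intro card_Un_disjoint) auto
   moreover have "card (K \<union> I) \<le> rank_of M (C \<union> I)" using K(2) by (intro card_le_rank[OF h]) blast
   ultimately show "rank_of M (C \<union> I) = card I + card K" using le by simp
  qed
 qed
 then show ?thesis unfolding contract_indep_iff[OF C] K(3)[symmetric] by blast
qed

text \<open>\<open>K\<close> is contracted and everything except the points is deleted. Comparing
  bases is enough, because an independent set extends to a basis inside \<open>K\<close> and the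
  points.\<close>

lemma has_minorI:
 assumes N: "ground N = {0..<n::nat}" "\<And>T. T \<subseteq> {0..<n} ==> T \<in> indep N \<longleftrightarrow> (\<exists>B\<in>\<B>. T \<subseteq> B)"
  and \<B>: "\<And>B. B \<in> \<B> ==> B \<subseteq> {0..<n} \<and> card B = k" "\<B> \<noteq> {}" "\<Union>\<B> = {0..<n}"
  and p: "inj_on p {0..<n}" "p ` {0..<n} \<inter> K = {}"
  and bases: "\<And>T. T \<subseteq> {0..<n} ==> card T = k ==> K \<union> p ` T \<in> bases M \<longleftrightarrow> T \<in> \<B>"
 shows "has_minor M N"
proof -
 let ?P = "p ` {0..<n}" and ?E = "ground M"
 obtain B0 where B0: "B0 \<in> \<B>" using \<B>(2) by blast
 have base: "K \<union> p ` B \<in> bases M" if "B \<in> \<B>" for B using bases[of B] \<B>(1) that by blast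
 have K: "K \<in> indep M" using indep_mono[OF bases_indep[OF base[OF B0]]] by blast
 have P: "?P \<subseteq> ?E"
 proof
  fix x assume "x \<in> ?P"
  then obtain i where "x = p i" "i \<in> {0..<n}" by blast
  then obtain B where "B \<in> \<B>" "x \<in> p ` B" using \<B>(3) by blast
  then show "x \<in> ?E" using indep_subset[OF bases_indep[OF base]] by blast
 qed
 have rank: "rank_of M (ground M) = card K + k"
 proof -
  have "card (p ` B0) = k" using \<B>(1)[OF B0] p(1) card_image inj_on_subset by metis
  moreover have "card (K \<union> p ` B0) = card K + card (p ` B0)"
   using \<B>(1)[OF B0] p(2) finite_indep[OF K] by (intro card_Un_disjoint) (auto intro: finite_subset[of B0 "{0..<n}"])
  ultimately show ?thesis using base[OF B0] by (simp add: bases_def)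
 qed
 have indep: "K \<union> p ` T \<in> indep M \<longleftrightarrow> (\<exists>B\<in>\<B>. T \<subseteq> B)" if T: "T \<subseteq> {0..<n}" for T
 proof
  assume "K \<union> p ` T \<in> indep M"
  moreover have "K \<union> p ` T \<subseteq> K \<union> ?P" "K \<union> p ` B0 \<subseteq> K \<union> ?P" using T \<B>(1)[OF B0] by blast+
  ultimately obtain B where B: "B \<in> bases M" "K \<union> p ` T \<subseteq> B" "B \<subseteq> K \<union> ?P"
   using extend_to_basis base[OF B0] by metis
  define S where "S = {i \<in> {0..<n}. p i \<in> B}"
  have BS: "B = K \<union> p ` S" using B(2,3) unfolding S_def by blast
  have S: "S \<subseteq> {0..<n}" unfolding S_def by blast
  have "card (p ` S) = card S" using p(1) S card_image inj_on_subset by metis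
  moreover have "card (K \<union> p ` S) = card K + card (p ` S)"
   using S p(2) finite_indep[OF K] by (intro card_Un_disjoint) (auto intro: finite_subset[of S "{0..<n}"])
  ultimately have "card S = k" using B(1) rank unfolding BS bases_def by simp
  then have "S \<in> \<B>" using bases[OF S] B(1) BS by simp
  moreover have "T \<subseteq> S" using B(2) T unfolding S_def by blast
  ultimately show "\<exists>B\<in>\<B>. T \<subseteq> B" by blast
 next
  assume "\<exists>B\<in>\<B>. T \<subseteq> B"
  then obtain B where B: "B \<in> \<B>" "T \<subseteq> B" by blast
  show "K \<union> p ` T \<in> indep M"
   by (rule indep_mono[OF bases_indep[OF base[OF B(1)]]]) (use B(2) in blast)
 qed
 let ?D = "?E - K - ?P"
 let ?N = "delete_set (contract_set M K) ?D"
 have KE: "K \<subseteq> ?E" using indep_subset[OF K] .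
 have g: "ground ?N = ?P" using P p(2) KE by (auto simp: delete_set_def contract_set_def dual_matroid_def)
 let ?f = "the_inv_into {0..<n} p"
 have "bij_betw ?f ?P {0..<n}" by (rule bij_betw_the_inv_into[OF inj_on_imp_bij_betw[OF p(1)]])
 moreover have "X \<in> indep ?N \<longleftrightarrow> ?f ` X \<in> indep N" if X: "X \<subseteq> ?P" for X
 proof -
  define T where "T = {i \<in> {0..<n}. p i \<in> X}"
  have XT: "X = p ` T" "T \<subseteq> {0..<n}" using X unfolding T_def by blast+
  have fX: "?f ` X = T"
   unfolding XT(1) image_image using XT(2) the_inv_into_f_f[OF p(1)] by (auto simp: subset_iff intro: rev_image_eqI)
  have "X \<inter> ?D = {}" "X \<subseteq> ?E - K" using X P p(2) by auto
  then have "X \<in> indep ?N \<longleftrightarrow> K \<union> X \<in> indep M"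
   using contract_indep_iff_basis[OF KE K order_refl] rank_indep[OF K] by (simp add: delete_set_def)
  also have "\<dots> \<longleftrightarrow> T \<in> indep N" unfolding XT(1) indep[OF XT(2)] N(2)[OF XT(2)] ..
  finally show ?thesis unfolding fX .
 qed
 ultimately have "matroid_isomorphic ?N N"
  unfolding matroid_isomorphic_def g N(1) by (intro exI[of _ ?f] conjI allI impI)
 then show ?thesis
  unfolding has_minor_def by (intro exI[of _ K] exI[of _ ?D] conjI) (use KE in auto)
qed

text \<open>Deleting elements may lower the rank; then some deleted elements have to be contracted instead.\<close>

lemma has_minorE:
 assumes minor: "has_minor M N"
  and N: "ground N = {0..<n::nat}" "\<And>T. T \<subseteq> {0..<n} ==> T \<in> indep N \<longleftrightarrow> (\<exists>B\<in>\<B>. T \<subseteq> B)"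
  and \<B>: "\<And>B. B \<in> \<B> ==> B \<subseteq> {0..<n} \<and> card B = k" "\<B> \<noteq> {}"
 obtains K p where "K \<subseteq> ground M" "p ` {0..<n} \<subseteq> ground M" "inj_on p {0..<n}" "p ` {0..<n} \<inter> K = {}"
  "\<And>T. T \<subseteq> {0..<n} ==> card T = k ==> K \<union> p ` T \<in> bases M \<longleftrightarrow> T \<in> \<B>"
proof -
 let ?E = "ground M"
 obtain C D where CD: "C \<subseteq> ?E" "D \<subseteq> ?E" "C \<inter> D = {}"
  and iso: "matroid_isomorphic (delete_set (contract_set M C) D) N"
  using minor unfolding has_minor_def by blast
 let ?N = "delete_set (contract_set M C) D"
 have g: "ground ?N = ?E - C - D" by (auto simp: delete_set_def contract_set_def dual_matroid_def)
 obtain f where f: "bij_betw f (?E - C - D) {0..<n}"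
  "\<And>X. X \<subseteq> ?E - C - D ==> X \<in> indep ?N \<longleftrightarrow> f ` X \<in> indep N"
  using iso unfolding matroid_isomorphic_def g N(1) by blast
 define p where "p = the_inv_into (?E - C - D) f"
 have p: "bij_betw p {0..<n} (?E - C - D)" unfolding p_def by (rule bij_betw_the_inv_into[OF f(1)])
 have P: "p ` {0..<n} = ?E - C - D" "inj_on p {0..<n}" using p by (auto simp: bij_betw_def)
 have fp: "f (p i) = i" if "i \<in> {0..<n}" for i
  unfolding p_def by (rule f_the_inv_into_f) (use f(1) that in \<open>auto simp: bij_betw_def\<close>)
 obtain K where K: "K \<in> indep M" "K \<subseteq> C" "card K = rank_of M C" using rank_witness by blast
 have indep: "K \<union> p ` T \<in> indep M \<longleftrightarrow> (\<exists>B\<in>\<B>. T \<subseteq> B)" if T: "T \<subseteq> {0..<n}" for T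
 proof -
  have sub: "p ` T \<subseteq> ?E - C - D" using P(1) T by blast
  have "f ` p ` T = T" unfolding image_image using fp T by (auto simp: subset_iff intro: rev_image_eqI)
  then have "p ` T \<in> indep ?N \<longleftrightarrow> (\<exists>B\<in>\<B>. T \<subseteq> B)" using f(2)[OF sub] N(2)[OF T] by simp
  moreover have "p ` T \<in> indep ?N \<longleftrightarrow> K \<union> p ` T \<in> indep M"
   using sub contract_indep_iff_basis[OF CD(1) K, of "p ` T"] by (auto simp: delete_set_def)
  ultimately show ?thesis by blast
 qed
 have dis: "p ` T \<inter> K = {}" "card (K \<union> p ` T) = card K + card T" if T: "T \<subseteq> {0..<n}" for T
 proof -
  show 1: "p ` T \<inter> K = {}" using P(1) T K(2) by blast
  have "card (p ` T) = card T" using P(2) T card_image inj_on_subset by metis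
  then show "card (K \<union> p ` T) = card K + card T"
   using 1 T finite_indep[OF K(1)] by (subst card_Un_disjoint) (auto intro: finite_subset[of T "{0..<n}"])
 qed
 obtain B0 where B0: "B0 \<in> \<B>" using \<B>(2) by blast
 have B0n: "B0 \<subseteq> {0..<n}" "card B0 = k" using \<B>(1)[OF B0] by blast+
 have B0i: "K \<union> p ` B0 \<in> indep M" using indep[OF B0n(1)] B0 by blast
 obtain J where J: "J \<in> indep M" "K \<union> p ` B0 \<subseteq> J" "J \<subseteq> ?E" "card J = rank_of M ?E"
  using extend_indep[OF B0i indep_subset[OF B0i]] by blast
 \<comment> \<open>\<open>U\<close> makes up for the rank lost in the deletion and is contracted
   together with \<open>K\<close>.\<close>
 define U where "U = J - (K \<union> p ` B0)"
 have bound: "card T \<le> k" if T: "K \<union> p ` T \<in> indep M" "T \<subseteq> {0..<n}" for T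
 proof -
  obtain B where B: "B \<in> \<B>" "T \<subseteq> B" using indep[OF T(2)] T(1) by blast
  have "finite B" using \<B>(1)[OF B(1)] finite_subset[of B "{0..<n}"] by simp
  then show ?thesis using \<B>(1)[OF B(1)] card_mono[OF _ B(2)] by simp
 qed
 \<comment> \<open>A further point in J' would give more than k points that are independent over
   \<open>K\<close>.\<close>
 have maximal: "p i \<notin> J'" if "J' \<in> indep M" "K \<union> p ` T \<subseteq> J'" "T \<subseteq> {0..<n}" "card T = k" "i \<in> {0..<n} - T" for J' T i
 proof
  assume "p i \<in> J'"
  then have "K \<union> p ` i ## T \<subseteq> J'" using that(2) by blast
  then have "card (i ## T) \<le> k" using bound[of "i ## T"] indep_mono[OF that(1)] that(3,5) by auto
  then show False using that(3-5) finite_subset[of T "{0..<n}"] by auto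
 qed
 have U: "U \<inter> K = {}" "U \<inter> p ` {0..<n} = {}"
 proof -
  show "U \<inter> K = {}" unfolding U_def by blast
  show "U \<inter> p ` {0..<n} = {}" unfolding U_def using maximal[OF J(1,2) B0n] by blast
 qed
 have J_eq: "J = (K \<union> p ` B0) \<union> U" using J(2) unfolding U_def by blast
 have cJ: "rank_of M ?E = card K + k + card U"
 proof -
  have "finite J" using finite_indep[OF J(1)] .
  then have "card J = card (K \<union> p ` B0) + card U"
   using J(2) unfolding U_def by (metis card_Diff_subset card_mono finite_subset le_add_diff_inverse)
  then show ?thesis using dis(2)[OF B0n(1)] B0n(2) J(4) by simp
 qed
 show thesis
 proof (rule that[of "K \<union> U" p])
  show "K \<union> U \<subseteq> ?E" using J(3) J_eq by blast
  show "p ` {0..<n} \<subseteq> ?E" using P(1) by blast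
  show "inj_on p {0..<n}" by (rule P(2))
  show "p ` {0..<n} \<inter> (K \<union> U) = {}" using U dis(1)[OF order_refl] by blast
  fix T assume T: "T \<subseteq> {0..<n}" "card T = k"
  have fin: "finite (K \<union> U \<union> p ` T)" using finite_indep[OF J(1)] J_eq T(1) finite_subset[of T "{0..<n}"] by auto
  have card: "card (K \<union> U \<union> p ` T) = rank_of M ?E"
  proof -
   have "card (K \<union> p ` T \<union> U) = card (K \<union> p ` T) + card U"
    using fin U T(1) by (intro card_Un_disjoint) auto
   then show ?thesis using dis(2)[OF T(1)] T(2) cJ by (simp add: Un_ac)
  qed
  show "K \<union> U \<union> p ` T \<in> bases M \<longleftrightarrow> T \<in> \<B>"
  proof
   assume "K \<union> U \<union> p ` T \<in> bases M"
   then have "K \<union> p ` T \<in> indep M" using indep_mono[OF bases_indep] by blast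
   then obtain B where "B \<in> \<B>" "T \<subseteq> B" using indep[OF T(1)] by blast
   then show "T \<in> \<B>" using card_seteq[of B T] \<B>(1)[of B] T(2) finite_subset[of B "{0..<n}"] by auto
  next
   assume "T \<in> \<B>"
   then have iT: "K \<union> p ` T \<in> indep M" using indep[OF T(1)] by blast
   have JB: "J \<in> bases M" using J by (simp add: bases_def)
   obtain B where B: "B \<in> bases M" "K \<union> p ` T \<subseteq> B" "B \<subseteq> K \<union> p ` T \<union> J"
    using extend_to_basis[OF iT, of "K \<union> p ` T \<union> J", OF _ JB] by blast
   have "B \<subseteq> K \<union> U \<union> p ` T"
   proof
    fix x assume x: "x \<in> B"
    have "x \<notin> p ` ({0..<n} - T)" using maximal[OF bases_indep[OF B(1)] B(2) T] x by blast
    then show "x \<in> K \<union> U \<union> p ` T" using x B(3) J_eq B0n(1) by blast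
   qed
   moreover have "card B = rank_of M ?E" using B(1) by (simp add: bases_def)
   ultimately have "B = K \<union> U \<union> p ` T" using card fin by (intro card_seteq) auto
   then show "K \<union> U \<union> p ` T \<in> bases M" using B(1) by simp
  qed
 qed
qed

end

section \<open>The Fano matroid, its dual and their minors\<close>

lemma fano_lines_cover:
 assumes "S \<subseteq> {0..<7}" "card S \<le> 2"
 obtains T where "S \<subseteq> T" "T \<subseteq> {0..<7}" "card T = 3" "T \<notin> fano_lines"
proof -
 obtain P where P: "S \<subseteq> P" "P \<subseteq> {0..<7}" "card P = 2"
  using exists_subset_between[of S 2 "{0..<7}"] assms by auto
 then obtain i j where ij: "P = {i, j}" "i < j" "j < 7"
  by (metis atLeastLessThan_iff card_2_iff insert_commute insert_subset linorder_neqE_nat)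
 define f where "f = (\<lambda>(a::nat) (b::nat) (c::nat). (a, b, c) \<in> {(0, 1, 3), (1, 2, 4), (2, 3, 5), (3, 4, 6), (0, 4, 5), (1, 5, 6), (0, 2, 6)})"
 have "\<exists>a b c. a < b \<and> b < c \<and> c < 7 \<and> {i, j} \<subseteq> {a, b, c} \<and> \<not> f a b c"
 proof (cases "j < 5")
  case True
  \<comment> \<open>Two lines of the plane share one point, so i, j, 5 and i, j, 6 are not both
    lines.\<close>
  then have "\<not> f i j 5 \<or> \<not> f i j 6" unfolding f_def by auto
  then show ?thesis
  proof
   assume "\<not> f i j 5"
   then show ?thesis using ij True by (intro exI[of _ i] exI[of _ j] exI[of _ 5]) auto
  next
   assume "\<not> f i j 6"
   then show ?thesis using ij True by (intro exI[of _ i] exI[of _ j] exI[of _ 6]) auto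
  qed
 next
  case False
  then consider "j = 5" "i \<noteq> 1" | "j = 6" "i \<noteq> 1" "i \<noteq> 5" | "i = 1" | "j = 6" "i = 5" using ij by linarith
  then show ?thesis
  proof cases
   case 1
   then show ?thesis using ij by (intro exI[of _ i] exI[of _ 5] exI[of _ 6]) (auto simp: f_def)
  next
   case 2
   then show ?thesis using ij by (intro exI[of _ i] exI[of _ 5] exI[of _ 6]) (auto simp: f_def)
  next
   case 3
   then show ?thesis using ij False by (intro exI[of _ 0] exI[of _ 1] exI[of _ j]) (auto simp: f_def)
  next
   case 4
   then show ?thesis by (intro exI[of _ 0] exI[of _ 5] exI[of _ 6]) (auto simp: f_def)
  qed
 qed
 then obtain a b c where abc: "a < b" "b < c" "c < 7" "{i, j} \<subseteq> {a, b, c}" "\<not> f a b c" by blast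
 have "{a, b, c} \<notin> fano_lines" using fano_lines_sorted[OF abc(1-3)] abc(5) unfolding f_def by blast
 then show thesis using that[of "{a, b, c}"] abc P(1) ij(1) by auto
qed

definition fano_bases :: "nat set set" where
 "fano_bases = {S. S \<subseteq> {0..<7} \<and> card S = 3 \<and> S \<notin> fano_lines}"

lemma fano_bases_cover: "S \<subseteq> {0..<7} ==> card S \<le> 2 ==> \<exists>B\<in>fano_bases. S \<subseteq> B"
 by (rule fano_lines_cover[of S]) (auto simp: fano_bases_def)

lemma fano_indep_iff:
 assumes "T \<subseteq> {0..<7}"
 shows "T \<in> indep fano \<longleftrightarrow> (\<exists>B\<in>fano_bases. T \<subseteq> B)"
proof -
 have lines: "card L = 3" if "L \<in> fano_lines" for L using that by (auto simp: fano_lines_eq)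
 show ?thesis
 proof
  assume T: "T \<in> indep fano"
  show "\<exists>B\<in>fano_bases. T \<subseteq> B"
  proof (cases "card T \<le> 2")
   case True
   then show ?thesis using fano_bases_cover[OF assms] by blast
  next
   case False
   then have "T \<in> fano_bases" using T by (auto simp: fano_def fano_bases_def)
   then show ?thesis by blast
  qed
 next
  assume "\<exists>B\<in>fano_bases. T \<subseteq> B"
  then obtain B where B: "B \<subseteq> {0..<7}" "card B = 3" "B \<notin> fano_lines" "T \<subseteq> B" by (auto simp: fano_bases_def)
  have f: "finite B" using B(1) finite_subset by blast
  then have "card T \<le> 3" using card_mono[OF f B(4)] B(2) by simp
  moreover have "T \<notin> fano_lines" using lines[of T] card_seteq[OF f B(4)] B by auto
  ultimately show "T \<in> indep fano" using assms by (simp add: fano_def)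
 qed
qed

lemma fano_rank_iff: "X \<subseteq> {0..<7} ==> rank_of fano X = 3 \<longleftrightarrow> (\<exists>B\<in>fano_bases. B \<subseteq> X)"
proof -
 assume X: "X \<subseteq> {0..<7}"
 let ?S = "card ` {I \<in> indep fano. I \<subseteq> X}"
 have fin: "finite ?S" by (rule finite_imageI, rule finite_subset[of _ "Pow {0..<7}"]) (auto simp: fano_def)
 have le: "n \<le> 3" if "n \<in> ?S" for n using that by (auto simp: fano_def)
 have ne: "?S \<noteq> {}" using fano_indep_iff[of "{}"] fano_bases_cover[of "{}"] by auto
 show ?thesis
 proof
  assume "rank_of fano X = 3"
  then have "3 \<in> ?S" using Max_in[OF fin ne] by (simp add: rank_of_def)
  then obtain I where "I \<in> indep fano" "I \<subseteq> X" "card I = 3" by auto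
  then have "I \<in> fano_bases" using X by (auto simp: fano_def fano_bases_def)
  then show "\<exists>B\<in>fano_bases. B \<subseteq> X" using \<open>I \<subseteq> X\<close> by blast
 next
  assume "\<exists>B\<in>fano_bases. B \<subseteq> X"
  then obtain B where B: "B \<in> fano_bases" "B \<subseteq> X" by blast
  then have "B \<in> indep fano" "card B = 3" using fano_indep_iff[of B] X by (auto simp: fano_bases_def)
  then have "3 \<in> ?S" using B(2) by force
  then show "rank_of fano X = 3" unfolding rank_of_def using le fin by (intro Max_eqI) auto
 qed
qed

definition fano_cobases :: "nat set set" where
 "fano_cobases = (\<lambda>B. {0..<7} - B) ` fano_bases"

lemma dual_fano_indep_iff:
 assumes "T \<subseteq> {0..<7}"
 shows "T \<in> indep (dual_matroid fano) \<longleftrightarrow> (\<exists>B\<in>fano_cobases. T \<subseteq> B)"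
proof -
 have "\<exists>B\<in>fano_bases. B \<subseteq> {0..<7}" using fano_bases_cover[of "{}"] by (auto simp: fano_bases_def)
 then have "rank_of fano {0..<7} = 3" using fano_rank_iff[of "{0..<7}"] by blast
 then have "T \<in> indep (dual_matroid fano) \<longleftrightarrow> (\<exists>B\<in>fano_bases. B \<subseteq> {0..<7} - T)"
  using assms fano_rank_iff[of "{0..<7} - T"] by (auto simp: dual_matroid_def fano_def)
 also have "\<dots> \<longleftrightarrow> (\<exists>B\<in>fano_bases. T \<subseteq> {0..<7} - B)"
 proof (rule bex_cong[OF refl])
  fix B assume "B \<in> fano_bases"
  then have "B \<subseteq> {0..<7}" by (simp add: fano_bases_def)
  then show "B \<subseteq> {0..<7} - T \<longleftrightarrow> T \<subseteq> {0..<7} - B" using assms by blast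
 qed
 also have "\<dots> \<longleftrightarrow> (\<exists>B\<in>fano_cobases. T \<subseteq> B)"
  by (simp add: fano_cobases_def)
 finally show ?thesis .
qed

lemma fano_bases_props:
 "B \<in> fano_bases ==> B \<subseteq> {0..<7} \<and> card B = 3" "fano_bases \<noteq> {}" "\<Union>fano_bases = {0..<7}"
 "C \<in> fano_cobases ==> C \<subseteq> {0..<7} \<and> card C = 4" "fano_cobases \<noteq> {}" "\<Union>fano_cobases = {0..<7}"
proof -
 show b: "B \<subseteq> {0..<7} \<and> card B = 3" if "B \<in> fano_bases" for B using that by (simp add: fano_bases_def)
 show ne: "fano_bases \<noteq> {}" using fano_bases_cover[of "{}"] by auto
 show "\<Union>fano_bases = {0..<7}"
 proof
  show "{0..<7} \<subseteq> \<Union>fano_bases"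
  proof
   fix i :: nat assume "i \<in> {0..<7}"
   then show "i \<in> \<Union>fano_bases" using fano_bases_cover[of "{i}"] by auto
  qed
  show "\<Union>fano_bases \<subseteq> {0..<7}" by (rule Union_least) (rule conjunct1[OF b])
 qed
 show c: "C \<subseteq> {0..<7} \<and> card C = 4" if C: "C \<in> fano_cobases" for C
 proof -
  obtain B where B: "B \<in> fano_bases" "C = {0..<7} - B" using C by (auto simp: fano_cobases_def)
  then have "card C = 7 - card B" using b[OF B(1)] card_Diff_subset[of B "{0..<7}"] finite_subset[of B "{0..<7}"] by auto
  then show ?thesis using b[OF B(1)] B(2) by auto
 qed
 show "fano_cobases \<noteq> {}" using ne by (simp add: fano_cobases_def)
 show "\<Union>fano_cobases = {0..<7}"
 proof
  show "{0..<7} \<subseteq> \<Union>fano_cobases"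
  proof
   fix i :: nat assume i: "i \<in> {0..<7}"
   have "\<exists>B\<in>fano_bases. i \<notin> B"
   proof (cases "i < 3")
    case True
    have "{3, 4, 5} \<in> fano_bases" using fano_lines_sorted[of 3 4 5] by (auto simp: fano_bases_def)
    then show ?thesis by (rule bexI[rotated]) (use True in auto)
   next
    case False
    have "{0, 1, 2} \<in> fano_bases" using fano_lines_sorted[of 0 1 2] by (auto simp: fano_bases_def)
    then show ?thesis by (rule bexI[rotated]) (use False in auto)
   qed
   then show "i \<in> \<Union>fano_cobases" using i by (auto simp: fano_cobases_def)
  qed
  show "\<Union>fano_cobases \<subseteq> {0..<7}" by (rule Union_least) (rule conjunct1[OF c])
 qed
qed

context matroid
begin

lemma has_minor_fano_iff: "has_minor M fano \<longleftrightarrow> (\<exists>K p. fano_pattern (bases M) K p)"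
proof
 assume minor: "has_minor M fano"
 have g: "ground fano = {0..<7}" by (simp add: fano_def)
 obtain K p where "inj_on p {0..<7}" "p ` {0..<7} \<inter> K = {}"
  "\<And>T. T \<subseteq> {0..<7} ==> card T = 3 ==> K \<union> p ` T \<in> bases M \<longleftrightarrow> T \<in> fano_bases"
  by (rule has_minorE[OF minor g fano_indep_iff fano_bases_props(1,2)], (assumption | rule that)+)
 then have "fano_pattern (bases M) K p" unfolding fano_pattern_def fano_bases_def by auto
 then show "\<exists>K p. fano_pattern (bases M) K p" by blast
next
 assume "\<exists>K p. fano_pattern (bases M) K p"
 then obtain K p where p: "fano_pattern (bases M) K p" by blast
 show "has_minor M fano"
 proof (rule has_minorI[OF _ fano_indep_iff fano_bases_props(1-3)])
  show "inj_on p {0..<7}" "p ` {0..<7} \<inter> K = {}" using p by (auto simp: fano_pattern_def)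
  show "K \<union> p ` T \<in> bases M \<longleftrightarrow> T \<in> fano_bases" if "T \<subseteq> {0..<7}" "card T = 3" for T
   using p that unfolding fano_pattern_def fano_bases_def by blast
 qed (simp add: fano_def)
qed

text \<open>Passing to the dual exchanges the contracted set with the deleted set; the seven points
  stay, and triples become their complements.\<close>

lemma has_minor_dual_fano_iff:
 "has_minor M (dual_matroid fano) \<longleftrightarrow> (\<exists>K p. fano_pattern (dual_family (ground M) (bases M)) K p)"
proof -
 let ?E = "ground M"
 have card: "card S = 3 \<longleftrightarrow> card ({0..<7} - S) = 4" if "S \<subseteq> {0..<7::nat}" for S
  using card_Diff_subset[of S "{0..<7}"] card_mono[of "{0..<7}" S] finite_subset[OF that] that by auto
 have dual: "{0..<7} - S \<in> fano_cobases \<longleftrightarrow> S \<in> fano_bases" if "S \<subseteq> {0..<7}" for S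
 proof -
  have "{0..<7} - ({0..<7} - S) = S" using that by blast
  moreover have "{0..<7} - ({0..<7} - B) = B" if "B \<in> fano_bases" for B using fano_bases_props(1)[OF that] by blast
  ultimately show ?thesis unfolding fano_cobases_def by (metis (no_types, lifting) image_iff)
 qed
 have mem: "K \<union> p ` S \<in> dual_family ?E (bases M) \<longleftrightarrow> L \<union> p ` ({0..<7} - S) \<in> bases M"
  if h: "K \<union> L \<union> p ` {0..<7} = ?E" "K \<inter> L = {}" "p ` {0..<7} \<inter> K = {}" "p ` {0..<7} \<inter> L = {}"
   "inj_on p {0..<7}" "S \<subseteq> {0..<7}" for K L p S
 proof -
  have "p ` ({0..<7} - S) = p ` {0..<7} - p ` S" using inj_on_image_set_diff[OF h(5), of "{0..<7}" S] h(6) by auto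
  moreover have "p ` S \<subseteq> p ` {0..<7}" using h(6) by blast
  moreover have "K \<union> L \<union> P - (K \<union> Q) = L \<union> (P - Q)" if "K \<inter> L = {}" "P \<inter> K = {}" "P \<inter> L = {}" "Q \<subseteq> P" for P Q
   using that by blast
  ultimately have "?E - (K \<union> p ` S) = L \<union> p ` ({0..<7} - S)" using h(2-4) unfolding h(1)[symmetric] by simp
  moreover have "K \<union> p ` S \<subseteq> ?E" using h(1,6) by blast
  ultimately show ?thesis using dual_family_iff[OF bases_subset] by simp
 qed
 show ?thesis
 proof
  assume minor: "has_minor M (dual_matroid fano)"
  have g: "ground (dual_matroid fano) = {0..<7}" by (simp add: fano_def dual_matroid_def)
  obtain L p where
   p: "L \<subseteq> ?E" "p ` {0..<7} \<subseteq> ?E" "inj_on p {0..<7}" "p ` {0..<7} \<inter> L = {}"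
   "\<And>T. T \<subseteq> {0..<7} ==> card T = 4 ==> L \<union> p ` T \<in> bases M \<longleftrightarrow> T \<in> fano_cobases"
   by (rule has_minorE[OF minor g dual_fano_indep_iff fano_bases_props(4,5)], (assumption | rule that)+)
  define K where "K = ?E - L - p ` {0..<7}"
  have K: "K \<union> L \<union> p ` {0..<7} = ?E" "K \<inter> L = {}" "p ` {0..<7} \<inter> K = {}" using p unfolding K_def by blast+
  have "fano_pattern (dual_family ?E (bases M)) K p"
   unfolding fano_pattern_def
  proof (intro conjI allI impI)
   fix S :: "nat set" assume S: "S \<subseteq> {0..<7}" "card S = 3"
   show "K \<union> p ` S \<in> dual_family ?E (bases M) \<longleftrightarrow> S \<notin> fano_lines"
    unfolding mem[OF K p(4,3) S(1)] using p(5)[of "{0..<7} - S"] dual[OF S(1)] card[OF S(1)] S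
    by (simp add: fano_bases_def)
  qed (use p K in auto)
  then show "\<exists>K p. fano_pattern (dual_family ?E (bases M)) K p" by blast
 next
  assume "\<exists>K p. fano_pattern (dual_family ?E (bases M)) K p"
  then obtain K p where kp: "fano_pattern (dual_family ?E (bases M)) K p" by blast
  have p: "inj_on p {0..<7}" "p ` {0..<7} \<inter> K = {}"
   "\<And>S. S \<in> fano_bases ==> K \<union> p ` S \<in> dual_family ?E (bases M)"
   "\<And>S. S \<subseteq> {0..<7} ==> card S = 3 ==> K \<union> p ` S \<in> dual_family ?E (bases M) \<longleftrightarrow> S \<notin> fano_lines"
   using kp by (auto simp: fano_pattern_def fano_bases_def)
  have sub: "K \<subseteq> ?E" "p ` {0..<7} \<subseteq> ?E"
  proof -
   have s: "K \<union> p ` S \<subseteq> ?E" if "S \<in> fano_bases" for S using p(3)[OF that] dual_family_subset by blast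
   then show "K \<subseteq> ?E" using fano_bases_props(2) by blast
   show "p ` {0..<7} \<subseteq> ?E" unfolding fano_bases_props(3)[symmetric] using s by blast
  qed
  define L where "L = ?E - K - p ` {0..<7}"
  have L: "K \<union> L \<union> p ` {0..<7} = ?E" "K \<inter> L = {}" "p ` {0..<7} \<inter> L = {}" using sub unfolding L_def by blast+
  show "has_minor M (dual_matroid fano)"
  proof (rule has_minorI[OF _ dual_fano_indep_iff fano_bases_props(4-6)])
   show "ground (dual_matroid fano) = {0..<7}" by (simp add: fano_def dual_matroid_def)
   fix T :: "nat set" assume T: "T \<subseteq> {0..<7}" "card T = 4"
   have TT: "{0..<7} - ({0..<7} - T) = T" using T(1) by blast
   have S: "{0..<7} - T \<subseteq> {0..<7}" "card ({0..<7} - T) = 3" using card[of "{0..<7} - T"] T TT by auto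
   show "L \<union> p ` T \<in> bases M \<longleftrightarrow> T \<in> fano_cobases"
    using mem[OF L(1,2) p(2) L(3) p(1) S(1)] p(4)[OF S] dual[OF S(1)] S unfolding TT by (simp add: fano_bases_def)
  qed (use p L in auto)
 qed
qed

section \<open>Hyperplanes over a corank 2 flat\<close>

lemma hyperplane_subset: "H \<in> hyperplanes M ==> H \<subseteq> ground M"
 by (auto simp: hyperplanes_def corank_flat_def flat_def)

lemma hyperplane_span:
 assumes K: "K \<in> indep M" "card K + 2 = rank_of M (ground M)" and H: "H \<in> hyperplanes M" "K \<subseteq> H"
  and p: "p \<in> H" "p \<notin> cl M K"
 shows "p ## K \<in> indep M" "p \<notin> K" "H = cl M (p ## K)"
proof -
 have pg: "p \<in> ground M" using hyperplane_subset[OF H(1)] p(1) by blast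
 show pK: "p ## K \<in> indep M" "p \<notin> K" using closure_indep_iff[OF K(1) pg] p(2) by auto
 show "H = cl M (p ## K)"
 proof (rule corank_flat_basis)
  show "corank_flat M 1 H" using H(1) by (simp add: hyperplanes_def)
  show "card (p ## K) + 1 = rank_of M (ground M)" using pK K(2) finite_indep[OF K(1)] by simp
 qed (use pK H p in auto)
qed

lemma hyperplane_pair:
 assumes K: "K \<in> indep M" "card K + 2 = rank_of M (ground M)"
  and H: "H \<in> hyperplanes M" "K \<subseteq> H" "H' \<in> hyperplanes M" "K \<subseteq> H'" "H \<noteq> H'"
  and p: "p \<in> H" "p \<notin> cl M K" "q \<in> H'" "q \<notin> cl M K"
 shows "p \<noteq> q" "p ## q ## K \<in> bases M"
proof -
 note s = hyperplane_span[OF K H(1,2) p(1,2)] and t = hyperplane_span[OF K H(3,4) p(3,4)]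
 have "p \<noteq> q \<and> p ## q ## K \<in> indep M"
  using closure_eq_of_dependent[OF s(1) t(1) s(2) t(2)] s(3) t(3) H(5) by blast
 moreover from this have "card (p ## q ## K) = rank_of M (ground M)"
  using s(2) t(2) K(2) finite_indep[OF K(1)] by simp
 ultimately show "p \<noteq> q" "p ## q ## K \<in> bases M" by (auto simp: bases_def)
qed

lemma hyperplane_outside:
 assumes K: "K \<in> indep M" "card K + 2 = rank_of M (ground M)" and H: "H \<in> hyperplanes M"
 obtains p where "p \<in> H" "p \<notin> cl M K"
proof -
 have "rank_of M H + 1 = rank_of M (ground M)" using H by (simp add: hyperplanes_def corank_flat_def)
 then have "\<not> H \<subseteq> cl M K" using rank_mono[of H "cl M K"] rank_closure[OF K(1)] K(2) by auto
 then show thesis using that by blast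
qed

lemma hyperplane_Int:
 assumes K: "K \<in> indep M" "card K + 2 = rank_of M (ground M)"
  and H: "H \<in> hyperplanes M" "K \<subseteq> H" "H' \<in> hyperplanes M" "K \<subseteq> H'" "H \<noteq> H'"
 shows "H \<inter> H' = cl M K"
proof -
 obtain p where p: "p \<in> H" "p \<notin> cl M K" by (rule hyperplane_outside[OF K H(1)])
 obtain q where q: "q \<in> H'" "q \<notin> cl M K" by (rule hyperplane_outside[OF K H(3)])
 note s = hyperplane_span[OF K H(1,2) p] and t = hyperplane_span[OF K H(3,4) q] and pq = hyperplane_pair[OF K H p q]
 show ?thesis using closure_Int_bases[OF pq(2,1) s(2) t(2)] s(3) t(3) by simp
qed

lemma corank2_basis:
 assumes "corank_flat M 2 L"
 obtains K where "K \<in> indep M" "card K + 2 = rank_of M (ground M)" "L = cl M K" "K \<subseteq> L"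
 using assms indep_subset_closure unfolding corank_flat_iff by blast

lemma theta_basis:
 assumes "(H1, H2, H3, H4) \<in> theta M"
 obtains K where "K \<in> indep M" "card K + 2 = rank_of M (ground M)" "H1 \<inter> H2 \<inter> H3 \<inter> H4 = cl M K"
  "K \<subseteq> H1" "K \<subseteq> H2" "K \<subseteq> H3" "K \<subseteq> H4" "H1 \<in> hyperplanes M" "H2 \<in> hyperplanes M" "H3 \<in> hyperplanes M" "H4 \<in> hyperplanes M"
  "H1 \<noteq> H3" "H1 \<noteq> H4" "H2 \<noteq> H3" "H2 \<noteq> H4"
  "(H1, H2, H3, H4) \<in> theta_nondeg M \<longleftrightarrow> H1 \<noteq> H2 \<and> H3 \<noteq> H4"
proof -
 define L where "L = H1 \<inter> H2 \<inter> H3 \<inter> H4"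
 have t: "H1 \<in> hyperplanes M" "H2 \<in> hyperplanes M" "H3 \<in> hyperplanes M" "H4 \<in> hyperplanes M" "corank_flat M 2 L"
  "H1 \<inter> H3 = L" "H1 \<inter> H4 = L" "H2 \<inter> H3 = L" "H2 \<inter> H4 = L"
  using assms unfolding mem_theta L_def[symmetric] by auto
 obtain K where K: "K \<in> indep M" "card K + 2 = rank_of M (ground M)" "L = cl M K" "K \<subseteq> L"
  by (rule corank2_basis[OF t(5)])
 have KH: "K \<subseteq> H1" "K \<subseteq> H2" "K \<subseteq> H3" "K \<subseteq> H4" using K(4) unfolding L_def by blast+
 have ne: "H \<noteq> L" if "H \<in> hyperplanes M" for H
 proof -
  obtain p where "p \<in> H" "p \<notin> cl M K" using hyperplane_outside[OF K(1,2)] \<open>H \<in> hyperplanes M\<close> by blast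
  then show ?thesis using K(3) by blast
 qed
 have d: "H1 \<noteq> H3" "H1 \<noteq> H4" "H2 \<noteq> H3" "H2 \<noteq> H4" using t ne by auto
 have *: "H \<inter> H' = L \<longleftrightarrow> H \<noteq> H'" if "H \<in> hyperplanes M" "K \<subseteq> H" "H' \<in> hyperplanes M" "K \<subseteq> H'" for H H'
  using hyperplane_Int[OF K(1,2) that] ne[OF that(1)] K(3) by auto
 have "H1 \<inter> H2 = L \<longleftrightarrow> H1 \<noteq> H2" "H3 \<inter> H4 = L \<longleftrightarrow> H3 \<noteq> H4"
  by (rule *[OF t(1) KH(1) t(2) KH(2)], rule *[OF t(3) KH(3) t(4) KH(4)])
 then have "(H1, H2, H3, H4) \<in> theta_nondeg M \<longleftrightarrow> H1 \<noteq> H2 \<and> H3 \<noteq> H4"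
  by (simp only: mem_theta_nondeg L_def[symmetric] assms simp_thms eq_commute[of L])
 then show thesis by (intro that[OF K(1,2) K(3)[unfolded L_def] KH t(1-4) d])
qed

lemma theta_nondegI:
 assumes K: "K \<in> indep M" "card K + 2 = rank_of M (ground M)"
  and H: "H1 \<in> hyperplanes M" "H2 \<in> hyperplanes M" "H3 \<in> hyperplanes M" "H4 \<in> hyperplanes M"
  "K \<subseteq> H1" "K \<subseteq> H2" "K \<subseteq> H3" "K \<subseteq> H4" "distinct [H1, H2, H3, H4]"
 shows "(H1, H2, H3, H4) \<in> theta_nondeg M"
proof -
 note Int = hyperplane_Int[OF K]
 have I: "H1 \<inter> H2 = cl M K" "H1 \<inter> H3 = cl M K" "H1 \<inter> H4 = cl M K" "H2 \<inter> H3 = cl M K" "H2 \<inter> H4 = cl M K" "H3 \<inter> H4 = cl M K"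
  by (intro Int H; use H(9) in simp)+
 then have all: "H1 \<inter> H2 \<inter> H3 \<inter> H4 = cl M K" by blast
 have "corank_flat M 2 (cl M K)" using K corank_flat_iff by blast
 then show ?thesis unfolding mem_theta_nondeg mem_theta all using I H by simp
qed

end

section \<open>Logarithms of representations\<close>

text \<open>The unit group of \<open>P\<close> is written additively as the quotient of the free abelian group on all
 elements by the kernel of \<open>ev\<close>.\<close>

locale pasture_log = pasture P for P :: "'p pasture" (structure) +
 fixes ev :: "('p \<Rightarrow>\<^sub>0 int) => 'p"
 assumes ev_add: "ev (x + y) = ev x \<otimes> ev y" and ev_frag: "a \<in> nonzeros P ==> ev (frag_of a) = a"
  and ev_nonzero: "ev x \<in> nonzeros P"

lemma (in pasture) exists_log: "\<exists>ev. pasture_log P ev"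
proof -
 let ?G = "units_of P"
 \<comment> \<open>The free group is taken on the whole type; elements that are not units are sent
   to the default value 1.\<close>
 define f where "f a = (if a \<in> nonzeros P then a else \<one>)" for a
 have G: "comm_group ?G" by (rule units_comm_group)
 have sub: "f ` UNIV \<subseteq> carrier ?G"
  unfolding f_def units_of_carrier Units_nonzeros using nonzeros_closed(3) by auto
 obtain h where h: "h \<in> hom (free_Abelian_group UNIV) ?G" "\<And>x. x \<in> UNIV ==> h (frag_of x) = f x"
  by (rule comm_group.free_Abelian_group_universal[OF G sub], rule that)
 have "pasture_log P h"
 proof
  show "h (x + y) = h x \<otimes> h y" for x y using h(1) by (simp add: hom_def units_of_mult)
  show "h (frag_of a) = a" if "a \<in> nonzeros P" for a using h(2)[of a] that by (simp add: f_def)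
  show "h x \<in> nonzeros P" for x using h(1) unfolding hom_def units_of_carrier Units_nonzeros[symmetric] by auto
 qed
 then show ?thesis by (rule exI[of _ h])
qed

context pasture_log
begin

lemma ev_closed: "ev x \<in> carrier P" "ev x \<in> Units P"
 using ev_nonzero[of x] Units_nonzeros by auto

lemma ev_0: "ev 0 = \<one>"
proof -
 have "ev 0 \<otimes> ev 0 = ev 0 \<otimes> \<one>" using ev_add[of 0 0] ev_closed by simp
 then show ?thesis using Units_l_cancel[OF ev_closed(2) ev_closed(1) one_closed] by simp
qed

lemma ev_uminus: "ev (- x) = inv (ev x)"
proof -
 have "ev (- x) \<otimes> ev x = \<one>" using ev_add[of "- x" x] ev_0 by simp
 moreover have "ev x \<otimes> ev (- x) = \<one>" using ev_add[of x "- x"] ev_0 by simp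
 ultimately show ?thesis using inv_unique'[of "ev x" "ev (- x)"] ev_closed by simp
qed

lemma ev_diff: "ev (x - y) = ev x \<otimes> inv (ev y)"
 using ev_add[of x "- y"] ev_uminus[of y] by simp

definition kernel :: "('p \<Rightarrow>\<^sub>0 int) set" where "kernel = {x. ev x = \<one>}"

sublocale congruence_group kernel
proof
 show "0 \<in> kernel" by (simp add: kernel_def ev_0)
 show "x - y \<in> kernel" if "x \<in> kernel" "y \<in> kernel" for x y
  using that by (simp add: kernel_def ev_diff)
qed

notation cong (infix "\<simeq>" 50)

lemma cong_iff: "x \<simeq> y \<longleftrightarrow> ev x = ev y"
proof -
 have 1: "ev x = ev (x - y) \<otimes> ev y" using ev_add[of "x - y" y] by simp
 show ?thesis
 proof
  assume "x \<simeq> y"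
  then have "ev (x - y) = \<one>" unfolding cong_def by (simp add: kernel_def)
  then show "ev x = ev y" using 1 ev_closed by simp
 next
  assume "ev x = ev y"
  then show "x \<simeq> y" unfolding cong_def using ev_closed by (simp add: kernel_def ev_diff Units_r_inv)
 qed
qed

abbreviation minus_one :: "'p \<Rightarrow>\<^sub>0 int" where "minus_one \<equiv> frag_of (pneg P \<one>)"

lemma ev_minus_one: "ev minus_one = pneg P \<one>"
 by (rule ev_frag) (rule nonzeros_closed(4)[OF nonzeros_closed(3)])

lemma minus_one_double: "minus_one + minus_one \<in> kernel"
 by (simp add: kernel_def ev_add ev_minus_one neg_one_square)

lemma pneg_ev: "pneg P (ev x) = ev (minus_one + x)"
 using neg_mult[OF ev_closed(1)[of x]] ev_closed m_comm[of "ev x" "ev minus_one"]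
  neg_ex[OF one_closed] by (simp add: ev_add ev_minus_one)

end

locale matroid_pasture = matroid M + pasture_log P ev
 for M :: "'a matroid" and P :: "'p pasture" (structure) and ev
begin

text \<open>The order is an arbitrary well-order of the type; an inverted pair contributes
  -1.\<close>

definition order_sign :: "'a => 'a => 'p \<Rightarrow>\<^sub>0 int" where
 "order_sign a b = (if (a, b) \<in> (SOME r. well_order_on UNIV r) then 0 else minus_one)"

sublocale signed_group kernel minus_one order_sign "ground M"
proof
 show "finite (ground M)" by (rule finite_ground)
 show "minus_one + minus_one \<in> kernel" by (rule minus_one_double)
 have wo: "well_order_on UNIV (SOME r :: 'a rel. well_order_on UNIV r)"
  using someI_ex[OF well_order_on] .
 show "order_sign a b + order_sign b a \<simeq> minus_one" if "a \<noteq> b" for a b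
 proof -
  have "(a, b) \<in> (SOME r. well_order_on UNIV r) \<longleftrightarrow> (b, a) \<notin> (SOME r. well_order_on UNIV r)"
   using wo that unfolding well_order_on_def linear_order_on_def partial_order_on_def total_on_def antisym_def by blast
  then show ?thesis by (simp add: order_sign_def)
 qed
 show "order_sign a b + order_sign a b \<in> kernel" for a b
  using minus_one_double by (simp add: order_sign_def zero_mem)
qed

end

context pasture_log
begin

lemma scale_nullset:
 assumes "{#ev x, ev y, ev z#} \<in> nullset P"
 shows "{#ev (t + x), ev (t + y), ev (t + z)#} \<in> nullset P"
 using nullset_mult[OF ev_closed(1)[of t] assms] by (simp add: ev_add)

lemma pair_nullset_iff:
 assumes "a \<in> carrier P" "b \<in> carrier P"
 shows "{#a, b, pzero P#} \<in> nullset P \<longleftrightarrow> b = pneg P a"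
 using neg_unique[OF assms] neg_ex[OF assms(1)] by auto

lemma ev_pair_nullset_iff: "{#ev x, ev y, pzero P#} \<in> nullset P \<longleftrightarrow> y \<simeq> minus_one + x"
 by (simp add: pair_nullset_iff ev_closed pneg_ev cong_iff)

lemma pneg_zero: "pneg P (pzero P) = pzero P"
 by (rule neg_unique[OF zero_closed zero_closed zero_nullset])

end

context matroid_pasture
begin

notation cong (infix "\<simeq>" 50)

abbreviation lg :: "('a set => 'a => 'p) => 'a set => 'a => 'p \<Rightarrow>\<^sub>0 int" where
 "lg \<phi> H e \<equiv> frag_of (\<phi> H e)"

lemma representation_value:
 assumes "\<phi> \<in> representations M P" "H \<in> hyperplanes M" "e \<in> ground M"
 shows "\<phi> H e \<in> carrier P" "\<phi> H e = pzero P \<longleftrightarrow> e \<in> H" "e \<notin> H ==> ev (lg \<phi> H e) = \<phi> H e"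
proof -
 show 1: "\<phi> H e \<in> carrier P" "\<phi> H e = pzero P \<longleftrightarrow> e \<in> H"
  using assms unfolding representations_def by blast+
 show "ev (lg \<phi> H e) = \<phi> H e" if "e \<notin> H" using ev_frag[of "\<phi> H e"] 1 that by simp
qed

text \<open>An element off \<open>cl M K\<close> lies on at most one of the three hyperplanes. At a
  point of one of them one summand vanishes and the other two are negatives of each other, so one
  zero coefficient would make all three zero. Hence the coefficients have logarithms.\<close>

lemma representation_triple:
 assumes \<phi>: "\<phi> \<in> representations M P" and K: "K \<in> indep M" "card K + 2 = rank_of M (ground M)"
  and H: "H1 \<in> hyperplanes M" "H2 \<in> hyperplanes M" "H3 \<in> hyperplanes M" "K \<subseteq> H1" "K \<subseteq> H2" "K \<subseteq> H3"
   "H1 \<noteq> H2" "H1 \<noteq> H3" "H2 \<noteq> H3"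
 obtains \<alpha> \<beta> \<gamma> where
  "\<And>e. e \<in> H3 - cl M K ==> \<beta> + lg \<phi> H2 e \<simeq> minus_one + (\<alpha> + lg \<phi> H1 e)"
  "\<And>e. e \<in> H1 - cl M K ==> \<gamma> + lg \<phi> H3 e \<simeq> minus_one + (\<beta> + lg \<phi> H2 e)"
  "\<And>e. e \<in> H2 - cl M K ==> \<gamma> + lg \<phi> H3 e \<simeq> minus_one + (\<alpha> + lg \<phi> H1 e)"
  "\<And>e. e \<in> ground M ==> e \<notin> H1 \<union> H2 \<union> H3 ==>
   {#ev (\<alpha> + lg \<phi> H1 e), ev (\<beta> + lg \<phi> H2 e), ev (\<gamma> + lg \<phi> H3 e)#} \<in> nullset P"
proof -
 have Int: "H1 \<inter> H2 = cl M K" "H1 \<inter> H3 = cl M K" "H2 \<inter> H3 = cl M K"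
  using hyperplane_Int[OF K] H by blast+
 have "corank_flat M 2 (cl M K)" using K corank_flat_iff by blast
 then have "corank_flat M 2 (H1 \<inter> H2 \<inter> H3)" using Int by (metis Int_assoc Int_absorb)
 then have "\<exists>a\<in>carrier P. \<exists>b\<in>carrier P. \<exists>c\<in>carrier P. (a, b, c) \<noteq> (pzero P, pzero P, pzero P) \<and>
   (\<forall>e\<in>ground M. {#a \<otimes> \<phi> H1 e, b \<otimes> \<phi> H2 e, c \<otimes> \<phi> H3 e#} \<in> nullset P)"
 proof -
  have "\<forall>H1\<in>hyperplanes M. \<forall>H2\<in>hyperplanes M. \<forall>H3\<in>hyperplanes M.
    H1 \<noteq> H2 \<and> H1 \<noteq> H3 \<and> H2 \<noteq> H3 \<and> corank_flat M 2 (H1 \<inter> H2 \<inter> H3) -->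
    (\<exists>a\<in>carrier P. \<exists>b\<in>carrier P. \<exists>c\<in>carrier P. (a, b, c) \<noteq> (pzero P, pzero P, pzero P) \<and>
      (\<forall>e\<in>ground M. {#a \<otimes> \<phi> H1 e, b \<otimes> \<phi> H2 e, c \<otimes> \<phi> H3 e#} \<in> nullset P))"
   using \<phi> unfolding representations_def mem_Collect_eq by (elim conjE)
  from this[rule_format, OF H(1-3)] \<open>corank_flat M 2 (H1 \<inter> H2 \<inter> H3)\<close> H(7-9) show ?thesis by simp
 qed
 then obtain a b c where abc: "a \<in> carrier P" "b \<in> carrier P" "c \<in> carrier P"
  "(a, b, c) \<noteq> (pzero P, pzero P, pzero P)"
  and null: "\<And>e. e \<in> ground M ==> {#a \<otimes> \<phi> H1 e, b \<otimes> \<phi> H2 e, c \<otimes> \<phi> H3 e#} \<in> nullset P"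
  by blast
 note val = representation_value[OF \<phi>]
 have gr: "e \<in> ground M" if "e \<in> H1 \<or> e \<in> H2 \<or> e \<in> H3" for e using that hyperplane_subset H(1-3) by blast
 have e3: "b \<otimes> \<phi> H2 e = pneg P (a \<otimes> \<phi> H1 e)" if "e \<in> H3 - cl M K" for e
 proof -
  have "\<phi> H3 e = pzero P" using val(2)[OF H(3) gr] that by blast
  then show ?thesis using null[OF gr, of e] that abc val(1)[OF H(1) gr, of e] val(1)[OF H(2) gr, of e]
   by (intro neg_unique[symmetric]) (auto simp: zero_absorb_right)
 qed
 have e1: "c \<otimes> \<phi> H3 e = pneg P (b \<otimes> \<phi> H2 e)" if "e \<in> H1 - cl M K" for e
 proof -
  have "\<phi> H1 e = pzero P" using val(2)[OF H(1) gr] that by blast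
  then show ?thesis using null[OF gr, of e] that abc val(1)[OF H(2) gr, of e] val(1)[OF H(3) gr, of e]
   by (intro neg_unique[symmetric]) (auto simp: zero_absorb_right add_mset_commute)
 qed
 have e2: "c \<otimes> \<phi> H3 e = pneg P (a \<otimes> \<phi> H1 e)" if "e \<in> H2 - cl M K" for e
 proof -
  have "\<phi> H2 e = pzero P" using val(2)[OF H(2) gr] that by blast
  then show ?thesis using null[OF gr, of e] that abc val(1)[OF H(1) gr, of e] val(1)[OF H(3) gr, of e]
   by (intro neg_unique[symmetric]) (auto simp: zero_absorb_right add_mset_commute)
 qed
 have nz: "x \<otimes> \<phi> H e \<in> nonzeros P \<longleftrightarrow> x \<in> nonzeros P"
  if "x \<in> carrier P" "H \<in> hyperplanes M" "e \<in> ground M" "e \<notin> H" for x H e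
  using that val(1,2)[OF that(2,3)] nonzeros_closed(1)[of x "\<phi> H e"] zero_absorb[of "\<phi> H e"] by auto
 have neg_nz: "pneg P x \<in> nonzeros P \<longleftrightarrow> x \<in> nonzeros P" if "x \<in> carrier P" for x
  using nonzeros_closed(4)[of x] pneg_zero that by auto
 obtain p1 where p1: "p1 \<in> H1" "p1 \<notin> cl M K" by (rule hyperplane_outside[OF K H(1)])
 obtain p2 where p2: "p2 \<in> H2" "p2 \<notin> cl M K" by (rule hyperplane_outside[OF K H(2)])
 obtain p3 where p3: "p3 \<in> H3" "p3 \<notin> cl M K" by (rule hyperplane_outside[OF K H(3)])
 have out: "p1 \<notin> H2" "p1 \<notin> H3" "p2 \<notin> H1" "p2 \<notin> H3" "p3 \<notin> H1" "p3 \<notin> H2"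
  using Int p1 p2 p3 by blast+
 have "b \<in> nonzeros P \<longleftrightarrow> a \<in> nonzeros P"
  using e3[of p3] p3 nz[OF abc(2) H(2) gr out(6)] nz[OF abc(1) H(1) gr out(5)] neg_nz[of "a \<otimes> \<phi> H1 p3"]
   val(1)[OF H(1) gr] abc by (metis DiffI m_closed)
 moreover have "c \<in> nonzeros P \<longleftrightarrow> a \<in> nonzeros P"
  using e2[of p2] p2 nz[OF abc(3) H(3) gr out(4)] nz[OF abc(1) H(1) gr out(3)] neg_nz[of "a \<otimes> \<phi> H1 p2"]
   val(1)[OF H(1) gr] abc by (metis DiffI m_closed)
 ultimately have abc': "a \<in> nonzeros P" "b \<in> nonzeros P" "c \<in> nonzeros P" using abc by auto
 have ev: "ev (frag_of x + lg \<phi> H e) = x \<otimes> \<phi> H e"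
  if "x \<in> nonzeros P" "H \<in> hyperplanes M" "e \<in> ground M" "e \<notin> H" for x H e
  using that val(3)[OF that(2-4)] ev_frag by (simp add: ev_add)
 have *: "frag_of y + lg \<phi> H' e \<simeq> minus_one + (frag_of x + lg \<phi> H e)"
  if "x \<in> nonzeros P" "H \<in> hyperplanes M" "e \<notin> H" "y \<in> nonzeros P" "H' \<in> hyperplanes M" "e \<notin> H'" "e \<in> ground M"
   "y \<otimes> \<phi> H' e = pneg P (x \<otimes> \<phi> H e)" for x y H H' e
  using ev[OF that(1,2,7,3)] ev[OF that(4,5,7,6)] that(8) pneg_ev[of "frag_of x + lg \<phi> H e"] by (simp add: cong_iff)
 show thesis
 proof (rule that[of "frag_of b" "frag_of a" "frag_of c"])
  show "frag_of b + lg \<phi> H2 e \<simeq> minus_one + (frag_of a + lg \<phi> H1 e)" if "e \<in> H3 - cl M K" for e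
   by (rule *[OF abc'(1) H(1) _ abc'(2) H(2) _ gr e3[OF that]]) (use that Int in auto)
  show "frag_of c + lg \<phi> H3 e \<simeq> minus_one + (frag_of b + lg \<phi> H2 e)" if "e \<in> H1 - cl M K" for e
   by (rule *[OF abc'(2) H(2) _ abc'(3) H(3) _ gr e1[OF that]]) (use that Int in auto)
  show "frag_of c + lg \<phi> H3 e \<simeq> minus_one + (frag_of a + lg \<phi> H1 e)" if "e \<in> H2 - cl M K" for e
   by (rule *[OF abc'(1) H(1) _ abc'(3) H(3) _ gr e2[OF that]]) (use that Int in auto)
  show "{#ev (frag_of a + lg \<phi> H1 e), ev (frag_of b + lg \<phi> H2 e), ev (frag_of c + lg \<phi> H3 e)#} \<in> nullset P"
   if "e \<in> ground M" "e \<notin> H1 \<union> H2 \<union> H3" for e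
   using null[OF that(1)] ev[OF abc'(1) H(1) that(1)] ev[OF abc'(2) H(2) that(1)] ev[OF abc'(3) H(3) that(1)] that(2)
   by simp
 qed
qed

definition cross_log :: "('a set => 'a => 'p) => 'a set => 'a set => 'a => 'a => 'p \<Rightarrow>\<^sub>0 int" where
 "cross_log \<phi> H1 H2 a b = lg \<phi> H1 a - lg \<phi> H1 b + lg \<phi> H2 b - lg \<phi> H2 a"

text \<open>Points on H2 and H3 determine the ratios of the coefficients in
  \<open>representation_triple\<close>. Eliminating them leaves the independence of the chosen
  point, the relation between the three hyperplanes at one point of each, and, off all three, the
  additive relation.\<close>

lemma representation_rank2:
 assumes \<phi>: "\<phi> \<in> representations M P" and K: "K \<in> indep M" "card K + 2 = rank_of M (ground M)"
  and H: "H1 \<in> hyperplanes M" "H2 \<in> hyperplanes M" "H3 \<in> hyperplanes M" "K \<subseteq> H1" "K \<subseteq> H2" "K \<subseteq> H3"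
   "H1 \<noteq> H2" "H1 \<noteq> H3" "H2 \<noteq> H3"
  and e: "e1 \<in> H1 - cl M K" "e2 \<in> H2 - cl M K" "e3 \<in> H3 - cl M K"
 shows "e \<in> H3 - cl M K ==> cross_log \<phi> H1 H2 e e3 \<simeq> 0"
  and "lg \<phi> H1 e3 - lg \<phi> H2 e3 + (lg \<phi> H2 e1 - lg \<phi> H3 e1) + (lg \<phi> H3 e2 - lg \<phi> H1 e2) \<simeq> minus_one"
  and "e \<in> ground M ==> e \<notin> H1 \<union> H2 \<union> H3 ==>
   {#ev (cross_log \<phi> H1 H2 e3 e), ev (cross_log \<phi> H1 H3 e2 e), pneg P \<one>#} \<in> nullset P"
proof -
 obtain \<alpha> \<beta> \<gamma> where c3: "\<And>e. e \<in> H3 - cl M K ==> \<beta> + lg \<phi> H2 e \<simeq> minus_one + (\<alpha> + lg \<phi> H1 e)"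
  and c1: "\<And>e. e \<in> H1 - cl M K ==> \<gamma> + lg \<phi> H3 e \<simeq> minus_one + (\<beta> + lg \<phi> H2 e)"
  and c2: "\<And>e. e \<in> H2 - cl M K ==> \<gamma> + lg \<phi> H3 e \<simeq> minus_one + (\<alpha> + lg \<phi> H1 e)"
  and c: "\<And>e. e \<in> ground M ==> e \<notin> H1 \<union> H2 \<union> H3 ==>
   {#ev (\<alpha> + lg \<phi> H1 e), ev (\<beta> + lg \<phi> H2 e), ev (\<gamma> + lg \<phi> H3 e)#} \<in> nullset P"
  by (rule representation_triple[OF \<phi> K H], rule that)
 have dbl: "minus_one + minus_one \<simeq> 0" using minus_one_double by (simp add: cong_0)
 show "cross_log \<phi> H1 H2 e e3 \<simeq> 0" if "e \<in> H3 - cl M K"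
  by (rule cong_eqI[OF cong_diff[OF c3[OF e(3)] c3[OF that]]]) (simp add: cross_log_def algebra_simps)
 show "lg \<phi> H1 e3 - lg \<phi> H2 e3 + (lg \<phi> H2 e1 - lg \<phi> H3 e1) + (lg \<phi> H3 e2 - lg \<phi> H1 e2) \<simeq> minus_one"
  by (rule cong_eqI[OF cong_diff[OF cong_diff[OF c2[OF e(2)] c1[OF e(1)]] cong_add[OF c3[OF e(3)] dbl]]])
   (simp add: algebra_simps)
 show "{#ev (cross_log \<phi> H1 H2 e3 e), ev (cross_log \<phi> H1 H3 e2 e), pneg P \<one>#} \<in> nullset P"
  if "e \<in> ground M" "e \<notin> H1 \<union> H2 \<union> H3"
 proof -
  define t where "t = minus_one - (\<alpha> + lg \<phi> H1 e)"
  have "t + (\<alpha> + lg \<phi> H1 e) = minus_one" by (simp add: t_def)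
  moreover have "t + (\<beta> + lg \<phi> H2 e) \<simeq> cross_log \<phi> H1 H2 e3 e"
   by (rule cong_eqI[OF cong_add[OF c3[OF e(3)] dbl]]) (simp add: t_def cross_log_def algebra_simps)
  moreover have "t + (\<gamma> + lg \<phi> H3 e) \<simeq> cross_log \<phi> H1 H3 e2 e"
   by (rule cong_eqI[OF cong_add[OF c2[OF e(2)] dbl]]) (simp add: t_def cross_log_def algebra_simps)
  ultimately show ?thesis
   using scale_nullset[OF c[OF that], of t] ev_minus_one by (simp add: cong_iff add_mset_commute)
 qed
qed

lemma ev_cross_log:
 assumes \<phi>: "\<phi> \<in> representations M P" and H: "H1 \<in> hyperplanes M" "H2 \<in> hyperplanes M"
  and ab: "a \<in> ground M" "b \<in> ground M" "a \<notin> H1" "a \<notin> H2" "b \<notin> H1" "b \<notin> H2"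
 shows "ev (cross_log \<phi> H1 H2 a b) = cross_ratio P \<phi> H1 H2 a b"
proof -
 note val = representation_value(3)[OF \<phi>]
 have "cross_log \<phi> H1 H2 a b = (lg \<phi> H1 a + lg \<phi> H2 b) - (lg \<phi> H1 b + lg \<phi> H2 a)"
  by (simp add: cross_log_def algebra_simps)
 then show ?thesis
  unfolding cross_ratio_def using val[OF H(1) ab(1)] val[OF H(1) ab(2)] val[OF H(2) ab(1)] val[OF H(2) ab(2)] ab
  by (simp add: ev_diff ev_add)
qed

lemma cross_log_simps:
 "cross_log \<phi> H H a b = 0" "cross_log \<phi> H1 H2 a a = 0" "cross_log \<phi> H2 H1 b a = cross_log \<phi> H1 H2 a b"
 "cross_log \<phi> H1 H2 b a = - cross_log \<phi> H1 H2 a b"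
 by (simp_all add: cross_log_def algebra_simps)

lemma cross_log_independent:
 assumes \<phi>: "\<phi> \<in> representations M P" and K: "K \<in> indep M" "card K + 2 = rank_of M (ground M)"
  and H: "H1 \<in> hyperplanes M" "H2 \<in> hyperplanes M" "H \<in> hyperplanes M" "K \<subseteq> H1" "K \<subseteq> H2" "K \<subseteq> H"
   "H1 \<noteq> H" "H2 \<noteq> H"
  and e: "a \<in> H - cl M K" "b \<in> H - cl M K"
 shows "cross_log \<phi> H1 H2 a b \<simeq> 0"
proof (cases "H1 = H2")
 case False
 obtain p1 where p1: "p1 \<in> H1" "p1 \<notin> cl M K" by (rule hyperplane_outside[OF K H(1)])
 obtain p2 where p2: "p2 \<in> H2" "p2 \<notin> cl M K" by (rule hyperplane_outside[OF K H(2)])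
 show ?thesis
  by (rule representation_rank2(1)[OF \<phi> K H(1-6) False H(7,8), of p1 p2]) (use p1 p2 e in auto)
qed (simp add: cross_log_simps)

text \<open>The difference of the relations for H1, H2, H4 and for H1, H2, H3.\<close>

lemma cross_log_transpose:
 assumes \<phi>: "\<phi> \<in> representations M P" and K: "K \<in> indep M" "card K + 2 = rank_of M (ground M)"
  and H: "H1 \<in> hyperplanes M" "H2 \<in> hyperplanes M" "H3 \<in> hyperplanes M" "H4 \<in> hyperplanes M"
   "K \<subseteq> H1" "K \<subseteq> H2" "K \<subseteq> H3" "K \<subseteq> H4" "distinct [H1, H2, H3, H4]"
  and e: "e1 \<in> H1 - cl M K" "e2 \<in> H2 - cl M K" "e3 \<in> H3 - cl M K" "e4 \<in> H4 - cl M K"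
 shows "cross_log \<phi> H3 H4 e1 e2 \<simeq> cross_log \<phi> H1 H2 e3 e4"
proof -
 have d: "H1 \<noteq> H2" "H1 \<noteq> H3" "H2 \<noteq> H3" "H1 \<noteq> H4" "H2 \<noteq> H4" using H(9) by auto
 show ?thesis
  by (rule cong_eqI[OF cong_diff[OF representation_rank2(2)[OF \<phi> K H(1,2,4,5,6,8) d(1,4,5) e(1,2,4)]
     representation_rank2(2)[OF \<phi> K H(1-3,5-7) d(1-3) e(1-3)]]])
   (simp add: cross_log_def algebra_simps)
qed

text \<open>The terms of H1 cancel, and the relation for H2, H3, H4 remains.\<close>

lemma cross_log_cyclic:
 assumes \<phi>: "\<phi> \<in> representations M P" and K: "K \<in> indep M" "card K + 2 = rank_of M (ground M)"
  and H: "H1 \<in> hyperplanes M" "H2 \<in> hyperplanes M" "H3 \<in> hyperplanes M" "H4 \<in> hyperplanes M"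
   "K \<subseteq> H1" "K \<subseteq> H2" "K \<subseteq> H3" "K \<subseteq> H4" "distinct [H1, H2, H3, H4]"
  and e: "e1 \<in> H1 - cl M K" "e2 \<in> H2 - cl M K" "e3 \<in> H3 - cl M K" "e4 \<in> H4 - cl M K"
 shows "cross_log \<phi> H1 H2 e3 e4 + cross_log \<phi> H1 H3 e4 e2 + cross_log \<phi> H1 H4 e2 e3 \<simeq> minus_one"
proof -
 have d: "H2 \<noteq> H3" "H2 \<noteq> H4" "H3 \<noteq> H4" using H(9) by auto
 show ?thesis
  by (rule cong_eqI[OF representation_rank2(2)[OF \<phi> K H(2-4,6-8) d e(2-4)]])
   (simp add: cross_log_def algebra_simps)
qed

text \<open>An edge of the basis graph over \<open>I\<close> compares two values on the hyperplane
  spanned by \<open>I\<close>. The holonomy of a triangle is the relation between three hyperplanes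
  over a corank 2 flat.\<close>

lemma representation_cochain:
 assumes \<phi>: "\<phi> \<in> representations M P"
 shows "cochain (bases M) minus_one (\<lambda>K a b u v. cross_log \<phi> (cl M (a ## K)) (cl M (b ## K)) u v)
  (\<lambda>I a b. lg \<phi> (cl M I) b - lg \<phi> (cl M I) a)"
 unfolding cochain_def
proof (intro conjI allI impI)
 fix K a b d
 assume h: "distinct [a, b, d] \<and> {a, b, d} \<inter> K = {} \<and> a ## b ## K \<in> bases M \<and>
  b ## d ## K \<in> bases M \<and> a ## d ## K \<in> bases M"
 let ?H = "\<lambda>x. cl M (x ## K)"
 have i: "a ## K \<in> indep M" "b ## K \<in> indep M" "d ## K \<in> indep M" "K \<in> indep M"
  by (rule indep_mono[OF bases_indep[of "a ## b ## K"]], use h in simp, blast,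
    rule indep_mono[OF bases_indep[of "a ## b ## K"]], use h in simp, blast,
    rule indep_mono[OF bases_indep[of "b ## d ## K"]], use h in simp, blast,
    rule indep_mono[OF bases_indep[of "b ## d ## K"]], use h in simp, blast)
 have c: "card K + 2 = rank_of M (ground M)"
  using h finite_indep[OF i(4)] by (auto simp: bases_def)
 have hyp: "?H a \<in> hyperplanes M" "?H b \<in> hyperplanes M" "?H d \<in> hyperplanes M"
  using closure_hyperplane(1)[of b "a ## K"] closure_hyperplane(1)[of a "b ## K"] closure_hyperplane(1)[of b "d ## K"] h
  by (auto simp: insert_commute)
 have mem: "x \<in> ?H x - cl M K" "K \<subseteq> ?H x" if "x ## K \<in> indep M" "x \<notin> K" for x
  using indep_subset_closure[OF that(1)] closure_indep_iff[OF i(4), of x] that indep_subset[OF that(1)] by auto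
 have ne: "?H x \<noteq> ?H y" if "x ## y ## K \<in> bases M" "x \<noteq> y" "x \<notin> K" "x ## K \<in> indep M" for x y
  using notin_closure[of x "y ## K"] that mem(1)[OF that(4,3)] by auto
 have n: "?H b \<noteq> ?H a" "?H b \<noteq> ?H d" "?H a \<noteq> ?H d"
  using ne[of a b] ne[of b d] ne[of a d] h i by auto
 have nK: "a \<notin> K" "b \<notin> K" "d \<notin> K" using h by auto
 show "lg \<phi> (?H b) d - lg \<phi> (?H b) a + (lg \<phi> (?H d) a - lg \<phi> (?H d) b) + (lg \<phi> (?H a) b - lg \<phi> (?H a) d) \<simeq> minus_one"
  by (rule cong_eqI[OF representation_rank2(2)[OF \<phi> i(4) c hyp(2,1,3) mem(2)[OF i(2) nK(2)] mem(2)[OF i(1) nK(1)]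
     mem(2)[OF i(3) nK(3)] n mem(1)[OF i(2) nK(2)] mem(1)[OF i(1) nK(1)] mem(1)[OF i(3) nK(3)]]])
   (simp add: algebra_simps)
qed (simp_all add: cross_log_def algebra_simps)

lemma cross_log_degenerate:
 assumes \<phi>: "\<phi> \<in> representations M P" and q: "quad (bases M) K a b u v"
  and d: "a ## b ## K \<notin> bases M \<or> u ## v ## K \<notin> bases M"
 shows "cross_log \<phi> (cl M (a ## K)) (cl M (b ## K)) u v \<simeq> 0"
proof (cases "a ## b ## K \<in> bases M")
 case False
 then show ?thesis using closure_eq_iff_bases(1)[OF q] by (simp add: cross_log_simps)
next
 case True
 then have eq: "cl M (u ## K) = cl M (v ## K)" using d closure_eq_iff_bases(2)[OF q] by blast
 note Q = quad_bases[OF q]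
 have hyp: "cl M (a ## K) \<in> hyperplanes M" "cl M (b ## K) \<in> hyperplanes M" "cl M (u ## K) \<in> hyperplanes M"
  using quad_theta(1)[OF q] by (auto simp: mem_theta)
 have sub: "K \<subseteq> cl M (a ## K)" "K \<subseteq> cl M (b ## K)" "K \<subseteq> cl M (u ## K)"
  using indep_subset_closure[OF Q(18)] indep_subset_closure[OF Q(19)] indep_subset_closure[OF Q(20)] by blast+
 have uv: "u \<in> cl M (u ## K) - cl M K" "v \<in> cl M (u ## K) - cl M K"
  using indep_subset_closure[OF Q(20)] indep_subset_closure[OF Q(21)] eq closure_indep_iff[OF Q(16), of u]
   closure_indep_iff[OF Q(16), of v] Q by auto
 have "a \<noteq> u" "u \<notin> cl M (a ## K)" "u \<notin> cl M (b ## K)"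
  using notin_closure[of u "a ## K"] notin_closure[of u "b ## K"] Q by (auto simp: insert_commute)
 then have ne: "cl M (a ## K) \<noteq> cl M (u ## K)" "cl M (b ## K) \<noteq> cl M (u ## K)" using uv by auto
 show ?thesis by (rule cross_log_independent[OF \<phi> Q(16,17) hyp sub ne uv])
qed

end

section \<open>Dual cochains and the sign forced by Fano minors\<close>

context signed_group
begin

lemma eps_triple: "eps + eps + eps \<simeq> eps"
 by (rule cong_eqI[OF eps_double[folded cong_0]]) simp

text \<open>Complementation turns edges over a common subset into edges below a common superset, so
  the first two conditions on a cochain change places. The shift by \<open>eps\<close>, which has
  order two, carries the holonomy over. For a = b the set \<open>E - J - {a, b}\<close> has the
  wrong size, which is why that value is set to 0.\<close>

lemma cochain_dual:
 assumes F: "F \<subseteq> Pow E" and X: "cochain F eps c X"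
 shows "cochain (dual_family E F) eps (cross_dual c) (\<lambda>J a b. if a = b then 0 else eps - X (E - J - {a, b}) a b)"
 unfolding cochain_def
proof (intro conjI allI impI)
 have dbl: "eps + eps \<simeq> 0" using eps_double by (simp add: cong_0)
 have mem: "b ## (E - J - {a, b}) \<in> F" "a ## (E - J - {a, b}) \<in> F"
  if "a ## J \<in> dual_family E F" "b ## J \<in> dual_family E F" "a \<notin> J" "b \<notin> J" "a \<noteq> b" for a b J
 proof -
  have s: "a ## J \<subseteq> E" "b ## J \<subseteq> E" using that dual_family_subset by blast+
  then have "E - a ## J = b ## (E - J - {a, b})" "E - b ## J = a ## (E - J - {a, b})" using that by auto
  then show "b ## (E - J - {a, b}) \<in> F" "a ## (E - J - {a, b}) \<in> F"
   using that(1,2) dual_family_iff[OF F s(1)] dual_family_iff[OF F s(2)] by auto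
 qed
 have swap: "X I a b + X I b a \<simeq> 0" if "a ## I \<in> F" "b ## I \<in> F" "a \<notin> I" "b \<notin> I" for I a b
 proof -
  have "X I a b + X I b a \<simeq> X I a a" by (rule cochain_path[OF X]) (use that in auto)
  moreover have "X I a a + X I a a \<simeq> X I a a" by (rule cochain_path[OF X]) (use that in auto)
  then have "X I a a \<simeq> 0" by (rule cong_eqI) simp
  ultimately show ?thesis by (rule cong_trans)
 qed
 {
  fix J a b d
  assume h: "{a, b, d} \<inter> J = {} \<and> a ## J \<in> dual_family E F \<and> b ## J \<in> dual_family E F \<and>
   d ## J \<in> dual_family E F"
  let ?Y = "\<lambda>J a b. if a = b then 0 else eps - X (E - J - {a, b}) a b"
  consider "a = b" | "b = d" | "a \<noteq> b" "a = d" | "distinct [a, b, d]" by auto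
  then show "?Y J a b + ?Y J b d \<simeq> ?Y J a d"
  proof cases
   case 3
   let ?I = "E - J - {a, b}"
   have I: "E - J - {b, a} = ?I" by auto
   have "X ?I a b + X ?I b a \<simeq> 0" by (rule swap) (use mem[of a J b] h 3 in auto)
   from cong_diff[OF dbl this] show ?thesis
    by (rule cong_eqI) (use 3 I in \<open>simp add: algebra_simps\<close>)
  next
   case 4
   define K where "K = E - J - {a, b, d}"
   have sub: "a ## J \<subseteq> E" "b ## J \<subseteq> E" "d ## J \<subseteq> E" using h dual_family_subset by blast+
   have K: "E - J - {a, b} = d ## K" "E - J - {b, d} = a ## K" "E - J - {a, d} = b ## K"
    unfolding K_def using sub 4 h by auto
   have "X (b ## K) a d + X (d ## K) b a + X (a ## K) d b \<simeq> eps"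
    by (rule cochain_triangle[OF X])
     (use mem[of a J b] mem[of b J d] mem[of a J d] h 4 in \<open>auto simp: K K_def\<close>)
   moreover have "X (d ## K) a b + X (d ## K) b a \<simeq> 0"
    by (rule swap) (use mem[of a J b] h 4 in \<open>auto simp: K K_def\<close>)
   moreover have "X (a ## K) b d + X (a ## K) d b \<simeq> 0"
    by (rule swap) (use mem[of b J d] h 4 in \<open>auto simp: K K_def\<close>)
   ultimately have "X (b ## K) a d + X (d ## K) b a + X (a ## K) d b -
     (X (d ## K) a b + X (d ## K) b a) - (X (a ## K) b d + X (a ## K) d b) \<simeq> eps - 0 - 0"
    by (intro cong_diff)
   from cong_add[OF this dbl]
   show ?thesis by (rule cong_eqI) (use 4 in \<open>simp add: K algebra_simps\<close>)
  qed simp_all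
 }
 {
  fix K a b d
  assume h: "distinct [a, b, d] \<and> {a, b, d} \<inter> K = {} \<and> a ## b ## K \<in> dual_family E F \<and>
   b ## d ## K \<in> dual_family E F \<and> a ## d ## K \<in> dual_family E F"
  let ?Y = "\<lambda>J a b. if a = b then 0 else eps - X (E - J - {a, b}) a b"
  define I where "I = E - K - {a, b, d}"
  have sub: "a ## b ## K \<subseteq> E" "b ## d ## K \<subseteq> E" "a ## d ## K \<subseteq> E"
   using h dual_family_subset by blast+
  have "E - a ## b ## K = d ## I" "E - b ## d ## K = a ## I" "E - a ## d ## K = b ## I"
   unfolding I_def using sub h by auto
  then have mI: "d ## I \<in> F" "a ## I \<in> F" "b ## I \<in> F"
   using dual_family_iff[OF F sub(1)] dual_family_iff[OF F sub(2)] dual_family_iff[OF F sub(3)] h by auto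
  have eq: "E - b ## K - {a, d} = I" "E - d ## K - {b, a} = I" "E - a ## K - {d, b} = I"
   unfolding I_def by auto
  have n: "{a, b, d} \<inter> I = {}" unfolding I_def by blast
  have "X I a d + X I d b \<simeq> X I a b" by (rule cochain_path[OF X]) (use mI n in auto)
  moreover have "X I a b + X I b a \<simeq> 0" by (rule swap) (use mI n in auto)
  ultimately have S: "X I a d + X I d b + (X I a b + X I b a) \<simeq> X I a b + 0" by (rule cong_add)
  have ne: "(a = d) = False" "(d = b) = False" "(b = a) = False" using h by auto
  show "?Y (b ## K) a d + ?Y (d ## K) b a + ?Y (a ## K) d b \<simeq> eps"
   unfolding ne if_False eq by (rule cong_eqI[OF cong_diff[OF eps_triple S]]) (simp add: algebra_simps)
 }
 {
  fix K a b u v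
  assume q: "quad (dual_family E F) K a b u v"
  let ?Y = "\<lambda>J a b. if a = b then 0 else eps - X (E - J - {a, b}) a b"
  let ?L = "E - K - {a, b, u, v}"
  have h: "K \<subseteq> E" "{a, b, u, v} \<subseteq> E" "{a, b, u, v} \<inter> K = {}" "quad F ?L a b u v"
   using q unfolding quad_dual[OF F] by blast+
  have d: "distinct [a, b, u, v]" using q by (simp add: quad_def)
  have eq: "E - b ## K - {u, v} = a ## ?L" "E - a ## K - {u, v} = b ## ?L" using h d by auto
  show "?Y (b ## K) u v - ?Y (a ## K) u v \<simeq> cross_dual c K a b u v"
   by (rule cong_eqI[OF cochain_quad[OF X h(4)]]) (use d in \<open>simp add: eq cross_dual_def\<close>)
 }
qed

text \<open>\<open>fano_cross_value\<close> gives \<open>eps\<close> for the square on x, y and e1,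
  e3 over e2. The seventh line e2 x y makes this square degenerate, so \<open>eps\<close> is
  trivial.\<close>

lemma fano_cochain:
 assumes X: "cochain F eps c X" and p: "fano_pattern F K p"
  and deg: "\<And>K a b u v. quad F K a b u v ==>
   a ## b ## K \<notin> F \<or> u ## v ## K \<notin> F ==> c K a b u v \<simeq> 0"
 shows "eps \<in> R"
proof -
 define T where "T a b d \<longleftrightarrow> a ## b ## d ## K \<in> F" for a b d
 have iff: "T (p a) (p b) (p d) \<longleftrightarrow>
    (a, b, d) \<notin> {(0, 1, 3), (1, 2, 4), (2, 3, 5), (3, 4, 6), (0, 4, 5), (1, 5, 6), (0, 2, 6)}"
  if "a < b" "b < d" "d < 7" for a b d
 proof -
  have "\<forall>a b c. a < b \<and> b < c \<and> c < 7 --> ((p a) ## (p b) ## (p c) ## K \<in> F \<longleftrightarrow>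
    (a, b, c) \<notin> {(0, 1, 3), (1, 2, 4), (2, 3, 5), (3, 4, 6), (0, 4, 5), (1, 5, 6), (0, 2, 6)})"
   using p unfolding fano_pattern_iff by (elim conjE)
  from this[rule_format, of a b d] that show ?thesis by (simp only: simp_thms T_def)
 qed
 have inj: "p i \<noteq> p j" if "i < 7" "j < 7" "i \<noteq> j" for i j
  using p that unfolding fano_pattern_def by (auto dest: inj_onD)
 have nK: "p i \<notin> K" if "i < 7" for i
 proof -
  have "p i \<in> p ` {0..<7}" using that by simp
  moreover have "p ` {0..<7} \<inter> K = {}" using p unfolding fano_pattern_def by (elim conjE)
  ultimately show ?thesis by blast
 qed
 have d: "distinct [p 0, p 1, p 2, p 3, p 4, p 6, p 5]" "{p 0, p 1, p 2, p 3, p 4, p 6, p 5} \<inter> K = {}"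
  using inj nK by auto
 have "X ((p 1) ## (p 5) ## K) (p 0) (p 2) - X ((p 1) ## (p 6) ## K) (p 0) (p 2) \<simeq> eps"
  by (rule fano_cross_value[OF _ _ deg T_def d]) (use X in \<open>auto intro: cochain_mono simp: iff\<close>)
 moreover have q: "quad F ((p 1) ## K) (p 6) (p 5) (p 0) (p 2)"
  using d iff[of 0 1 6] iff[of 1 2 6] iff[of 0 1 5] iff[of 1 2 5] unfolding quad_def T_def by (auto simp: insert_commute)
 moreover have "(p 6) ## (p 5) ## (p 1) ## K \<notin> F"
  using iff[of 1 5 6] unfolding T_def by (auto simp: insert_commute)
 ultimately have "X ((p 5) ## (p 1) ## K) (p 0) (p 2) - X ((p 6) ## (p 1) ## K) (p 0) (p 2) \<simeq> 0"
  "X ((p 5) ## (p 1) ## K) (p 0) (p 2) - X ((p 6) ## (p 1) ## K) (p 0) (p 2) \<simeq> eps"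
  using cong_trans[OF cochain_quad[OF X q] deg[OF q]] by (auto simp: insert_commute)
 then have "eps \<simeq> 0" using cong_trans cong_sym by blast
 then show ?thesis by (simp add: cong_0)
qed

end

section \<open>The relations as equations between units\<close>

definition rank3_config ::
  "'a matroid => 'a set => 'a set => 'a set => 'a set => 'a set => 'a set => 'a set => 'a set => 'a set => bool" where
 "rank3_config M H13 H23 H34 H35 H14 H24 H45 H15 H25 \<longleftrightarrow>
   (H13, H23, H34, H35) \<in> theta M \<and> (H14, H24, H45, H34) \<in> theta M \<and> (H15, H25, H35, H45) \<in> theta M \<and>
   (\<exists>L A1 A2 A3 A4 A5. L = \<Inter>{H13, H23, H34, H35, H14, H24, H45, H15, H25} \<and>
    corank_flat M 3 L \<and> (\<forall>i\<in>{A1, A2, A3, A4, A5}. atom_flat M i) \<and>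
    H13 = cl M (L \<union> A1 \<union> A3) \<and> H23 = cl M (L \<union> A2 \<union> A3) \<and> H34 = cl M (L \<union> A3 \<union> A4) \<and>
    H35 = cl M (L \<union> A3 \<union> A5) \<and> H14 = cl M (L \<union> A1 \<union> A4) \<and> H24 = cl M (L \<union> A2 \<union> A4) \<and>
    H45 = cl M (L \<union> A4 \<union> A5) \<and> H15 = cl M (L \<union> A1 \<union> A5) \<and> H25 = cl M (L \<union> A2 \<union> A5))"

text \<open>What a family of units must satisfy in order to extend to a morphism from the quotient,
  see \<open>cross_values_iff\<close>.\<close>

locale cross_values =
 fixes M :: "'a matroid" and P :: "'p pasture" (structure) and x :: "'a set \<times> 'a set \<times> 'a set \<times> 'a set => 'p"
 assumes x_nonzero: "t \<in> theta M ==> x t \<in> nonzeros P"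
  and x_minor: "has_minor M fano \<or> has_minor M (dual_matroid fano) ==> pneg P \<one> = \<one>"
  and x_sym: "(H1, H2, H3, H4) \<in> theta_nondeg M ==> x (H1, H2, H3, H4) = x (H2, H1, H4, H3) \<and>
   x (H1, H2, H3, H4) = x (H3, H4, H1, H2) \<and> x (H1, H2, H3, H4) = x (H4, H3, H2, H1)"
  and x_deg: "(H1, H2, H3, H4) \<in> theta M - theta_nondeg M ==> x (H1, H2, H3, H4) = \<one>"
  and x_inv: "(H1, H2, H3, H4) \<in> theta_nondeg M ==> x (H1, H2, H4, H3) = inv x (H1, H2, H3, H4)"
  and x_cyclic: "(H1, H2, H3, H4) \<in> theta_nondeg M ==>
   x (H1, H2, H3, H4) \<otimes> x (H1, H3, H4, H2) \<otimes> x (H1, H4, H2, H3) = pneg P \<one>"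
  and x_chain: "(H1, H2, H3, H4) \<in> theta_nondeg M \<and> (H1, H2, H4, H5) \<in> theta_nondeg M \<and>
   (H1, H2, H5, H3) \<in> theta_nondeg M ==>
   x (H1, H2, H3, H4) \<otimes> x (H1, H2, H4, H5) \<otimes> x (H1, H2, H5, H3) = \<one>"
  and x_rank3: "rank3_config M H13 H23 H34 H35 H14 H24 H45 H15 H25 ==>
   x (H13, H23, H34, H35) \<otimes> x (H14, H24, H45, H34) \<otimes> x (H15, H25, H35, H45) = \<one>"
  and x_plus: "(H1, H2, H3, H4) \<in> theta_nondeg M ==> {#x (H1, H2, H3, H4), x (H1, H3, H2, H4), pneg P \<one>#} \<in> nullset P"

lemma ball_setcompr4:
 "(\<forall>B\<in>{f a b c d | a b c d. p a b c d}. q B) \<longleftrightarrow> (\<forall>a b c d. p a b c d --> q (f a b c d))"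
 and ball_setcompr5:
 "(\<forall>B\<in>{g a b c d i | a b c d i. r a b c d i}. s B) \<longleftrightarrow> (\<forall>a b c d i. r a b c d i --> s (g a b c d i))"
 by blast+

lemma ball_setcompr9:
 "(\<forall>B\<in>{f a b c d i j k l m | a b c d i j k l m. p a b c d i j k l m}. q B) \<longleftrightarrow>
  (\<forall>a b c d i j k l m. p a b c d i j k l m --> q (f a b c d i j k l m))"
 by blast

lemma theta_nondeg_perm:
 assumes "(H1, H2, H3, H4) \<in> theta_nondeg M"
 shows "(H2, H1, H4, H3) \<in> theta_nondeg M" "(H3, H4, H1, H2) \<in> theta_nondeg M" "(H4, H3, H2, H1) \<in> theta_nondeg M"
  "(H1, H2, H4, H3) \<in> theta_nondeg M" "(H1, H3, H2, H4) \<in> theta_nondeg M" "(H1, H3, H4, H2) \<in> theta_nondeg M"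
  "(H1, H4, H2, H3) \<in> theta_nondeg M"
proof -
 define L where "L = H1 \<inter> H2 \<inter> H3 \<inter> H4"
 have L: "H1 \<inter> H2 = L" "H3 \<inter> H4 = L" "H1 \<inter> H3 = L" "H1 \<inter> H4 = L" "H2 \<inter> H3 = L" "H2 \<inter> H4 = L"
  "{H1, H2, H3, H4} \<subseteq> hyperplanes M" "corank_flat M 2 L"
  using assms unfolding mem_theta_nondeg mem_theta L_def[symmetric] by metis+
 have L': "H2 \<inter> H1 = L" "H4 \<inter> H3 = L" "H3 \<inter> H1 = L" "H4 \<inter> H1 = L" "H3 \<inter> H2 = L" "H4 \<inter> H2 = L"
  using L by (simp_all only: Int_commute)
 have 4: "L \<inter> H = L" if "H \<in> {H1, H2, H3, H4}" for H using that unfolding L_def by blast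
 show "(H2, H1, H4, H3) \<in> theta_nondeg M" "(H3, H4, H1, H2) \<in> theta_nondeg M" "(H4, H3, H2, H1) \<in> theta_nondeg M"
  "(H1, H2, H4, H3) \<in> theta_nondeg M" "(H1, H3, H2, H4) \<in> theta_nondeg M" "(H1, H3, H4, H2) \<in> theta_nondeg M"
  "(H1, H4, H2, H3) \<in> theta_nondeg M"
  unfolding mem_theta_nondeg mem_theta using L(7,8) by (simp_all add: L(1-6) L' 4)
qed

lemma hom_rel_eq:
 assumes P: "pasture P" and Q: "pasture Q" and h: "h \<in> pasture_hom P Q" and ab: "a \<in> carrier P" "b \<in> carrier P"
 shows "image_mset h (rel_eq P a b) \<in> nullset Q \<longleftrightarrow> h a = h b"
proof -
 interpret P: pasture P by fact
 interpret Q: pasture Q by fact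
 have hc: "h a \<in> carrier Q" "h b \<in> carrier Q" using h ab unfolding pasture_hom_def by blast+
 have m1: "pneg P \<one>\<^bsub>P\<^esub> \<in> carrier P" using P.neg_ex[OF P.one_closed] by blast
 have neg: "h (pneg P b) = pneg Q (h b)"
  using h ab(2) m1 P.neg_mult[OF ab(2)] Q.neg_mult[OF hc(2)] pasture_hom_neg_one[OF P Q h]
  unfolding pasture_hom_def by auto
 have nn: "pneg Q (pneg Q y) = y" "pneg Q y \<in> carrier Q" if "y \<in> carrier Q" for y
 proof -
  show c: "pneg Q y \<in> carrier Q" using Q.neg_ex[OF that] by blast
  show "pneg Q (pneg Q y) = y"
   using Q.neg_ex[OF that] by (intro Q.neg_unique[OF c that]) (simp add: add_mset_commute)
 qed
 have "image_mset h (rel_eq P a b) = {#h a, pneg Q (h b), pzero Q#}"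
  using h neg by (simp add: rel_eq_def pasture_hom_def)
 also have "\<dots> \<in> nullset Q \<longleftrightarrow> pneg Q (h b) = pneg Q (h a)"
  using Q.neg_unique[OF hc(1) nn(2)[OF hc(2)]] Q.neg_ex[OF hc(1)] by auto
 also have "\<dots> \<longleftrightarrow> h a = h b" using nn hc by metis
 finally show ?thesis .
qed

lemma pasture_hom_mult: "g \<in> pasture_hom P Q ==> a \<in> carrier P ==> b \<in> carrier P ==> g (a \<otimes>\<^bsub>P\<^esub> b) = g a \<otimes>\<^bsub>Q\<^esub> g b"
 and pasture_hom_closed: "g \<in> pasture_hom P Q ==> a \<in> carrier P ==> g a \<in> carrier Q"
 and pasture_hom_zero: "g \<in> pasture_hom P Q ==> g (pzero P) = pzero Q"
 and pasture_hom_one: "g \<in> pasture_hom P Q ==> g \<one>\<^bsub>P\<^esub> = \<one>\<^bsub>Q\<^esub>"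
 and pasture_hom_null: "g \<in> pasture_hom P Q ==> A \<in> nullset P ==> image_mset g A \<in> nullset Q"
 unfolding pasture_hom_def by blast+

lemma pasture_hom_inv:
 assumes "pasture P" "pasture Q" "g \<in> pasture_hom P Q" "a \<in> nonzeros P"
 shows "g (inv\<^bsub>P\<^esub> a) = inv\<^bsub>Q\<^esub> (g a)"
proof -
 interpret P: pasture P by fact
 interpret Q: pasture Q by fact
 have a: "a \<in> carrier P" "a \<in> Units P" "inv\<^bsub>P\<^esub> a \<in> carrier P"
  using assms(4) P.Units_nonzeros P.nonzeros_closed(2) by auto
 note g = pasture_hom_mult[OF assms(3)] pasture_hom_closed[OF assms(3)] pasture_hom_one[OF assms(3)]
 have "g a \<otimes>\<^bsub>Q\<^esub> g (inv\<^bsub>P\<^esub> a) = \<one>\<^bsub>Q\<^esub>" "g (inv\<^bsub>P\<^esub> a) \<otimes>\<^bsub>Q\<^esub> g a = \<one>\<^bsub>Q\<^esub>"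
  using g(1)[OF a(1,3)] g(1)[OF a(3,1)] g(3) P.Units_r_inv[OF a(2)] P.Units_l_inv[OF a(2)] by simp_all
 then show ?thesis using g(2) a by (intro Q.inv_unique')
qed

lemma cross_values_iff:
 assumes P: "pasture P" and h: "h \<in> pasture_hom (cross_algebra M) P"
  and hx: "\<And>t. t \<in> theta M ==> h (free_gen t) = x t"
 shows "(\<forall>B\<in>cross_relations M. image_mset h B \<in> nullset P) \<longleftrightarrow> cross_values M P x"
proof -
 let ?A = "cross_algebra M"
 interpret A: pasture ?A by (rule pasture_free_algebra)
 interpret P: pasture P by fact
 have sub: "t \<in> theta M" if "t \<in> theta_nondeg M" for t using that by (auto simp: theta_nondeg_def)
 have gen: "free_gen t \<in> nonzeros ?A" if "t \<in> theta M" for t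
  using that by (auto simp: free_gen_def free_algebra_simps signed_monomials_simps)
 have genc: "free_gen t \<in> carrier ?A" if "t \<in> theta M" for t using gen[OF that] by blast
 have nz: "\<forall>t. t \<in> theta M --> x t \<in> nonzeros P"
  using pasture_hom_Units[OF A.pasture_axioms P h gen] hx by simp
 have m1: "pneg ?A \<one>\<^bsub>?A\<^esub> \<in> carrier ?A" using A.neg_ex[OF A.one_closed] by blast
 have h1: "h \<one>\<^bsub>?A\<^esub> = \<one>\<^bsub>P\<^esub>" using h by (simp add: pasture_hom_def)
 have hm1: "h (pneg ?A \<one>\<^bsub>?A\<^esub>) = pneg P \<one>\<^bsub>P\<^esub>" by (rule pasture_hom_neg_one[OF A.pasture_axioms P h])
 note eq = hom_rel_eq[OF A.pasture_axioms P h]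
 have hm: "h (a \<otimes>\<^bsub>?A\<^esub> b \<otimes>\<^bsub>?A\<^esub> c) = h a \<otimes>\<^bsub>P\<^esub> h b \<otimes>\<^bsub>P\<^esub> h c"
  if "a \<in> carrier ?A" "b \<in> carrier ?A" "c \<in> carrier ?A" for a b c
  using that pasture_hom_mult[OF h] by simp
 have hinv: "h (inv\<^bsub>?A\<^esub> free_gen t) = inv\<^bsub>P\<^esub> x t" "inv\<^bsub>?A\<^esub> free_gen t \<in> carrier ?A" if "t \<in> theta M" for t
  using pasture_hom_inv[OF A.pasture_axioms P h gen[OF that]] hx[OF that] A.nonzeros_closed(2)[OF gen[OF that]] by auto
 note perm = theta_nondeg_perm[THEN sub]
 have config: "(H13, H23, H34, H35) \<in> theta M" "(H14, H24, H45, H34) \<in> theta M" "(H15, H25, H35, H45) \<in> theta M"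
  if "rank3_config M H13 H23 H34 H35 H14 H24 H45 H15 H25" for H13 H23 H34 H35 H14 H24 H45 H15 H25
  using iffD1[OF rank3_config_def that] by simp_all
 have four: "(\<forall>B\<in>R_four M. image_mset h B \<in> nullset P) \<longleftrightarrow> (\<forall>H13 H23 H34 H35 H14 H24 H45 H15 H25.
    rank3_config M H13 H23 H34 H35 H14 H24 H45 H15 H25 -->
    image_mset h (rel_eq ?A (cr H13 H23 H34 H35 \<otimes>\<^bsub>?A\<^esub> cr H14 H24 H45 H34 \<otimes>\<^bsub>?A\<^esub> cr H15 H25 H35 H45) \<one>\<^bsub>?A\<^esub>) \<in> nullset P)"
  unfolding R_four_def Let_def rank3_config_def[symmetric] by (rule ball_setcompr9)
 show ?thesis
  unfolding cross_values_def cross_relations_def ball_Un four R_minus_def R_sigma_def R_zero_def R_one_def R_two_def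
   R_three_def R_plus_def Let_def ball_UN Ball_def[of "theta_nondeg M"] split_paired_All prod.case ball_setcompr4 ball_setcompr5
  by (simp only: eqTrueI[OF nz[unfolded split_paired_All]] simp_thms conj_assoc,
    intro arg_cong2[where f = "(\<and>)"] all_cong1 imp_cong refl)
   (auto simp: perm sub config hx h1 hm1 hm m1 eq genc hinv rel_sum_one_def)
qed

section \<open>Frames of corank 2 flats and atoms over corank 3 flats\<close>

context matroid
begin

lemma theta_Int:
 assumes t: "(H1, H2, H3, H4) \<in> theta M" and K: "K \<in> indep M" "card K + 2 = rank_of M (ground M)"
  and sub: "K \<subseteq> H1" "K \<subseteq> H2" "K \<subseteq> H3" "K \<subseteq> H4"
 shows "H1 \<inter> H2 \<inter> H3 \<inter> H4 = cl M K"
proof (rule corank_flat_basis[OF _ K(1) _ K(2)])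
 show "corank_flat M 2 (H1 \<inter> H2 \<inter> H3 \<inter> H4)" using t unfolding mem_theta by (elim conjE)
qed (use sub in blast)

lemma theta_Int_pairs:
 assumes "(H1, H2, H3, H4) \<in> theta M" "K \<in> indep M" "card K + 2 = rank_of M (ground M)"
  "K \<subseteq> H1" "K \<subseteq> H2" "K \<subseteq> H3" "K \<subseteq> H4"
 shows "H1 \<in> hyperplanes M" "H2 \<in> hyperplanes M" "H3 \<in> hyperplanes M" "H4 \<in> hyperplanes M"
  "H1 \<inter> H3 = cl M K" "H1 \<inter> H4 = cl M K" "H2 \<inter> H3 = cl M K" "H2 \<inter> H4 = cl M K"
proof -
 note T = assms(1)[unfolded mem_theta theta_Int[OF assms]]
 show "H1 \<in> hyperplanes M" "H2 \<in> hyperplanes M" "H3 \<in> hyperplanes M" "H4 \<in> hyperplanes M"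
  using conjunct1[OF T] by simp_all
 note T' = T[THEN conjunct2, THEN conjunct2]
 show "H1 \<inter> H3 = cl M K" by (rule T'[THEN conjunct1, symmetric])
 show "H1 \<inter> H4 = cl M K" by (rule T'[THEN conjunct2, THEN conjunct1, symmetric])
 show "H2 \<inter> H3 = cl M K" by (rule T'[THEN conjunct2, THEN conjunct2, THEN conjunct1, symmetric])
 show "H2 \<inter> H4 = cl M K" by (rule T'[THEN conjunct2, THEN conjunct2, THEN conjunct2, symmetric])
qed

lemma flat_closure_subset: "flat M X ==> I \<in> indep M ==> I \<subseteq> X ==> cl M I \<subseteq> X"
 using extend_indep[of I X] flat_eq_closure[of X] closure_mono_indep[of _ I] indep_subset_closure by metis

lemma atom_closure:
 assumes "atom_flat M A" "e \<in> A" "e \<notin> cl M {}"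
 shows "{e} \<in> indep M" "A = cl M {e}"
proof -
 have f: "flat M A" using assms(1) by (simp add: atom_flat_def)
 then have eg: "e \<in> ground M" using assms(2) by (auto simp: flat_def)
 show i: "{e} \<in> indep M" using closure_indep_iff[OF empty_indep eg] assms(3) by simp
 have "cl M {e} \<subseteq> A" by (rule flat_closure_subset[OF f i]) (use assms(2) in simp)
 moreover have "e \<in> cl M {e}" using indep_subset_closure[OF i] by simp
 ultimately show "A = cl M {e}"
  using assms(1,3) flat_closure[OF i] unfolding atom_flat_def by blast
qed

lemma atom_element: "atom_flat M A ==> \<exists>e\<in>A. e \<notin> cl M {}"
 using flat_closure_subset[OF _ empty_indep, of A] unfolding atom_flat_def by blast

text \<open>The hyperplane has rank \<open>card K + 2\<close>, so the two atoms can span it over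
  \<open>cl M K\<close> only if each of them raises the rank by one.\<close>

lemma closure_atoms:
 assumes K: "K \<in> indep M" "card K + 3 = rank_of M (ground M)"
  and e: "{e} \<in> indep M" "{e'} \<in> indep M" and H: "cl M (cl M K \<union> cl M {e} \<union> cl M {e'}) \<in> hyperplanes M"
 shows "e ## e' ## K \<in> indep M" "e \<noteq> e'" "e \<notin> K" "e' \<notin> K"
  "cl M (cl M K \<union> cl M {e} \<union> cl M {e'}) = cl M (e ## e' ## K)"
proof -
 let ?X = "cl M K \<union> cl M {e} \<union> cl M {e'}" and ?Y = "e ## e' ## K"
 have YX: "?Y \<subseteq> ?X" using indep_subset_closure[OF K(1)] indep_subset_closure[OF e(1)] indep_subset_closure[OF e(2)] by blast
 obtain J where J: "J \<in> indep M" "K \<subseteq> J" "J \<subseteq> ?Y" "card J = rank_of M ?Y"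
  using extend_indep[OF K(1), of ?Y] by blast
 have clY: "cl M ?Y = cl M J" by (rule closure_of_basis[OF J(1,3,4)])
 have Yg: "?Y \<subseteq> ground M" using indep_subset[OF K(1)] indep_subset[OF e(1)] indep_subset[OF e(2)] by blast
 have Ysub: "?Y \<subseteq> cl M J"
  unfolding clY[symmetric] using Yg by (auto simp: closure_of_set_def insert_absorb)
 have XJ: "?X \<subseteq> cl M J"
  by (intro Un_least closure_mono_indep[OF J(1)] K(1) e; use Ysub in simp)
 have rX: "card J = rank_of M ?X"
  using rank_mono[OF XJ] rank_closure[OF J(1)] card_le_rank[OF J(1), of ?X] J(3) YX by auto
 have clX: "cl M ?X = cl M J" by (rule closure_of_basis[OF J(1) _ rX]) (use J(3) YX in blast)
 have "card J + 1 = rank_of M (ground M)"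
  using H rank_closure[OF J(1)] unfolding clX by (simp add: hyperplanes_def corank_flat_def)
 then have cJ: "card J = Suc (Suc (card K))" using K(2) by simp
 have fK: "finite K" by (rule finite_indep[OF K(1)])
 have "card ?Y \<ge> card J" using J(3) fK by (intro card_mono) auto
 then have cY: "card ?Y = Suc (Suc (card K))" "e \<noteq> e' \<and> e \<notin> K \<and> e' \<notin> K"
 proof -
  have c: "card (e' ## K) = (if e' \<in> K then card K else Suc (card K))"
   "card ?Y = (if e \<in> e' ## K then card (e' ## K) else Suc (card (e' ## K)))"
   using card_insert_if[of K e'] card_insert_if[of "e' ## K" e] fK by simp_all
  assume le: "card J \<le> card ?Y"
  have "e' \<notin> K" "e \<notin> e' ## K" using c le cJ by (auto split: if_splits)
  then show "card ?Y = Suc (Suc (card K))" "e \<noteq> e' \<and> e \<notin> K \<and> e' \<notin> K" using c by auto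
 qed
 have "J = ?Y" by (rule card_seteq) (use J(3) fK cJ cY in auto)
 then show "e ## e' ## K \<in> indep M" "e \<noteq> e'" "e \<notin> K" "e' \<notin> K"
  "cl M ?X = cl M (e ## e' ## K)" using J(1) cY(2) clX by auto
qed

lemma theta_frame:
 assumes t: "(H1, H2, H3, H4) \<in> theta M"
 obtains K e1 e2 e3 e4 where "K \<in> indep M" "card K + 2 = rank_of M (ground M)"
  "K \<subseteq> H1" "K \<subseteq> H2" "K \<subseteq> H3" "K \<subseteq> H4"
  "e1 \<in> H1 - cl M K" "e2 \<in> H2 - cl M K" "e3 \<in> H3 - cl M K" "e4 \<in> H4 - cl M K"
proof -
 obtain K where K: "K \<in> indep M" "card K + 2 = rank_of M (ground M)"
  "K \<subseteq> H1" "K \<subseteq> H2" "K \<subseteq> H3" "K \<subseteq> H4" "H1 \<in> hyperplanes M" "H2 \<in> hyperplanes M" "H3 \<in> hyperplanes M" "H4 \<in> hyperplanes M"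
  by (rule theta_basis[OF t], rule that)
 obtain e1 where e1: "e1 \<in> H1" "e1 \<notin> cl M K" by (rule hyperplane_outside[OF K(1,2,7)])
 obtain e2 where e2: "e2 \<in> H2" "e2 \<notin> cl M K" by (rule hyperplane_outside[OF K(1,2,8)])
 obtain e3 where e3: "e3 \<in> H3" "e3 \<notin> cl M K" by (rule hyperplane_outside[OF K(1,2,9)])
 obtain e4 where e4: "e4 \<in> H4" "e4 \<notin> cl M K" by (rule hyperplane_outside[OF K(1,2,10)])
 show thesis by (rule that[OF K(1-6), of e1 e2 e3 e4]) (use e1 e2 e3 e4 in auto)
qed

end

context matroid_pasture
begin

text \<open>The choice of the two points is immaterial by \<open>cross_map_log\<close>.\<close>

definition cross_map :: "('a set => 'a => 'p) => 'a set \<times> 'a set \<times> 'a set \<times> 'a set => 'p" where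
 "cross_map \<phi> = (\<lambda>(H1, H2, H3, H4). cross_ratio P \<phi> H1 H2 (SOME a. a \<in> H3 - H1 \<inter> H2 \<inter> H3 \<inter> H4)
   (SOME b. b \<in> H4 - H1 \<inter> H2 \<inter> H3 \<inter> H4))"

lemma cross_map_log:
 assumes \<phi>: "\<phi> \<in> representations M P" and t: "(H1, H2, H3, H4) \<in> theta M"
  and K: "K \<in> indep M" "card K + 2 = rank_of M (ground M)" "K \<subseteq> H1" "K \<subseteq> H2" "K \<subseteq> H3" "K \<subseteq> H4"
  and ab: "a \<in> H3 - cl M K" "b \<in> H4 - cl M K"
 shows "cross_map \<phi> (H1, H2, H3, H4) = ev (cross_log \<phi> H1 H2 a b)"
  and "cross_ratio P \<phi> H1 H2 a b = ev (cross_log \<phi> H1 H2 a b)"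
proof -
 note L = theta_Int[OF t K]
 note H = theta_Int_pairs[OF t K]
 have ne: "H1 \<noteq> H3" "H1 \<noteq> H4" "H2 \<noteq> H3" "H2 \<noteq> H4"
  using H(5) H(6) H(7) H(8) ab by blast+
 define a' where "a' = (SOME a. a \<in> H3 - cl M K)"
 define b' where "b' = (SOME b. b \<in> H4 - cl M K)"
 have a': "a' \<in> H3 - cl M K" unfolding a'_def by (rule someI[of _ a]) (rule ab)
 have b': "b' \<in> H4 - cl M K" unfolding b'_def by (rule someI[of _ b]) (rule ab)
 have val: "ev (cross_log \<phi> H1 H2 c d) = cross_ratio P \<phi> H1 H2 c d" if "c \<in> H3 - cl M K" "d \<in> H4 - cl M K" for c d
 proof (rule ev_cross_log[OF \<phi> H(1,2)])
  show "c \<in> ground M" "d \<in> ground M" using that hyperplane_subset[OF H(3)] hyperplane_subset[OF H(4)] by blast+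
  show "c \<notin> H1" using that(1) H(5) by blast
  show "c \<notin> H2" using that(1) H(7) by blast
  show "d \<notin> H1" using that(2) H(6) by blast
  show "d \<notin> H2" using that(2) H(8) by blast
 qed
 show "cross_ratio P \<phi> H1 H2 a b = ev (cross_log \<phi> H1 H2 a b)" using val[OF ab] by simp
 have "cross_log \<phi> H1 H2 a' b' \<simeq> cross_log \<phi> H1 H2 a b"
  by (rule cong_eqI[OF cong_diff[OF cross_log_independent[OF \<phi> K(1,2) H(1-3) K(3-5) ne(1,3) a' ab(1)]
     cross_log_independent[OF \<phi> K(1,2) H(1,2,4) K(3,4,6) ne(2,4) b' ab(2)]]])
   (simp add: cross_log_def algebra_simps)
 then show "cross_map \<phi> (H1, H2, H3, H4) = ev (cross_log \<phi> H1 H2 a b)"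
  unfolding cross_map_def prod.case L a'_def[symmetric] b'_def[symmetric] using val[OF a' b'] by (simp add: cong_iff)
qed

lemma cross_map_eq:
 assumes \<phi>: "\<phi> \<in> representations M P" and t: "(H1, H2, H3, H4) \<in> theta M"
  and ab: "a \<in> H3 - H1 \<inter> H2 \<inter> H3 \<inter> H4" "b \<in> H4 - H1 \<inter> H2 \<inter> H3 \<inter> H4"
 shows "cross_map \<phi> (H1, H2, H3, H4) = cross_ratio P \<phi> H1 H2 a b"
proof -
 obtain K where K: "K \<in> indep M" "card K + 2 = rank_of M (ground M)" "H1 \<inter> H2 \<inter> H3 \<inter> H4 = cl M K"
  "K \<subseteq> H1" "K \<subseteq> H2" "K \<subseteq> H3" "K \<subseteq> H4"
  by (rule theta_basis[OF t], rule that)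
 show ?thesis using cross_map_log[OF \<phi> t K(1,2,4-7) ab[unfolded K(3)]] by simp
qed

text \<open>For x = e1 and for x = e2, the hyperplanes through x and e3, e4, e5 satisfy the relation
  of \<open>representation_rank2\<close> over \<open>x ## K\<close>, evaluated at e5, e3, e4. The
  difference of the two instances is the logarithm of the product.\<close>

lemma cross_map_rank3:
 assumes \<phi>: "\<phi> \<in> representations M P"
  and th: "(H13, H23, H34, H35) \<in> theta M" "(H14, H24, H45, H34) \<in> theta M" "(H15, H25, H35, H45) \<in> theta M"
  and L: "corank_flat M 3 L" and A: "\<forall>i\<in>{A1, A2, A3, A4, A5}. atom_flat M i"
  and H: "H13 = cl M (L \<union> A1 \<union> A3)" "H23 = cl M (L \<union> A2 \<union> A3)" "H34 = cl M (L \<union> A3 \<union> A4)" "H35 = cl M (L \<union> A3 \<union> A5)"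
   "H14 = cl M (L \<union> A1 \<union> A4)" "H24 = cl M (L \<union> A2 \<union> A4)" "H45 = cl M (L \<union> A4 \<union> A5)" "H15 = cl M (L \<union> A1 \<union> A5)"
   "H25 = cl M (L \<union> A2 \<union> A5)"
 shows "cross_map \<phi> (H13, H23, H34, H35) \<otimes> cross_map \<phi> (H14, H24, H45, H34) \<otimes> cross_map \<phi> (H15, H25, H35, H45) = \<one>"
proof -
 obtain K where K: "K \<in> indep M" "card K + 3 = rank_of M (ground M)" "L = cl M K" using L corank_flat_iff by blast
 have ex: "\<exists>e. {e} \<in> indep M \<and> A = cl M {e}" if "A \<in> {A1, A2, A3, A4, A5}" for A
  using atom_element[of A] atom_closure[of A] A that by blast
 obtain e1 where e1: "{e1} \<in> indep M" "A1 = cl M {e1}" using ex[of A1] by auto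
 obtain e2 where e2: "{e2} \<in> indep M" "A2 = cl M {e2}" using ex[of A2] by auto
 obtain e3 where e3: "{e3} \<in> indep M" "A3 = cl M {e3}" using ex[of A3] by auto
 obtain e4 where e4: "{e4} \<in> indep M" "A4 = cl M {e4}" using ex[of A4] by auto
 obtain e5 where e5: "{e5} \<in> indep M" "A5 = cl M {e5}" using ex[of A5] by auto
 note e = e1(1) e2(1) e3(1) e4(1) e5(1) and A_eq = e1(2) e2(2) e3(2) e4(2) e5(2)
 define N where "N x y = cl M (x ## y ## K)" for x y
 define good where "good x y \<longleftrightarrow> x ## y ## K \<in> indep M \<and> x \<noteq> y \<and> x \<notin> K \<and> y \<notin> K \<and> N x y \<in> hyperplanes M" for x y
 have N_sym: "N x y = N y x" "good x y \<longleftrightarrow> good y x" for x y unfolding N_def good_def by (auto simp: insert_commute)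
 have hyp: "H13 \<in> hyperplanes M" "H23 \<in> hyperplanes M" "H34 \<in> hyperplanes M" "H35 \<in> hyperplanes M"
   "H14 \<in> hyperplanes M" "H24 \<in> hyperplanes M" "H45 \<in> hyperplanes M" "H15 \<in> hyperplanes M" "H25 \<in> hyperplanes M"
  using th by (auto simp: mem_theta)
 have span: "cl M (cl M K \<union> cl M {x} \<union> cl M {y}) = N x y \<and> good x y"
  if "{x} \<in> indep M" "{y} \<in> indep M" "cl M (cl M K \<union> cl M {x} \<union> cl M {y}) \<in> hyperplanes M" for x y
  using closure_atoms[OF K(1,2) that] that(3) unfolding N_def good_def by auto
 note H' = H[unfolded K(3) A_eq]
 have HN: "H13 = N e1 e3" "H23 = N e2 e3" "H34 = N e3 e4" "H35 = N e3 e5" "H14 = N e1 e4" "H24 = N e2 e4" "H45 = N e4 e5"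
   "H15 = N e1 e5" "H25 = N e2 e5"
  and g: "good e1 e3" "good e2 e3" "good e3 e4" "good e3 e5" "good e1 e4" "good e2 e4" "good e4 e5" "good e1 e5" "good e2 e5"
  using span[OF e(1,3)] span[OF e(2,3)] span[OF e(3,4)] span[OF e(3,5)] span[OF e(1,4)] span[OF e(2,4)] span[OF e(4,5)]
   span[OF e(1,5)] span[OF e(2,5)] hyp unfolding H' by (simp_all only: simp_thms)
 have K1: "x ## K \<in> indep M" "card (x ## K) + 2 = rank_of M (ground M)" "x ## K \<subseteq> N x y" "N x y \<in> hyperplanes M"
  "y \<in> N x y - cl M (x ## K)" if "good x y" for x y
 proof -
  have gd: "x ## y ## K \<in> indep M" "x \<noteq> y" "x \<notin> K" "y \<notin> K" "N x y \<in> hyperplanes M"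
   using that unfolding good_def by auto
  show i: "x ## K \<in> indep M" by (rule indep_mono[OF gd(1)]) blast
  show "card (x ## K) + 2 = rank_of M (ground M)" using gd(3) finite_indep[OF K(1)] K(2) by simp
  have s: "x ## y ## K \<subseteq> N x y" unfolding N_def by (rule indep_subset_closure[OF gd(1)])
  then show "x ## K \<subseteq> N x y" by blast
  show "N x y \<in> hyperplanes M" by (rule gd(5))
  have "y \<in> ground M" using indep_subset[OF gd(1)] by blast
  then have "y \<notin> cl M (x ## K)" using closure_indep_iff[OF i, of y] gd by (simp add: insert_commute)
  then show "y \<in> N x y - cl M (x ## K)" using s by blast
 qed
 have ne: "N x y \<noteq> N x z" if "good x y" "good x z" "good y z" "N x y \<noteq> N y z" for x y z
 proof
  assume eq: "N x y = N x z"
  have "y ## z ## K \<subseteq> N x y"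
   using K1(3,5)[OF that(1)] K1(5)[OF that(2)] eq by auto
  moreover have "card (y ## z ## K) = card (x ## y ## K)"
   using that finite_indep[OF K(1)] unfolding good_def by simp
  ultimately have "N y z = N x y"
   unfolding N_def using that unfolding good_def by (intro closure_eqI) auto
  then show False using that(4) by simp
 qed
 have dis: "N e1 e3 \<noteq> N e3 e4" "N e1 e3 \<noteq> N e3 e5" "N e2 e3 \<noteq> N e3 e4" "N e2 e3 \<noteq> N e3 e5"
  "N e1 e4 \<noteq> N e4 e5" "N e2 e4 \<noteq> N e4 e5"
  using theta_basis[OF th(1)] theta_basis[OF th(2)] unfolding HN by metis+
 have hex: "lg \<phi> (N x e3) e5 - lg \<phi> (N x e4) e5 + (lg \<phi> (N x e4) e3 - lg \<phi> (N x e5) e3)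
   + (lg \<phi> (N x e5) e4 - lg \<phi> (N x e3) e4) \<simeq> minus_one"
  if gx: "good x e3" "good x e4" "good x e5" and dx: "N x e3 \<noteq> N e3 e4" "N x e3 \<noteq> N e3 e5" "N x e4 \<noteq> N e4 e5" for x
  by (rule representation_rank2(2)[OF \<phi> K1(1,2)[OF gx(1)] K1(4)[OF gx(1)] K1(4)[OF gx(2)] K1(4)[OF gx(3)]
     K1(3)[OF gx(1)] K1(3)[OF gx(2)] K1(3)[OF gx(3)] ne[OF gx(1,2) g(3) dx(1)] ne[OF gx(1,3) g(4) dx(2)]
     ne[OF gx(2,3) g(7) dx(3)] K1(5)[OF gx(1)] K1(5)[OF gx(2)] K1(5)[OF gx(3)]])
 have val: "cross_map \<phi> (N x z, N y z, N z u, N z v) = ev (cross_log \<phi> (N x z) (N y z) u v)"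
  if "(N x z, N y z, N z u, N z v) \<in> theta M" "good x z" "good y z" "good z u" "good z v" for x y z u v
 proof -
  note gz = iffD1[OF N_sym(2) that(2)] iffD1[OF N_sym(2) that(3)]
  show ?thesis
   by (rule cross_map_log(1)[OF \<phi> that(1) K1(1,2)[OF that(4)]])
    (use K1(3)[OF gz(1)] K1(3)[OF gz(2)] K1(3)[OF that(4)] K1(3)[OF that(5)] K1(5)[OF that(4)] K1(5)[OF that(5)]
     N_sym(1)[of z x] N_sym(1)[of z y] in simp_all)
 qed
 have v1: "cross_map \<phi> (H13, H23, H34, H35) = ev (cross_log \<phi> (N e1 e3) (N e2 e3) e4 e5)"
  unfolding HN by (rule val[OF th(1)[unfolded HN] g(1,2,3,4)])
 have s34: "N e3 e4 = N e4 e3" and s35: "N e3 e5 = N e5 e3" and s45: "N e4 e5 = N e5 e4" by (rule N_sym(1))+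
 have v2: "cross_map \<phi> (H14, H24, H45, H34) = ev (cross_log \<phi> (N e1 e4) (N e2 e4) e5 e3)"
  unfolding HN s34 by (rule val[OF th(2)[unfolded HN s34] g(5,6,7) iffD1[OF N_sym(2) g(3)]])
 have v3: "cross_map \<phi> (H15, H25, H35, H45) = ev (cross_log \<phi> (N e1 e5) (N e2 e5) e3 e4)"
  unfolding HN s35 s45 by (rule val[OF th(3)[unfolded HN s35 s45] g(8,9) iffD1[OF N_sym(2) g(4)] iffD1[OF N_sym(2) g(7)]])
 have "cross_log \<phi> (N e1 e3) (N e2 e3) e4 e5 + cross_log \<phi> (N e1 e4) (N e2 e4) e5 e3 + cross_log \<phi> (N e1 e5) (N e2 e5) e3 e4 \<simeq> 0"
  by (rule cong_eqI[OF cong_diff[OF hex[OF g(2,6,9) dis(3,4,6)] hex[OF g(1,5,8) dis(1,2,5)]]])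
   (simp add: cross_log_def algebra_simps)
 then show ?thesis unfolding v1 v2 v3 by (simp add: cong_iff ev_add ev_0)
qed

theorem cross_map_values:
 assumes \<phi>: "\<phi> \<in> representations M P"
 shows "cross_values M P (cross_map \<phi>)"
proof -
 let ?x = "cross_map \<phi>"
 have sub: "t \<in> theta M" if "t \<in> theta_nondeg M" for t using that by (auto simp: theta_nondeg_def)
 have nz: "?x t \<in> nonzeros P" if that': "t \<in> theta M" for t
 proof -
  obtain H1 H2 H3 H4 where t: "t = (H1, H2, H3, H4)" by (cases t)
  obtain K e1 e2 e3 e4 where K: "K \<in> indep M" "card K + 2 = rank_of M (ground M)"
   "K \<subseteq> H1" "K \<subseteq> H2" "K \<subseteq> H3" "K \<subseteq> H4" "e1 \<in> H1 - cl M K" "e2 \<in> H2 - cl M K" "e3 \<in> H3 - cl M K" "e4 \<in> H4 - cl M K"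
   by (rule theta_frame[OF that'[unfolded t]], rule that)
  show ?thesis using cross_map_log(1)[OF \<phi> that'[unfolded t] K(1-6,9,10)] ev_nonzero unfolding t by simp
 qed
 \<comment> \<open>A dual Fano minor is a Fano pattern in the dual family, for which
   \<open>cochain_dual\<close> provides the cochain.\<close>
 have minor: "pneg P \<one> = \<one>" if "has_minor M fano \<or> has_minor M (dual_matroid fano)"
 proof -
  let ?c = "\<lambda>K a b u v. cross_log \<phi> (cl M (a ## K)) (cl M (b ## K)) u v"
  note X = representation_cochain[OF \<phi>]
  have "minus_one \<in> kernel"
   using that
  proof
   assume "has_minor M fano"
   then obtain K p where "fano_pattern (bases M) K p" using has_minor_fano_iff by blast
   then show ?thesis by (rule fano_cochain[OF X]) (rule cross_log_degenerate[OF \<phi>])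
  next
   assume "has_minor M (dual_matroid fano)"
   then obtain K p where "fano_pattern (dual_family (ground M) (bases M)) K p" using has_minor_dual_fano_iff by blast
   then show ?thesis
   proof (rule fano_cochain[OF cochain_dual[OF bases_subset X]])
    fix K a b u v
    assume q: "quad (dual_family (ground M) (bases M)) K a b u v"
     and d: "a ## b ## K \<notin> dual_family (ground M) (bases M) \<or> u ## v ## K \<notin> dual_family (ground M) (bases M)"
    let ?L = "ground M - K - {a, b, u, v}"
    have h: "K \<subseteq> ground M" "{a, b, u, v} \<subseteq> ground M" "{a, b, u, v} \<inter> K = {}" "quad (bases M) ?L a b u v"
     using q unfolding quad_dual[OF bases_subset] by blast+
    have s: "a ## b ## K \<subseteq> ground M" "u ## v ## K \<subseteq> ground M" using h by auto
    have "distinct [a, b, u, v]" using h(4) by (simp add: quad_def)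
    then have "ground M - a ## b ## K = u ## v ## ?L" "ground M - u ## v ## K = a ## b ## ?L"
     using h(1-3) by auto
    then have "a ## b ## ?L \<notin> bases M \<or> u ## v ## ?L \<notin> bases M"
     using d dual_family_iff[OF bases_subset s(1)] dual_family_iff[OF bases_subset s(2)] by auto
    then show "cross_dual ?c K a b u v \<simeq> 0" unfolding cross_dual_def by (rule cross_log_degenerate[OF \<phi> h(4)])
   qed
  qed
  then show ?thesis using ev_minus_one by (simp add: kernel_def)
 qed
 have nondeg: "?x (H1, H2, H3, H4) = ?x (H2, H1, H4, H3) \<and> ?x (H1, H2, H3, H4) = ?x (H3, H4, H1, H2) \<and>
   ?x (H1, H2, H3, H4) = ?x (H4, H3, H2, H1)" "?x (H1, H2, H4, H3) = inv ?x (H1, H2, H3, H4)"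
   "?x (H1, H2, H3, H4) \<otimes> ?x (H1, H3, H4, H2) \<otimes> ?x (H1, H4, H2, H3) = pneg P \<one>"
   "{#?x (H1, H2, H3, H4), ?x (H1, H3, H2, H4), pneg P \<one>#} \<in> nullset P"
  if n: "(H1, H2, H3, H4) \<in> theta_nondeg M" for H1 H2 H3 H4
 proof -
  obtain K e1 e2 e3 e4 where K: "K \<in> indep M" "card K + 2 = rank_of M (ground M)"
   and s: "K \<subseteq> H1" "K \<subseteq> H2" "K \<subseteq> H3" "K \<subseteq> H4" and e: "e1 \<in> H1 - cl M K" "e2 \<in> H2 - cl M K" "e3 \<in> H3 - cl M K" "e4 \<in> H4 - cl M K"
   by (rule theta_frame[OF sub[OF n]], rule that)
  note hyp = theta_Int_pairs(1-4)[OF sub[OF n] K s]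
  have L: "H1 \<inter> H2 \<inter> H3 \<inter> H4 = cl M K" by (rule theta_Int[OF sub[OF n] K s])
  note nn = conjunct2[OF n[unfolded mem_theta_nondeg L]]
  note I = nn[THEN conjunct1, symmetric] nn[THEN conjunct2, symmetric] theta_Int_pairs(5-8)[OF sub[OF n] K s]
  have dd: "X \<noteq> Y" if "X \<inter> Y = cl M K" "x \<in> X - cl M K" for X Y x using that by blast
  have d: "distinct [H1, H2, H3, H4]"
   using dd[OF I(1) e(1)] dd[OF I(2) e(3)] dd[OF I(3) e(1)] dd[OF I(4) e(1)] dd[OF I(5) e(2)] dd[OF I(6) e(2)] by simp
  note th = sub[OF n] sub[OF theta_nondeg_perm(1)[OF n]] sub[OF theta_nondeg_perm(2)[OF n]] sub[OF theta_nondeg_perm(3)[OF n]]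
   sub[OF theta_nondeg_perm(4)[OF n]] sub[OF theta_nondeg_perm(5)[OF n]] sub[OF theta_nondeg_perm(6)[OF n]] sub[OF theta_nondeg_perm(7)[OF n]]
  note v = cross_map_log(1)[OF \<phi> _ K]
  note vs = v[OF th(1) s e(3,4)] v[OF th(2) s(2,1,4,3) e(4,3)] v[OF th(3) s(3,4,1,2) e(1,2)] v[OF th(4) s(4,3,2,1) e(2,1)]
   v[OF th(5) s(1,2,4,3) e(4,3)] v[OF th(6) s(1,3,2,4) e(2,4)] v[OF th(7) s(1,3,4,2) e(4,2)] v[OF th(8) s(1,4,2,3) e(2,3)]
  have tr: "ev (cross_log \<phi> H3 H4 e1 e2) = ev (cross_log \<phi> H1 H2 e3 e4)"
   using cross_log_transpose[OF \<phi> K hyp s d e] by (simp add: cong_iff)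
  show "?x (H1, H2, H3, H4) = ?x (H2, H1, H4, H3) \<and> ?x (H1, H2, H3, H4) = ?x (H3, H4, H1, H2) \<and>
   ?x (H1, H2, H3, H4) = ?x (H4, H3, H2, H1)"
   unfolding vs cross_log_simps(3)[of \<phi> H2 H1 e4 e3] cross_log_simps(3)[of \<phi> H4 H3 e2 e1] tr by simp
  show "?x (H1, H2, H4, H3) = inv ?x (H1, H2, H3, H4)"
   unfolding vs cross_log_simps(4)[of \<phi> H1 H2 e4 e3] by (rule ev_uminus)
  show "?x (H1, H2, H3, H4) \<otimes> ?x (H1, H3, H4, H2) \<otimes> ?x (H1, H4, H2, H3) = pneg P \<one>"
   unfolding vs using cross_log_cyclic[OF \<phi> K hyp s d e] by (simp add: cong_iff ev_add ev_minus_one)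
  have d3: "H1 \<noteq> H2" "H1 \<noteq> H3" "H2 \<noteq> H3" using d by auto
  have out: "y \<notin> X" if "X \<inter> Y = cl M K" "y \<in> Y - cl M K" for X Y y using that by blast
  have "e4 \<in> ground M" using e(4) hyperplane_subset[OF hyp(4)] by blast
  moreover have "e4 \<notin> H1 \<union> H2 \<union> H3" using out[OF I(4) e(4)] out[OF I(6) e(4)] out[OF I(2) e(4)] by simp
  ultimately show "{#?x (H1, H2, H3, H4), ?x (H1, H3, H2, H4), pneg P \<one>#} \<in> nullset P"
   unfolding vs by (rule representation_rank2(3)[OF \<phi> K hyp(1-3) s(1-3) d3 e(1-3)])
 qed
 have deg: "?x (H1, H2, H3, H4) = \<one>" if n: "(H1, H2, H3, H4) \<in> theta M - theta_nondeg M" for H1 H2 H3 H4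
 proof -
  have t: "(H1, H2, H3, H4) \<in> theta M" using n by blast
  obtain K where K: "K \<in> indep M" "card K + 2 = rank_of M (ground M)"
   and s: "K \<subseteq> H1" "K \<subseteq> H2" "K \<subseteq> H3" "K \<subseteq> H4" and hyp: "H1 \<in> hyperplanes M" "H2 \<in> hyperplanes M" "H3 \<in> hyperplanes M" "H4 \<in> hyperplanes M"
   and d: "H1 \<noteq> H3" "H2 \<noteq> H3" and nd: "(H1, H2, H3, H4) \<in> theta_nondeg M \<longleftrightarrow> H1 \<noteq> H2 \<and> H3 \<noteq> H4"
   by (rule theta_basis[OF t], rule that)
  obtain e3 where e3: "e3 \<in> H3" "e3 \<notin> cl M K" by (rule hyperplane_outside[OF K hyp(3)])
  obtain e4 where e4: "e4 \<in> H4" "e4 \<notin> cl M K" by (rule hyperplane_outside[OF K hyp(4)])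
  have v: "?x (H1, H2, H3, H4) = ev (cross_log \<phi> H1 H2 e3 e4)"
   by (rule cross_map_log(1)[OF \<phi> t K s]) (use e3 e4 in auto)
  have "cross_log \<phi> H1 H2 e3 e4 \<simeq> 0"
  proof (cases "H1 = H2")
   case False
   then have "H3 = H4" using n nd by blast
   then show ?thesis by (intro cross_log_independent[OF \<phi> K hyp(1-3) s(1-3) d]) (use e3 e4 in auto)
  qed (simp add: cross_log_simps)
  then show ?thesis unfolding v by (simp add: cong_iff ev_0)
 qed
 have chain: "?x (H1, H2, H3, H4) \<otimes> ?x (H1, H2, H4, H5) \<otimes> ?x (H1, H2, H5, H3) = \<one>"
  if n: "(H1, H2, H3, H4) \<in> theta_nondeg M" "(H1, H2, H4, H5) \<in> theta_nondeg M" "(H1, H2, H5, H3) \<in> theta_nondeg M"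
  for H1 H2 H3 H4 H5
 proof -
  obtain K e1 e2 e3 e4 where K: "K \<in> indep M" "card K + 2 = rank_of M (ground M)"
   and s: "K \<subseteq> H1" "K \<subseteq> H2" "K \<subseteq> H3" "K \<subseteq> H4"
   and "e1 \<in> H1 - cl M K" "e2 \<in> H2 - cl M K" and e: "e3 \<in> H3 - cl M K" "e4 \<in> H4 - cl M K"
   by (rule theta_frame[OF sub[OF n(1)]], rule that)
  have "H1 \<inter> H2 \<subseteq> H5" using n(2) unfolding mem_theta_nondeg by blast
  then have s5: "K \<subseteq> H5" using s by blast
  have "H5 \<in> hyperplanes M" using sub[OF n(2)] by (simp add: mem_theta)
  then obtain e5 where e5: "e5 \<in> H5" "e5 \<notin> cl M K" by (rule hyperplane_outside[OF K])
  then have e5': "e5 \<in> H5 - cl M K" by blast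
  note v = cross_map_log(1)[OF \<phi> sub[OF n(1)] K s e] cross_map_log(1)[OF \<phi> sub[OF n(2)] K s(1,2,4) s5 e(2) e5']
   cross_map_log(1)[OF \<phi> sub[OF n(3)] K s(1,2) s5 s(3) e5' e(1)]
  have "cross_log \<phi> H1 H2 e3 e4 + cross_log \<phi> H1 H2 e4 e5 + cross_log \<phi> H1 H2 e5 e3 = 0"
   by (simp add: cross_log_def algebra_simps)
  then show ?thesis unfolding v by (simp flip: ev_add add: ev_0)
 qed
 have rank3: "?x (H13, H23, H34, H35) \<otimes> ?x (H14, H24, H45, H34) \<otimes> ?x (H15, H25, H35, H45) = \<one>"
  if "rank3_config M H13 H23 H34 H35 H14 H24 H45 H15 H25" for H13 H23 H34 H35 H14 H24 H45 H15 H25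
  using iffD1[OF rank3_config_def that] by (elim conjE exE) (rule cross_map_rank3[OF \<phi>])
 show ?thesis
  by (rule cross_values.intro; (elim conjE)?; (rule nz minor nondeg deg chain rank3; assumption))
qed

end

context matroid
begin

lemma atom_flat_closure:
 assumes e: "{e} \<in> indep M"
 shows "atom_flat M (cl M {e})"
 unfolding atom_flat_def
proof (intro conjI allI impI)
 show "flat M (cl M {e})" by (rule flat_closure[OF e])
 have "e \<in> ground M" using indep_subset[OF e] by simp
 then have "e \<notin> cl M {}" using closure_indep_iff[OF empty_indep, of e] e by simp
 then show "cl M {e} \<noteq> cl M {}" using indep_subset_closure[OF e] by auto
 fix B assume B: "flat M B \<and> B \<subseteq> cl M {e}"
 obtain I where I: "I \<in> indep M" "I \<subseteq> B" "card I = rank_of M B" using rank_witness by blast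
 have BI: "B = cl M I" using flat_eq_closure[OF _ I] B by blast
 have "card I \<le> 1" using card_le_rank[OF I(1), of "cl M {e}"] I(2) B rank_closure[OF e] by auto
 then consider "card I = 0" | "card I = 1" by linarith
 then show "B = cl M {} \<or> B = cl M {e}"
 proof cases
  case 1
  then show ?thesis using BI finite_indep[OF I(1)] by simp
 next
  case 2
  have "cl M I = cl M {e}" by (rule closure_eqI[OF e I(1)]) (use I(2) B 2 in auto)
  then show ?thesis using BI by simp
 qed
qed

lemma closure_union_atoms:
 assumes "e ## e' ## K \<in> indep M"
 shows "cl M (cl M K \<union> cl M {e} \<union> cl M {e'}) = cl M (e ## e' ## K)"
proof (rule closure_of_basis[OF assms])
 have i: "K \<in> indep M" "{e} \<in> indep M" "{e'} \<in> indep M" by (rule indep_mono[OF assms], blast)+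
 have s: "e ## e' ## K \<subseteq> cl M (e ## e' ## K)" by (rule indep_subset_closure[OF assms])
 show sub: "e ## e' ## K \<subseteq> cl M K \<union> cl M {e} \<union> cl M {e'}"
  using indep_subset_closure[OF i(1)] indep_subset_closure[OF i(2)] indep_subset_closure[OF i(3)] by blast
 have "cl M K \<union> cl M {e} \<union> cl M {e'} \<subseteq> cl M (e ## e' ## K)"
  by (intro Un_least closure_mono_indep[OF assms] i; use s in simp)
 from rank_mono[OF this] show "card (e ## e' ## K) = rank_of M (cl M K \<union> cl M {e} \<union> cl M {e'})"
  using rank_closure[OF assms] card_le_rank[OF assms sub] by simp
qed

lemma outside_hyperplane:
 assumes "H \<in> hyperplanes M"
 shows "\<exists>e\<in>ground M. e \<notin> H"
proof (rule ccontr)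
 assume "\<not> (\<exists>e\<in>ground M. e \<notin> H)"
 then have "H = ground M" using hyperplane_subset[OF assms] by blast
 then show False using assms by (simp add: hyperplanes_def corank_flat_def)
qed

end

section \<open>Representations from cross-ratios\<close>

locale cross_valued_matroid = matroid_pasture M P ev + cross_values M P x
 for M :: "'a matroid" and P :: "'p pasture" (structure) and ev x
begin

definition val :: "'a set => 'a => 'a => 'a => 'a => 'p \<Rightarrow>\<^sub>0 int" where
 "val K a b u v = frag_of (x (cl M (a ## K), cl M (b ## K), cl M (u ## K), cl M (v ## K)))"

lemma ev_val:
 assumes "quad (bases M) K a b u v"
 shows "ev (val K a b u v) = x (cl M (a ## K), cl M (b ## K), cl M (u ## K), cl M (v ## K))"
 unfolding val_def by (rule ev_frag[OF x_nonzero[OF quad_theta(1)[OF assms]]])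

lemma quad_perms:
 assumes "quad (bases M) K a b u v"
 shows "quad (bases M) K a b v u" "quad (bases M) K b a v u" "quad (bases M) K u v a b"
 using assms by (simp_all add: quad_perm)

lemma val_degenerate:
 assumes q: "quad (bases M) K a b u v" and d: "a ## b ## K \<notin> bases M \<or> u ## v ## K \<notin> bases M"
 shows "val K a b u v \<simeq> 0"
proof -
 have "(cl M (a ## K), cl M (b ## K), cl M (u ## K), cl M (v ## K)) \<notin> theta_nondeg M"
  using quad_theta(3)[OF q] d by blast
 then show ?thesis using x_deg quad_theta(1)[OF q] ev_val[OF q] by (simp add: cong_iff ev_0)
qed

lemma val_perm:
 assumes q: "quad (bases M) K a b u v"
 shows "val K a b v u \<simeq> - val K a b u v" "val K b a v u \<simeq> val K a b u v" "val K u v a b \<simeq> val K a b u v"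
proof -
 note qp = quad_perms[OF q]
 have "val K a b v u \<simeq> - val K a b u v \<and> val K b a v u \<simeq> val K a b u v \<and> val K u v a b \<simeq> val K a b u v"
 proof (cases "a ## b ## K \<in> bases M \<and> u ## v ## K \<in> bases M")
  case True
  then have n: "(cl M (a ## K), cl M (b ## K), cl M (u ## K), cl M (v ## K)) \<in> theta_nondeg M"
   using quad_theta(3)[OF q] by blast
  show ?thesis
   unfolding cong_iff ev_val[OF q] ev_uminus ev_val[OF qp(1)] ev_val[OF qp(2)] ev_val[OF qp(3)]
   using x_sym[OF n] x_inv[OF n] by metis
 next
  case False
  then have d: "a ## b ## K \<notin> bases M \<or> u ## v ## K \<notin> bases M"
   "a ## b ## K \<notin> bases M \<or> v ## u ## K \<notin> bases M"
   "b ## a ## K \<notin> bases M \<or> v ## u ## K \<notin> bases M"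
   "u ## v ## K \<notin> bases M \<or> a ## b ## K \<notin> bases M"
   by (auto simp: insert_commute)
  note z = val_degenerate[OF q d(1)] val_degenerate[OF qp(1) d(2)] val_degenerate[OF qp(2) d(3)] val_degenerate[OF qp(3) d(4)]
  have "- val K a b u v \<simeq> 0" using cong_minus[OF z(1)] by simp
  then show ?thesis using z cong_trans cong_sym by blast
 qed
 then show "val K a b v u \<simeq> - val K a b u v" "val K b a v u \<simeq> val K a b u v" "val K u v a b \<simeq> val K a b u v"
  by blast+
qed

lemma val_cyclic:
 assumes q: "quad (bases M) K a b u v" "a ## b ## K \<in> bases M" "u ## v ## K \<in> bases M"
 shows "val K a b u v + val K a u v b + val K a v b u \<simeq> minus_one"
proof -
 have n: "(cl M (a ## K), cl M (b ## K), cl M (u ## K), cl M (v ## K)) \<in> theta_nondeg M"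
  using quad_theta(3)[OF q(1)] q(2,3) by blast
 have q2: "quad (bases M) K a u v b" "quad (bases M) K a v b u"
  using q unfolding quad_def by (auto simp: insert_commute)
 show ?thesis
  unfolding cong_iff ev_add ev_val[OF q(1)] ev_val[OF q2(1)] ev_val[OF q2(2)] ev_minus_one by (rule x_cyclic[OF n])
qed

text \<open>(R3) speaks of nondegenerate tuples only. Otherwise two of the hyperplanes coincide, and
  (R0) and (R1) give the equation.\<close>

lemma val_rank2:
 assumes q: "quad (bases M) K a b u v" "quad (bases M) K a b v z" "quad (bases M) K a b z u"
 shows "val K a b u v + val K a b v z + val K a b z u \<simeq> 0"
proof -
 have zero: "val K a b z u + (val K a b v z + val K a b u v) \<simeq> 0"
  if q: "quad (bases M) K a b u v" "quad (bases M) K a b v z" "quad (bases M) K a b z u"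
   and d: "u ## v ## K \<notin> bases M" for u v z
 proof -
  have eq: "cl M (u ## K) = cl M (v ## K)" using closure_eq_iff_bases(2)[OF q(1)] d by blast
  have "val K a b z u = val K a b z v" unfolding val_def eq ..
  then have "val K a b z u \<simeq> - val K a b v z" using val_perm(1)[OF q(2)] by simp
  from cong_add[OF this val_degenerate[OF q(1)]] d show ?thesis
   by (intro cong_eqI[OF cong_add[OF \<open>val K a b z u \<simeq> - val K a b v z\<close> val_degenerate[OF q(1)]]]) (auto simp: algebra_simps)
 qed
 consider "a ## b ## K \<notin> bases M" | "u ## v ## K \<notin> bases M" | "v ## z ## K \<notin> bases M"
  | "z ## u ## K \<notin> bases M"
  | "a ## b ## K \<in> bases M" "u ## v ## K \<in> bases M" "v ## z ## K \<in> bases M" "z ## u ## K \<in> bases M"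
  by blast
 then show ?thesis
 proof cases
  case 1
  then have "val K a b u v + val K a b v z + val K a b z u \<simeq> 0 + 0 + 0" by (intro cong_add val_degenerate q disjI1)
  then show ?thesis by simp
 next
  case 2
  show ?thesis using zero[OF q 2] by (simp add: algebra_simps)
 next
  case 3
  show ?thesis using zero[OF q(2,3,1) 3] by (simp add: algebra_simps)
 next
  case 4
  show ?thesis using zero[OF q(3,1,2) 4] by (simp add: algebra_simps)
 next
  case 5
  have n: "(cl M (a ## K), cl M (b ## K), cl M (u ## K), cl M (v ## K)) \<in> theta_nondeg M"
   "(cl M (a ## K), cl M (b ## K), cl M (v ## K), cl M (z ## K)) \<in> theta_nondeg M"
   "(cl M (a ## K), cl M (b ## K), cl M (z ## K), cl M (u ## K)) \<in> theta_nondeg M"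
   using quad_theta(3)[OF q(1)] quad_theta(3)[OF q(2)] quad_theta(3)[OF q(3)] 5 by blast+
  show ?thesis
   unfolding cong_iff ev_add ev_val[OF q(1)] ev_val[OF q(2)] ev_val[OF q(3)] ev_0 using x_chain n by blast
 qed
qed

text \<open>This is (R4) with a, b, z, u, v in the places of 1, 2, 3, 4, 5.\<close>

lemma val_rank3:
 assumes q: "quad (bases M) (z ## K) a b u v" "quad (bases M) (u ## K) a b v z" "quad (bases M) (v ## K) a b z u"
 shows "val (z ## K) a b u v + val (u ## K) a b v z + val (v ## K) a b z u \<simeq> 0"
proof -
 define N where "N p r = cl M (p ## r ## K)" for p r
 have N_sym: "N p r = N r p" for p r by (simp add: N_def insert_commute)
 note th = quad_theta(1,2)[OF q(1), folded N_def] quad_theta(1,2)[OF q(2), folded N_def] quad_theta(1,2)[OF q(3), folded N_def]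
 note Q = quad_bases[OF q(1)] and Q2 = quad_bases[OF q(2)]
 have i: "a ## u ## z ## K \<in> indep M" "a ## v ## z ## K \<in> indep M" "b ## u ## z ## K \<in> indep M"
  "b ## v ## z ## K \<in> indep M" "a ## v ## u ## K \<in> indep M" "b ## v ## u ## K \<in> indep M"
  using Q(11-14) Q2(11,13) by (auto intro: bases_indep)
 have zu: "z ## u ## K \<in> indep M" by (rule indep_mono[OF i(1)]) blast
 have zuK: "z \<noteq> u" "z \<notin> K" "u \<notin> K" using Q Q2 by auto
 have K1: "K \<in> indep M" by (rule indep_mono[OF zu]) blast
 have "card K + 3 = rank_of M (ground M)" using Q(17) finite_indep[OF K1] zuK(2) by simp
 note K = K1 this
 define L where "L = \<Inter>{N a z, N b z, N z u, N z v, N a u, N b u, N u v, N a v, N b v}"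
 \<comment> \<open>Two of the tuples meet in the flats spanned by \<open>z ## K\<close> and
   \<open>u ## K\<close>, and these meet in the flat spanned by \<open>K\<close>.\<close>
 have LK: "L = cl M K"
 proof
  have "L \<subseteq> cl M (z ## K)" "L \<subseteq> cl M (u ## K)"
   unfolding L_def th(2)[symmetric] th(4)[symmetric] using N_sym by auto
  then show "L \<subseteq> cl M K" using closure_Int[OF zu zuK] by blast
  have *: "cl M K \<subseteq> N p r" if "p ## r ## K \<in> indep M" for p r
   unfolding N_def by (rule closure_mono_indep[OF that _ K(1)]) (use indep_subset_closure[OF that] in blast)
  have "a ## z ## K \<in> indep M" "b ## z ## K \<in> indep M" "z ## u ## K \<in> indep M" "z ## v ## K \<in> indep M"
   "a ## u ## K \<in> indep M" "b ## u ## K \<in> indep M" "u ## v ## K \<in> indep M" "a ## v ## K \<in> indep M"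
   "b ## v ## K \<in> indep M"
   by (rule indep_mono[OF i(1)], blast, rule indep_mono[OF i(3)], blast, rule indep_mono[OF i(1)], blast, rule indep_mono[OF i(2)], blast,
     rule indep_mono[OF i(1)], blast, rule indep_mono[OF i(3)], blast, rule indep_mono[OF i(5)], blast, rule indep_mono[OF i(2)], blast,
     rule indep_mono[OF i(4)], blast)
  note * = this[THEN *]
  show "cl M K \<subseteq> L" unfolding L_def using * by simp
 qed
 have single: "{a} \<in> indep M" "{b} \<in> indep M" "{z} \<in> indep M" "{u} \<in> indep M" "{v} \<in> indep M"
  by (rule indep_mono[OF i(1)], blast, rule indep_mono[OF i(3)], blast, rule indep_mono[OF i(1)], blast, rule indep_mono[OF i(1)], blast,
    rule indep_mono[OF i(2)], blast)
 have NL: "N p r = cl M (L \<union> cl M {p} \<union> cl M {r})" if "p ## r ## K \<subseteq> J" "J \<in> indep M" for p r J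
  unfolding N_def LK by (rule closure_union_atoms[OF indep_mono[OF that(2,1)], symmetric])
 have "x (N a z, N b z, N z u, N z v) \<otimes> x (N a u, N b u, N u v, N z u) \<otimes> x (N a v, N b v, N z v, N u v) = \<one>"
 proof (rule x_rank3, unfold rank3_config_def, intro conjI exI)
  show "(N a z, N b z, N z u, N z v) \<in> theta M" "(N a u, N b u, N u v, N z u) \<in> theta M" "(N a v, N b v, N z v, N u v) \<in> theta M"
   using th(1,3,5) N_sym[of u z] N_sym[of v z] N_sym[of v u] by simp_all
  show "L = \<Inter>{N a z, N b z, N z u, N z v, N a u, N b u, N u v, N a v, N b v}" by (rule L_def)
  show "corank_flat M 3 L" unfolding LK using K corank_flat_iff by blast
  show "\<forall>i\<in>{cl M {a}, cl M {b}, cl M {z}, cl M {u}, cl M {v}}. atom_flat M i"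
   using single by (simp add: atom_flat_closure)
  show "N a z = cl M (L \<union> cl M {a} \<union> cl M {z})" by (rule NL[OF _ i(1)]) blast
  show "N b z = cl M (L \<union> cl M {b} \<union> cl M {z})" by (rule NL[OF _ i(3)]) blast
  show "N z u = cl M (L \<union> cl M {z} \<union> cl M {u})" by (rule NL[OF _ i(1)]) blast
  show "N z v = cl M (L \<union> cl M {z} \<union> cl M {v})" by (rule NL[OF _ i(2)]) blast
  show "N a u = cl M (L \<union> cl M {a} \<union> cl M {u})" by (rule NL[OF _ i(1)]) blast
  show "N b u = cl M (L \<union> cl M {b} \<union> cl M {u})" by (rule NL[OF _ i(3)]) blast
  show "N u v = cl M (L \<union> cl M {u} \<union> cl M {v})" by (rule NL[OF _ i(5)]) blast
  show "N a v = cl M (L \<union> cl M {a} \<union> cl M {v})" by (rule NL[OF _ i(2)]) blast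
  show "N b v = cl M (L \<union> cl M {b} \<union> cl M {v})" by (rule NL[OF _ i(4)]) blast
 qed
 then show ?thesis
  unfolding cong_iff ev_add ev_val[OF q(1), folded N_def] ev_val[OF q(2), folded N_def] ev_val[OF q(3), folded N_def] ev_0
   N_sym[of u z] N_sym[of v z] N_sym[of v u] .
qed

lemma cross_system_val: "cross_system (bases M) val"
proof (rule cross_systemI)
 fix K s t a b u v
 assume st: "s \<noteq> t" "s \<notin> K" "t \<notin> K"
  and q: "quad (bases M) (s ## K) a b u v" "quad (bases M) (t ## K) a b u v"
  and par: "\<And>z. z \<in> {a, b, u, v} ==> z ## s ## t ## K \<notin> bases M"
 note Q1 = quad_bases[OF q(1)] and Q2 = quad_bases[OF q(2)]
 \<comment> \<open>Since s and t are parallel over z, they span the same hyperplane; so the two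
   tuples of hyperplanes are equal.\<close>
 have "cl M (z ## s ## K) = cl M (z ## t ## K)" if z: "z \<in> {a, b, u, v}" for z
 proof -
  have i: "s ## z ## K \<in> indep M" "t ## z ## K \<in> indep M"
   using Q1(18-21) Q2(18-21) z by (auto simp: insert_commute)
  have n: "s \<notin> z ## K" "t \<notin> z ## K" using Q1 Q2 st z by auto
  have zK: "z \<notin> K" using Q1(7-10) z by auto
  have "card (s ## t ## z ## K) = rank_of M (ground M)"
   using n zK st(1) finite_indep[OF i(1)] Q1(17) st(2) by simp
  then have "s ## t ## z ## K \<notin> indep M"
   using par[OF z] by (auto simp: bases_def insert_commute)
  then show ?thesis using closure_eq_of_dependent[OF i n] by (simp add: insert_commute)
 qed
 note h = this[of a] this[of b] this[of u] this[of v]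
 show "val (s ## K) a b u v \<simeq> val (t ## K) a b u v" unfolding val_def using h by simp
next
 have m: "minus_one \<in> kernel" if "has_minor M fano \<or> has_minor M (dual_matroid fano)"
  using x_minor[OF that] ev_minus_one by (simp add: kernel_def)
 show "minus_one \<in> kernel" if "fano_pattern (bases M) K p" for K p
  using m has_minor_fano_iff that by blast
 show "minus_one \<in> kernel" if "fano_pattern (dual_family (ground M) (bases M)) K p" for K p
  using m has_minor_dual_fano_iff that by blast
qed (rule val_perm val_degenerate val_cyclic val_rank2 val_rank3; assumption)+

lemma exists_cochain: "\<exists>X. cochain (bases M) minus_one val X"
proof -
 obtain D where D: "potential (bases M) val D"
  using potential_exists[OF basis_family_bases bases_subset cross_system_val] by blast
 have "cochain (bases M) minus_one val (gradient D)"
  by (rule potential_cochain[OF _ D]) (rule finite_indep[OF bases_indep])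
 then show ?thesis by blast
qed

definition X :: "'a set => 'a => 'a => 'p \<Rightarrow>\<^sub>0 int" where
 "X = (SOME X. cochain (bases M) minus_one val X)"

lemma cochain_X: "cochain (bases M) minus_one val X"
 unfolding X_def by (rule someI_ex[OF exists_cochain])

definition span :: "'a set => 'a set" where
 "span H = (SOME I. I \<in> indep M \<and> card I + 1 = rank_of M (ground M) \<and> H = cl M I)"

definition base_point :: "'a set => 'a" where
 "base_point H = (SOME a. a \<in> ground M \<and> a \<notin> H)"

text \<open>The logarithm of the value at e, normalized to be trivial at
  \<open>base_point H\<close>; other normalizations would rescale the hyperplane.\<close>

definition psi :: "'a set => 'a => 'p \<Rightarrow>\<^sub>0 int" where
 "psi H e = X (span H) (base_point H) e"

text \<open>\<open>I\<close> and \<open>J\<close> span the same hyperplane. The bases that contain a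
  and otherwise lie in this hyperplane form a basis family, so exchanges lead from
  \<open>a ## I\<close> to \<open>a ## J\<close>. The two exchanged elements lie in the hyperplane,
  hence the square that compares the edges from a to e is degenerate.\<close>

lemma X_span_independent:
 assumes I: "I \<in> indep M" "card I + 1 = rank_of M (ground M)" "J \<in> indep M" "card J + 1 = rank_of M (ground M)"
  and eq: "cl M I = cl M J" and ae: "a \<in> ground M" "a \<notin> cl M I" "e \<in> ground M" "e \<notin> cl M I"
 shows "X J a e \<simeq> X I a e"
proof -
 let ?Y = "ground M - cl M I - {a}"
 let ?G = "{B \<in> bases M. B \<inter> ?Y = {}}"
 have IB: "a ## I \<in> bases M" "a \<notin> I" using notin_hyperplane_iff[OF I(1,2), of a] ae(1,2) by auto
 have JB: "a ## J \<in> bases M" "a \<notin> J" using notin_hyperplane_iff[OF I(3,4), of a] ae(1,2) eq by auto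
 have "I \<subseteq> cl M I" "J \<subseteq> cl M I" using indep_subset_closure[OF I(1)] indep_subset_closure[OF I(3)] eq by auto
 then have IG: "a ## I \<in> ?G" and JG: "a ## J \<in> ?G" using IB JB by auto
 have G: "basis_family ?G" by (rule basis_family_avoid[OF basis_family_bases IB(1)]) (use IG in auto)
 have outside: "p ## L \<in> bases M" "p \<notin> L"
  if "L \<in> indep M" "card L + 1 = rank_of M (ground M)" "L \<subseteq> cl M I" "p \<in> ground M" "p \<notin> cl M I" for p L
 proof -
  have "cl M L = cl M I" by (rule closure_eqI[OF I(1) that(1,3)]) (use that(2) I(2) in simp)
  then have "p \<notin> L \<and> p ## L \<in> bases M" using notin_hyperplane_iff[OF that(1,2), of p] that(4,5) by blast
  then show "p ## L \<in> bases M" "p \<notin> L" by blast+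
 qed
 have aG: "a \<in> B" "B - {a} \<subseteq> cl M I" if "B \<in> ?G" for B
 proof -
  have B: "B \<in> bases M" "B \<subseteq> ground M" using that bases_subset by auto
  show "B - {a} \<subseteq> cl M I" using that B(2) by blast
  show "a \<in> B"
  proof (rule ccontr)
   assume "a \<notin> B"
   then have "B \<subseteq> cl M I" using that B(2) by blast
   then have "card B \<le> card I" using card_le_rank[OF bases_indep[OF B(1)], of "cl M I"] rank_closure[OF I(1)] by simp
   then show False using B(1) I(2) by (simp add: bases_def)
  qed
 qed
 have "X (a ## J - {a}) a e \<simeq> X I a e"
  using G IG JG
 proof (induction rule: basis_family_induct)
  case base
  then show ?case using IB by simp
 next
  case (step B i j)
  let ?K = "B - {i} - {a}"
  note aB = aG[OF step.hyps(1)] and aB' = aG[OF step.hyps(4)]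
  have ij: "i \<noteq> a" "j \<noteq> a" "i \<noteq> j" using step.hyps aB(1) aB'(1) by auto
  have B: "B \<in> bases M" "j ## (B - {i}) \<in> bases M" using step.hyps by auto
  have eq1: "B - {a} = i ## ?K" "j ## (B - {i}) - {a} = j ## ?K" "i ## a ## ?K = B"
   "j ## a ## ?K = j ## (B - {i})"
   using ij step.hyps(2,3) aB(1) by auto
  have fB: "finite B" by (rule finite_indep[OF bases_indep[OF B(1)]])
  have r: "card B = rank_of M (ground M)" "card (j ## (B - {i})) = rank_of M (ground M)" using B by (simp_all add: bases_def)
  have i1: "i ## ?K \<in> indep M" unfolding eq1(1)[symmetric] by (rule indep_mono[OF bases_indep[OF B(1)]]) blast
  have i2: "j ## ?K \<in> indep M" unfolding eq1(2)[symmetric] by (rule indep_mono[OF bases_indep[OF B(2)]]) blast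
  have c1: "card (i ## ?K) + 1 = rank_of M (ground M)"
   unfolding eq1(1)[symmetric] using r(1) aB(1) fB card_Suc_Diff1[of B a] by simp
  have c2: "card (j ## ?K) + 1 = rank_of M (ground M)"
   unfolding eq1(2)[symmetric] using r(2) aB'(1) fB card_Suc_Diff1[of "j ## (B - {i})" a] by simp
  have s: "i ## ?K \<subseteq> cl M I" "j ## ?K \<subseteq> cl M I" unfolding eq1(1,2)[symmetric] by (rule aB(2), rule aB'(2))
  note e1 = outside[OF i1 c1 s(1) ae(3,4)] and e2 = outside[OF i2 c2 s(2) ae(3,4)]
  have "X (j ## ?K) a e \<simeq> X (i ## ?K) a e"
  proof (cases "e = a")
   case True
   have "X L a a \<simeq> 0" if "a ## L \<in> bases M" "a \<notin> L" for L
   proof -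
    have "X L a a + X L a a \<simeq> X L a a" by (rule cochain_path[OF cochain_X]) (use that in auto)
    then show ?thesis by (rule cong_eqI) simp
   qed
   then have "X (j ## ?K) a a \<simeq> 0" "X (i ## ?K) a a \<simeq> 0" using e1 e2 True by auto
   then show ?thesis using True cong_trans cong_sym by blast
  next
   case False
   have q: "quad (bases M) ?K i j a e"
    unfolding quad_def using ij False e1 e2 B eq1(3,4) step.hyps(2,3) by (auto simp: insert_commute)
   have "i ## j ## ?K \<notin> bases M"
   proof
    assume "i ## j ## ?K \<in> bases M"
    moreover have "i ## j ## ?K \<subseteq> cl M I" using s by blast
    ultimately have "rank_of M (ground M) \<le> card I"
     using card_le_rank[OF bases_indep, of "i ## j ## ?K" "cl M I"] rank_closure[OF I(1)] by (simp add: bases_def)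
    then show False using I(2) by simp
   qed
   then have "val ?K i j a e \<simeq> 0" using val_degenerate[OF q] by blast
   from cong_trans[OF cochain_quad[OF cochain_X q] this] show ?thesis by (rule cong_eqI) simp
  qed
  then show ?case using step.IH cong_trans unfolding eq1(1,2) by blast
 qed
 then show ?thesis using JB(2) by simp
qed

lemma psi_diff:
 assumes I: "I \<in> indep M" "card I + 1 = rank_of M (ground M)"
  and e: "e ## I \<in> bases M" "e \<notin> I" "e' ## I \<in> bases M" "e' \<notin> I"
 shows "psi (cl M I) e' - psi (cl M I) e \<simeq> X I e e'"
proof -
 let ?H = "cl M I" and ?a = "base_point (cl M I)" and ?J = "span (cl M I)"
 have H: "?H \<in> hyperplanes M" using I hyperplanes_iff by blast
 have J: "?J \<in> indep M" "card ?J + 1 = rank_of M (ground M)" "?H = cl M ?J"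
  unfolding span_def using someI_ex[of "\<lambda>J. J \<in> indep M \<and> card J + 1 = rank_of M (ground M) \<and> ?H = cl M J"] I by blast+
 have a: "?a \<in> ground M" "?a \<notin> ?H"
  unfolding base_point_def using someI_ex[of "\<lambda>a. a \<in> ground M \<and> a \<notin> ?H"] outside_hyperplane[OF H] by blast+
 have eg: "e \<in> ground M" "e \<notin> ?H" "e' \<in> ground M" "e' \<notin> ?H"
  using notin_hyperplane_iff[OF I] e by blast+
 have aI: "?a \<notin> I" "?a ## I \<in> bases M" using notin_hyperplane_iff[OF I] a by blast+
 have 1: "psi ?H e' \<simeq> X I ?a e'" "psi ?H e \<simeq> X I ?a e"
  unfolding psi_def by (rule X_span_independent[OF I J(1,2) J(3) a eg(3,4)], rule X_span_independent[OF I J(1,2) J(3) a eg(1,2)])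
 have 2: "X I ?a e + X I e e' \<simeq> X I ?a e'"
  by (rule cochain_path[OF cochain_X]) (use aI e in auto)
 show ?thesis by (rule cong_eqI[OF cong_diff[OF cong_diff[OF 1] 2]]) (simp add: algebra_simps)
qed

lemma psi_quad:
 assumes q: "quad (bases M) K a b u v"
 shows "psi (cl M (a ## K)) u - psi (cl M (a ## K)) v + (psi (cl M (b ## K)) v - psi (cl M (b ## K)) u)
  \<simeq> val K a b u v"
proof -
 note Q = quad_bases[OF q]
 have c: "card (a ## K) + 1 = rank_of M (ground M)" "card (b ## K) + 1 = rank_of M (ground M)"
  using Q(7,8,17) finite_indep[OF Q(16)] by simp_all
 have 1: "psi (cl M (a ## K)) v - psi (cl M (a ## K)) u \<simeq> X (a ## K) u v"
  by (rule psi_diff[OF Q(18) c(1)]) (use Q in \<open>auto simp: insert_commute\<close>)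
 have 2: "psi (cl M (b ## K)) v - psi (cl M (b ## K)) u \<simeq> X (b ## K) u v"
  by (rule psi_diff[OF Q(19) c(2)]) (use Q in \<open>auto simp: insert_commute\<close>)
 show ?thesis
  by (rule cong_eqI[OF cong_add[OF cochain_quad[OF cochain_X q] cong_diff[OF 2 1]]]) (simp add: algebra_simps)
qed

lemma psi_triangle:
 assumes "distinct [a, b, d]" "{a, b, d} \<inter> K = {}" "a ## b ## K \<in> bases M" "b ## d ## K \<in> bases M"
  "a ## d ## K \<in> bases M"
 shows "(psi (cl M (b ## K)) d - psi (cl M (b ## K)) a) + (psi (cl M (d ## K)) a - psi (cl M (d ## K)) b)
  + (psi (cl M (a ## K)) b - psi (cl M (a ## K)) d) \<simeq> minus_one"
proof -
 have c: "p ## K \<in> indep M" "card (p ## K) + 1 = rank_of M (ground M)"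
  if "p ## r ## K \<in> bases M" "p \<noteq> r" "r \<notin> K" for p r
  using closure_hyperplane(2,3)[of r "p ## K"] that by (auto simp: insert_commute)
 have d: "a \<noteq> b" "b \<noteq> d" "a \<noteq> d" "a \<notin> K" "b \<notin> K" "d \<notin> K" using assms(1,2) by auto
 have sw: "b ## a ## K \<in> bases M" "d ## b ## K \<in> bases M" "d ## a ## K \<in> bases M"
  using assms by (simp_all add: insert_commute)
 have 1: "psi (cl M (b ## K)) d - psi (cl M (b ## K)) a \<simeq> X (b ## K) a d"
  by (rule psi_diff[OF c[OF sw(1)]]) (use assms(3-5) d sw in auto)
 have 2: "psi (cl M (d ## K)) a - psi (cl M (d ## K)) b \<simeq> X (d ## K) b a"
  by (rule psi_diff[OF c[OF sw(2)]]) (use assms(3-5) d sw in auto)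
 have 3: "psi (cl M (a ## K)) b - psi (cl M (a ## K)) d \<simeq> X (a ## K) d b"
  by (rule psi_diff[OF c[OF assms(3)]]) (use assms(3-5) d sw in auto)
 show ?thesis
  by (rule cong_trans[OF cong_add[OF cong_add[OF 1 2] 3] cochain_triangle[OF cochain_X assms]])
qed

definition rep :: "'a set => 'a => 'p" where
 "rep H e = (if e \<in> H then pzero P else ev (psi H e))"

text \<open>With coefficient 1 at H1, the relation at p3 on H3 forces \<open>\<beta>\<close> and the
  relation at p2 on H2 forces \<open>\<gamma>\<close>. Other points of H2 and H3 follow from
  degenerate cross-ratios (\<open>compare\<close>), points of H1 from the triangle holonomy, and
  points on none of the three from (R+).\<close>

lemma rep_triple:
 assumes K: "K \<in> indep M" "card K + 2 = rank_of M (ground M)"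
  and H: "H1 \<in> hyperplanes M" "H2 \<in> hyperplanes M" "H3 \<in> hyperplanes M" "K \<subseteq> H1" "K \<subseteq> H2" "K \<subseteq> H3" "H1 \<noteq> H2" "H1 \<noteq> H3" "H2 \<noteq> H3"
 shows "\<exists>\<beta> \<gamma>. \<forall>e\<in>ground M. {#rep H1 e, ev \<beta> \<otimes> rep H2 e, ev \<gamma> \<otimes> rep H3 e#} \<in> nullset P"
proof -
 obtain p1 where p1: "p1 \<in> H1" "p1 \<notin> cl M K" by (rule hyperplane_outside[OF K H(1)])
 obtain p2 where p2: "p2 \<in> H2" "p2 \<notin> cl M K" by (rule hyperplane_outside[OF K H(2)])
 obtain p3 where p3: "p3 \<in> H3" "p3 \<notin> cl M K" by (rule hyperplane_outside[OF K H(3)])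
 note s1 = hyperplane_span[OF K H(1,4)] and s2 = hyperplane_span[OF K H(2,5)] and s3 = hyperplane_span[OF K H(3,6)]
 note b12 = hyperplane_pair[OF K H(1,4,2,5,7)] and b13 = hyperplane_pair[OF K H(1,4,3,6,8)] and b23 = hyperplane_pair[OF K H(2,5,3,6,9)]
 have Int: "H1 \<inter> H2 = cl M K" "H1 \<inter> H3 = cl M K" "H2 \<inter> H3 = cl M K"
  by (rule hyperplane_Int[OF K H(1,4,2,5,7)], rule hyperplane_Int[OF K H(1,4,3,6,8)], rule hyperplane_Int[OF K H(2,5,3,6,9)])
 define \<beta> where "\<beta> = psi H1 p3 - psi H2 p3 + minus_one"
 define \<gamma> where "\<gamma> = psi H1 p2 - psi H3 p2 + minus_one"
 have dbl: "minus_one + minus_one \<simeq> 0" using minus_one_double by (simp add: cong_0)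
 have compare: "psi G e - psi G p \<simeq> psi G' e - psi G' p"
  if G: "G \<in> hyperplanes M" "K \<subseteq> G" "G' \<in> hyperplanes M" "K \<subseteq> G'" "G'' \<in> hyperplanes M" "K \<subseteq> G''" "G \<noteq> G'" "G \<noteq> G''" "G' \<noteq> G''"
   and pe: "e \<in> G''" "e \<notin> cl M K" "p \<in> G''" "p \<notin> cl M K" "g \<in> G" "g \<notin> cl M K" "g' \<in> G'" "g' \<notin> cl M K" for G G' G'' e p g g'
 proof (cases "e = p")
  case False
  note t = hyperplane_span[OF K G(1,2) pe(5,6)] hyperplane_span[OF K G(3,4) pe(7,8)] hyperplane_span[OF K G(5,6) pe(1,2)]
   hyperplane_span[OF K G(5,6) pe(3,4)]
  note b1 = hyperplane_pair[OF K G(1,2,5,6,8) pe(5,6)] and b2 = hyperplane_pair[OF K G(3,4,5,6,9) pe(7,8)]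
  have "g \<noteq> g'" by (rule hyperplane_pair(1)[OF K G(1-4,7) pe(5-8)])
  then have q: "quad (bases M) K g g' e p"
   unfolding quad_def using b1[OF pe(1,2)] b1[OF pe(3,4)] b2[OF pe(1,2)] b2[OF pe(3,4)] t(2,5,8,11) False by auto
  have "e ## p ## K \<notin> bases M" using closure_eq_iff_bases(2)[OF q] t(9,12) by simp
  then have "val K g g' e p \<simeq> 0" using val_degenerate[OF q] by blast
  from cong_trans[OF psi_quad[OF q] this] show ?thesis
   unfolding t(3)[symmetric] t(6)[symmetric] by (rule cong_eqI) (simp add: algebra_simps)
 qed simp
 have "{#rep H1 e, ev \<beta> \<otimes> rep H2 e, ev \<gamma> \<otimes> rep H3 e#} \<in> nullset P" if e: "e \<in> ground M" for e
 proof -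
  consider "e \<in> cl M K" | "e \<in> H1" "e \<notin> cl M K" | "e \<in> H2" "e \<notin> cl M K" | "e \<in> H3" "e \<notin> cl M K" | "e \<notin> H1" "e \<notin> H2" "e \<notin> H3"
   by blast
  then show ?thesis
  proof cases
   case 1
   then have "e \<in> H1" "e \<in> H2" "e \<in> H3" using Int by blast+
   then show ?thesis using zero_nullset by (simp add: rep_def zero_absorb_right ev_closed)
  next
   case 2
   then have n: "e \<notin> H2" "e \<notin> H3" using Int by blast+
   note b = b12[OF 2 p2] b13[OF 2 p3] b23[OF p2 p3]
   have "psi H2 p3 - psi H2 e + (psi H3 e - psi H3 p2) + (psi H1 p2 - psi H1 p3) \<simeq> minus_one"
    using psi_triangle[of e p2 p3 K] b s1(2)[OF 2] s2(2)[OF p2] s3(2)[OF p3]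
    unfolding s1(3)[OF 2, symmetric] s2(3)[OF p2, symmetric] s3(3)[OF p3, symmetric] by simp
   then have "\<gamma> + psi H3 e \<simeq> minus_one + (\<beta> + psi H2 e)"
    by (rule cong_eqI) (simp add: \<beta>_def \<gamma>_def algebra_simps)
   then show ?thesis using 2 n ev_pair_nullset_iff[of "\<beta> + psi H2 e" "\<gamma> + psi H3 e"]
    by (simp add: rep_def ev_add add_mset_commute)
  next
   case 3
   then have n: "e \<notin> H1" "e \<notin> H3" using Int by blast+
   have "psi H1 e - psi H1 p2 \<simeq> psi H3 e - psi H3 p2"
    by (rule compare[OF H(1,4,3,6,2,5) H(8,7) H(9)[symmetric] 3 p2 p1 p3])
   from cong_minus[OF this] have "\<gamma> + psi H3 e \<simeq> minus_one + psi H1 e"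
    by (rule cong_eqI) (simp add: \<gamma>_def algebra_simps)
   then show ?thesis using 3 n ev_pair_nullset_iff[of "psi H1 e" "\<gamma> + psi H3 e"]
    by (simp add: rep_def ev_add add_mset_commute zero_absorb_right ev_closed)
  next
   case 4
   then have n: "e \<notin> H1" "e \<notin> H2" using Int by blast+
   have "psi H1 e - psi H1 p3 \<simeq> psi H2 e - psi H2 p3"
    by (rule compare[OF H(1,4,2,5,3,6) H(7-9) 4 p3 p1 p2])
   from cong_minus[OF this] have "\<beta> + psi H2 e \<simeq> minus_one + psi H1 e"
    by (rule cong_eqI) (simp add: \<beta>_def algebra_simps)
   then show ?thesis using 4 n ev_pair_nullset_iff[of "psi H1 e" "\<beta> + psi H2 e"]
    by (simp add: rep_def ev_add zero_absorb_right ev_closed)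
  next
   \<comment> \<open>With \<open>K\<close>, e spans a fourth hyperplane. (R+) for the four
     hyperplanes, multiplied by minus the value of H1 at e, is the required relation.\<close>
   case 5
   have eK: "e \<notin> cl M K" using 5 Int by blast
   have i: "e \<notin> K" "e ## K \<in> indep M" using closure_indep_iff[OF K(1) e] eK by auto
   have "card (e ## K) + 1 = rank_of M (ground M)" using i(1) K(2) finite_indep[OF K(1)] by simp
   then have H4: "cl M (e ## K) \<in> hyperplanes M" "K \<subseteq> cl M (e ## K)" "e \<in> cl M (e ## K)"
    using i(2) hyperplanes_iff indep_subset_closure[OF i(2)] by blast+
   have d: "distinct [H1, H2, H3, cl M (e ## K)]" using H(7-9) 5 H4(3) by auto
   have n: "(H1, H2, H3, cl M (e ## K)) \<in> theta_nondeg M"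
    by (rule theta_nondegI[OF K H(1-3) H4(1) H(4-6) H4(2) d])
   have n4: "H1 \<noteq> cl M (e ## K)" "H2 \<noteq> cl M (e ## K)" "H3 \<noteq> cl M (e ## K)" using d by auto
   note c1 = hyperplane_pair[OF K H(1,4) H4(1,2) n4(1) p1 H4(3) eK] and c2 = hyperplane_pair[OF K H(2,5) H4(1,2) n4(2) p2 H4(3) eK]
    and c3 = hyperplane_pair[OF K H(3,6) H4(1,2) n4(3) p3 H4(3) eK]
   have q1: "quad (bases M) K p1 p2 p3 e" and q2: "quad (bases M) K p1 p3 p2 e"
    unfolding quad_def using c1 c2 c3 b12[OF p1 p2] b13[OF p1 p3] b23[OF p2 p3] s1(2)[OF p1] s2(2)[OF p2] s3(2)[OF p3] i(1)
    by (auto simp: insert_commute)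
   note eqs = s1(3)[OF p1, symmetric] s2(3)[OF p2, symmetric] s3(3)[OF p3, symmetric]
   have v1: "psi H1 p3 - psi H1 e + (psi H2 e - psi H2 p3) \<simeq> val K p1 p2 p3 e" using psi_quad[OF q1] unfolding eqs .
   have v2: "psi H1 p2 - psi H1 e + (psi H3 e - psi H3 p2) \<simeq> val K p1 p3 p2 e" using psi_quad[OF q2] unfolding eqs .
   have "{#ev (val K p1 p2 p3 e), ev (val K p1 p3 p2 e), ev minus_one#} \<in> nullset P"
    unfolding ev_val[OF q1] ev_val[OF q2] eqs ev_minus_one by (rule x_plus[OF n])
   then have N: "{#ev (minus_one + psi H1 e + val K p1 p2 p3 e), ev (minus_one + psi H1 e + val K p1 p3 p2 e),
     ev (minus_one + psi H1 e + minus_one)#} \<in> nullset P"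
    by (rule scale_nullset)
   have "ev (minus_one + psi H1 e + val K p1 p2 p3 e) = ev (\<beta> + psi H2 e)"
    unfolding cong_iff[symmetric] by (rule cong_eqI[OF cong_sym[OF v1]]) (simp add: \<beta>_def algebra_simps)
   moreover have "ev (minus_one + psi H1 e + val K p1 p3 p2 e) = ev (\<gamma> + psi H3 e)"
    unfolding cong_iff[symmetric] by (rule cong_eqI[OF cong_sym[OF v2]]) (simp add: \<gamma>_def algebra_simps)
   moreover have "ev (minus_one + psi H1 e + minus_one) = ev (psi H1 e)"
    unfolding cong_iff[symmetric] by (rule cong_eqI[OF dbl]) (simp add: algebra_simps)
   ultimately show ?thesis using N 5 by (simp add: rep_def ev_add add_mset_commute)
  qed
 qed
 then show ?thesis by blast
qed

theorem rep_representation: "rep \<in> representations M P"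
proof -
 have val: "rep H e \<in> carrier P \<and> (rep H e = pzero P \<longleftrightarrow> e \<in> H)" for H e
  using ev_nonzero[of "psi H e"] zero_closed by (auto simp: rep_def)
 have triple: "\<exists>a\<in>carrier P. \<exists>b\<in>carrier P. \<exists>c\<in>carrier P. (a, b, c) \<noteq> (pzero P, pzero P, pzero P) \<and>
   (\<forall>e\<in>ground M. {#a \<otimes> rep H1 e, b \<otimes> rep H2 e, c \<otimes> rep H3 e#} \<in> nullset P)"
  if H: "H1 \<in> hyperplanes M" "H2 \<in> hyperplanes M" "H3 \<in> hyperplanes M" "H1 \<noteq> H2" "H1 \<noteq> H3" "H2 \<noteq> H3"
   and L: "corank_flat M 2 (H1 \<inter> H2 \<inter> H3)" for H1 H2 H3
 proof -
  obtain K where K: "K \<in> indep M" "card K + 2 = rank_of M (ground M)" "H1 \<inter> H2 \<inter> H3 = cl M K" "K \<subseteq> H1 \<inter> H2 \<inter> H3"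
   by (rule corank2_basis[OF L])
  obtain \<beta> \<gamma> where c: "\<forall>e\<in>ground M. {#rep H1 e, ev \<beta> \<otimes> rep H2 e, ev \<gamma> \<otimes> rep H3 e#} \<in> nullset P"
   using rep_triple[OF K(1,2) H(1-3) _ _ _ H(4-6)] K(4) by blast
  show ?thesis
   by (intro bexI[of _ \<one>] bexI[of _ "ev \<beta>"] bexI[of _ "ev \<gamma>"] conjI)
    (use c val zero_neq_one ev_closed in auto)
 qed
 show ?thesis unfolding representations_def using val triple by blast
qed

theorem rep_cross_map:
 assumes t: "t \<in> theta M"
 shows "cross_map rep t = x t"
proof -
 obtain H1 H2 H3 H4 where t': "t = (H1, H2, H3, H4)" by (cases t)
 show ?thesis
 proof (cases "t \<in> theta_nondeg M")
  case False
  then show ?thesis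
   using cross_values.x_deg[OF cross_map_values[OF rep_representation]] t x_deg unfolding t' by simp
 next
  case True
  obtain K e1 e2 e3 e4 where K: "K \<in> indep M" "card K + 2 = rank_of M (ground M)"
   and s: "K \<subseteq> H1" "K \<subseteq> H2" "K \<subseteq> H3" "K \<subseteq> H4"
   and e: "e1 \<in> H1 - cl M K" "e2 \<in> H2 - cl M K" "e3 \<in> H3 - cl M K" "e4 \<in> H4 - cl M K"
   by (rule theta_frame[OF t[unfolded t']], rule that)
  note hyp = theta_Int_pairs(1-4)[OF t[unfolded t'] K s] and Int = theta_Int_pairs(5-8)[OF t[unfolded t'] K s]
  have L: "H1 \<inter> H2 = cl M K" "H3 \<inter> H4 = cl M K"
   using True theta_Int[OF t[unfolded t'] K s] unfolding t' mem_theta_nondeg by auto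
  have ne: "H1 \<noteq> H2" "H1 \<noteq> H3" "H1 \<noteq> H4" "H2 \<noteq> H3" "H2 \<noteq> H4" "H3 \<noteq> H4"
   using L(1) Int(1) Int(2) Int(3) Int(4) L(2) e by blast+
  have m: "e1 \<in> H1" "e1 \<notin> cl M K" "e2 \<in> H2" "e2 \<notin> cl M K" "e3 \<in> H3" "e3 \<notin> cl M K" "e4 \<in> H4" "e4 \<notin> cl M K" using e by auto
  note b = hyperplane_pair[OF K hyp(1) s(1) hyp(2) s(2) ne(1) m(1-4)] hyperplane_pair[OF K hyp(1) s(1) hyp(3) s(3) ne(2) m(1,2,5,6)]
   hyperplane_pair[OF K hyp(1) s(1) hyp(4) s(4) ne(3) m(1,2,7,8)] hyperplane_pair[OF K hyp(2) s(2) hyp(3) s(3) ne(4) m(3-6)]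
   hyperplane_pair[OF K hyp(2) s(2) hyp(4) s(4) ne(5) m(3,4,7,8)] hyperplane_pair[OF K hyp(3) s(3) hyp(4) s(4) ne(6) m(5-8)]
  note p1 = hyperplane_span[OF K hyp(1) s(1) m(1,2)] and p2 = hyperplane_span[OF K hyp(2) s(2) m(3,4)]
   and p3 = hyperplane_span[OF K hyp(3) s(3) m(5,6)] and p4 = hyperplane_span[OF K hyp(4) s(4) m(7,8)]
  have q: "quad (bases M) K e1 e2 e3 e4" unfolding quad_def using b p1(2) p2(2) p3(2) p4(2) by auto
  note eqs = p1(3)[symmetric] p2(3)[symmetric] p3(3)[symmetric] p4(3)[symmetric]
  have out: "e3 \<notin> H1" "e4 \<notin> H1" "e3 \<notin> H2" "e4 \<notin> H2" using Int(1) Int(2) Int(3) Int(4) e by blast+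
  note rv = representation_value(3)[OF rep_representation]
  have g: "e3 \<in> ground M" "e4 \<in> ground M" using hyperplane_subset[OF hyp(3)] hyperplane_subset[OF hyp(4)] e by blast+
  have "lg rep H e \<simeq> psi H e" if "H \<in> hyperplanes M" "e \<in> ground M" "e \<notin> H" for H e
   unfolding cong_iff rv[OF that] using that(3) by (simp add: rep_def)
  then have "cross_log rep H1 H2 e3 e4 \<simeq> psi H1 e3 - psi H1 e4 + psi H2 e4 - psi H2 e3"
   unfolding cross_log_def using hyp g out by (intro cong_diff cong_add) auto
  moreover have "psi H1 e3 - psi H1 e4 + psi H2 e4 - psi H2 e3 \<simeq> val K e1 e2 e3 e4"
   by (rule cong_eqI[OF psi_quad[OF q, unfolded eqs]]) (simp add: algebra_simps)
  ultimately have "cross_log rep H1 H2 e3 e4 \<simeq> val K e1 e2 e3 e4" by (rule cong_trans)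
  then show ?thesis
   using cross_map_log(1)[OF rep_representation t[unfolded t'] K s e(3,4)] ev_val[OF q] eqs unfolding t' by (simp add: cong_iff)
 qed
qed

end

context matroid_pasture
begin

text \<open>The logarithm of the quotient of the two representations gives a flat cochain, since the
  two holonomies cancel. Exactness yields the scaling \<open>t\<close> of the elements; what remains
  is constant on the complement of each hyperplane and gives \<open>s\<close>.\<close>

theorem rescaling_of_cross_map_eq:
 assumes \<phi>: "\<phi> \<in> representations M P" and \<phi>': "\<phi>' \<in> representations M P"
  and eq: "\<And>t. t \<in> theta M ==> cross_map \<phi> t = cross_map \<phi>' t"
 shows "(\<phi>, \<phi>') \<in> rescaling M P"
proof -
 define Y where "Y I a b = lg \<phi>' (cl M I) b - lg \<phi>' (cl M I) a - (lg \<phi> (cl M I) b - lg \<phi> (cl M I) a)" for I a b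
 let ?c = "\<lambda>\<phi> K a b u v. cross_log \<phi> (cl M (a ## K)) (cl M (b ## K)) u v"
 have same: "?c \<phi> K a b u v \<simeq> ?c \<phi>' K a b u v" if q: "quad (bases M) K a b u v" for K a b u v
 proof -
  note Q = quad_bases[OF q] and th = quad_theta(1)[OF q]
  have s: "K \<subseteq> cl M (a ## K)" "K \<subseteq> cl M (b ## K)" "K \<subseteq> cl M (u ## K)" "K \<subseteq> cl M (v ## K)"
   using indep_subset_closure[OF Q(18)] indep_subset_closure[OF Q(19)] indep_subset_closure[OF Q(20)]
    indep_subset_closure[OF Q(21)] by blast+
  have uv: "u \<in> cl M (u ## K) - cl M K" "v \<in> cl M (v ## K) - cl M K"
   using indep_subset_closure[OF Q(20)] indep_subset_closure[OF Q(21)] closure_indep_iff[OF Q(16), of u]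
    closure_indep_iff[OF Q(16), of v] Q by auto
  show ?thesis
   unfolding cong_iff cross_map_log(1)[OF \<phi> th Q(16,17) s uv, symmetric] cross_map_log(1)[OF \<phi>' th Q(16,17) s uv, symmetric]
   by (rule eq[OF th])
 qed
 have Yc: "cochain (bases M) (minus_one - minus_one) (\<lambda>K a b u v. ?c \<phi>' K a b u v - ?c \<phi> K a b u v) Y"
  unfolding Y_def by (rule cochain_diff[OF representation_cochain[OF \<phi>'] representation_cochain[OF \<phi>]])
 have "flat_cochain (bases M) Y"
  unfolding cochain_def
 proof (intro conjI allI impI)
  show "Y I a b + Y I b d \<simeq> Y I a d" if "{a, b, d} \<inter> I = {} \<and> a ## I \<in> bases M \<and> b ## I \<in> bases M \<and> d ## I \<in> bases M" for I a b d
   by (rule cochain_path[OF Yc]) (use that in auto)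
  show "Y (b ## K) a d + Y (d ## K) b a + Y (a ## K) d b \<simeq> 0"
   if "distinct [a, b, d] \<and> {a, b, d} \<inter> K = {} \<and> a ## b ## K \<in> bases M \<and> b ## d ## K \<in> bases M \<and>
    a ## d ## K \<in> bases M" for K a b d
  proof -
   have "Y (b ## K) a d + Y (d ## K) b a + Y (a ## K) d b \<simeq> minus_one - minus_one"
    by (rule cochain_triangle[OF Yc]) (use that in auto)
   then show ?thesis by simp
  qed
  show "Y (b ## K) u v - Y (a ## K) u v \<simeq> 0" if q: "quad (bases M) K a b u v" for K a b u v
  proof -
   have "?c \<phi>' K a b u v - ?c \<phi> K a b u v \<simeq> 0" by (rule cong_eqI[OF cong_sym[OF same[OF q]]]) simp
   then show ?thesis using cochain_quad[OF Yc q] cong_trans by blast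
  qed
 qed
 then obtain t where t: "exact_on (bases M) Y t" using exact[OF basis_family_bases] by blast
 define s where "s H = (let a = SOME a. a \<in> ground M \<and> a \<notin> H in lg \<phi>' H a - lg \<phi> H a - t a)" for H
 have main: "lg \<phi>' H e \<simeq> s H + t e + lg \<phi> H e" if H: "H \<in> hyperplanes M" and e: "e \<in> ground M" "e \<notin> H" for H e
 proof -
  define a where "a = (SOME a. a \<in> ground M \<and> a \<notin> H)"
  have a: "a \<in> ground M" "a \<notin> H"
   unfolding a_def using someI_ex[of "\<lambda>a. a \<in> ground M \<and> a \<notin> H"] outside_hyperplane[OF H] by blast+
  obtain I where I: "I \<in> indep M" "card I + 1 = rank_of M (ground M)" "H = cl M I" using H hyperplanes_iff by blast
  have m: "a \<notin> I" "a ## I \<in> bases M" "e \<notin> I" "e ## I \<in> bases M"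
   using notin_hyperplane_iff[OF I(1,2)] a e I(3) by blast+
  have "Y I a e \<simeq> t e - t a" using t m unfolding exact_on_def by blast
  then show ?thesis
   by (rule cong_eqI) (simp add: Y_def s_def Let_def a_def[symmetric] I(3)[symmetric] algebra_simps)
 qed
 have resc: "\<phi>' H e = ev (s H) \<otimes> ev (t e) \<otimes> \<phi> H e" if H: "H \<in> hyperplanes M" and e: "e \<in> ground M" for H e
 proof (cases "e \<in> H")
  case True
  then show ?thesis
   using representation_value(2)[OF \<phi> H e] representation_value(2)[OF \<phi>' H e] by (simp add: zero_absorb_right ev_closed)
 next
  case False
  then show ?thesis
   using main[OF H e False] representation_value(3)[OF \<phi> H e False] representation_value(3)[OF \<phi>' H e False]
   by (simp add: cong_iff ev_add)
 qed
 show ?thesis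
  unfolding rescaling_def mem_Collect_eq prod.case
  by (intro conjI \<phi> \<phi>' exI[of _ "\<lambda>H. ev (s H)"] exI[of _ "\<lambda>e. ev (t e)"] ballI ev_nonzero resc)
qed

end

section \<open>The universal property\<close>

definition has_cross_ratios ::
  "'a matroid => 'p pasture => ('a set => 'a => 'p) => ('a set \<times> 'a set \<times> 'a set \<times> 'a set => 'p) => bool" where
 "has_cross_ratios M P \<phi> x \<longleftrightarrow> (\<forall>H1 H2 H3 H4 a b. (H1, H2, H3, H4) \<in> theta M --> a \<in> H3 - H1 \<inter> H2 \<inter> H3 \<inter> H4 -->
   b \<in> H4 - H1 \<inter> H2 \<inter> H3 \<inter> H4 --> cross_ratio P \<phi> H1 H2 a b = x (H1, H2, H3, H4))"

lemma has_cross_ratiosD: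
 assumes "has_cross_ratios M P \<phi> x" "(H1, H2, H3, H4) \<in> theta M" "a \<in> H3 - H1 \<inter> H2 \<inter> H3 \<inter> H4"
  "b \<in> H4 - H1 \<inter> H2 \<inter> H3 \<inter> H4"
 shows "cross_ratio P \<phi> H1 H2 a b = x (H1, H2, H3, H4)"
 by (rule assms(1)[unfolded has_cross_ratios_def, rule_format, OF assms(2-4)])

lemma has_cross_ratios_cong:
 "has_cross_ratios M P \<phi> x ==> (\<And>t. t \<in> theta M ==> x t = y t) ==> has_cross_ratios M P \<phi> y"
 unfolding has_cross_ratios_def by simp

lemma (in matroid) theta_points:
 assumes "(H1, H2, H3, H4) \<in> theta M"
 obtains a b where "a \<in> H3 - H1 \<inter> H2 \<inter> H3 \<inter> H4" "b \<in> H4 - H1 \<inter> H2 \<inter> H3 \<inter> H4"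
proof -
 obtain K e1 e2 e3 e4 where K: "K \<in> indep M" "card K + 2 = rank_of M (ground M)"
  "K \<subseteq> H1" "K \<subseteq> H2" "K \<subseteq> H3" "K \<subseteq> H4"
  "e1 \<in> H1 - cl M K" "e2 \<in> H2 - cl M K" "e3 \<in> H3 - cl M K" "e4 \<in> H4 - cl M K"
  by (rule theta_frame[OF assms], rule that)
 then show thesis using that[of e3 e4] theta_Int[OF assms K(1-6)] by simp
qed

lemma (in matroid) has_cross_ratios_unique:
 assumes "has_cross_ratios M P \<phi> x" "has_cross_ratios M P \<phi> y" "t \<in> theta M"
 shows "x t = y t"
proof -
 obtain H1 H2 H3 H4 where t: "t = (H1, H2, H3, H4)" by (cases t)
 obtain a b where "a \<in> H3 - H1 \<inter> H2 \<inter> H3 \<inter> H4" "b \<in> H4 - H1 \<inter> H2 \<inter> H3 \<inter> H4"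
  by (rule theta_points[OF assms(3)[unfolded t]])
 then show ?thesis
  using has_cross_ratiosD[OF assms(1)] has_cross_ratiosD[OF assms(2)] assms(3) unfolding t by metis
qed

lemma matroid_pastureE:
 assumes "matroid M" "pasture P"
 obtains ev where "matroid_pasture M P ev"
proof -
 obtain ev where "pasture_log P ev" using pasture.exists_log[OF assms(2)] by blast
 then show thesis using that assms(1) by (simp add: matroid_pasture_def)
qed

lemma representation_cross_values:
 assumes "matroid M" "pasture P" "\<phi> \<in> representations M P"
 shows "\<exists>x. cross_values M P x \<and> has_cross_ratios M P \<phi> x"
proof -
 obtain ev where "matroid_pasture M P ev" by (rule matroid_pastureE[OF assms(1,2)])
 then interpret matroid_pasture M P ev .
 have "has_cross_ratios M P \<phi> (cross_map \<phi>)"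
  unfolding has_cross_ratios_def using cross_map_eq[OF assms(3)] by simp
 then show ?thesis using cross_map_values[OF assms(3)] by blast
qed

lemma cross_values_representation:
 assumes "matroid M" "pasture P" "cross_values M P x"
 shows "\<exists>\<phi>\<in>representations M P. has_cross_ratios M P \<phi> x"
proof -
 obtain ev where "matroid_pasture M P ev" by (rule matroid_pastureE[OF assms(1,2)])
 then interpret matroid_pasture M P ev .
 interpret cross_values M P x by fact
 interpret cross_valued_matroid M P ev x ..
 have "has_cross_ratios M P rep x"
  unfolding has_cross_ratios_def using cross_map_eq[OF rep_representation] rep_cross_map by simp
 then show ?thesis using rep_representation by blast
qed

lemma rescaling_of_cross_ratios:
 assumes "matroid M" "pasture P" and \<phi>: "\<phi> \<in> representations M P" "\<phi>' \<in> representations M P"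
  and x: "has_cross_ratios M P \<phi> x" "has_cross_ratios M P \<phi>' x"
 shows "(\<phi>, \<phi>') \<in> rescaling M P"
proof -
 obtain ev where "matroid_pasture M P ev" by (rule matroid_pastureE[OF assms(1,2)])
 then interpret matroid_pasture M P ev .
 show ?thesis
 proof (rule rescaling_of_cross_map_eq[OF \<phi>])
  fix t assume th: "t \<in> theta M"
  obtain H1 H2 H3 H4 where t: "t = (H1, H2, H3, H4)" by (cases t)
  note th' = th[unfolded t]
  obtain a b where ab: "a \<in> H3 - H1 \<inter> H2 \<inter> H3 \<inter> H4" "b \<in> H4 - H1 \<inter> H2 \<inter> H3 \<inter> H4" by (rule theta_points[OF th'])
  show "cross_map \<phi> t = cross_map \<phi>' t"
   unfolding t cross_map_eq[OF \<phi>(1) th' ab] cross_map_eq[OF \<phi>(2) th' ab]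
    has_cross_ratiosD[OF x(1) th' ab] has_cross_ratiosD[OF x(2) th' ab] ..
 qed
qed

lemma has_cross_ratios_rescaling:
 assumes "matroid M" "pasture P" and r: "(\<phi>, \<phi>') \<in> rescaling M P" and x: "has_cross_ratios M P \<phi> x"
 shows "has_cross_ratios M P \<phi>' x"
proof -
 obtain ev where "matroid_pasture M P ev" by (rule matroid_pastureE[OF assms(1,2)])
 then interpret matroid_pasture M P ev .
 obtain s t where \<phi>: "\<phi> \<in> representations M P" "\<phi>' \<in> representations M P"
  and s: "\<And>H. H \<in> hyperplanes M ==> s H \<in> nonzeros P" and t: "\<And>e. e \<in> ground M ==> t e \<in> nonzeros P"
  and eq: "\<And>H e. H \<in> hyperplanes M ==> e \<in> ground M ==> \<phi>' H e = s H \<otimes>\<^bsub>P\<^esub> t e \<otimes>\<^bsub>P\<^esub> \<phi> H e"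
  using r unfolding rescaling_def by blast
 have lg: "lg \<phi>' H e \<simeq> frag_of (s H) + frag_of (t e) + lg \<phi> H e" if "H \<in> hyperplanes M" "e \<in> ground M" "e \<notin> H" for H e
  unfolding cong_iff ev_add representation_value(3)[OF \<phi>(1) that] representation_value(3)[OF \<phi>(2) that]
   ev_frag[OF s[OF that(1)]] ev_frag[OF t[OF that(2)]] by (rule eq[OF that(1,2)])
 show ?thesis
  unfolding has_cross_ratios_def
 proof (intro allI impI)
  fix H1 H2 H3 H4 a b
  assume th: "(H1, H2, H3, H4) \<in> theta M" and ab: "a \<in> H3 - H1 \<inter> H2 \<inter> H3 \<inter> H4" "b \<in> H4 - H1 \<inter> H2 \<inter> H3 \<inter> H4"
  obtain K e1 e2 e3 e4 where K: "K \<in> indep M" "card K + 2 = rank_of M (ground M)"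
   "K \<subseteq> H1" "K \<subseteq> H2" "K \<subseteq> H3" "K \<subseteq> H4"
   "e1 \<in> H1 - cl M K" "e2 \<in> H2 - cl M K" "e3 \<in> H3 - cl M K" "e4 \<in> H4 - cl M K"
   by (rule theta_frame[OF th], rule that)
  note ab' = ab[unfolded theta_Int[OF th K(1-6)]]
  note H = theta_Int_pairs[OF th K(1-6)]
  have out: "a \<notin> H1" "a \<notin> H2" "b \<notin> H1" "b \<notin> H2" using ab' H(5) H(6) H(7) H(8) by blast+
  have g: "a \<in> ground M" "b \<in> ground M" using ab hyperplane_subset[OF H(3)] hyperplane_subset[OF H(4)] by blast+
  have "cross_log \<phi>' H1 H2 a b \<simeq> cross_log \<phi> H1 H2 a b"
   by (rule cong_eqI[OF cong_diff[OF cong_add[OF cong_diff[OF lg[OF H(1) g(1) out(1)] lg[OF H(1) g(2) out(3)]]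
     lg[OF H(2) g(2) out(4)]] lg[OF H(2) g(1) out(2)]]]) (simp add: cross_log_def algebra_simps)
  then show "cross_ratio P \<phi>' H1 H2 a b = x (H1, H2, H3, H4)"
   using cross_map_log(2)[OF \<phi>(2) th K(1-6) ab'] cross_map_log(2)[OF \<phi>(1) th K(1-6) ab'] has_cross_ratiosD[OF x th ab]
   by (simp add: cong_iff)
 qed
qed

lemma push_representation:
 assumes M: "matroid M" and P: "pasture P" and Q: "pasture Q" and g: "g \<in> pasture_hom P Q" and \<phi>: "\<phi> \<in> representations M P"
 shows "(\<lambda>H e. g (\<phi> H e)) \<in> representations M Q"
  and "has_cross_ratios M P \<phi> x ==> has_cross_ratios M Q (\<lambda>H e. g (\<phi> H e)) (\<lambda>t. g (x t))"
proof -
 interpret matroid M by fact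
 interpret P: pasture P by fact
 interpret Q: pasture Q by fact
 note g' = pasture_hom_mult[OF g] pasture_hom_closed[OF g] pasture_hom_zero[OF g]
 have val: "\<phi> H e \<in> carrier P" "\<phi> H e = pzero P \<longleftrightarrow> e \<in> H" if "H \<in> hyperplanes M" "e \<in> ground M" for H e
  using \<phi> that unfolding representations_def by blast+
 have zero: "g a = pzero Q \<longleftrightarrow> a = pzero P" if "a \<in> carrier P" for a
  using pasture_hom_Units[OF P Q g, of a] g'(3) that by auto
 have triple: "\<exists>a\<in>carrier Q. \<exists>b\<in>carrier Q. \<exists>c\<in>carrier Q. (a, b, c) \<noteq> (pzero Q, pzero Q, pzero Q) \<and>
   (\<forall>e\<in>ground M. {#a \<otimes>\<^bsub>Q\<^esub> g (\<phi> H1 e), b \<otimes>\<^bsub>Q\<^esub> g (\<phi> H2 e), c \<otimes>\<^bsub>Q\<^esub> g (\<phi> H3 e)#} \<in> nullset Q)"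
  if H: "H1 \<in> hyperplanes M" "H2 \<in> hyperplanes M" "H3 \<in> hyperplanes M"
   and L: "H1 \<noteq> H2 \<and> H1 \<noteq> H3 \<and> H2 \<noteq> H3 \<and> corank_flat M 2 (H1 \<inter> H2 \<inter> H3)" for H1 H2 H3
 proof -
  have "\<forall>H1\<in>hyperplanes M. \<forall>H2\<in>hyperplanes M. \<forall>H3\<in>hyperplanes M.
    H1 \<noteq> H2 \<and> H1 \<noteq> H3 \<and> H2 \<noteq> H3 \<and> corank_flat M 2 (H1 \<inter> H2 \<inter> H3) -->
    (\<exists>a\<in>carrier P. \<exists>b\<in>carrier P. \<exists>c\<in>carrier P. (a, b, c) \<noteq> (pzero P, pzero P, pzero P) \<and>
      (\<forall>e\<in>ground M. {#a \<otimes>\<^bsub>P\<^esub> \<phi> H1 e, b \<otimes>\<^bsub>P\<^esub> \<phi> H2 e, c \<otimes>\<^bsub>P\<^esub> \<phi> H3 e#} \<in> nullset P))"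
   using \<phi> unfolding representations_def mem_Collect_eq by (elim conjE)
  from this[rule_format, OF H L] obtain a b c where abc: "a \<in> carrier P" "b \<in> carrier P" "c \<in> carrier P"
   "(a, b, c) \<noteq> (pzero P, pzero P, pzero P)"
   and null: "\<And>e. e \<in> ground M ==> {#a \<otimes>\<^bsub>P\<^esub> \<phi> H1 e, b \<otimes>\<^bsub>P\<^esub> \<phi> H2 e, c \<otimes>\<^bsub>P\<^esub> \<phi> H3 e#} \<in> nullset P"
   by blast
  have "{#g a \<otimes>\<^bsub>Q\<^esub> g (\<phi> H1 e), g b \<otimes>\<^bsub>Q\<^esub> g (\<phi> H2 e), g c \<otimes>\<^bsub>Q\<^esub> g (\<phi> H3 e)#} \<in> nullset Q" if "e \<in> ground M" for e
   using pasture_hom_null[OF g null[OF that]] g'(1)[OF abc(1) val(1)[OF H(1) that]] g'(1)[OF abc(2) val(1)[OF H(2) that]]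
    g'(1)[OF abc(3) val(1)[OF H(3) that]] by simp
  moreover have "(g a, g b, g c) \<noteq> (pzero Q, pzero Q, pzero Q)" using abc zero by auto
  ultimately show ?thesis using g'(2) abc(1-3) by blast
 qed
 show "(\<lambda>H e. g (\<phi> H e)) \<in> representations M Q"
  unfolding representations_def mem_Collect_eq
  by (intro conjI ballI impI triple) (use val zero g'(2) in auto)
 assume x: "has_cross_ratios M P \<phi> x"
 show "has_cross_ratios M Q (\<lambda>H e. g (\<phi> H e)) (\<lambda>t. g (x t))"
  unfolding has_cross_ratios_def
 proof (intro allI impI)
  fix H1 H2 H3 H4 a b
  assume th: "(H1, H2, H3, H4) \<in> theta M" and ab: "a \<in> H3 - H1 \<inter> H2 \<inter> H3 \<inter> H4" "b \<in> H4 - H1 \<inter> H2 \<inter> H3 \<inter> H4"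
  obtain K e1 e2 e3 e4 where K: "K \<in> indep M" "card K + 2 = rank_of M (ground M)"
   "K \<subseteq> H1" "K \<subseteq> H2" "K \<subseteq> H3" "K \<subseteq> H4"
   "e1 \<in> H1 - cl M K" "e2 \<in> H2 - cl M K" "e3 \<in> H3 - cl M K" "e4 \<in> H4 - cl M K"
   by (rule theta_frame[OF th], rule that)
  note ab' = ab[unfolded theta_Int[OF th K(1-6)]]
  note H = theta_Int_pairs[OF th K(1-6)]
  have out: "a \<notin> H1" "a \<notin> H2" "b \<notin> H1" "b \<notin> H2" using ab' H(5) H(6) H(7) H(8) by blast+
  have gr: "a \<in> ground M" "b \<in> ground M" using ab hyperplane_subset[OF H(3)] hyperplane_subset[OF H(4)] by blast+
  have nz: "\<phi> H1 a \<in> nonzeros P" "\<phi> H2 b \<in> nonzeros P" "\<phi> H1 b \<in> nonzeros P" "\<phi> H2 a \<in> nonzeros P"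
   using val[OF H(1) gr(1)] val[OF H(1) gr(2)] val[OF H(2) gr(1)] val[OF H(2) gr(2)] out by auto
  note prod = P.nonzeros_closed(1)[OF nz(1,2)] P.nonzeros_closed(1)[OF nz(3,4)]
  have c: "\<phi> H1 a \<in> carrier P" "\<phi> H2 b \<in> carrier P" "\<phi> H1 b \<in> carrier P" "\<phi> H2 a \<in> carrier P"
   "\<phi> H1 a \<otimes>\<^bsub>P\<^esub> \<phi> H2 b \<in> carrier P" "inv\<^bsub>P\<^esub> (\<phi> H1 b \<otimes>\<^bsub>P\<^esub> \<phi> H2 a) \<in> carrier P"
   using nz prod P.nonzeros_closed(2)[OF prod(2)] by blast+
  have "cross_ratio Q (\<lambda>H e. g (\<phi> H e)) H1 H2 a b = g (cross_ratio P \<phi> H1 H2 a b)"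
   unfolding cross_ratio_def g'(1)[OF c(5,6)] pasture_hom_inv[OF P Q g prod(2)] g'(1)[OF c(1,2)] g'(1)[OF c(3,4)] ..
  then show "cross_ratio Q (\<lambda>H e. g (\<phi> H e)) H1 H2 a b = g (x (H1, H2, H3, H4))"
   using has_cross_ratiosD[OF x th ab] by simp
 qed
qed

section \<open>Composition and copies of pastures\<close>

lemma pasture_hom_compose:
 assumes P: "pasture P" and f: "f \<in> pasture_hom P Q" and g: "g \<in> pasture_hom Q S"
 shows "compose (carrier P) g f \<in> pasture_hom P S"
proof -
 interpret P: pasture P by fact
 have "image_mset (compose (carrier P) g f) A \<in> nullset S" if A: "A \<in> nullset P" for A
 proof -
  have "image_mset (compose (carrier P) g f) A = image_mset (\<lambda>a. g (f a)) A"
   by (rule image_mset_cong_sym3[of _ P]) (use A P.nullset_sym3 in \<open>auto simp: compose_def\<close>)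
  then show ?thesis
   using pasture_hom_null[OF g pasture_hom_null[OF f A]] by (simp add: multiset.map_comp comp_def)
 qed
 then show ?thesis
  unfolding pasture_hom_def[of P S]
  using pasture_hom_mult[OF f] pasture_hom_mult[OF g] pasture_hom_closed[OF f] pasture_hom_closed[OF g]
   pasture_hom_zero[OF f] pasture_hom_zero[OF g] pasture_hom_one[OF f] pasture_hom_one[OF g] P.zero_closed P.one_closed
  by (auto simp: compose_def)
qed

lemma pasture_hom_id: "pasture P ==> (\<lambda>x\<in>carrier P. x) \<in> pasture_hom P P"
proof -
 assume "pasture P"
 then interpret P: pasture P .
 have "image_mset (\<lambda>x\<in>carrier P. x) A \<in> nullset P" if A: "A \<in> nullset P" for A
 proof -
  have "image_mset (\<lambda>x\<in>carrier P. x) A = image_mset (\<lambda>x. x) A"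
   by (rule image_mset_cong_sym3[of _ P]) (use A P.nullset_sym3 in auto)
  then show ?thesis using A by simp
 qed
 then show ?thesis unfolding pasture_hom_def using P.zero_closed P.one_closed by auto
qed

text \<open>The foundation is tested on pastures over its own type, while the quotient lives on a
  different one. A copy along an injection, with morphisms in both directions, bridges this.\<close>

lemma transport_pasture:
 fixes Q :: "'q pasture" and i :: "'q => 'u"
 assumes Q: "pasture Q" and i: "inj_on i (carrier Q)"
 shows "\<exists>Q' :: 'u pasture. pasture Q' \<and> (\<exists>j\<in>pasture_hom Q Q'. \<exists>j'\<in>pasture_hom Q' Q. \<forall>q\<in>carrier Q. j' (j q) = q)"
proof -
 interpret Q: pasture Q by fact
 define r where "r = the_inv_into (carrier Q) i"
 have ri: "r (i q) = q" if "q \<in> carrier Q" for q unfolding r_def by (rule the_inv_into_f_f[OF i that])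
 define Q' where "Q' = \<lparr> carrier = i ` carrier Q, monoid.mult = (\<lambda>x y. i (r x \<otimes>\<^bsub>Q\<^esub> r y)), one = i \<one>\<^bsub>Q\<^esub>,
  pzero = i (pzero Q), nullset = image_mset i ` nullset Q \<rparr>"
 have simps: "carrier Q' = i ` carrier Q" "\<one>\<^bsub>Q'\<^esub> = i \<one>\<^bsub>Q\<^esub>" "pzero Q' = i (pzero Q)" "nullset Q' = image_mset i ` nullset Q"
  unfolding Q'_def by simp_all
 have mult: "i a \<otimes>\<^bsub>Q'\<^esub> i b = i (a \<otimes>\<^bsub>Q\<^esub> b)" if "a \<in> carrier Q" "b \<in> carrier Q" for a b
  using that by (simp add: Q'_def ri)
 have undo: "image_mset r (image_mset i A) = A" if "A \<in> sym3 Q" for A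
 proof -
  have "image_mset (\<lambda>a. r (i a)) A = image_mset (\<lambda>a. a) A"
   by (rule image_mset_cong_sym3[OF that]) (rule ri)
  then show ?thesis by (simp add: multiset.map_comp comp_def)
 qed
 have null_iff: "image_mset i A \<in> nullset Q' \<longleftrightarrow> A \<in> nullset Q" if "A \<in> sym3 Q" for A
 proof
  assume "image_mset i A \<in> nullset Q'"
  then obtain B where B: "B \<in> nullset Q" "image_mset i A = image_mset i B" unfolding simps by blast
  then have "A = B" using undo[OF that] undo[of B] Q.nullset_sym3 by (metis subsetD)
  then show "A \<in> nullset Q" using B by simp
 qed (simp add: simps)
 have cm: "comm_monoid Q'"
  by (rule comm_monoidI) (auto simp: simps mult Q.m_ac)
 have P': "pasture Q'"
 proof (intro pasture.intro cm pasture_axioms.intro)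
  show "pzero Q' \<in> carrier Q'" by (simp add: simps Q.zero_closed)
  show "pzero Q' \<otimes>\<^bsub>Q'\<^esub> a = pzero Q'" if "a \<in> carrier Q'" for a
   using that by (auto simp: simps mult Q.zero_closed Q.zero_absorb)
  show "pzero Q' \<noteq> \<one>\<^bsub>Q'\<^esub>" using Q.zero_neq_one ri Q.zero_closed Q.one_closed unfolding simps by metis
  show "a \<in> Units Q'" if a: "a \<in> carrier Q'" "a \<noteq> pzero Q'" for a
  proof -
   obtain q where q: "q \<in> carrier Q" "a = i q" using a(1) unfolding simps by blast
   then have "q \<in> Units Q" using Q.nonzero_Units a(2) unfolding simps by blast
   then have "i q \<otimes>\<^bsub>Q'\<^esub> i (inv\<^bsub>Q\<^esub> q) = \<one>\<^bsub>Q'\<^esub>" "i (inv\<^bsub>Q\<^esub> q) \<otimes>\<^bsub>Q'\<^esub> i q = \<one>\<^bsub>Q'\<^esub>" "i (inv\<^bsub>Q\<^esub> q) \<in> carrier Q'"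
    using q(1) by (simp_all add: mult simps)
   then show ?thesis unfolding Units_def using a(1) q(2) by blast
  qed
  show "nullset Q' \<subseteq> sym3 Q'"
  proof
   fix A assume "A \<in> nullset Q'"
   then obtain B where "B \<in> sym3 Q" "A = image_mset i B" using Q.nullset_sym3 unfolding simps by blast
   then show "A \<in> sym3 Q'" unfolding sym3_def simps by fastforce
  qed
  show "image_mset ((\<otimes>\<^bsub>Q'\<^esub>) a) A \<in> nullset Q'" if a: "a \<in> carrier Q'" "A \<in> nullset Q'" for a A
  proof -
   obtain q B where q: "q \<in> carrier Q" "a = i q" "B \<in> nullset Q" "A = image_mset i B" using a unfolding simps by blast
   have "image_mset (\<lambda>b. a \<otimes>\<^bsub>Q'\<^esub> i b) B = image_mset (\<lambda>b. i (q \<otimes>\<^bsub>Q\<^esub> b)) B"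
    by (rule image_mset_cong_sym3[of _ Q]) (use q Q.nullset_sym3 mult in auto)
   then have "image_mset ((\<otimes>\<^bsub>Q'\<^esub>) a) A = image_mset i (image_mset ((\<otimes>\<^bsub>Q\<^esub>) q) B)"
    by (simp add: q(4) multiset.map_comp comp_def)
   then show ?thesis using Q.nullset_mult[OF q(1,3)] unfolding simps by blast
  qed
  show "\<exists>!b. b \<in> carrier Q' \<and> {#a, b, pzero Q'#} \<in> nullset Q'" if a: "a \<in> carrier Q'" for a
  proof -
   obtain q where q: "q \<in> carrier Q" "a = i q" using a unfolding simps by blast
   have iff: "{#a, i b, pzero Q'#} \<in> nullset Q' \<longleftrightarrow> {#q, b, pzero Q#} \<in> nullset Q" if "b \<in> carrier Q" for b
    using null_iff[of "{#q, b, pzero Q#}"] that q Q.zero_closed by (auto simp: sym3_def simps)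
   show ?thesis
   proof (rule ex1I[of _ "i (pneg Q q)"])
    show "i (pneg Q q) \<in> carrier Q' \<and> {#a, i (pneg Q q), pzero Q'#} \<in> nullset Q'"
     using iff Q.neg_ex[OF q(1)] by (simp add: simps(1))
    fix b assume b: "b \<in> carrier Q' \<and> {#a, b, pzero Q'#} \<in> nullset Q'"
    then obtain c where "c \<in> carrier Q" "b = i c" unfolding simps by blast
    then show "b = i (pneg Q q)" using b iff Q.neg_unique[OF q(1)] by blast
   qed
  qed
 qed
 have j: "(\<lambda>q\<in>carrier Q. i q) \<in> pasture_hom Q Q'"
 proof -
  have "image_mset (\<lambda>q\<in>carrier Q. i q) A \<in> nullset Q'" if "A \<in> nullset Q" for A
  proof -
   have "image_mset (\<lambda>q\<in>carrier Q. i q) A = image_mset i A"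
    by (rule image_mset_cong_sym3[of _ Q]) (use that Q.nullset_sym3 in auto)
   then show ?thesis using that by (simp add: simps)
  qed
  then show ?thesis unfolding pasture_hom_def using Q.zero_closed Q.one_closed by (auto simp: simps mult)
 qed
 have j': "(\<lambda>y\<in>carrier Q'. r y) \<in> pasture_hom Q' Q"
 proof -
  have "image_mset (\<lambda>y\<in>carrier Q'. r y) A \<in> nullset Q" if A: "A \<in> nullset Q'" for A
  proof -
   obtain B where B: "B \<in> nullset Q" "A = image_mset i B" using A unfolding simps by blast
   have "image_mset (\<lambda>y\<in>carrier Q'. r y) A = image_mset r A"
    by (rule image_mset_cong_sym3[of _ Q']) (use A pasture.nullset_sym3[OF P'] in auto)
   then show ?thesis using undo[of B] B Q.nullset_sym3 by auto
  qed
  moreover have "r (a \<otimes>\<^bsub>Q'\<^esub> b) = r a \<otimes>\<^bsub>Q\<^esub> r b" if "a \<in> carrier Q'" "b \<in> carrier Q'" for a b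
   using that by (auto simp: simps mult ri)
  moreover have "a \<otimes>\<^bsub>Q'\<^esub> b \<in> carrier Q'" if "a \<in> carrier Q'" "b \<in> carrier Q'" for a b
   using that by (auto simp: simps mult)
  ultimately show ?thesis unfolding pasture_hom_def using Q.zero_closed Q.one_closed by (auto simp: simps ri)
 qed
 have "(\<lambda>y\<in>carrier Q'. r y) ((\<lambda>q\<in>carrier Q. i q) q) = q" if "q \<in> carrier Q" for q
  using that by (simp add: simps ri)
 then show ?thesis using P' j j' by blast
qed

text \<open>Countability provides the injection of the quotient into the infinite type of the
  foundation.\<close>

lemma countable_free_quotient:
 fixes X :: "'x set"
 assumes "finite X"
 shows "countable (carrier (free_quotient X R))"
proof -
 obtain xs where xs: "set xs = X" using finite_list[OF assms] by blast
 have "inj_on (\<lambda>m. map (poly_mapping.lookup m) xs) {m :: 'x \<Rightarrow>\<^sub>0 int. Poly_Mapping.keys m \<subseteq> X}"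
 proof (rule inj_onI, rule poly_mapping_eqI)
  fix m m' :: "'x \<Rightarrow>\<^sub>0 int" and y
  assume h: "m \<in> {m. Poly_Mapping.keys m \<subseteq> X}" "m' \<in> {m. Poly_Mapping.keys m \<subseteq> X}"
   "map (poly_mapping.lookup m) xs = map (poly_mapping.lookup m') xs"
  show "poly_mapping.lookup m y = poly_mapping.lookup m' y"
  proof (cases "y \<in> X")
   case True
   then show ?thesis using h(3) xs by simp
  next
   case False
   then have "y \<notin> Poly_Mapping.keys m" "y \<notin> Poly_Mapping.keys m'" using h by blast+
   then show ?thesis by (simp add: in_keys_iff)
  qed
 qed
 then have "countable {m :: 'x \<Rightarrow>\<^sub>0 int. Poly_Mapping.keys m \<subseteq> X}"
  by (rule countable_image_inj_on[OF countableI_type])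
 then have "countable ((UNIV :: int set) \<times> {m :: 'x \<Rightarrow>\<^sub>0 int. Poly_Mapping.keys m \<subseteq> X})" by simp
 moreover have "carrier (signed_monomials X) \<subseteq> (UNIV :: int set) \<times> {m :: 'x \<Rightarrow>\<^sub>0 int. Poly_Mapping.keys m \<subseteq> X}"
  by (auto simp: signed_monomials_simps)
 ultimately have "countable (carrier (signed_monomials X))" by (rule countable_subset[rotated])
 moreover have "carrier (signed_monomials X Mod relation_subgroup X R) =
   (\<lambda>a. relation_subgroup X R #>\<^bsub>signed_monomials X\<^esub> a) ` carrier (signed_monomials X)"
  by (auto simp: FactGroup_def RCOSETS_def)
 ultimately show ?thesis by (simp add: free_quotient_def adjoin_zero_simps)
qed

lemma finite_theta: "matroid M ==> finite (theta M)"
proof -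
 assume "matroid M"
 then interpret matroid M .
 have "theta M \<subseteq> Pow (ground M) \<times> Pow (ground M) \<times> Pow (ground M) \<times> Pow (ground M)"
 proof
  fix t assume th: "t \<in> theta M"
  obtain H1 H2 H3 H4 where t: "t = (H1, H2, H3, H4)" by (cases t)
  have "{H1, H2, H3, H4} \<subseteq> hyperplanes M" using th unfolding t mem_theta by (elim conjE)
  then show "t \<in> Pow (ground M) \<times> Pow (ground M) \<times> Pow (ground M) \<times> Pow (ground M)"
   using hyperplane_subset unfolding t by simp
 qed
 then show ?thesis by (rule finite_subset) (simp add: finite_ground)
qed

section \<open>Morphisms out of the quotient and the isomorphism\<close>

abbreviation cross_quotient :: "'a matroid => (int \<times> ('a set \<times> 'a set \<times> 'a set \<times> 'a set \<Rightarrow>\<^sub>0 int)) set option pasture" where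
 "cross_quotient M \<equiv> free_quotient (theta M) (cross_relations M)"

abbreviation cross_class :: "'a matroid => 'a set \<times> 'a set \<times> 'a set \<times> 'a set => (int \<times> ('a set \<times> 'a set \<times> 'a set \<times> 'a set \<Rightarrow>\<^sub>0 int)) set option" where
 "cross_class M t \<equiv> quotient_map (theta M) (cross_relations M) (free_gen t)"

lemma cross_quotient_bij:
 assumes "pasture P"
 shows "bij_betw (\<lambda>f. \<lambda>a\<in>carrier (cross_algebra M). f (quotient_map (theta M) (cross_relations M) a))
  (pasture_hom (cross_quotient M) P)
  {h \<in> pasture_hom (cross_algebra M) P. \<forall>B\<in>cross_relations M. image_mset h B \<in> nullset P}"
proof (rule free_quotient_universal[OF _ _ assms])
 show "cross_relations M \<subseteq> sym3 (cross_algebra M)"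
  using cross_relations_proper[of M] unfolding sym3_def by blast
 show "a = None" if "{#a, None, None#} \<in> cross_relations M" for a
 proof -
  obtain b c d where abc: "{#a, None, None#} = {#b, c, d#}" "b \<noteq> None" "c \<noteq> None"
   using cross_relations_proper[of M] \<open>{#a, None, None#} \<in> cross_relations M\<close>
   by (fastforce simp: free_algebra_simps(2))
  then show ?thesis by (auto simp: add_eq_conv_ex)
 qed
qed

lemma free_gen_carrier: "t \<in> X ==> free_gen t \<in> carrier (free_algebra X)"
 by (auto simp: free_gen_def free_algebra_simps signed_monomials_simps)

lemma cross_quotient_values:
 assumes P: "pasture P" and f: "f \<in> pasture_hom (cross_quotient M) P"
 shows "cross_values M P (\<lambda>t. f (cross_class M t))"
proof -
 let ?h = "\<lambda>a\<in>carrier (cross_algebra M). f (quotient_map (theta M) (cross_relations M) a)"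
 have "?h \<in> {h \<in> pasture_hom (cross_algebra M) P. \<forall>B\<in>cross_relations M. image_mset h B \<in> nullset P}"
  by (rule bij_betw_apply[OF cross_quotient_bij[OF P] f])
 then show ?thesis using cross_values_iff[OF P, of ?h M] by (simp add: free_gen_carrier)
qed

lemma cross_quotient_extend:
 assumes P: "pasture P" and x: "cross_values M P x"
 shows "\<exists>f\<in>pasture_hom (cross_quotient M) P. \<forall>t\<in>theta M. f (cross_class M t) = x t"
proof -
 let ?A = "cross_algebra M"
 have "(\<lambda>t\<in>theta M. x t) \<in> theta M \<rightarrow>\<^sub>E nonzeros P" using cross_values.x_nonzero[OF x] by auto
 then have "(\<lambda>t\<in>theta M. x t) \<in> (\<lambda>f. \<lambda>t\<in>theta M. f (free_gen t)) ` pasture_hom ?A P"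
  using free_algebra_universal[OF P, of "theta M"] by (simp add: bij_betw_def)
 then obtain h where h: "h \<in> pasture_hom ?A P" "(\<lambda>t\<in>theta M. x t) = (\<lambda>t\<in>theta M. h (free_gen t))" by blast
 have hx: "h (free_gen t) = x t" if "t \<in> theta M" for t using fun_cong[OF h(2), of t] that by simp
 have "h \<in> {h \<in> pasture_hom ?A P. \<forall>B\<in>cross_relations M. image_mset h B \<in> nullset P}"
  using cross_values_iff[OF P h(1) hx] h(1) x by blast
 then obtain f where f: "f \<in> pasture_hom (cross_quotient M) P"
  "h = (\<lambda>a\<in>carrier ?A. f (quotient_map (theta M) (cross_relations M) a))"
  unfolding bij_betw_imp_surj_on[OF cross_quotient_bij[OF P], symmetric] by (elim imageE)
 have "f (cross_class M t) = x t" if "t \<in> theta M" for t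
  using hx[OF that] free_gen_carrier[OF that] f(2) by simp
 then show ?thesis using f(1) by blast
qed

lemma cross_quotient_hom_eqI:
 assumes P: "pasture P" and fg: "f \<in> pasture_hom (cross_quotient M) P" "g \<in> pasture_hom (cross_quotient M) P"
  and eq: "\<And>t. t \<in> theta M ==> f (cross_class M t) = g (cross_class M t)"
 shows "f = g"
proof -
 let ?r = "\<lambda>f. \<lambda>a\<in>carrier (cross_algebra M). f (quotient_map (theta M) (cross_relations M) a)"
 have h: "?r f \<in> pasture_hom (cross_algebra M) P" "?r g \<in> pasture_hom (cross_algebra M) P"
  using bij_betw_apply[OF cross_quotient_bij[OF P] fg(1)] bij_betw_apply[OF cross_quotient_bij[OF P] fg(2)] by blast+
 have "(\<lambda>t\<in>theta M. ?r f (free_gen t)) = (\<lambda>t\<in>theta M. ?r g (free_gen t))"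
  by (rule restrict_ext) (simp add: free_gen_carrier eq)
 then have "?r f = ?r g"
  by (rule inj_onD[OF bij_betw_imp_inj_on[OF free_algebra_universal[OF P, of "theta M"]] _ h])
 then show ?thesis
  by (rule inj_onD[OF bij_betw_imp_inj_on[OF cross_quotient_bij[OF P]] _ fg])
qed

theorem theorem2p37:
 fixes M :: "'a matroid"
  and F :: "'u::infinite pasture"
  and \<eta> :: "'u pasture \<Rightarrow> ('u \<Rightarrow> 'u) \<Rightarrow> ('a set \<Rightarrow> 'a \<Rightarrow> 'u) set"
 assumes "matroid M"
  and "is_foundation M F \<eta>"
 shows "\<exists>f \<in> pasture_iso (free_quotient (theta M) (cross_relations M)) F.
      \<forall>\<phi> \<in> universal_representations F \<eta>. \<forall>(H1, H2, H3, H4) \<in> theta M.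
       \<forall>a \<in> H3 - H1 \<inter> H2 \<inter> H3 \<inter> H4. \<forall>b \<in> H4 - H1 \<inter> H2 \<inter> H3 \<inter> H4.
        f (quotient_map (theta M) (cross_relations M) (cr H1 H2 H3 H4))
         = cross_ratio F \<phi> H1 H2 a b"
proof -
 interpret matroid M by fact
 let ?Q = "cross_quotient M" and ?id = "\<lambda>x\<in>carrier F. x"
 note found = assms(2)[unfolded is_foundation_def]
 note F = conjunct1[OF found]
 have bij: "bij_betw (\<eta> P) (pasture_hom F P) (rescaling_classes M P)" if "pasture P" for P
  using conjunct1[OF conjunct2[OF found]] that by simp
 have nat: "\<eta> Q (compose (carrier F) g f) = push_class M Q g (\<eta> P f)"
  if "pasture P" "pasture Q" "f \<in> pasture_hom F P" "g \<in> pasture_hom P Q" for P Q f g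
  using conjunct2[OF conjunct2[OF found]] that by simp
 have Q: "pasture ?Q" by (rule pasture_cross_quotient)
 note refl = rescaling_of_cross_ratios[OF assms(1)] and inv = has_cross_ratios_rescaling[OF assms(1)]
 have rep: "\<phi> \<in> representations M P \<and> \<phi>' \<in> representations M P" if "(\<phi>, \<phi>') \<in> rescaling M P" for \<phi> \<phi>' and P :: "'u pasture"
  using that unfolding rescaling_def by blast
 have idF: "?id \<in> pasture_hom F F" by (rule pasture_hom_id[OF F])
 \<comment> \<open>A universal representation; its cross-ratios x satisfy the relations and define
   the morphism f.\<close>
 obtain \<phi>0 where \<phi>0: "\<phi>0 \<in> representations M F" "\<eta> F ?id = rescaling M F `` {\<phi>0}"
  using bij_betw_apply[OF bij[OF F] idF] unfolding rescaling_classes_def by (rule quotientE)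
 obtain x where x: "cross_values M F x" "has_cross_ratios M F \<phi>0 x"
  using representation_cross_values[OF assms(1) F \<phi>0(1)] by blast
 obtain f where f: "f \<in> pasture_hom ?Q F" "\<And>t. t \<in> theta M \<Longrightarrow> f (cross_class M t) = x t"
  using cross_quotient_extend[OF F x(1)] by blast
 have cls: "cross_class M t \<in> carrier ?Q" if "t \<in> theta M" for t
 proof -
  have "(1, frag_of t) \<in> carrier (signed_monomials (theta M))" using that by (simp add: signed_monomials_simps)
  then show ?thesis
   by (auto simp: free_quotient_def adjoin_zero_simps free_gen_def quotient_map_def FactGroup_def RCOSETS_def)
 qed

 obtain i :: "_ \<Rightarrow> 'u" where i: "inj_on i (carrier ?Q)"
 proof -
  obtain e :: "_ \<Rightarrow> nat" where e: "inj_on e (carrier ?Q)"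
   using countable_free_quotient[OF finite_theta[OF assms(1)]] by (rule countableE)
  obtain u :: "nat \<Rightarrow> 'u" where u: "inj u" using infinite_countable_subset[OF infinite_UNIV] by blast
  have "inj_on (u \<circ> e) (carrier ?Q)" by (rule comp_inj_on[OF e]) (use u in \<open>blast intro: inj_on_subset\<close>)
  then show thesis by (rule that)
 qed
 obtain Q' :: "'u pasture" and j j' where Q': "pasture Q'" and j: "j \<in> pasture_hom ?Q Q'" and j': "j' \<in> pasture_hom Q' ?Q"
  and j'j: "\<And>q. q \<in> carrier ?Q \<Longrightarrow> j' (j q) = q"
  using transport_pasture[OF Q i] by blast
 \<comment> \<open>For the way back, the generators are copied to Q'. They are the cross-ratios of a
   representation \<open>\<rho>\<close>, which corresponds to a morphism g from the
   foundation.\<close>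
 let ?x' = "\<lambda>t. j (cross_class M t)"
 obtain \<rho> where \<rho>: "\<rho> \<in> representations M Q'" "has_cross_ratios M Q' \<rho> ?x'"
  using cross_values_representation[OF assms(1) Q' cross_quotient_values[OF Q' j]] by blast
 have "rescaling M Q' `` {\<rho>} \<in> rescaling_classes M Q'" unfolding rescaling_classes_def by (rule quotientI[OF \<rho>(1)])
 then have "rescaling M Q' `` {\<rho>} \<in> \<eta> Q' ` pasture_hom F Q'" unfolding bij_betw_imp_surj_on[OF bij[OF Q']] .
 then obtain g where g: "g \<in> pasture_hom F Q'" "\<eta> Q' g = rescaling M Q' `` {\<rho>}" by (metis imageE)
 have "compose (carrier F) g ?id = g"
  by (rule ext) (use g(1) in \<open>auto simp: compose_def pasture_hom_def PiE_def extensional_def\<close>)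
 \<comment> \<open>By naturality \<open>\<rho>\<close> is the image of \<open>\<phi>0\<close> under
   g up to rescaling. Comparing cross-ratios shows that g sends x t to the copy of the generator
   t.\<close>
 then have "rescaling M Q' `` {\<rho>} = push_class M Q' g (rescaling M F `` {\<phi>0})"
  using nat[OF F Q' idF g(1)] g(2) \<phi>0(2) by simp
 moreover have "(\<lambda>H e. g (\<phi>0 H e)) \<in> push_class M Q' g (rescaling M F `` {\<phi>0})"
 proof -
  have "(\<phi>0, \<phi>0) \<in> rescaling M F" by (rule refl[OF F \<phi>0(1) \<phi>0(1) x(2) x(2)])
  moreover have "((\<lambda>H e. g (\<phi>0 H e)), (\<lambda>H e. g (\<phi>0 H e))) \<in> rescaling M Q'"
   using push_representation[OF assms(1) F Q' g(1) \<phi>0(1)] x(2) by (intro refl[OF Q']) blast+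
  ultimately show ?thesis unfolding push_class_def by blast
 qed
 ultimately have "(\<rho>, (\<lambda>H e. g (\<phi>0 H e))) \<in> rescaling M Q'" by blast
 then have "has_cross_ratios M Q' (\<lambda>H e. g (\<phi>0 H e)) ?x'" by (rule inv[OF Q' _ \<rho>(2)])
 then have gx: "g (x t) = j (cross_class M t)" if "t \<in> theta M" for t
  using has_cross_ratios_unique[OF push_representation(2)[OF assms(1) F Q' g(1) \<phi>0(1) x(2)] _ that] by blast

 let ?k = "compose (carrier F) j' g"
 have k: "?k \<in> pasture_hom F ?Q" by (rule pasture_hom_compose[OF F g(1) j'])
 \<comment> \<open>Morphisms out of the quotient are determined by their values on the
   generators.\<close>
 have "compose (carrier ?Q) ?k f = (\<lambda>q\<in>carrier ?Q. q)"
 proof (rule cross_quotient_hom_eqI[OF Q pasture_hom_compose[OF Q f(1) k] pasture_hom_id[OF Q]])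
  fix t assume t: "t \<in> theta M"
  have "f (cross_class M t) \<in> carrier F" by (rule pasture_hom_closed[OF f(1) cls[OF t]])
  then show "compose (carrier ?Q) ?k f (cross_class M t) = (\<lambda>q\<in>carrier ?Q. q) (cross_class M t)"
   using cls[OF t] f(2)[OF t] gx[OF t] j'j[OF cls[OF t]] by (simp add: compose_def)
 qed
 then have kf: "?k (f q) = q" if "q \<in> carrier ?Q" for q
  using that by (metis (no_types, lifting) compose_eq restrict_apply')

 let ?l = "compose (carrier Q') f j'"
 have l: "?l \<in> pasture_hom Q' F" by (rule pasture_hom_compose[OF Q' j' f(1)])
 have lx: "?l (?x' t) = x t" if "t \<in> theta M" for t
  using pasture_hom_closed[OF j cls[OF that]] j'j[OF cls[OF that]] f(2)[OF that] by (simp add: compose_def)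
 have push_x: "(\<lambda>H e. ?l (\<phi> H e)) \<in> representations M F \<and> has_cross_ratios M F (\<lambda>H e. ?l (\<phi> H e)) x"
  if "(\<rho>, \<phi>) \<in> rescaling M Q'" for \<phi>
 proof -
  have \<phi>: "\<phi> \<in> representations M Q'" using rep[OF that] by blast
  have "has_cross_ratios M F (\<lambda>H e. ?l (\<phi> H e)) (\<lambda>t. ?l (?x' t))"
   by (rule push_representation(2)[OF assms(1) Q' F l \<phi> inv[OF Q' that \<rho>(2)]])
  then show ?thesis using push_representation(1)[OF assms(1) Q' F l \<phi>] has_cross_ratios_cong lx by blast
 qed
 \<comment> \<open>The foundation is not known to be generated by cross-ratios at this point.
   Instead, the composite and the identity are shown to give the same rescaling class, and
   \<open>\<eta> F\<close> is injective.\<close>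
 have "\<eta> F (compose (carrier F) ?l g) = \<eta> F ?id"
 proof -
  have "\<eta> F (compose (carrier F) ?l g) = push_class M F ?l (rescaling M Q' `` {\<rho>})"
   using nat[OF Q' F g(1) l] g(2) by simp
  also have "\<dots> = rescaling M F `` {\<phi>0}"
  proof (intro equalityI subsetI)
   fix \<psi> assume "\<psi> \<in> push_class M F ?l (rescaling M Q' `` {\<rho>})"
   then obtain \<phi> where \<phi>: "(\<rho>, \<phi>) \<in> rescaling M Q'" "((\<lambda>H e. ?l (\<phi> H e)), \<psi>) \<in> rescaling M F"
    unfolding push_class_def by blast
   have "has_cross_ratios M F \<psi> x" by (rule inv[OF F \<phi>(2)]) (use push_x[OF \<phi>(1)] in blast)
   then show "\<psi> \<in> rescaling M F `` {\<phi>0}" using refl[OF F \<phi>0(1) _ x(2)] rep[OF \<phi>(2)] by blast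
  next
   fix \<psi> assume "\<psi> \<in> rescaling M F `` {\<phi>0}"
   then have \<psi>: "(\<phi>0, \<psi>) \<in> rescaling M F" by blast
   have r: "(\<rho>, \<rho>) \<in> rescaling M Q'" by (rule refl[OF Q' \<rho>(1) \<rho>(1) \<rho>(2) \<rho>(2)])
   have "((\<lambda>H e. ?l (\<rho> H e)), \<psi>) \<in> rescaling M F"
    by (rule refl[OF F _ _ _ inv[OF F \<psi> x(2)]]) (use push_x[OF r] rep[OF \<psi>] in blast)+
   then show "\<psi> \<in> push_class M F ?l (rescaling M Q' `` {\<rho>})" unfolding push_class_def using r by blast
  qed
  finally show ?thesis using \<phi>0(2) by simp
 qed
 then have lg: "compose (carrier F) ?l g = ?id"
  by (rule inj_onD[OF bij_betw_imp_inj_on[OF bij[OF F]] _ pasture_hom_compose[OF F g(1) l] idF])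
 have fk: "f (?k y) = y" if "y \<in> carrier F" for y
 proof -
  have "compose (carrier F) ?l g y = y" unfolding lg using that by simp
  then show ?thesis using that pasture_hom_closed[OF g(1) that] by (simp add: compose_eq)
 qed

 have "f \<in> pasture_iso ?Q F"
  unfolding pasture_iso_def using f(1) k kf fk by blast
 moreover have "\<forall>\<phi> \<in> universal_representations F \<eta>. \<forall>(H1, H2, H3, H4) \<in> theta M.
   \<forall>a \<in> H3 - H1 \<inter> H2 \<inter> H3 \<inter> H4. \<forall>b \<in> H4 - H1 \<inter> H2 \<inter> H3 \<inter> H4.
   f (quotient_map (theta M) (cross_relations M) (cr H1 H2 H3 H4)) = cross_ratio F \<phi> H1 H2 a b"
 proof (rule ballI, rule ballI)
  fix \<phi> t
  assume \<phi>: "\<phi> \<in> universal_representations F \<eta>" and "t \<in> theta M"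
  moreover obtain H1 H2 H3 H4 where tH: "t = (H1, H2, H3, H4)" by (cases t)
  ultimately have t: "(H1, H2, H3, H4) \<in> theta M" by simp
  have "(\<phi>0, \<phi>) \<in> rescaling M F" using \<phi> \<phi>0(2) by (simp add: universal_representations_def)
  then have "has_cross_ratios M F \<phi> x" by (rule inv[OF F _ x(2)])
  note cross = has_cross_ratiosD[OF this t]
  show "case t of (H1, H2, H3, H4) \<Rightarrow> \<forall>a \<in> H3 - H1 \<inter> H2 \<inter> H3 \<inter> H4. \<forall>b \<in> H4 - H1 \<inter> H2 \<inter> H3 \<inter> H4.
    f (quotient_map (theta M) (cross_relations M) (cr H1 H2 H3 H4)) = cross_ratio F \<phi> H1 H2 a b"
   unfolding tH prod.case
  proof (intro ballI)
   fix a b assume "a \<in> H3 - H1 \<inter> H2 \<inter> H3 \<inter> H4" "b \<in> H4 - H1 \<inter> H2 \<inter> H3 \<inter> H4"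
   from cross[OF this] show "f (cross_class M (H1, H2, H3, H4)) = cross_ratio F \<phi> H1 H2 a b" using f(2)[OF t] by simp
  qed
 qed
 ultimately show ?thesis by blast
qed

end
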